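(* Let $1\le p<\infty$, let $T>0$, and let $b\in L_1(0,T;W^1_{1(loc)}(\mathbb{R}^n))$ be a vector field such that $$\operatorname{div} b\in L_1(0,T;BMO(\mathbb{R}^n)),\qquad \frac{b}{1+|x|}\in L_1(0,T;L_1(\mathbb{R}^n)),$$ and, for a fixed $R>0$, $\operatorname{supp}\operatorname{div} b(\cdot,t)\subset B(0,R)$. Let $u_0,u_0^k\in L_\infty(\mathbb{R}^n)$ ($k\in\mathbb{N}$) with $(u_0^k-u_0)\in L_p(\mathbb{R}^n)$ be such that $$\sup_{k\in\mathbb{N}}\|u_0^k\|_{L_\infty(\mathbb{R}^n)}+\|u_0\|_{L_\infty(\mathbb{R}^n)}=m<\infty\quad\text{and}\quad (u_0^k-u_0)\to0\ \text{ in }L_p(\mathbb{R}^n)\ \text{ as }k\to\infty.$$ Let $u$ and $u^k$ be the unique weak solutions of $v_t+b\cdot\nabla v=0$ in $\mathbb{R}^n\times(0,T)$ with initial data $u_0$ and $u_0^k$, respectively, such that $u,u^k\in L_\infty(0,T;L_\infty(\mathbb{R}^n))$, $\|u\|_{L_\infty(0,T;L_\infty(\mathbb{R}^n))}\le\|u_0\|_{L_\infty(\mathbb{R}^n)}$ and $\|u^k\|_{L_\infty(0,T;L_\infty(\mathbb{R}^n))}\le\|u_0^k\|_{L_\infty(\mathbb{R}^n)}$. Then $$(u^k-u)\to0\quad\text{in } L_\infty(0,T;L_p(\mathbb{R}^n))\quad\text{as }k\to\infty.$$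
   Context: Here $b:\mathbb{R}^n\times(0,T)\to\mathbb{R}^n$ is a given vector field, $u,u^k$ are scalar functions, $\operatorname{div}$ and $\nabla$ are taken in the space variable $x\in\mathbb{R}^n$, $B(x,r)$ is the ball of radius $r$ centered at $x$, and the subscript $(loc)$ refers to locality in the space variable. Weak solution: a function $v\in L_\infty(0,T;L_\infty(\mathbb{R}^n))$ is a weak solution of $v_t+b\cdot\nabla v=0$, $v|_{t=0}=v_0$ iff $$\int_0^T\int_{\mathbb{R}^n}v\,\phi_t\,dx\,dt+\int_0^T\int_{\mathbb{R}^n}(\operatorname{div} b)\,v\,\phi\,dx\,dt+\int_0^T\int_{\mathbb{R}^n}(b\cdot\nabla\phi)\,v\,dx\,dt=-\int_{\mathbb{R}^n}v_0\,\phi(\cdot,0)\,dx$$ for each $\phi\in C^\infty([0,T];C_0^\infty(\mathbb{R}^n))$ such that $\phi|_{t=T}\equiv0$. Under the stated assumptions on $b$, for every $v_0\in L_\infty(\mathbb{R}^n)$ there exists a unique weak solution $v$ with $v\in L_\infty(0,T;L_\infty(\mathbb{R}^n))$ and $\|v\|_{L_\infty(0,T;L_\infty(\mathbb{R}^n))}\le\|v_0\|_{L_\infty(\mathbb{R}^n)}$. $BMO(\mathbb{R}^n)$: the set of locally integrable $f$ with finite semi-norm $$\|f\|_{BMO(\mathbb{R}^n)}=\sup_{x\in\mathbb{R}^n,\,r>0}\frac{1}{|B(x,r)|}\int_{B(x,r)}|f(y)-\{f\}_{B(x,r)}|\,dy,\qquad \{f\}_{B(x,r)}=\frac{1}{|B(x,r)|}\int_{B(x,r)}f(y)\,dy.$$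 *)

theory Defs
  imports "HOL-Analysis.Analysis" "HOL-Probability.Essential_Supremum"
begin

text \<open>
  A function on \<open>R\<^sup>n \<times> (0,T)\<close> is a curried function \<open>u\<close> with time as its first argument, so
  that \<open>u t\<close> is the section \<open>u(\<cdot>,t)\<close>.  Elements of the function spaces are represented by
  Lebesgue measurable functions; apart from test functions, everything below is invariant under
  changes on null sets.
  Norms take values in \<^typ>\<open>ennreal\<close> and are \<open>\<infinity>\<close> outside the corresponding space.
\<close>

section \<open>Smooth functions and test functions\<close>

text \<open>
  Derivatives are taken within \<open>S\<close>.  For \<open>S = [0,T] \<times> R\<^sup>n\<close> they are unique, and are one-sided in
  time at \<open>t = 0\<close> and \<open>t = T\<close>.
\<close>

fun Ck_on :: "nat \<Rightarrow> 'a::real_normed_vector set \<Rightarrow> ('a \<Rightarrow> real) \<Rightarrow> bool" where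
  "Ck_on 0 S f \<longleftrightarrow> continuous_on S f"
| "Ck_on (Suc k) S f \<longleftrightarrow>
     (\<forall>x\<in>S. f differentiable (at x within S)) \<and>
     (\<forall>v. Ck_on k S (\<lambda>x. frechet_derivative f (at x within S) v))"

definition smooth_on :: "'a::real_normed_vector set \<Rightarrow> ('a \<Rightarrow> real) \<Rightarrow> bool" where
  "smooth_on S f \<longleftrightarrow> (\<forall>k. Ck_on k S f)"

definition test_function :: "(real^'n \<Rightarrow> real) \<Rightarrow> bool" where
  "test_function \<phi> \<longleftrightarrow>
     smooth_on UNIV \<phi> \<and> (\<exists>K. compact K \<and> (\<forall>x. x \<notin> K \<longrightarrow> \<phi> x = 0))"

text \<open>
  \<open>C\<^sup>\<infinity>([0,T]; C\<^sub>0\<^sup>\<infinity>(R\<^sup>n))\<close>: a continuous curve on \<open>[0,T]\<close> in the inductive limit \<open>C\<^sub>0\<^sup>\<infinity>(R\<^sup>n)\<close>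
  has its supports in one common compact set.
\<close>

definition spacetime_test_function :: "real \<Rightarrow> (real \<Rightarrow> real^'n \<Rightarrow> real) \<Rightarrow> bool" where
  "spacetime_test_function T \<phi> \<longleftrightarrow>
     smooth_on ({0..T} \<times> UNIV) (\<lambda>(t, x). \<phi> t x) \<and>
     (\<exists>K. compact K \<and> (\<forall>t\<in>{0..T}. \<forall>x. x \<notin> K \<longrightarrow> \<phi> t x = 0))"

definition grad :: "(real^'n \<Rightarrow> real) \<Rightarrow> real^'n \<Rightarrow> real^'n" where
  "grad \<phi> x = (\<chi> j. frechet_derivative \<phi> (at x) (axis j 1))"

section \<open>Function spaces in the space variable\<close>

definition Linf_norm :: "('a::euclidean_space \<Rightarrow> real) \<Rightarrow> ennreal" where
  "Linf_norm f = esssup lebesgue (\<lambda>x. ennreal \<bar>f x\<bar>)"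

definition in_Linf :: "('a::euclidean_space \<Rightarrow> real) \<Rightarrow> bool" where
  "in_Linf f \<longleftrightarrow> f \<in> borel_measurable lebesgue \<and> Linf_norm f < \<infinity>"

definition Lp_norm :: "real \<Rightarrow> ('a::euclidean_space \<Rightarrow> 'b::euclidean_space) \<Rightarrow> ennreal" where
  "Lp_norm p f =
     (let I = (\<integral>\<^sup>+x. ennreal (norm (f x) powr p) \<partial>lebesgue)
      in if f \<in> borel_measurable lebesgue \<and> I < \<infinity> then ennreal (enn2real I powr (1 / p)) else \<infinity>)"

definition in_Lp :: "real \<Rightarrow> ('a::euclidean_space \<Rightarrow> 'b::euclidean_space) \<Rightarrow> bool" where
  "in_Lp p f \<longleftrightarrow> f \<in> borel_measurable lebesgue \<and> Lp_norm p f < \<infinity>"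

definition locally_integrable :: "('a::euclidean_space \<Rightarrow> 'b::euclidean_space) \<Rightarrow> bool" where
  "locally_integrable f \<longleftrightarrow> (\<forall>K. compact K \<longrightarrow> set_integrable lebesgue K f)"

definition mean_on :: "'a::euclidean_space set \<Rightarrow> ('a \<Rightarrow> real) \<Rightarrow> real" where
  "mean_on A f = (LINT y:A|lebesgue. f y) / measure lebesgue A"

definition BMO_norm :: "('a::euclidean_space \<Rightarrow> real) \<Rightarrow> ennreal" where
  "BMO_norm f =
     (if locally_integrable f
      then SUP (x, r) \<in> UNIV \<times> {0<..}.
             ennreal (mean_on (ball x r) (\<lambda>y. \<bar>f y - mean_on (ball x r) f\<bar>))
      else \<infinity>)"

text \<open>The support of an equivalence class of functions modulo null sets.\<close>

definition ess_support :: "('a::euclidean_space \<Rightarrow> real) \<Rightarrow> 'a set" where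
  "ess_support f = {x. \<forall>U. open U \<and> x \<in> U \<longrightarrow> \<not> (AE y in lebesgue. y \<in> U \<longrightarrow> f y = 0)}"

definition weak_jacobian :: "(real^'n \<Rightarrow> real^'n) \<Rightarrow> (real^'n \<Rightarrow> real^'n^'n) \<Rightarrow> bool" where
  "weak_jacobian f G \<longleftrightarrow>
     locally_integrable f \<and> locally_integrable G \<and>
     (\<forall>\<phi>. test_function \<phi> \<longrightarrow>
       (\<forall>i j. (LINT x|lebesgue. f x $ i * grad \<phi> x $ j) = - (LINT x|lebesgue. G x $ i $ j * \<phi> x)))"

definition weak_divergence :: "(real^'n \<Rightarrow> real^'n) \<Rightarrow> (real^'n \<Rightarrow> real) \<Rightarrow> bool" where
  "weak_divergence f d \<longleftrightarrow>
     locally_integrable f \<and> locally_integrable d \<and>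
     (\<forall>\<phi>. test_function \<phi> \<longrightarrow>
       (LINT x|lebesgue. f x \<bullet> grad \<phi> x) = - (LINT x|lebesgue. d x * \<phi> x))"

section \<open>Function spaces over \<open>(0,T)\<close>\<close>

definition spacetime_measurable ::
    "real \<Rightarrow> (real \<Rightarrow> 'a::euclidean_space \<Rightarrow> 'b::euclidean_space) \<Rightarrow> bool" where
  "spacetime_measurable T u \<longleftrightarrow>
     (\<lambda>(t, x). u t x) \<in> borel_measurable (lebesgue_on ({0<..<T} \<times> UNIV))"

text \<open>
  \<open>L\<^sub>1(0,T;X)\<close> and \<open>L\<^sub>\<infinity>(0,T;X)\<close>, where the parameter \<open>N\<close> is the (semi-)norm of \<open>X\<close>.  Measurability
  is joint measurability in \<open>(t,x)\<close>.  For the non-separable spaces \<open>L\<^sub>\<infinity>\<close> and \<open>BMO\<close> this is the usual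
  convention in place of strong measurability; in particular \<open>L\<^sub>\<infinity>(0,T;L\<^sub>\<infinity>(R\<^sup>n))\<close> is
  \<open>L\<^sub>\<infinity>(R\<^sup>n \<times> (0,T))\<close>.
\<close>

definition in_L1_time ::
    "real \<Rightarrow> (('a::euclidean_space \<Rightarrow> 'b::euclidean_space) \<Rightarrow> ennreal) \<Rightarrow> (real \<Rightarrow> 'a \<Rightarrow> 'b) \<Rightarrow> bool" where
  "in_L1_time T N u \<longleftrightarrow>
     spacetime_measurable T u \<and> (\<integral>\<^sup>+t\<in>{0<..<T}. N (u t) \<partial>lebesgue) < \<infinity>"

definition Linf_time_norm ::
    "real \<Rightarrow> (('a::euclidean_space \<Rightarrow> 'b::euclidean_space) \<Rightarrow> ennreal) \<Rightarrow> (real \<Rightarrow> 'a \<Rightarrow> 'b) \<Rightarrow> ennreal" where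
  "Linf_time_norm T N u = esssup (lebesgue_on {0<..<T}) (\<lambda>t. N (u t))"

definition in_Linf_time ::
    "real \<Rightarrow> (('a::euclidean_space \<Rightarrow> 'b::euclidean_space) \<Rightarrow> ennreal) \<Rightarrow> (real \<Rightarrow> 'a \<Rightarrow> 'b) \<Rightarrow> bool" where
  "in_Linf_time T N u \<longleftrightarrow> spacetime_measurable T u \<and> Linf_time_norm T N u < \<infinity>"

definition in_L1_W11_loc :: "real \<Rightarrow> (real \<Rightarrow> real^'n \<Rightarrow> real^'n) \<Rightarrow> bool" where
  "in_L1_W11_loc T b \<longleftrightarrow>
     spacetime_measurable T b \<and>
     (\<exists>G. spacetime_measurable T G \<and>
          (AE t in lebesgue_on {0<..<T}. weak_jacobian (b t) (G t)) \<and>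
          (\<forall>r>0. (\<integral>\<^sup>+t\<in>{0<..<T}. (\<integral>\<^sup>+x\<in>ball 0 r. ennreal (norm (b t x) + norm (G t x)) \<partial>lebesgue)
                    \<partial>lebesgue) < \<infinity>))"

text \<open>\<open>d\<close> is (a representative of) \<open>div b\<close>; it is unique up to null sets.\<close>

definition has_weak_divergence ::
    "real \<Rightarrow> (real \<Rightarrow> real^'n \<Rightarrow> real^'n) \<Rightarrow> (real \<Rightarrow> real^'n \<Rightarrow> real) \<Rightarrow> bool" where
  "has_weak_divergence T b d \<longleftrightarrow>
     spacetime_measurable T d \<and> (AE t in lebesgue_on {0<..<T}. weak_divergence (b t) (d t))"

section \<open>Weak solutions of the transport equation\<close>

definition weak_solution ::
    "real \<Rightarrow> (real \<Rightarrow> real^'n \<Rightarrow> real^'n) \<Rightarrow> (real \<Rightarrow> real^'n \<Rightarrow> real) \<Rightarrow>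
     (real^'n \<Rightarrow> real) \<Rightarrow> (real \<Rightarrow> real^'n \<Rightarrow> real) \<Rightarrow> bool" where
  "weak_solution T b divb v0 v \<longleftrightarrow>
     in_Linf_time T Linf_norm v \<and>
     (\<forall>\<phi>. spacetime_test_function T \<phi> \<and> (\<forall>x. \<phi> T x = 0) \<longrightarrow>
        (LINT t:{0<..<T}|lebesgue. LINT x|lebesgue. v t x * deriv (\<lambda>s. \<phi> s x) t)
      + (LINT t:{0<..<T}|lebesgue. LINT x|lebesgue. divb t x * v t x * \<phi> t x)
      + (LINT t:{0<..<T}|lebesgue. LINT x|lebesgue. (b t x \<bullet> grad (\<phi> t) x) * v t x)
      = - (LINT x|lebesgue. v0 x * \<phi> 0 x))"

end

theory Submission
  imports Defs "HOL-Computational_Algebra.Polynomial"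
begin

text \<open>
  Mollifying in space and estimating the commutator shows that bounded weak solutions are
  renormalized: they form an algebra that is closed under continuous functions.  Hence, with
  \<open>w = u\<^sup>k - u\<close>, the function \<open>\<bar>w\<bar>\<^sup>p\<close> is again a solution, and testing with cut-offs (this uses
  the growth condition on \<open>b\<close>) gives
  \<open>\<integral> \<bar>w(t)\<bar>\<^sup>p = \<integral> \<bar>w(0)\<bar>\<^sup>p + \<integral>\<^sub>0\<^sup>t \<integral> div b \<bar>w\<bar>\<^sup>p\<close>.  By the John--Nirenberg inequality
  \<open>div b\<close> lies in \<open>exp L\<close> with a bound \<open>A(t)\<close> that is integrable in time, so splitting at the
  level \<open>m A(t)\<close> bounds the inner integral by \<open>A (m L \<integral> \<bar>w\<bar>\<^sup>p + C 2\<^sup>-\<^sup>m)\<close> for every \<open>m\<close>.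
  Choosing \<open>m\<close> large and applying Gronwall's inequality on finitely many intervals with small
  \<open>\<integral> A\<close> transports the smallness of \<open>\<integral> \<bar>w(0)\<bar>\<^sup>p\<close> up to time \<open>T\<close>.
\<close>

text \<open>The obstacle is that div b is unbounded, so the balance for Y(t) = \<integral> |w(t)|^p
  is not closed by a plain Gronwall argument. The splitting gives Y' \<le> A (m L Y + C 2^-m) with m
  free, a logarithmic modulus of Osgood type: over an interval the linear part costs exp (m L
  \<integral> A) while the error gains 2^-m. The gain wins only while L \<integral> A < ln 2; this
  forces the subdivision of [0,T], with a fresh m on each piece. The constant C contains sup |w|^p
  and the measure of a ball: here the uniform bound on the data and the compact support of div b
  enter. The gradient of b is only locally integrable, yet the commutator tends to 0 in L1 because v
  is bounded. Closing the class under products and applying Weierstrass replaces a chain rule, so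
  |y|^p needs no smoothness at 0. Identities hold only for almost every time, with a null set
  depending on the test function. Arguments in time are therefore run on primitives
  \<open>prim\<close>, and \<open>Lp_power\<close> is the continuous version of Y. The analysis is
  done with Borel functions on \<open>lborel\<close>; passing from Lebesgue classes to them is a
  separate matter.\<close>

abbreviation nn_lborel :: "('a::euclidean_space \<Rightarrow> ennreal) \<Rightarrow> ennreal"  (binder \<open>NNINT \<close> 10)
  where "nn_lborel f \<equiv> nn_integral lborel f"

text \<open>Unqualified, these names would refer to the Henstock--Kurzweil integral.\<close>

lemmas LINT_add = Bochner_Integration.integral_add
lemmas LINT_diff = Bochner_Integration.integral_diff
lemmas LINT_sum = Bochner_Integration.integral_sum
lemmas LINT_cong = Bochner_Integration.integral_cong
lemmas LINT_nonneg = Bochner_Integration.integral_nonneg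
lemmas L1_add = Bochner_Integration.integrable_add
lemmas L1_diff = Bochner_Integration.integrable_diff
lemmas L1_sum = Bochner_Integration.integrable_sum
lemmas L1_bound = Bochner_Integration.integrable_bound

subsection \<open>Test functions and mollifiers\<close>

text \<open>This is the premise of \<open>frechet_derivative_unique_within\<close>: derivatives
  within S are unique when S accumulates at each of its points along every basis direction. It lets
  one calculus of \<open>Ck_on\<close> serve the whole space and the closed time strip.\<close>

definition accum_dirs :: "'a::euclidean_space set \<Rightarrow> bool" where
  "accum_dirs S \<longleftrightarrow> (\<forall>x\<in>S. \<forall>i\<in>Basis. \<forall>e>0. \<exists>d. 0 < \<bar>d\<bar> \<and> \<bar>d\<bar> < e \<and> x + d *\<^sub>R i \<in> S)"

lemma accum_dirs_UNIV: "accum_dirs UNIV"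
  unfolding accum_dirs_def
proof (intro ballI allI impI)
  fix x i :: 'a and e :: real
  assume "0 < e"
  then show "\<exists>d. 0 < \<bar>d\<bar> \<and> \<bar>d\<bar> < e \<and> x + d *\<^sub>R i \<in> UNIV" by (intro exI[of _ "e/2"]) auto
qed

lemma accum_dirs_strip:
  assumes "0 < T"
  shows "accum_dirs ({0..T::real} \<times> (UNIV::'a::euclidean_space set))"
  unfolding accum_dirs_def
proof (intro ballI allI impI)
  fix x :: "real \<times> 'a" and i :: "real \<times> 'a" and e :: real
  assume x: "x \<in> {0..T} \<times> UNIV" and i: "i \<in> Basis" and e: "0 < e"
  \<comment> \<open>The step is directed away from the nearer end of [0,T] and has length at most
    T/2, so it stays in the strip also at t = 0 and t = T.\<close>
  define d where "d = (if fst x < T/2 then min (e/2) (T/2) else - min (e/2) (T/2))"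
  have 1: "0 < \<bar>d\<bar>" "\<bar>d\<bar> < e" using e assms by (auto simp: d_def)
  have "fst i = 0 \<or> fst i = 1" using i by (auto simp: Basis_prod_def)
  then have "fst x + d * fst i \<in> {0..T}" using x assms e by (auto simp: d_def min_def split: if_splits)
  then show "\<exists>d. 0 < \<bar>d\<bar> \<and> \<bar>d\<bar> < e \<and> x + d *\<^sub>R i \<in> {0..T} \<times> UNIV"
    using 1 by (intro exI[of _ d] conjI) (simp_all add: mem_Times_iff)
qed

lemma Ck_on_cong:
  assumes "\<And>x. x \<in> S \<Longrightarrow> f x = g x" "Ck_on k S f"
  shows "Ck_on k S g"
  using assms
proof (induction k arbitrary: f g)
  case 0
  then show ?case by (metis Ck_on.simps(1) continuous_on_cong)
next
  case (Suc k)
  have hd: "(f has_derivative D) (at x within S) \<longleftrightarrow> (g has_derivative D) (at x within S)" if "x \<in> S" for x D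
    using that Suc.prems(1) by (metis has_derivative_transform)
  have fd: "frechet_derivative f (at x within S) = frechet_derivative g (at x within S)" if "x \<in> S" for x
    unfolding frechet_derivative_def using hd[OF that] by simp
  show ?case
    using Suc.prems(2) Suc.IH[of "\<lambda>x. frechet_derivative f (at x within S) _" "\<lambda>x. frechet_derivative g (at x within S) _"] hd fd
    by (auto simp: differentiable_def)
qed

text \<open>\<open>Ck_on\<close> speaks of \<open>frechet_derivative\<close>, a chosen derivative.
  Uniqueness identifies it with any derivative computed by the usual rules, so closure properties
  follow by induction on k.\<close>

lemma Ck_on_SucI:
  assumes S: "accum_dirs S" and f: "\<And>x. x \<in> S \<Longrightarrow> (f has_derivative f' x) (at x within S)"
    and k: "\<And>v. Ck_on k S (\<lambda>x. f' x v)"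
  shows "Ck_on (Suc k) S f"
proof -
  have fd: "frechet_derivative f (at x within S) = f' x" if "x \<in> S" for x
  proof (rule frechet_derivative_unique_within)
    show "(f has_derivative frechet_derivative f (at x within S)) (at x within S)"
      using f[OF that] frechet_derivative_works differentiable_def by blast
    show "(f has_derivative f' x) (at x within S)" by (rule f[OF that])
  qed (use S that in \<open>auto simp: accum_dirs_def\<close>)
  have "Ck_on k S (\<lambda>x. frechet_derivative f (at x within S) v)" for v
    by (rule Ck_on_cong[OF _ k[of v]]) (simp add: fd)
  then show ?thesis using f by (auto simp: differentiable_def)
qed

lemma Ck_on_SucD:
  assumes "Ck_on (Suc k) S f"
  shows "x \<in> S \<Longrightarrow> (f has_derivative frechet_derivative f (at x within S)) (at x within S)"
    and "Ck_on k S (\<lambda>x. frechet_derivative f (at x within S) v)"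
  using assms frechet_derivative_works by auto

lemma Ck_on_mono_Suc: "Ck_on (Suc k) S f \<Longrightarrow> Ck_on k S f"
proof (induction k arbitrary: f)
  case 0
  then show ?case
    by (auto simp: continuous_on_eq_continuous_within intro: differentiable_imp_continuous_within)
next
  case (Suc k)
  then show ?case by simp
qed

lemma Ck_on_const:
  assumes "accum_dirs S" shows "Ck_on k S (\<lambda>x. c)"
proof (induction k arbitrary: c)
  case (Suc k)
  show ?case by (rule Ck_on_SucI[OF assms, where f' = "\<lambda>x v. 0"]) (use Suc in auto)
qed simp

lemma Ck_on_add:
  assumes S: "accum_dirs S" and "Ck_on k S f" "Ck_on k S g"
  shows "Ck_on k S (\<lambda>x. f x + g x)"
  using assms(2,3)
proof (induction k arbitrary: f g)
  case 0
  then show ?case by (auto intro: continuous_intros)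
next
  case (Suc k)
  show ?case
    by (rule Ck_on_SucI[OF S has_derivative_add[OF Ck_on_SucD(1)[OF Suc.prems(1)] Ck_on_SucD(1)[OF Suc.prems(2)]]])
      (use Suc.IH Ck_on_SucD(2)[OF Suc.prems(1)] Ck_on_SucD(2)[OF Suc.prems(2)] in auto)
qed

lemma Ck_on_mult:
  assumes S: "accum_dirs S" and "Ck_on k S f" "Ck_on k S g"
  shows "Ck_on k S (\<lambda>x. f x * g x)"
  using assms(2,3)
proof (induction k arbitrary: f g)
  case 0
  then show ?case by (auto intro: continuous_intros)
next
  case (Suc k)
  show ?case
    by (rule Ck_on_SucI[OF S has_derivative_mult[OF Ck_on_SucD(1)[OF Suc.prems(1)] Ck_on_SucD(1)[OF Suc.prems(2)]]])
      (use Suc.IH Ck_on_SucD(2)[OF Suc.prems(1)] Ck_on_SucD(2)[OF Suc.prems(2)]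
         Ck_on_mono_Suc[OF Suc.prems(1)] Ck_on_mono_Suc[OF Suc.prems(2)] in \<open>auto intro!: Ck_on_add[OF S]\<close>)
qed

text \<open>With L a scaling this covers dilated and translated kernels, with L a projection the two
  factors of a product test function on the strip.\<close>

lemma Ck_on_affine:
  assumes S: "accum_dirs S" and L: "bounded_linear L" and "Ck_on k UNIV f"
  shows "Ck_on k S (\<lambda>x. f (a + L x))"
  using assms(3)
proof (induction k arbitrary: f)
  case 0
  then show ?case
    using continuous_on_compose2[of UNIV f S "\<lambda>x. a + L x"]
    by (simp add: continuous_on_add linear_continuous_on[OF L])
next
  case (Suc k)
  have *: "((\<lambda>x. f (a + L x)) has_derivative (\<lambda>v. frechet_derivative f (at (a + L x)) (L v))) (at x within S)" for x
  proof -
    have 1: "((\<lambda>x. a + L x) has_derivative L) (at x within S)"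
    proof -
      have c: "((\<lambda>x. a) has_derivative (\<lambda>x. 0)) (at x within S)" by (rule has_derivative_const)
      have l: "(L has_derivative L) (at x within S)" by (rule bounded_linear_imp_has_derivative[OF L])
      show ?thesis using has_derivative_add[OF c l] by simp
    qed
    have 2: "(f has_derivative frechet_derivative f (at (a + L x))) (at (a + L x))"
      using Ck_on_SucD(1)[OF Suc.prems, of "a + L x"] by simp
    show ?thesis by (rule has_derivative_compose[OF 1 2])
  qed
  show ?case
    by (rule Ck_on_SucI[OF S *]) (use Suc.IH Ck_on_SucD(2)[OF Suc.prems] in auto)
qed

lemma Ck_on_bounded_linear:
  fixes L :: "'a::euclidean_space \<Rightarrow> real"
  assumes "bounded_linear L" shows "Ck_on k UNIV L"
proof (cases k)
  case 0
  then show ?thesis using assms by (auto intro: linear_continuous_on)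
next
  case (Suc n)
  show ?thesis unfolding Suc
    by (rule Ck_on_SucI[OF accum_dirs_UNIV, where f' = "\<lambda>x. L"])
      (auto intro: bounded_linear_imp_has_derivative assms Ck_on_const accum_dirs_UNIV)
qed

section \<open>A smooth bump with compact support\<close>

definition exp_bump :: "real poly \<Rightarrow> real \<Rightarrow> real" where
  "exp_bump P s = (if 0 < s then poly P (1/s) * exp (- (1/s)) else 0)"

lemma poly_exp_tendsto_0: "((\<lambda>z. poly P z * exp (- z)) \<longlongrightarrow> (0::real)) at_top"
proof -
  have "((\<lambda>z. \<Sum>i\<le>degree P. coeff P i * (z ^ i / exp z)) \<longlongrightarrow> (\<Sum>i\<le>degree P. coeff P i * 0)) at_top"
    by (intro tendsto_intros tendsto_power_div_exp_0)
  then show ?thesis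
    by (simp add: poly_altdef exp_minus sum_distrib_right divide_inverse mult.assoc)
qed

lemma exp_bump_tendsto_0: "(exp_bump P \<longlongrightarrow> 0) (at 0)"
proof -
  have "(exp_bump P \<longlongrightarrow> 0) (at_left 0)"
    by (rule tendsto_eventually) (auto simp: exp_bump_def eventually_at_filter)
  moreover have "(exp_bump P \<longlongrightarrow> 0) (at_right 0)"
  proof -
    have "((\<lambda>s. poly P (inverse s) * exp (- inverse s)) \<longlongrightarrow> 0) (at_right 0)"
      by (rule filterlim_compose[OF poly_exp_tendsto_0 filterlim_inverse_at_top_right])
    then show ?thesis
      by (rule Lim_transform_eventually) (auto simp: exp_bump_def eventually_at_filter inverse_eq_divide)
  qed
  ultimately show ?thesis by (simp add: filterlim_split_at)
qed

text \<open>The functions P(1/s) exp(-1/s) form a family closed under differentiation: since (1/s)'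
  = -1/s^2, the polynomial P becomes z^2 (P - P'). This closure is what makes all orders of
  smoothness accessible by induction.\<close>

lemma exp_bump_has_derivative:
  "(exp_bump P has_real_derivative exp_bump (monom 1 2 * (P - pderiv P)) s) (at s)"
proof -
  consider "s < 0" | "s = 0" | "0 < s" by linarith
  then show ?thesis
  proof cases
    case 1
    have "(exp_bump P has_real_derivative 0) (at s)"
      by (rule has_field_derivative_transform_within_open[of "\<lambda>_. 0" _ _ "{..<0}"])
        (use 1 in \<open>auto simp: exp_bump_def\<close>)
    then show ?thesis using 1 by (simp add: exp_bump_def)
  next
    case 2
    \<comment> \<open>Dividing by h multiplies the polynomial in 1/h by its variable, so the
      difference quotient at 0 is again a member of the family, with polynomial
      \<open>pCons 0 P\<close>.\<close>
    have "((\<lambda>h. (exp_bump P (0 + h) - exp_bump P 0) / h) \<longlongrightarrow> 0) (at 0)"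
      by (rule Lim_transform_eventually[OF exp_bump_tendsto_0[of "pCons 0 P"]])
        (auto simp: exp_bump_def eventually_at_filter)
    then show ?thesis unfolding 2 DERIV_def by (simp add: exp_bump_def)
  next
    case 3
    have "((\<lambda>s. poly P (1/s) * exp (- (1/s))) has_real_derivative exp_bump (monom 1 2 * (P - pderiv P)) s) (at s)"
      using 3 by (auto intro!: derivative_eq_intros DERIV_chain2[OF poly_DERIV]
          simp: exp_bump_def poly_monom field_simps power2_eq_square)
    then show ?thesis
      by (rule has_field_derivative_transform_within_open[of _ _ _ "{0<..}"])
        (use 3 in \<open>auto simp: exp_bump_def\<close>)
  qed
qed

text \<open>Using \<open>x \<bullet> x\<close> in place of the norm keeps the inner function
  polynomial, hence smooth at the origin.\<close>

definition ball_bump :: "'a::euclidean_space \<Rightarrow> real" where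
  "ball_bump x = exp_bump 1 (1 - x \<bullet> x)"

text \<open>P must be general for the induction: a derivative changes P and contributes a linear
  factor.\<close>

lemma Ck_on_exp_bump: "Ck_on k UNIV (\<lambda>x::'a::euclidean_space. exp_bump P (1 - x \<bullet> x))"
proof (induction k arbitrary: P)
  case 0
  have "isCont (exp_bump P) s" for s using exp_bump_has_derivative DERIV_isCont by blast
  then have "continuous_on UNIV (exp_bump P)" by (simp add: continuous_at_imp_continuous_on)
  then show ?case
    by (auto intro!: continuous_on_compose2[of UNIV "exp_bump P"] continuous_intros)
next
  case (Suc k)
  let ?Q = "monom 1 2 * (P - pderiv P)"
  have *: "((\<lambda>x::'a. exp_bump P (1 - x \<bullet> x)) has_derivative (\<lambda>v. exp_bump ?Q (1 - x \<bullet> x) * (- 2 * (v \<bullet> x)))) (at x)" for x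
  proof -
    have "((\<lambda>x::'a. 1 - x \<bullet> x) has_derivative (\<lambda>v. - 2 * (v \<bullet> x))) (at x)"
      by (auto intro!: derivative_eq_intros simp: inner_commute)
    from has_derivative_compose[OF this exp_bump_has_derivative[unfolded has_field_derivative_def]]
    show ?thesis .
  qed
  show ?case
  proof (rule Ck_on_SucI[OF accum_dirs_UNIV *])
    show "Ck_on k UNIV (\<lambda>x. exp_bump ?Q (1 - x \<bullet> x) * (- 2 * (v \<bullet> x)))" for v :: 'a
      by (intro Ck_on_mult accum_dirs_UNIV Suc.IH Ck_on_const
          Ck_on_bounded_linear[OF bounded_linear_inner_right])
  qed
qed

lemma ball_bump_nonneg: "0 \<le> ball_bump x"
  and ball_bump_pos: "norm x < 1 \<Longrightarrow> 0 < ball_bump x"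
  and ball_bump_zero: "1 \<le> norm x \<Longrightarrow> ball_bump x = 0"
  and ball_bump_le: "ball_bump x \<le> ball_bump 0"
proof -
  have n: "x \<bullet> x = (norm x)^2" by (simp add: power2_norm_eq_inner)
  show "0 \<le> ball_bump x" by (simp add: ball_bump_def exp_bump_def)
  show "norm x < 1 \<Longrightarrow> 0 < ball_bump x"
    by (simp add: ball_bump_def exp_bump_def n abs_square_less_1)
  show "1 \<le> norm x \<Longrightarrow> ball_bump x = 0"
    by (simp add: ball_bump_def exp_bump_def n abs_square_less_1 leD)
  show "ball_bump x \<le> ball_bump 0"
    by (auto simp: ball_bump_def exp_bump_def n field_simps)
qed

text \<open>\<^const>\<open>test_function\<close> over an arbitrary Euclidean space.\<close>

definition csmooth :: "('a::euclidean_space \<Rightarrow> real) \<Rightarrow> bool" where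
  "csmooth f \<longleftrightarrow> smooth_on UNIV f \<and> (\<exists>r. \<forall>x. r \<le> norm x \<longrightarrow> f x = 0)"

lemma csmooth_test_function: "csmooth (f :: real^'n \<Rightarrow> real) \<longleftrightarrow> test_function f"
proof
  assume "csmooth f"
  then obtain r where r: "smooth_on UNIV f" "\<And>x. r \<le> norm x \<Longrightarrow> f x = 0" unfolding csmooth_def by blast
  then show "test_function f" unfolding test_function_def
    by (intro conjI exI[of _ "cball 0 r"]) auto
next
  assume "test_function f"
  then obtain K where "smooth_on UNIV f" "compact K" and K: "\<And>x. x \<notin> K \<Longrightarrow> f x = 0"
    unfolding test_function_def by blast
  moreover obtain r where "\<forall>x\<in>K. norm x < r"
    using \<open>compact K\<close> compact_imp_bounded bounded_pos_less by blast
  ultimately show "csmooth f" unfolding csmooth_def by (metis linorder_not_less)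
qed

lemma csmooth_ball_bump: "csmooth ball_bump"
  unfolding csmooth_def smooth_on_def using ball_bump_zero
  by (auto simp: ball_bump_def[abs_def] intro!: Ck_on_exp_bump)

lemma csmooth_const_mult:
  assumes "csmooth f" shows "csmooth (\<lambda>x. c * f x)"
  using assms unfolding csmooth_def smooth_on_def
  by (auto intro!: Ck_on_mult Ck_on_const accum_dirs_UNIV)

lemma smooth_mult_csmooth:
  assumes "csmooth f" "smooth_on UNIV g" shows "csmooth (\<lambda>x. g x * f x)"
  using assms unfolding csmooth_def smooth_on_def
  by (auto intro!: Ck_on_mult accum_dirs_UNIV)

lemma csmooth_affine:
  assumes f: "csmooth f" and c: "c \<noteq> 0"
  shows "csmooth (\<lambda>x. f (a + c *\<^sub>R x))"
proof -
  obtain r where r: "\<And>x. r \<le> norm x \<Longrightarrow> f x = 0" using f unfolding csmooth_def by blast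
  have "smooth_on UNIV (\<lambda>x. f (a + c *\<^sub>R x))"
    using f unfolding csmooth_def smooth_on_def
    by (auto intro!: Ck_on_affine accum_dirs_UNIV bounded_linear_scaleR_right)
  moreover have "f (a + c *\<^sub>R x) = 0" if "(r + norm a) / \<bar>c\<bar> \<le> norm x" for x
  proof (rule r)
    have "r + norm a \<le> norm (c *\<^sub>R x)" using that c by (simp add: field_simps)
    also have "\<dots> \<le> norm (a + c *\<^sub>R x) + norm a" by (metis add_diff_cancel_left' norm_triangle_ineq4 add.commute)
    finally show "r \<le> norm (a + c *\<^sub>R x)" by simp
  qed
  ultimately show ?thesis unfolding csmooth_def by blast
qed

lemma csmooth_has_derivative:
  "csmooth f \<Longrightarrow> (f has_derivative frechet_derivative f (at x)) (at x)"
  using Ck_on_SucD(1)[of 0 UNIV f x] by (auto simp: csmooth_def smooth_on_def)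

lemma csmooth_deriv:
  assumes f: "csmooth f"
  shows "csmooth (\<lambda>x. frechet_derivative f (at x) v)"
proof -
  obtain r where r: "\<And>x. r \<le> norm x \<Longrightarrow> f x = 0" using f unfolding csmooth_def by blast
  have "frechet_derivative f (at x) v = 0" if "r + 1 \<le> norm x" for x
  proof -
    have "(f has_derivative (\<lambda>_. 0)) (at x)"
      by (rule has_derivative_transform_within_open[of "\<lambda>_. 0" _ _ _ "- cball 0 r"])
        (use that r in \<open>auto simp: open_Compl\<close>)
    then show ?thesis using frechet_derivative_at by metis
  qed
  then show ?thesis
    using f Ck_on_SucD(2)[of _ UNIV f v] unfolding csmooth_def smooth_on_def by blast
qed

lemma csmooth_continuous: "csmooth f \<Longrightarrow> continuous_on UNIV f"
  unfolding csmooth_def smooth_on_def using Ck_on.simps(1) by blast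

lemma csmooth_borel[measurable (raw)]: "csmooth f \<Longrightarrow> f \<in> borel_measurable borel"
  using csmooth_continuous borel_measurable_continuous_onI by blast

lemma csmooth_bounded:
  assumes "csmooth f" obtains C where "0 < C" "\<And>x. \<bar>f x\<bar> \<le> C"
proof -
  obtain r where r: "\<And>x. r \<le> norm x \<Longrightarrow> f x = 0" using assms unfolding csmooth_def by blast
  have "bounded (f ` cball 0 r)"
    using csmooth_continuous[OF assms]
    by (intro compact_imp_bounded compact_continuous_image) (auto intro: continuous_on_subset)
  then obtain C where C: "0 < C" "\<And>x. norm x \<le> r \<Longrightarrow> \<bar>f x\<bar> \<le> C"
    unfolding bounded_pos by auto
  have "\<bar>f x\<bar> \<le> C" for x
    using C(1) C(2)[of x] r[of x] by (cases "norm x \<le> r") auto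
  then show ?thesis using C(1) that by blast
qed

lemma csmooth_support:
  assumes "csmooth f" obtains r where "0 < r" "\<And>x. r \<le> norm x \<Longrightarrow> f x = 0"
proof -
  obtain r where "\<And>x. r \<le> norm x \<Longrightarrow> f x = 0" using assms unfolding csmooth_def by blast
  then show ?thesis by (intro that[of "max 1 r"]) auto
qed

lemma integrable_bounded_support:
  fixes f :: "'a::euclidean_space \<Rightarrow> 'b::euclidean_space"
  assumes [measurable]: "f \<in> borel_measurable borel"
    and C: "\<And>x. norm (f x) \<le> C" and r: "\<And>x. r \<le> norm x \<Longrightarrow> f x = 0"
  shows "integrable lborel f"
proof (rule L1_bound)
  show "integrable lborel (\<lambda>x. C * indicator (cball (0::'a) r) x :: real)"
    by (intro integrable_mult_right integrable_real_indicator)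
      (use emeasure_lborel_cball_finite in \<open>auto simp: less_top[symmetric]\<close>)
  have "0 \<le> C" using C[of 0] norm_ge_zero order_trans by blast
  then show "AE x in lborel. norm (f x) \<le> norm (C * indicator (cball (0::'a) r) x :: real)"
    using C r by (auto simp: indicator_def)
qed simp

lemma csmooth_integrable:
  assumes "csmooth f" shows "integrable lborel f"
proof -
  obtain C r where "\<And>x. \<bar>f x\<bar> \<le> C" "\<And>x. r \<le> norm x \<Longrightarrow> f x = 0"
    using csmooth_bounded[OF assms] csmooth_support[OF assms] by metis
  then show ?thesis by (intro integrable_bounded_support) (auto simp: csmooth_borel[OF assms])
qed

lemma csmooth_deriv_bounded:
  assumes f: "csmooth f"
  obtains C where "0 < C" "\<And>x v. \<bar>frechet_derivative f (at x) v\<bar> \<le> C * norm v"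
proof -
  have "\<exists>C. 0 < C \<and> (\<forall>x. \<bar>frechet_derivative f (at x) i\<bar> \<le> C)" for i
    by (rule csmooth_bounded[OF csmooth_deriv[OF f, of i]]) blast
  then obtain C where C: "\<And>i. 0 < C i" "\<And>i x. \<bar>frechet_derivative f (at x) i\<bar> \<le> C i" by metis
  show ?thesis
  proof (rule that)
    show "0 < (\<Sum>i\<in>Basis. C i)" by (intro sum_pos) (auto simp: C)
    fix x v
    have lin: "linear (frechet_derivative f (at x))"
      using csmooth_has_derivative[OF f] has_derivative_linear by blast
    have "\<bar>frechet_derivative f (at x) v\<bar> = \<bar>\<Sum>i\<in>Basis. (v \<bullet> i) * frechet_derivative f (at x) i\<bar>"
      by (subst (1) euclidean_representation[symmetric, of v])
        (simp add: linear_sum[OF lin] linear_scale[OF lin])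
    also have "\<dots> \<le> (\<Sum>i\<in>Basis. norm v * C i)"
      by (intro order_trans[OF sum_abs] sum_mono) (auto simp: abs_mult intro!: mult_mono Basis_le_norm C(2))
    finally show "\<bar>frechet_derivative f (at x) v\<bar> \<le> (\<Sum>i\<in>Basis. C i) * norm v"
      by (simp add: sum_distrib_left mult.commute)
  qed
qed

lemma csmooth_lipschitz:
  assumes f: "csmooth f"
  obtains C where "0 < C" "\<And>x y. \<bar>f x - f y\<bar> \<le> C * norm (x - y)"
proof -
  obtain C where C: "0 < C" "\<And>x v. \<bar>frechet_derivative f (at x) v\<bar> \<le> C * norm v"
    using csmooth_deriv_bounded[OF f] by blast
  have "norm (f x - f y) \<le> C * norm (x - y)" for x y
    by (rule differentiable_bound[of UNIV f "\<lambda>x. frechet_derivative f (at x)"])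
      (use csmooth_has_derivative[OF f] C in \<open>auto intro!: onorm_bound\<close>)
  then show ?thesis using that C(1) by auto
qed

section \<open>Convolution of a bounded function with a test function\<close>

definition conv :: "('a::euclidean_space \<Rightarrow> real) \<Rightarrow> ('a \<Rightarrow> real) \<Rightarrow> 'a \<Rightarrow> real" where
  "conv v K y = (LINT x|lborel. v x * K (y - x))"

lemma csmooth_reflect: "csmooth K \<Longrightarrow> csmooth (\<lambda>x. K (y - x))"
  using csmooth_affine[of K "-1" y] by simp

lemma conv_integrable:
  assumes K: "csmooth K" and [measurable]: "v \<in> borel_measurable borel" and M: "\<And>x. \<bar>v x\<bar> \<le> M"
  shows "integrable lborel (\<lambda>x. v x * K (y - x))"
proof -
  have "integrable lborel (\<lambda>x. M * K (y - x))"
    by (intro integrable_mult_right csmooth_integrable csmooth_reflect K)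
  then show ?thesis
    by (rule L1_bound)
      (use csmooth_borel[OF K, measurable] M in \<open>auto simp: abs_mult intro!: mult_right_mono order_trans[OF M]\<close>)
qed

text \<open>Since v is only bounded and measurable, the derivative has to fall on the kernel. The
  normalized remainders of K tend to 0 pointwise, and the Lipschitz bound and compact support of K
  give one integrable majorant, so dominated convergence applies along sequences.\<close>

lemma conv_has_derivative:
  assumes K: "csmooth K" and [measurable]: "v \<in> borel_measurable borel" and M: "\<And>x. \<bar>v x\<bar> \<le> M"
  shows "(conv v K has_derivative (\<lambda>h. conv v (\<lambda>x. frechet_derivative K (at x) h) y)) (at y)"
proof -
  note [measurable] = csmooth_borel[OF K] csmooth_borel[OF csmooth_deriv[OF K]]
  let ?D = "\<lambda>x h. frechet_derivative K (at x) h"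
  note int = conv_integrable[OF K assms(2) M] conv_integrable[OF csmooth_deriv[OF K] assms(2) M]
  have lin: "linear (?D x)" for x
    using csmooth_has_derivative[OF K] has_derivative_linear by blast
  have "linear (\<lambda>h. conv v (\<lambda>x. ?D x h) y)"
    by (rule linearI)
      (auto simp: conv_def linear_add[OF lin] linear_scale[OF lin] distrib_left int
        LINT_add mult.left_commute[of _ "_::real"])
  then have bl: "bounded_linear (\<lambda>h. conv v (\<lambda>x. ?D x h) y)"
    using linear_conv_bounded_linear by blast
  obtain r where r: "0 < r" "\<And>x. r \<le> norm x \<Longrightarrow> K x = 0" using csmooth_support[OF K] by metis
  obtain L where L: "0 < L" "\<And>x y. \<bar>K x - K y\<bar> \<le> L * norm (x - y)" using csmooth_lipschitz[OF K] by metis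
  obtain C where C: "0 < C" "\<And>x v. \<bar>?D x v\<bar> \<le> C * norm v" using csmooth_deriv_bounded[OF K] by metis
  have D0: "?D x h = 0" if "r < norm x" for x h
  proof -
    have "(K has_derivative (\<lambda>_. 0)) (at x)"
      by (rule has_derivative_transform_within_open[of "\<lambda>_. 0" _ _ _ "- cball 0 r"])
        (use that r in \<open>auto simp: open_Compl\<close>)
    then show ?thesis using frechet_derivative_at by metis
  qed
  have M0: "0 \<le> M" using M[of 0] by linarith
  have "((\<lambda>z. norm (conv v K z - conv v K y - conv v (\<lambda>x. ?D x (z - y)) y) / norm (z - y)) \<longlongrightarrow> 0) (at y)"
    unfolding tendsto_at_iff_sequentially
  proof (intro allI impI)
    fix Z assume Z0: "\<forall>i. Z i \<in> UNIV - {y}" and Z: "Z \<longlonglongrightarrow> y"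
    define q where "q k x = v x * (K (Z k - x) - K (y - x) - ?D (y - x) (Z k - y)) / norm (Z k - y)" for k x
    have [measurable]: "q k \<in> borel_measurable borel" for k unfolding q_def by measurable
    have eq: "(conv v K (Z k) - conv v K y - conv v (\<lambda>x. ?D x (Z k - y)) y) / norm (Z k - y) = (LINT x|lborel. q k x)" for k
      unfolding q_def conv_def by (simp add: right_diff_distrib int LINT_diff)
    have "(\<lambda>k. (LINT x|lborel. q k x)) \<longlonglongrightarrow> (\<integral>x. 0 \<partial>(lborel::'a measure))"
    proof -
      obtain B where B: "\<And>k. norm (Z k - y) \<le> B"
        using Z convergent_imp_Bseq[of "\<lambda>k. Z k - y"] LIM_zero[OF Z] unfolding Bseq_def convergent_def by blast
      have "0 \<le> B" using B[of 0] norm_ge_zero order_trans by blast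
      \<comment> \<open>L accounts for the increment of K and C for its linear part. Farther than r
        + B from y both vanish for every k, because |Z k - y| \<le> B.\<close>
      let ?w = "\<lambda>x::'a. M * (L + C) * indicator (cball y (r + B)) x :: real"
      have bnd: "norm (q k x) \<le> ?w x" for k x
      proof (cases "x \<in> cball y (r + B)")
        case True
        have "\<bar>K (Z k - x) - K (y - x) - ?D (y - x) (Z k - y)\<bar> \<le> L * norm (Z k - y) + C * norm (Z k - y)"
          using L(2)[of "Z k - x" "y - x"] C(2)[of "y - x" "Z k - y"] by simp
        then have "\<bar>v x * (K (Z k - x) - K (y - x) - ?D (y - x) (Z k - y))\<bar> \<le> M * ((L + C) * norm (Z k - y))"
          using M M0 by (auto simp: abs_mult distrib_right intro!: mult_mono)
        then show ?thesis using True Z0 by (simp add: q_def field_simps)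
      next
        case False
        then have n: "r + B < norm (y - x)" by (simp add: dist_norm)
        then have "r < norm (y - x)" using \<open>0 \<le> B\<close> by linarith
        moreover have "r \<le> norm (Z k - x)"
          using n B[of k] norm_triangle_ineq[of "y - Z k" "Z k - x"] by (simp add: norm_minus_commute)
        ultimately have "q k x = 0" using r D0 unfolding q_def by simp
        then show ?thesis using False by simp
      qed
      have lim: "(\<lambda>k. q k x) \<longlonglongrightarrow> 0" for x
      proof -
        have "((\<lambda>z. norm (K z - K (y - x) - ?D (y - x) (z - (y - x))) / norm (z - (y - x))) \<longlongrightarrow> 0) (at (y - x))"
          using csmooth_has_derivative[OF K, of "y - x"] unfolding has_derivative_iff_norm by blast
        then have "((\<lambda>z. norm (K z - K (y - x) - ?D (y - x) (z - (y - x))) / norm (z - (y - x))) \<circ> (\<lambda>k. Z k - x)) \<longlonglongrightarrow> 0"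
          by (rule tendsto_at_iff_sequentially[THEN iffD1, rule_format]) (use Z0 in \<open>auto intro!: tendsto_intros Z\<close>)
        then have "(\<lambda>k. \<bar>K (Z k - x) - K (y - x) - ?D (y - x) (Z k - y)\<bar> / norm (Z k - y)) \<longlonglongrightarrow> 0"
          by (simp add: o_def)
        then have "(\<lambda>k. \<bar>(K (Z k - x) - K (y - x) - ?D (y - x) (Z k - y)) / norm (Z k - y)\<bar>) \<longlonglongrightarrow> 0"
          by simp
        then have "(\<lambda>k. (K (Z k - x) - K (y - x) - ?D (y - x) (Z k - y)) / norm (Z k - y)) \<longlonglongrightarrow> 0"
          by (simp only: tendsto_rabs_zero_iff)
        from tendsto_mult_right_zero[OF this, of "v x"] show ?thesis by (simp add: q_def)
      qed
      show ?thesis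
      proof (rule integral_dominated_convergence[where w = ?w])
        show "integrable lborel ?w"
          by (intro integrable_mult_right integrable_real_indicator) (use emeasure_lborel_cball_finite in \<open>auto simp: less_top[symmetric]\<close>)
      qed (use bnd lim in auto)
    qed
    then have "(\<lambda>k. \<bar>\<integral>x. q k x \<partial>lborel\<bar>) \<longlonglongrightarrow> 0" by (simp add: tendsto_rabs_zero)
    then show "((\<lambda>z. norm (conv v K z - conv v K y - conv v (\<lambda>x. ?D x (z - y)) y) / norm (z - y)) \<circ> Z) \<longlonglongrightarrow> 0"
      by (simp add: o_def flip: eq)
  qed
  then show ?thesis unfolding has_derivative_iff_norm using bl by blast
qed

lemma conv_smooth:
  assumes "csmooth K" and v: "v \<in> borel_measurable borel" "\<And>x. \<bar>v x\<bar> \<le> M"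
  shows "smooth_on UNIV (conv v K)"
  unfolding smooth_on_def
proof
  fix k show "Ck_on k UNIV (conv v K)" using assms(1)
  proof (induction k arbitrary: K)
    case 0
    then show ?case
      by (auto intro!: continuous_at_imp_continuous_on has_derivative_continuous[OF conv_has_derivative[OF 0 v]])
  next
    case (Suc k)
    show ?case
      by (rule Ck_on_SucI[OF accum_dirs_UNIV conv_has_derivative[OF Suc.prems v]])
        (intro Suc.IH csmooth_deriv Suc.prems)
  qed
qed

section \<open>Continuity of translations in L1\<close>

lemma nn_integral_lborel_shift:
  assumes "f \<in> borel_measurable borel"
  shows "(NNINT x. f (x + h)) = (\<integral>\<^sup>+x. f x \<partial>(lborel :: 'a::euclidean_space measure))"
proof -
  have "(NNINT x. f x) = (\<integral>\<^sup>+x. f x \<partial>distr lborel borel ((+) h))" by (simp add: lborel_distr_plus)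
  also have "\<dots> = (NNINT x. f (h + x))" by (rule nn_integral_distr) (use assms in auto)
  finally show ?thesis by (simp add: add.commute)
qed

lemma integral_lborel_shift:
  fixes f :: "'a::euclidean_space \<Rightarrow> 'b::euclidean_space"
  assumes "f \<in> borel_measurable borel"
  shows "(LINT x|lborel. f (x + h)) = (LINT x|lborel. f x)"
proof -
  have "(LINT x|lborel. f x) = (\<integral>x. f x \<partial>distr lborel borel ((+) h))" by (simp add: lborel_distr_plus)
  also have "\<dots> = (LINT x|lborel. f (h + x))" by (rule integral_distr) (use assms in auto)
  finally show ?thesis by (simp add: add.commute)
qed

lemma integrable_lborel_shift:
  fixes f :: "'a::euclidean_space \<Rightarrow> 'b::euclidean_space"
  assumes "integrable lborel f"
  shows "integrable lborel (\<lambda>x. f (x + h))"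
proof -
  have "integrable (distr lborel borel ((+) h)) f" using assms by (simp add: lborel_distr_plus)
  then have "integrable lborel (\<lambda>x. f (h + x))"
    by (subst (asm) integrable_distr_eq) (use assms in auto)
  then show ?thesis by (simp add: add.commute)
qed

lemma integral_lborel_affine:
  fixes f :: "'a::euclidean_space \<Rightarrow> real"
  assumes "c \<noteq> 0" and [measurable]: "f \<in> borel_measurable borel"
  shows "(LINT x|lborel. f x) = \<bar>c\<bar> ^ DIM('a) * (LINT x|lborel. f (t + c *\<^sub>R x))"
proof -
  have "(LINT x|lborel. f x) = (\<integral>x. f x \<partial>density (distr lborel borel (\<lambda>x. t + c *\<^sub>R x)) (\<lambda>_. ennreal (\<bar>c\<bar> ^ DIM('a))))"
    by (subst lborel_affine[OF assms(1), of t]) simp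
  also have "\<dots> = (\<integral>x. \<bar>c\<bar> ^ DIM('a) * f x \<partial>distr lborel borel (\<lambda>x. t + c *\<^sub>R x))"
    by (subst integral_density) auto
  also have "\<dots> = (LINT x|lborel. \<bar>c\<bar> ^ DIM('a) * f (t + c *\<^sub>R x))"
    by (rule integral_distr) auto
  finally show ?thesis by simp
qed

text \<open>Translations are L1 isometries, so the translation error of f exceeds that of an
  approximation g by at most twice the distance of f and g.\<close>

lemma L1_translation_approx:
  fixes f :: "'a::euclidean_space \<Rightarrow> 'b::euclidean_space"
  assumes f: "integrable lborel f"
    and g: "\<And>e. 0 < e \<Longrightarrow> \<exists>g. integrable lborel g \<and> (LINT x|lborel. norm (f x - g x)) \<le> e \<and>
        (\<lambda>k. LINT x|lborel. norm (g (x + h k) - g x)) \<longlonglongrightarrow> 0"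
  shows "(\<lambda>k. LINT x|lborel. norm (f (x + h k) - f x)) \<longlonglongrightarrow> 0"
proof (rule LIMSEQ_I)
  fix r :: real assume r: "0 < r"
  \<comment> \<open>The budget is r/4 for each of the two approximation errors and r/2 for the
    translation of g.\<close>
  obtain g where gi: "integrable lborel g" and gf: "(LINT x|lborel. norm (f x - g x)) \<le> r/4"
    and gl: "(\<lambda>k. LINT x|lborel. norm (g (x + h k) - g x)) \<longlonglongrightarrow> 0"
    using g[of "r/4"] r by auto
  obtain N where N: "\<And>k. k \<ge> N \<Longrightarrow> norm ((LINT x|lborel. norm (g (x + h k) - g x)) - 0) < r/2"
    using LIMSEQ_D[OF gl, of "r/2"] r by auto
  show "\<exists>N. \<forall>k\<ge>N. norm ((LINT x|lborel. norm (f (x + h k) - f x)) - 0) < r"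
  proof (intro exI allI impI)
    fix k assume k: "N \<le> k"
    have i1: "integrable lborel (\<lambda>x. norm (f (x + h k) - g (x + h k)))"
      and i2: "integrable lborel (\<lambda>x. norm (g (x + h k) - g x))"
      and i3: "integrable lborel (\<lambda>x. norm (f x - g x))"
      and i4: "integrable lborel (\<lambda>x. norm (f (x + h k) - f x))"
      by (intro integrable_norm L1_diff integrable_lborel_shift f gi)+
    have "(LINT x|lborel. norm (f (x + h k) - f x))
        \<le> (LINT x|lborel. norm (f (x + h k) - g (x + h k)) + norm (g (x + h k) - g x) + norm (f x - g x))"
    proof (rule integral_mono)
      fix x
      have "f (x + h k) - f x = (f (x + h k) - g (x + h k)) + (g (x + h k) - g x) - (f x - g x)" by simp
      also have "norm \<dots> \<le> norm (f (x + h k) - g (x + h k)) + norm (g (x + h k) - g x) + norm (f x - g x)"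
        by (intro order_trans[OF norm_triangle_ineq4] add_mono norm_triangle_ineq order_refl)
      finally show "norm (f (x + h k) - f x) \<le> \<dots>" .
    qed (use i1 i2 i3 i4 in auto)
    also have "\<dots> = (LINT x|lborel. norm (f (x + h k) - g (x + h k))) + (LINT x|lborel. norm (g (x + h k) - g x))
        + (LINT x|lborel. norm (f x - g x))"
      using i1 i2 i3 by (simp add: LINT_add)
    also have "(LINT x|lborel. norm (f (x + h k) - g (x + h k))) = (LINT x|lborel. norm (f x - g x))"
      by (rule integral_lborel_shift[of "\<lambda>x. norm (f x - g x)"])
        (use borel_measurable_integrable[OF f] borel_measurable_integrable[OF gi] in auto)
    finally show "norm ((LINT x|lborel. norm (f (x + h k) - f x)) - 0) < r"
      using N[OF k] gf r LINT_nonneg[of lborel "\<lambda>x. norm (f (x + h k) - f x)"]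
        by simp
  qed
qed

text \<open>Pointwise convergence of the translated indicator is clear inside U but can fail on the
  boundary. Writing |a - b| = a + b - 2ab for indicators avoids this: the first two integrals agree,
  and the product vanishes off U, where nothing needs to converge.\<close>

lemma L1_translation_open:
  fixes U :: "'a::euclidean_space set" and c :: "'b::euclidean_space"
  assumes U: "open U" and fin: "emeasure lborel U < \<infinity>" and h: "h \<longlonglongrightarrow> 0"
  shows "(\<lambda>k. LINT x|lborel. norm (indicator U (x + h k) *\<^sub>R c - indicator U x *\<^sub>R c)) \<longlonglongrightarrow> 0"
proof -
  have [measurable]: "U \<in> sets borel" using U by simp
  let ?u = "indicator U :: 'a \<Rightarrow> real"
  have iu: "integrable lborel ?u" using fin by (intro integrable_real_indicator) auto
  have ip: "integrable lborel (\<lambda>x. ?u (x + h k) * ?u x)" for k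
    by (rule L1_bound[OF iu]) (auto simp: indicator_def)
  have "(\<lambda>k. LINT x|lborel. ?u (x + h k) * ?u x) \<longlonglongrightarrow> (LINT x|lborel. ?u x)"
  proof (rule integral_dominated_convergence[where w = ?u])
    show "AE x in lborel. (\<lambda>k. ?u (x + h k) * ?u x) \<longlonglongrightarrow> ?u x"
    proof (rule AE_I2)
      fix x :: 'a
      show "(\<lambda>k. ?u (x + h k) * ?u x) \<longlonglongrightarrow> ?u x"
      proof (cases "x \<in> U")
        case True
        have "(\<lambda>k. x + h k) \<longlonglongrightarrow> x" using tendsto_add[OF tendsto_const h, of x] by simp
        then have "\<forall>\<^sub>F k in sequentially. x + h k \<in> U" using U True by (rule topological_tendstoD)
        then show ?thesis
          by (intro tendsto_eventually) (auto simp: True elim: eventually_mono)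
      qed simp
    qed
  qed (use iu in \<open>auto simp: indicator_def\<close>)
  then have lim: "(\<lambda>k. norm c * ((LINT x|lborel. ?u x) + (LINT x|lborel. ?u x) - 2 * (LINT x|lborel. ?u (x + h k) * ?u x)))
      \<longlonglongrightarrow> norm c * ((LINT x|lborel. ?u x) + (LINT x|lborel. ?u x) - 2 * (LINT x|lborel. ?u x))"
    by (intro tendsto_intros)
  have eq: "(LINT x|lborel. norm (?u (x + h k) *\<^sub>R c - ?u x *\<^sub>R c))
      = norm c * ((LINT x|lborel. ?u x) + (LINT x|lborel. ?u x) - 2 * (LINT x|lborel. ?u (x + h k) * ?u x))" for k
  proof -
    have ius: "integrable lborel (\<lambda>x. ?u (x + h k))" by (rule integrable_lborel_shift[OF iu])
    have "(LINT x|lborel. norm (?u (x + h k) *\<^sub>R c - ?u x *\<^sub>R c))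
      = (LINT x|lborel. norm c * (?u (x + h k) + ?u x - 2 * (?u (x + h k) * ?u x)))"
      by (rule LINT_cong) (auto simp: indicator_def)
    also have "\<dots> = norm c * ((LINT x|lborel. ?u (x + h k)) + (LINT x|lborel. ?u x) - 2 * (LINT x|lborel. ?u (x + h k) * ?u x))"
      using iu ip[of k] ius by simp
    also have "(LINT x|lborel. ?u (x + h k)) = (LINT x|lborel. ?u x)"
      by (rule integral_lborel_shift) auto
    finally show ?thesis .
  qed
  show ?thesis using lim unfolding eq by simp
qed

lemma L1_translation:
  fixes f :: "'a::euclidean_space \<Rightarrow> 'b::euclidean_space"
  assumes "integrable lborel f" and h: "h \<longlonglongrightarrow> 0"
  shows "(\<lambda>k. LINT x|lborel. norm (f (x + h k) - f x)) \<longlonglongrightarrow> 0"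
  using assms(1)
proof (induction rule: integrable_induct)
  case (base A c)
  show ?case
  proof (rule L1_translation_approx)
    show "integrable lborel (\<lambda>x. indicat_real A x *\<^sub>R c)"
      using base by (intro integrable_scaleR_left integrable_real_indicator) auto
    fix e :: real assume "0 < e"
    \<comment> \<open>The summand 1 keeps the quotient meaningful when c = 0. Outer regularity then
      reduces the Borel set A to an open superset.\<close>
    then have "0 < e / (norm c + 1)" by (intro divide_pos_pos) (auto intro: add_nonneg_pos)
    then obtain U where U: "open U" "A \<subseteq> U" "emeasure lborel (U - A) < ennreal (e / (norm c + 1))"
      using outer_regular_lborel[of A "e / (norm c + 1)"] base by auto
    have [measurable]: "U \<in> sets borel" "A \<in> sets borel" using U base by auto
    have "emeasure lborel U \<le> emeasure lborel A + emeasure lborel (U - A)"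
      using U(2) by (subst plus_emeasure) (auto simp: Un_absorb1)
    also have "\<dots> < \<infinity>" using base U(3) by (auto simp: less_top[symmetric] top_unique ennreal_add_eq_top)
    finally have fU: "emeasure lborel U < \<infinity>" .
    have "(LINT x|lborel. norm (indicat_real A x *\<^sub>R c - indicat_real U x *\<^sub>R c))
        = (LINT x|lborel. norm c * indicat_real (U - A) x)"
      by (rule LINT_cong) (use U(2) in \<open>auto simp: indicator_def\<close>)
    also have "\<dots> = norm c * measure lborel (U - A)" by simp
    also have "\<dots> \<le> norm c * (e / (norm c + 1))"
      using U(3) \<open>0 < e / (norm c + 1)\<close>
      by (intro mult_left_mono) (auto simp: measure_def intro!: enn2real_leI)
    also have "norm c * (e / (norm c + 1)) = e * (norm c / (norm c + 1))" by simp
    also have "\<dots> \<le> e * 1" using \<open>0 < e\<close> by (intro mult_left_mono) (auto simp: divide_le_eq add_nonneg_pos)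
    also have "\<dots> = e" by simp
    finally have "(LINT x|lborel. norm (indicat_real A x *\<^sub>R c - indicat_real U x *\<^sub>R c)) \<le> e" .
    then show "\<exists>g. integrable lborel g \<and> (LINT x|lborel. norm (indicat_real A x *\<^sub>R c - g x)) \<le> e \<and>
        (\<lambda>k. LINT x|lborel. norm (g (x + h k) - g x)) \<longlonglongrightarrow> 0"
      using L1_translation_open[OF U(1) fU h, of c] fU
      by (intro exI[of _ "\<lambda>x. indicat_real U x *\<^sub>R c"]) (auto intro!: integrable_scaleR_left integrable_real_indicator)
  qed
next
  case (add f g)
  show ?case
  proof (rule tendsto_sandwich[OF _ _ tendsto_const])
    show "(\<lambda>k. (LINT x|lborel. norm (f (x + h k) - f x)) + (LINT x|lborel. norm (g (x + h k) - g x))) \<longlonglongrightarrow> 0"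
      using tendsto_add[OF add(3,4)] by simp
    show "\<forall>\<^sub>F k in sequentially. (LINT x|lborel. norm (f (x + h k) + g (x + h k) - (f x + g x)))
       \<le> (LINT x|lborel. norm (f (x + h k) - f x)) + (LINT x|lborel. norm (g (x + h k) - g x))"
    proof (intro always_eventually allI)
      fix k
      have i: "integrable lborel (\<lambda>x. norm (f (x + h k) - f x))" "integrable lborel (\<lambda>x. norm (g (x + h k) - g x))"
        "integrable lborel (\<lambda>x. norm (f (x + h k) + g (x + h k) - (f x + g x)))"
        by (intro integrable_norm L1_diff L1_add integrable_lborel_shift add)+
      have "(LINT x|lborel. norm (f (x + h k) + g (x + h k) - (f x + g x)))
        \<le> (LINT x|lborel. norm (f (x + h k) - f x) + norm (g (x + h k) - g x))"
        by (rule integral_mono) (use i norm_diff_triangle_ineq in auto)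
      then show "(LINT x|lborel. norm (f (x + h k) + g (x + h k) - (f x + g x)))
       \<le> (LINT x|lborel. norm (f (x + h k) - f x)) + (LINT x|lborel. norm (g (x + h k) - g x))"
        using i by simp
    qed
  qed (auto intro!: always_eventually LINT_nonneg)
next
  case (lim f s)
  note sf = \<open>\<And>x. x \<in> space lborel \<Longrightarrow> (\<lambda>i. s i x) \<longlonglongrightarrow> f x\<close>
    and sb = \<open>\<And>i x. x \<in> space lborel \<Longrightarrow> norm (s i x) \<le> 2 * norm (f x)\<close>
    and si = \<open>\<And>i. integrable lborel (s i)\<close> and sl = \<open>\<And>i. (\<lambda>k. LBINT x. norm (s i (x + h k) - s i x)) \<longlonglongrightarrow> 0\<close>
    and fi = \<open>integrable lborel f\<close>
  show ?case
  proof (rule L1_translation_approx[OF \<open>integrable lborel f\<close>])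
    fix e :: real assume e: "0 < e"
    have "(\<lambda>i. LINT x|lborel. norm (f x - s i x)) \<longlonglongrightarrow> (\<integral>x. 0 \<partial>(lborel::'a measure))"
    proof (rule integral_dominated_convergence[where w = "\<lambda>x. 3 * norm (f x)"])
      show "AE x in lborel. (\<lambda>i. norm (f x - s i x)) \<longlonglongrightarrow> 0"
      proof (rule AE_I2)
        fix x :: 'a
        have "(\<lambda>i. norm (s i x - f x)) \<longlonglongrightarrow> 0" by (intro tendsto_norm_zero LIM_zero sf) simp
        then show "(\<lambda>i. norm (f x - s i x)) \<longlonglongrightarrow> 0" by (simp add: norm_minus_commute)
      qed
      show "AE x in lborel. norm (norm (f x - s i x)) \<le> 3 * norm (f x)" for i
      proof (rule AE_I2)
        fix x :: 'a
        show "norm (norm (f x - s i x)) \<le> 3 * norm (f x)"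
          using norm_triangle_ineq4[of "f x" "s i x"] sb[of x i] by simp
      qed
      show "integrable lborel (\<lambda>x. 3 * norm (f x))" using fi by auto
      show "(\<lambda>x. norm (f x - s i x)) \<in> borel_measurable lborel" for i
        using fi si[of i] by auto
    qed auto
    then have "(\<lambda>i. LINT x|lborel. norm (f x - s i x)) \<longlonglongrightarrow> 0" by simp
    from LIMSEQ_D[OF this e] obtain i where "(LINT x|lborel. norm (f x - s i x)) < e" by auto
    then show "\<exists>g. integrable lborel g \<and> (LINT x|lborel. norm (f x - g x)) \<le> e \<and>
        (\<lambda>k. LINT x|lborel. norm (g (x + h k) - g x)) \<longlonglongrightarrow> 0"
      using si sl by (intro exI[of _ "s i"]) auto
  qed
qed

lemma nn_L1_translation:
  fixes f :: "'a::euclidean_space \<Rightarrow> 'b::euclidean_space"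
  assumes f: "integrable lborel f" and h: "h \<longlonglongrightarrow> 0"
  shows "(\<lambda>k. NNINT x. ennreal (norm (f (x + h k) - f x))) \<longlonglongrightarrow> 0"
proof -
  have "(NNINT x. ennreal (norm (f (x + h k) - f x))) = ennreal (LINT x|lborel. norm (f (x + h k) - f x))" for k
    by (intro nn_integral_eq_integral integrable_norm L1_diff integrable_lborel_shift f) auto
  then show ?thesis using tendsto_ennrealI[OF L1_translation[OF assms]] by simp
qed

lemma tendsto_ennreal_0_le:
  fixes f g :: "nat \<Rightarrow> ennreal"
  assumes "g \<longlonglongrightarrow> 0" "\<And>k. f k \<le> g k" shows "f \<longlonglongrightarrow> 0"
  by (rule tendsto_sandwich[OF _ _ tendsto_const assms(1)]) (auto simp: assms(2))

text \<open>Here v is bounded but not integrable, so \<open>nn_L1_translation\<close> does not apply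
  to it. With d the shift, F (v(.+d) - v) is the translation error of the integrable function vF
  minus v(.+d) times that of F, and both are controlled in L1.\<close>

lemma weighted_translation:
  fixes F :: "'a::euclidean_space \<Rightarrow> 'b::euclidean_space"
  assumes F: "integrable lborel F" and v[measurable]: "v \<in> borel_measurable borel"
    and M: "\<And>x. \<bar>v x\<bar> \<le> M" and h: "h \<longlonglongrightarrow> 0"
  shows "(\<lambda>k. NNINT y. ennreal (norm (F y) * \<bar>v (y + h k) - v y\<bar>)) \<longlonglongrightarrow> 0"
proof -
  note [measurable] = borel_measurable_integrable[OF F, simplified]
  have M0: "0 \<le> M" using M[of 0] by linarith
  have vF: "integrable lborel (\<lambda>y. v y *\<^sub>R F y)"
    by (rule L1_bound[OF integrable_scaleR_right[OF F, of M]])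
      (use M M0 in \<open>auto intro!: mult_right_mono\<close>)
  let ?g = "\<lambda>k. (NNINT y. ennreal (norm (v (y + h k) *\<^sub>R F (y + h k) - v y *\<^sub>R F y)))
     + ennreal M * (NNINT y. ennreal (norm (F (y + h k) - F y)))"
  have "?g \<longlonglongrightarrow> 0 + ennreal M * 0"
    by (intro tendsto_add ennreal_tendsto_cmult nn_L1_translation vF F h) auto
  then have "?g \<longlonglongrightarrow> 0" by simp
  then show ?thesis
  proof (rule tendsto_ennreal_0_le)
    fix k
    have *: "norm (F y) * \<bar>v (y + h k) - v y\<bar> \<le> norm (v (y + h k) *\<^sub>R F (y + h k) - v y *\<^sub>R F y) + M * norm (F (y + h k) - F y)" for y
    proof -
      have "norm (F y) * \<bar>v (y + h k) - v y\<bar> = norm ((v (y + h k) *\<^sub>R F (y + h k) - v y *\<^sub>R F y) - v (y + h k) *\<^sub>R (F (y + h k) - F y))"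
        by (simp add: algebra_simps flip: scaleR_left_diff_distrib)
      also have "\<dots> \<le> norm (v (y + h k) *\<^sub>R F (y + h k) - v y *\<^sub>R F y) + \<bar>v (y + h k)\<bar> * norm (F (y + h k) - F y)"
        by (metis norm_scaleR norm_triangle_ineq4)
      also have "\<bar>v (y + h k)\<bar> * norm (F (y + h k) - F y) \<le> M * norm (F (y + h k) - F y)"
        by (intro mult_right_mono M) auto
      finally show ?thesis by simp
    qed
    have "(NNINT y. ennreal (norm (F y) * \<bar>v (y + h k) - v y\<bar>)) \<le>
      (NNINT y. ennreal (norm (v (y + h k) *\<^sub>R F (y + h k) - v y *\<^sub>R F y)) + ennreal M * ennreal (norm (F (y + h k) - F y)))"
      using * M0 by (intro nn_integral_mono) (simp add: ennreal_leI flip: ennreal_plus ennreal_mult)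
    then show "(NNINT y. ennreal (norm (F y) * \<bar>v (y + h k) - v y\<bar>)) \<le> ?g k"
      by (simp add: nn_integral_add nn_integral_cmult)
  qed
qed

section \<open>Mollifiers and weighted mollification errors\<close>

definition mol :: "'a::euclidean_space \<Rightarrow> real" where
  "mol x = ball_bump x / (\<integral>x. ball_bump x \<partial>(lborel::'a measure))"

lemma integral_ball_bump_pos: "0 < (\<integral>x. ball_bump x \<partial>(lborel::'a::euclidean_space measure))"
proof -
  have i: "integrable lborel (ball_bump :: 'a \<Rightarrow> real)" by (rule csmooth_integrable[OF csmooth_ball_bump])
  have "(\<integral>x. ball_bump x \<partial>(lborel::'a measure)) \<noteq> 0"
  proof
    assume "(\<integral>x. ball_bump x \<partial>(lborel::'a measure)) = 0"
    then have "AE x in lborel. ball_bump (x::'a) = 0"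
      using integral_nonneg_eq_0_iff_AE[OF i] ball_bump_nonneg by auto
    then have "AE x in lborel. (x::'a) \<notin> ball 0 1" by eventually_elim (auto dest: ball_bump_pos)
    then have "emeasure lborel (ball (0::'a) 1) = 0" by (subst (asm) AE_iff_measurable[of "ball 0 1"]) auto
    then have "Henstock_Kurzweil_Integration.content (ball (0::'a) 1) = 0" by (simp add: measure_def)
    then show False by (simp add: content_ball_eq_0_iff)
  qed
  moreover have "0 \<le> (\<integral>x. ball_bump x \<partial>(lborel::'a measure))"
    by (intro LINT_nonneg ball_bump_nonneg)
  ultimately show ?thesis by linarith
qed

lemma mol_nonneg: "0 \<le> mol (x::'a)" and mol_zero: "1 \<le> norm x \<Longrightarrow> mol (x::'a) = 0"
  and csmooth_mol: "csmooth (mol :: 'a::euclidean_space \<Rightarrow> real)"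
  and integral_mol: "(\<integral>x. mol x \<partial>(lborel::'a measure)) = 1"
proof -
  show "0 \<le> mol x" using integral_ball_bump_pos[where 'a='a] by (simp add: mol_def ball_bump_nonneg)
  show "1 \<le> norm x \<Longrightarrow> mol x = 0" by (simp add: mol_def ball_bump_zero)
  show "csmooth (mol :: 'a \<Rightarrow> real)"
    using csmooth_const_mult[OF csmooth_ball_bump, of "1 / (\<integral>x. ball_bump x \<partial>(lborel::'a measure))"]
    by (simp add: mol_def[abs_def])
  show "(\<integral>x. mol x \<partial>(lborel::'a measure)) = 1"
    using integral_ball_bump_pos[where 'a='a] by (simp add: mol_def)
qed

lemma borel_mol[measurable]: "mol \<in> borel_measurable borel"
  by (rule csmooth_borel[OF csmooth_mol])

lemma nn_integral_mol: "(\<integral>\<^sup>+z. ennreal (mol z) \<partial>(lborel::'a::euclidean_space measure)) = 1"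
  by (subst nn_integral_eq_integral) (auto simp: integral_mol mol_nonneg csmooth_integrable[OF csmooth_mol])

definition molr :: "real \<Rightarrow> 'a::euclidean_space \<Rightarrow> real" where
  "molr e x = mol ((1 / e) *\<^sub>R x) / e ^ DIM('a)"

lemma csmooth_molr: "0 < e \<Longrightarrow> csmooth (molr e)"
  using csmooth_const_mult[OF csmooth_affine[OF csmooth_mol, of "1/e" 0], of "1 / e ^ DIM('a)"]
  by (simp add: molr_def[abs_def])

lemma molr_zero: "0 < e \<Longrightarrow> e \<le> norm x \<Longrightarrow> molr e x = 0"
  by (simp add: molr_def mol_zero)

text \<open>The substitution x = y - e z moves the scale from the kernel to the argument of v, so
  mollification becomes an average of translations with the fixed density
  \<open>mol\<close>.\<close>

lemma conv_molr:
  fixes v :: "'a::euclidean_space \<Rightarrow> real"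
  assumes e: "0 < e" and [measurable]: "v \<in> borel_measurable borel"
  shows "conv v (molr e) y = (LINT z|lborel. v (y - e *\<^sub>R z) * mol z)"
proof -
  note [measurable] = csmooth_borel[OF csmooth_molr[OF e]]
  have "conv v (molr e) y = e ^ DIM('a) * (LINT z|lborel. v (y - e *\<^sub>R z) * molr e (y - (y - e *\<^sub>R z)))"
    unfolding conv_def using integral_lborel_affine[of "-e" "\<lambda>x. v x * molr e (y - x)" y] e by simp
  also have "\<dots> = (LINT z|lborel. v (y - e *\<^sub>R z) * mol z)"
    using e by (subst integral_mult_right_zero[symmetric]) (simp add: molr_def)
  finally show ?thesis .
qed

lemma conv_molr_integrable:
  fixes v :: "'a::euclidean_space \<Rightarrow> real"
  assumes [measurable]: "v \<in> borel_measurable borel" and M: "\<And>x. \<bar>v x\<bar> \<le> M"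
  shows "integrable lborel (\<lambda>z. v (y - e *\<^sub>R z) * mol z)"
  by (rule L1_bound[OF integrable_mult_right[OF csmooth_integrable[OF csmooth_mol], of M]])
    (auto simp: abs_mult mol_nonneg intro!: mult_right_mono order_trans[OF M])

lemma conv_molr_bound:
  fixes v :: "'a::euclidean_space \<Rightarrow> real"
  assumes e: "0 < e" and v[measurable]: "v \<in> borel_measurable borel" and M: "\<And>x. \<bar>v x\<bar> \<le> M"
  shows "\<bar>conv v (molr e) y\<bar> \<le> M"
proof -
  have "\<bar>conv v (molr e) y\<bar> \<le> (LINT z|lborel. \<bar>v (y - e *\<^sub>R z) * mol z\<bar>)"
    unfolding conv_molr[OF e v] using integral_norm_bound[of lborel "\<lambda>z. v (y - e *\<^sub>R z) * mol z"] by simp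
  also have "\<dots> \<le> (LINT z|lborel. M * mol (z::'a))"
    by (intro integral_mono integrable_abs conv_molr_integrable[OF v M] integrable_mult_right csmooth_integrable csmooth_mol)
      (auto simp: abs_mult mol_nonneg intro!: mult_right_mono M)
  finally show ?thesis by (simp add: integral_mol)
qed

lemma borel_conv[measurable]:
  assumes [measurable]: "K \<in> borel_measurable borel" "v \<in> borel_measurable borel"
  shows "conv v K \<in> borel_measurable borel"
  unfolding conv_def[abs_def] by measurable

text \<open>Mollification averages the shifts by e z, so the error is at most the
  \<open>mol\<close>-average of the errors of \<open>weighted_translation\<close>. For each z these
  tend to 0, and they are bounded by 2M \<integral> |F|.\<close>

lemma weighted_conv_molr:
  fixes F :: "'a::euclidean_space \<Rightarrow> 'b::euclidean_space"
  assumes F: "integrable lborel F" and v[measurable]: "v \<in> borel_measurable borel"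
    and M: "\<And>x. \<bar>v x\<bar> \<le> M" and e: "\<And>k. 0 < e k" "e \<longlonglongrightarrow> 0"
  shows "(\<lambda>k. NNINT y. ennreal (norm (F y) * \<bar>conv v (molr (e k)) y - v y\<bar>)) \<longlonglongrightarrow> 0"
proof -
  note [measurable] = borel_measurable_integrable[OF F, simplified]
  have M0: "0 \<le> M" using M[of 0] by linarith
  define J where "J k z = (NNINT y. ennreal (norm (F y) * \<bar>v (y - e k *\<^sub>R z) - v y\<bar>))" for k and z :: 'a
  have Jm[measurable]: "J k \<in> borel_measurable borel" for k unfolding J_def by measurable
  have "(\<lambda>k. NNINT z. J k z * ennreal (mol z)) \<longlonglongrightarrow> (\<integral>\<^sup>+z. 0 \<partial>(lborel::'a measure))"
  proof (rule nn_integral_dominated_convergence[where w = "\<lambda>z. (NNINT y. ennreal (norm (F y) * (2 * M))) * ennreal (mol z)"])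
    have fin: "(NNINT y. ennreal (norm (F y) * (2 * M))) < \<infinity>"
      using integrable_mult_left[OF integrable_norm[OF F], of "2*M"] M0
      unfolding integrable_iff_bounded by (simp add: abs_mult)
    then show "(\<integral>\<^sup>+z. (NNINT y. ennreal (norm (F y) * (2 * M))) * ennreal (mol z) \<partial>(lborel::'a measure)) < \<infinity>"
      by (subst nn_integral_cmult) (auto simp: nn_integral_mol)
    have "J k z \<le> (NNINT y. ennreal (norm (F y) * (2 * M)))" for k z
      unfolding J_def
    proof (intro nn_integral_mono ennreal_leI mult_left_mono norm_ge_zero)
      fix y show "\<bar>v (y - e k *\<^sub>R z) - v y\<bar> \<le> 2 * M" using M[of "y - e k *\<^sub>R z"] M[of y] by linarith
    qed
    then show "AE z in lborel. J k z * ennreal (mol z) \<le> (NNINT y. ennreal (norm (F y) * (2 * M))) * ennreal (mol z)" for k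
      by (intro AE_I2 mult_right_mono) auto
    have "(\<lambda>k. J k z * ennreal (mol z)) \<longlonglongrightarrow> 0 * ennreal (mol z)" for z
    proof (rule tendsto_mult_ennreal)
      have "(\<lambda>k. - (e k *\<^sub>R z)) \<longlonglongrightarrow> - (0 *\<^sub>R z)" by (intro tendsto_intros e)
      then show "(\<lambda>k. J k z) \<longlonglongrightarrow> 0" unfolding J_def
        using weighted_translation[OF F v M, of "\<lambda>k. - (e k *\<^sub>R z)"] by simp
    qed auto
    then show "AE z in lborel. (\<lambda>k. J k z * ennreal (mol z)) \<longlonglongrightarrow> 0" by simp
  qed auto
  then have "(\<lambda>k. NNINT z. J k z * ennreal (mol z)) \<longlonglongrightarrow> 0" by simp
  then show ?thesis
  proof (rule tendsto_ennreal_0_le)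
    fix k
    have pt: "ennreal (norm (F y) * \<bar>conv v (molr (e k)) y - v y\<bar>)
       \<le> (NNINT z. ennreal (norm (F y) * \<bar>v (y - e k *\<^sub>R z) - v y\<bar>) * ennreal (mol z))" for y
    proof -
      have i: "integrable lborel (\<lambda>z::'a. v y * mol z)"
        by (intro integrable_mult_right csmooth_integrable csmooth_mol)
      have "v y = (LINT z|lborel. v y * mol (z::'a))" by (simp add: integral_mol)
      then have "conv v (molr (e k)) y - v y = (LINT z|lborel. v (y - e k *\<^sub>R z) * mol z - v y * mol z)"
        unfolding conv_molr[OF e(1) v]
        using LINT_diff[OF conv_molr_integrable[OF v M, of y "e k"] i] by simp
      then have "ennreal \<bar>conv v (molr (e k)) y - v y\<bar> \<le> (NNINT z. ennreal (norm (v (y - e k *\<^sub>R z) * mol z - v y * mol z)))"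
        using integral_norm_bound_ennreal[OF L1_diff[OF conv_molr_integrable[OF v M, of y "e k"] i]] by simp
      also have "\<dots> = (NNINT z. ennreal (\<bar>v (y - e k *\<^sub>R z) - v y\<bar>) * ennreal (mol z))"
        by (intro nn_integral_cong) (simp add: mol_nonneg abs_mult flip: ennreal_mult left_diff_distrib)
      finally have "ennreal (norm (F y)) * ennreal \<bar>conv v (molr (e k)) y - v y\<bar>
        \<le> ennreal (norm (F y)) * (NNINT z. ennreal (\<bar>v (y - e k *\<^sub>R z) - v y\<bar>) * ennreal (mol z))"
        by (rule mult_left_mono) auto
      then show ?thesis
        by (subst (asm) nn_integral_cmult[symmetric]) (auto simp: ennreal_mult mult.assoc)
    qed
    have "(NNINT y. ennreal (norm (F y) * \<bar>conv v (molr (e k)) y - v y\<bar>))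
      \<le> (NNINT y. NNINT z. ennreal (norm (F y) * \<bar>v (y - e k *\<^sub>R z) - v y\<bar>) * ennreal (mol z))"
      by (intro nn_integral_mono pt)
    also have "\<dots> = (NNINT z. NNINT y. ennreal (norm (F y) * \<bar>v (y - e k *\<^sub>R z) - v y\<bar>) * ennreal (mol z))"
      by (rule lborel_pair.Fubini') measurable
    also have "\<dots> = (NNINT z. J k z * ennreal (mol z))"
      unfolding J_def by (intro nn_integral_cong nn_integral_multc) measurable
    finally show "(NNINT y. ennreal (norm (F y) * \<bar>conv v (molr (e k)) y - v y\<bar>)) \<le> \<dots>" .
  qed
qed

lemma weighted_integral_conv_molr:
  fixes F :: "'a::euclidean_space \<Rightarrow> real"
  assumes F: "integrable lborel F" and v[measurable]: "v \<in> borel_measurable borel"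
    and M: "\<And>x. \<bar>v x\<bar> \<le> M" and e: "\<And>k. 0 < e k" "e \<longlonglongrightarrow> 0"
  shows "(\<lambda>k. LINT y|lborel. F y * conv v (molr (e k)) y) \<longlonglongrightarrow> (LINT y|lborel. F y * v y)"
proof -
  note [measurable] = borel_measurable_integrable[OF F, simplified] csmooth_borel[OF csmooth_molr[OF e(1)]]
  have i1: "integrable lborel (\<lambda>y. F y * conv v (molr (e k)) y)" for k
    by (rule L1_bound[OF integrable_mult_left[OF F, of M]])
      (auto simp: abs_mult intro!: mult_left_mono order_trans[OF conv_molr_bound[OF e(1) v M]])
  have i2: "integrable lborel (\<lambda>y. F y * v y)"
    by (rule L1_bound[OF integrable_mult_left[OF F, of M]])
      (auto simp: abs_mult intro!: mult_left_mono order_trans[OF M])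
  have "(\<lambda>k. ennreal (norm ((LINT y|lborel. F y * conv v (molr (e k)) y) - (LINT y|lborel. F y * v y)))) \<longlonglongrightarrow> 0"
  proof (rule tendsto_ennreal_0_le[OF weighted_conv_molr[OF F v M e]])
    fix k
    show "ennreal (norm ((LINT y|lborel. F y * conv v (molr (e k)) y) - (LINT y|lborel. F y * v y)))
      \<le> (NNINT y. ennreal (norm (F y) * \<bar>conv v (molr (e k)) y - v y\<bar>))"
      unfolding LINT_diff[OF i1 i2, symmetric]
      using integral_norm_bound_ennreal[OF L1_diff[OF i1[of k] i2]]
      by (simp add: abs_mult flip: right_diff_distrib)
  qed
  then have "(\<lambda>k. norm ((LINT y|lborel. F y * conv v (molr (e k)) y) - (LINT y|lborel. F y * v y))) \<longlonglongrightarrow> 0"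
    by (simp add: tendsto_ennreal_iff[of _ _ 0, simplified] flip: ennreal_0)
  then show ?thesis by (rule LIM_zero_cancel[OF tendsto_norm_zero_cancel])
qed

section \<open>Local integrability and the fundamental lemma\<close>

definition locint :: "('a::euclidean_space \<Rightarrow> 'b::euclidean_space) \<Rightarrow> bool" where
  "locint f \<longleftrightarrow> f \<in> borel_measurable borel \<and> (\<forall>r. integrable lborel (\<lambda>x. indicator (cball 0 r) x *\<^sub>R f x))"

lemma csmooth_conv_molr:
  fixes v :: "'a::euclidean_space \<Rightarrow> real"
  assumes e: "0 < e" and v: "v \<in> borel_measurable borel" "\<And>x. \<bar>v x\<bar> \<le> M" and r: "\<And>x. r < norm x \<Longrightarrow> v x = 0"
  shows "csmooth (conv v (molr e))"
  unfolding csmooth_def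
proof (intro conjI exI allI impI)
  show "smooth_on UNIV (conv v (molr e))" by (rule conv_smooth[OF csmooth_molr[OF e] v])
  fix x :: 'a assume "r + e \<le> norm x"
  have "v z * molr e (x - z) = 0" for z
  proof (cases "r < norm z")
    case False
    then have "e \<le> norm (x - z)" using \<open>r + e \<le> norm x\<close> norm_triangle_ineq2[of x z] by linarith
    then show ?thesis using molr_zero[OF e, of "x - z"] by simp
  qed (simp add: r)
  then have "conv v (molr e) x = (\<integral>z. 0 \<partial>(lborel::'a measure))"
    unfolding conv_def by (intro LINT_cong) auto
  then show "conv v (molr e) x = 0" by simp
qed

lemma locint_integrable_mult:
  fixes f :: "'a::euclidean_space \<Rightarrow> 'b::euclidean_space"
  assumes f: "locint f" and [measurable]: "g \<in> borel_measurable borel"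
    and C: "\<And>x. \<bar>g x\<bar> \<le> C" and r: "\<And>x. r < norm x \<Longrightarrow> g x = 0"
  shows "integrable lborel (\<lambda>x. g x *\<^sub>R f x)"
proof (rule L1_bound)
  have [measurable]: "f \<in> borel_measurable borel" using f unfolding locint_def by blast
  show "integrable lborel (\<lambda>x. C *\<^sub>R (indicator (cball 0 r) x *\<^sub>R f x))"
    using f unfolding locint_def by (intro integrable_scaleR_right) blast
  have "0 \<le> C" using C[of 0] by linarith
  then show "AE x in lborel. norm (g x *\<^sub>R f x) \<le> norm (C *\<^sub>R (indicator (cball 0 r) x *\<^sub>R f x))"
    using C r by (intro AE_I2) (auto simp: indicator_def intro!: mult_right_mono)
  show "(\<lambda>x. g x *\<^sub>R f x) \<in> borel_measurable lborel" by simp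
qed

lemma csmooth_locint:
  assumes "csmooth \<phi>" "locint f" shows "integrable lborel (\<lambda>x. \<phi> x *\<^sub>R f x)"
proof -
  obtain C where "\<And>x. \<bar>\<phi> x\<bar> \<le> C" using csmooth_bounded[OF assms(1)] by metis
  moreover obtain r where "\<And>x. r \<le> norm x \<Longrightarrow> \<phi> x = 0" using csmooth_support[OF assms(1)] by metis
  ultimately show ?thesis
    using locint_integrable_mult[OF assms(2) csmooth_borel[OF assms(1)]] by (meson less_imp_le)
qed

text \<open>The ideal test function is sgn f restricted to a ball, which would give \<integral> |f|
  = 0 there. Its mollifications are admissible, and the integrals converge by
  \<open>weighted_integral_conv_molr\<close>.\<close>

lemma fundamental_lemma:
  fixes f :: "'a::euclidean_space \<Rightarrow> real"
  assumes f: "locint f" and 0: "\<And>\<phi>. csmooth \<phi> \<Longrightarrow> (LINT x|lborel. f x * \<phi> x) = 0"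
  shows "AE x in lborel. f x = 0"
proof -
  have [measurable]: "f \<in> borel_measurable borel" using f unfolding locint_def by blast
  have "AE x in lborel. indicator (cball 0 (real n)) x *\<^sub>R f x = 0" for n
  proof -
    define v where "v x = (if norm x \<le> real n then sgn (f x) else 0)" for x
    have v[measurable]: "v \<in> borel_measurable borel" unfolding v_def sgn_if by measurable
    have v1: "\<bar>v x\<bar> \<le> 1" for x by (simp add: v_def sgn_if)
    \<comment> \<open>Mollifying at scale e k \<le> 1 enlarges the support of v by at most 1, so on
      the larger ball f may be replaced by the integrable F.\<close>
    define F where "F x = indicator (cball 0 (real n + 1)) x *\<^sub>R f x" for x
    have F: "integrable lborel F" unfolding F_def using f unfolding locint_def by blast
    define e where "e k = 1 / real (Suc k)" for k
    have e: "0 < e k" "e \<longlonglongrightarrow> 0" "e k \<le> 1" for k unfolding e_def using LIMSEQ_Suc[OF lim_inverse_n'] by auto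
    have z: "(LINT y|lborel. F y * conv v (molr (e k)) y) = 0" for k
    proof -
      have cs: "csmooth (conv v (molr (e k)))"
        by (rule csmooth_conv_molr[OF e(1) v v1, of "real n"]) (simp add: v_def indicator_def)
      have "F y * conv v (molr (e k)) y = f y * conv v (molr (e k)) y" for y
      proof (cases "norm y \<le> real n + 1")
        case False
        have "v z * molr (e k) (y - z) = 0" for z
        proof (cases "norm z \<le> n")
          case True
          then have "e k \<le> norm (y - z)" using False norm_triangle_ineq2[of y z] e(3)[of k] by linarith
          then show ?thesis using molr_zero[OF e(1), of k "y - z"] by simp
        qed (simp add: v_def indicator_def)
        then have "conv v (molr (e k)) y = (\<integral>z. 0 \<partial>(lborel::'a measure))"
          unfolding conv_def by (intro LINT_cong) auto
        then show ?thesis by simp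
      qed (simp add: F_def)
      then have "(LINT y|lborel. F y * conv v (molr (e k)) y) = (LINT y|lborel. f y * conv v (molr (e k)) y)"
        by (intro LINT_cong) auto
      then show ?thesis using 0[OF cs] by (simp only:)
    qed
    have "(LINT y|lborel. F y * v y) = 0"
      using weighted_integral_conv_molr[OF F v v1 e(1,2)] unfolding z by (simp add: LIMSEQ_const_iff)
    moreover have "F y * v y = norm (indicator (cball 0 (real n)) y *\<^sub>R f y)" for y
      by (auto simp: F_def v_def indicator_def sgn_if)
    ultimately have "(LINT y|lborel. norm (indicator (cball 0 (real n)) y *\<^sub>R f y)) = 0" by simp
    then show ?thesis
      using f unfolding locint_def by (subst (asm) integral_nonneg_eq_0_iff_AE) auto
  qed
  then have "AE x in lborel. \<forall>n. indicator (cball 0 (real n)) x *\<^sub>R f x = 0" unfolding AE_all_countable by blast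
  then show ?thesis
  proof eventually_elim
    case (elim x)
    obtain n where "norm x \<le> real n" using real_arch_simple by blast
    then show ?case using elim[rule_format, of n] by simp
  qed
qed

section \<open>Calculus of test functions and Fubini on pairs\<close>

abbreviation fd :: "('a::real_normed_vector \<Rightarrow> real) \<Rightarrow> 'a \<Rightarrow> 'a \<Rightarrow> real" where
  "fd f x \<equiv> frechet_derivative f (at x)"

lemma fd_expand:
  assumes "csmooth f" shows "fd f x h = (\<Sum>i\<in>Basis. (h \<bullet> i) * fd f x i)"
proof -
  have lin: "linear (fd f x)" using csmooth_has_derivative[OF assms] has_derivative_linear by blast
  show ?thesis
    by (subst (1) euclidean_representation[symmetric, of h])
      (simp add: linear_sum[OF lin] linear_scale[OF lin])
qed

lemma borel_fd:
  assumes f: "csmooth f" and [measurable]: "g \<in> borel_measurable M" "h \<in> borel_measurable M"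
  shows "(\<lambda>x. fd f (g x) (h x)) \<in> borel_measurable M"
proof -
  note [measurable] = csmooth_borel[OF csmooth_deriv[OF f]]
  show ?thesis by (subst fd_expand[OF f]) measurable
qed

lemma smooth_has_derivative:
  "smooth_on UNIV f \<Longrightarrow> (f has_derivative fd f x) (at x)"
  using Ck_on_SucD(1)[of 0 UNIV f x] by (auto simp: smooth_on_def)

lemma fd_mult:
  assumes "smooth_on UNIV f" "smooth_on UNIV g"
  shows "fd (\<lambda>x. f x * g x) x h = f x * fd g x h + fd f x h * g x"
  using frechet_derivative_at[OF has_derivative_mult[OF smooth_has_derivative[OF assms(1)] smooth_has_derivative[OF assms(2)]], of x]
  by metis

lemma fd_affine:
  assumes "smooth_on UNIV f"
  shows "fd (\<lambda>x. f (a + c *\<^sub>R x)) x h = c * fd f (a + c *\<^sub>R x) h"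
proof -
  have "((\<lambda>x. a + c *\<^sub>R x) has_derivative (\<lambda>h. c *\<^sub>R h)) (at x)"
    by (auto intro!: derivative_eq_intros)
  from has_derivative_compose[OF this smooth_has_derivative[OF assms]]
  have "fd (\<lambda>x. f (a + c *\<^sub>R x)) x = (\<lambda>h. fd f (a + c *\<^sub>R x) (c *\<^sub>R h))"
    using frechet_derivative_at by metis
  then show ?thesis
    using linear_scale[OF has_derivative_linear[OF smooth_has_derivative[OF assms]]] by simp
qed

lemma fd_const_mult:
  assumes "smooth_on UNIV f" shows "fd (\<lambda>x. c * f x) x h = c * fd f x h"
  using frechet_derivative_at[OF has_derivative_mult_right[OF smooth_has_derivative[OF assms], of c]] by metis

lemma csmooth_smooth: "csmooth f \<Longrightarrow> smooth_on UNIV f"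
  by (simp add: csmooth_def)

text \<open>Convolving f with the constant 1 gives a constant function of y, whose derivative is 0;
  by \<open>conv_has_derivative\<close> that derivative is also the integral of the derivative of
  f.\<close>

lemma integral_fd_eq_0:
  fixes f :: "'a::euclidean_space \<Rightarrow> real"
  assumes f: "csmooth f"
  shows "(LINT x|lborel. fd f x h) = 0"
proof -
  have eq: "(LINT x|lborel. g (y - x)) = (LINT x|lborel. g x)" if "g \<in> borel_measurable borel" for g :: "'a \<Rightarrow> real" and y
    using integral_lborel_affine[of "-1" g y] that by simp
  have "conv (\<lambda>_. 1) f = (\<lambda>y. LINT x|lborel. f x)"
    using eq[OF csmooth_borel[OF f]] by (simp add: conv_def fun_eq_iff)
  moreover have "(conv (\<lambda>_. 1) f has_derivative (\<lambda>h. conv (\<lambda>_. 1) (\<lambda>x. fd f x h) 0)) (at 0)"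
    by (rule conv_has_derivative[OF f, where M = 1]) auto
  ultimately have "((\<lambda>y. LINT x|lborel. f x) has_derivative (\<lambda>h. conv (\<lambda>_. 1) (\<lambda>x. fd f x h) 0)) (at (0::'a))" by simp
  then have "(\<lambda>h. conv (\<lambda>_. 1) (\<lambda>x. fd f x h) 0) = (\<lambda>h. 0)"
    using has_derivative_unique[OF _ has_derivative_const] by blast
  then have "conv (\<lambda>_. 1) (\<lambda>x. fd f x h) 0 = 0" by metis
  then show ?thesis using eq[OF csmooth_borel[OF csmooth_deriv[OF f]], of 0] by (simp add: conv_def)
qed

lemma csmooth_FTC:
  fixes f :: "'a::euclidean_space \<Rightarrow> real"
  assumes f: "csmooth f"
  shows "f (y + h) - f y = (LINT s|lborel. indicator {0..1::real} s * fd f (y + s *\<^sub>R h) h)"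
proof -
  have "(LINT s|lborel. indicator {0..1::real} s *\<^sub>R fd f (y + s *\<^sub>R h) h) = f (y + 1 *\<^sub>R h) - f (y + 0 *\<^sub>R h)"
  proof (rule integral_FTC_Icc)
    fix s :: real assume "0 \<le> s" "s \<le> 1"
    have "((\<lambda>s. y + s *\<^sub>R h) has_derivative (\<lambda>t. t *\<^sub>R h)) (at s within {0..1})"
      by (auto intro!: derivative_eq_intros)
    from has_derivative_compose[OF this csmooth_has_derivative[OF f]]
    have "((\<lambda>s. f (y + s *\<^sub>R h)) has_derivative (\<lambda>t. fd f (y + s *\<^sub>R h) (t *\<^sub>R h))) (at s within {0..1})" .
    then show "((\<lambda>s. f (y + s *\<^sub>R h)) has_vector_derivative fd f (y + s *\<^sub>R h) h) (at s within {0..1})"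
      unfolding has_vector_derivative_def
      using linear_scale[OF has_derivative_linear[OF csmooth_has_derivative[OF f]]] by simp
  next
    show "continuous_on {0..1} (\<lambda>s. fd f (y + s *\<^sub>R h) h)"
      by (rule continuous_on_compose2[OF csmooth_continuous[OF csmooth_deriv[OF f]]]) (auto intro!: continuous_intros)
  qed simp
  then show ?thesis by simp
qed

lemma pair_integrableI:
  fixes f :: "'a::euclidean_space \<Rightarrow> 'b::euclidean_space \<Rightarrow> 'c::euclidean_space"
  assumes [measurable]: "(\<lambda>(x, y). f x y) \<in> borel_measurable (borel \<Otimes>\<^sub>M borel)"
    and "(NNINT x. NNINT y. ennreal (norm (f x y))) < \<infinity>"
  shows "integrable (lborel \<Otimes>\<^sub>M lborel) (\<lambda>(x, y). f x y)"
  unfolding integrable_iff_bounded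
proof
  show m: "(\<lambda>(x, y). f x y) \<in> borel_measurable (lborel \<Otimes>\<^sub>M lborel)" by measurable
  have "(NNINT x. NNINT y. ennreal (norm (case (x, y) of (x, y) \<Rightarrow> f x y)))
    = (\<integral>\<^sup>+z. ennreal (norm (case z of (x, y) \<Rightarrow> f x y)) \<partial>(lborel \<Otimes>\<^sub>M lborel))"
    by (rule lborel.nn_integral_fst) (use m in measurable)
  then show "(\<integral>\<^sup>+z. ennreal (norm (case z of (x, y) \<Rightarrow> f x y)) \<partial>(lborel \<Otimes>\<^sub>M lborel)) < \<infinity>"
    using assms(2) by simp
qed

lemma pair_Fubini:
  fixes f :: "'a::euclidean_space \<Rightarrow> 'b::euclidean_space \<Rightarrow> real"
  assumes m: "(\<lambda>(x, y). f x y) \<in> borel_measurable (borel \<Otimes>\<^sub>M borel)"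
    and fin: "(NNINT x. NNINT y. ennreal \<bar>f x y\<bar>) < \<infinity>"
  shows "(LINT x|lborel. LINT y|lborel. f x y) = (LINT y|lborel. LINT x|lborel. f x y)"
    and "AE x in lborel. integrable lborel (f x)"
    and "AE y in lborel. integrable lborel (\<lambda>x. f x y)"
    and "integrable lborel (\<lambda>x. LINT y|lborel. f x y)"
    and "integrable lborel (\<lambda>y. LINT x|lborel. f x y)"
proof -
  have i: "integrable (lborel \<Otimes>\<^sub>M lborel) (\<lambda>(x, y). f x y)"
    by (rule pair_integrableI[OF m]) (use fin in simp)
  show "(LINT x|lborel. LINT y|lborel. f x y) = (LINT y|lborel. LINT x|lborel. f x y)"
    using lborel_pair.Fubini_integral[OF i] by simp
  show "AE x in lborel. integrable lborel (f x)" using lborel_pair.AE_integrable_fst[OF i] by simp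
  show "AE y in lborel. integrable lborel (\<lambda>x. f x y)" using lborel_pair.AE_integrable_snd[OF i] by simp
  show "integrable lborel (\<lambda>x. LINT y|lborel. f x y)" using lborel_pair.integrable_fst[OF i] by simp
  show "integrable lborel (\<lambda>y. LINT x|lborel. f x y)" using lborel_pair.integrable_snd[OF i] by simp
qed

section \<open>Weak Jacobians and increments of the vector field\<close>

lemma cball_sets_borel[measurable]: "cball a r \<in> sets borel"
  and ball_sets_borel[measurable]: "ball a r \<in> sets borel"
  by simp_all

lemma borel_vec_nth[measurable (raw)]:
  fixes f :: "'a \<Rightarrow> 'b::euclidean_space ^ 'n"
  assumes "f \<in> borel_measurable M" shows "(\<lambda>x. f x $ i) \<in> borel_measurable M"
  by (rule measurable_compose[OF assms borel_measurable_continuous_onI]) (intro continuous_intros)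

lemma norm_matrix_vector_mult_le: "norm (A *v x) \<le> norm A * norm (x :: real^'n)"
proof -
  have "norm (A *v x) = L2_set (\<lambda>i. \<bar>A $ i \<bullet> x\<bar>) UNIV"
    by (simp add: norm_vec_def matrix_vector_mul_component)
  also have "\<dots> \<le> L2_set (\<lambda>i. norm (A $ i) * norm x) UNIV"
    by (intro L2_set_mono Cauchy_Schwarz_ineq2) auto
  also have "\<dots> = norm A * norm x" by (simp add: norm_vec_def L2_set_left_distrib)
  finally show ?thesis .
qed

text \<open>The Borel counterpart of \<open>weak_jacobian\<close>: integrals are over
  \<open>lborel\<close> and \<open>csmooth\<close> replaces \<open>test_function\<close>.\<close>

definition jac :: "(real^'n \<Rightarrow> real^'n) \<Rightarrow> (real^'n \<Rightarrow> real^'n^'n) \<Rightarrow> bool" where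
  "jac b G \<longleftrightarrow> locint b \<and> locint G \<and>
     (\<forall>\<phi> i j. csmooth \<phi> \<longrightarrow> (LINT x|lborel. b x $ i * fd \<phi> x (axis j 1)) = - (LINT x|lborel. G x $ i $ j * \<phi> x))"

lemma locint_borel: "locint f \<Longrightarrow> f \<in> borel_measurable borel"
  by (simp add: locint_def)

lemma locint_bound:
  fixes f :: "'a::euclidean_space \<Rightarrow> 'b::euclidean_space" and g :: "'a \<Rightarrow> 'c::euclidean_space"
  assumes f: "locint f" and [measurable]: "g \<in> borel_measurable borel" and C: "\<And>x. norm (g x) \<le> C * norm (f x)"
  shows "locint g"
  unfolding locint_def
proof (intro conjI allI)
  note [measurable] = locint_borel[OF f]
  fix r
  have "integrable lborel (\<lambda>x. C *\<^sub>R (indicator (cball 0 r) x *\<^sub>R f x))"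
    using f unfolding locint_def by (intro integrable_scaleR_right) blast
  then show "integrable lborel (\<lambda>x. indicator (cball 0 r) x *\<^sub>R g x)"
    by (rule L1_bound)
      (auto simp: indicator_def abs_mult intro!: AE_I2 order_trans[OF C] mult_right_mono)
qed simp

lemma locint_nn: "locint f \<Longrightarrow> (NNINT x. indicator (cball 0 r) x * ennreal (norm (f x))) < \<infinity>"
proof -
  assume "locint f"
  then have "integrable lborel (\<lambda>x. indicator (cball 0 r) x *\<^sub>R f x)" by (simp add: locint_def)
  then have "(NNINT x. ennreal (norm (indicator (cball 0 r) x *\<^sub>R f x))) < \<infinity>"
    unfolding integrable_iff_bounded by blast
  also have "(NNINT x. ennreal (norm (indicator (cball 0 r) x *\<^sub>R f x))) = (NNINT x. indicator (cball 0 r) x * ennreal (norm (f x)))"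
    by (intro nn_integral_cong) (auto simp: indicator_def)
  finally show ?thesis .
qed

lemma locintI_nn:
  fixes f :: "'a::euclidean_space \<Rightarrow> 'b::euclidean_space"
  assumes [measurable]: "f \<in> borel_measurable borel"
    and "\<And>r. (NNINT x. indicator (cball 0 r) x * ennreal (norm (f x))) < \<infinity>"
  shows "locint f"
  unfolding locint_def integrable_iff_bounded
proof (intro conjI allI)
  fix r
  have "(NNINT x. ennreal (norm (indicator (cball 0 r) x *\<^sub>R f x))) = (NNINT x. indicator (cball 0 r) x * ennreal (norm (f x)))"
    by (intro nn_integral_cong) (auto simp: indicator_def)
  then show "(NNINT x. ennreal (norm (indicator (cball 0 r) x *\<^sub>R f x))) < \<infinity>" using assms(2) by simp
qed auto

text \<open>Integrating \<open>G\<close> along the segment from \<open>y\<close> to \<open>y + h\<close> recovers the increment of \<open>b\<close>; by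
  duality this is the fundamental theorem of calculus for the test function.\<close>

lemma jac_increment:
  fixes b :: "real^'n \<Rightarrow> real^'n"
  assumes J: "jac b G"
  shows "AE y in lborel. b (y + h) $ i - b y $ i = (LINT s|lborel. indicator {0..1::real} s * (G (y + s *\<^sub>R h) $ i \<bullet> h))"
proof -
  have lb: "locint b" and lG: "locint G" using J by (auto simp: jac_def)
  note [measurable] = locint_borel[OF lb] locint_borel[OF lG]
  define S where "S y = (LINT s|lborel. indicator {0..1::real} s * (G (y + s *\<^sub>R h) $ i \<bullet> h))" for y
  have [measurable]: "S \<in> borel_measurable borel" unfolding S_def by measurable
  have Gh: "\<bar>G x $ i \<bullet> h\<bar> \<le> norm h * norm (G x)" for x
    using Cauchy_Schwarz_ineq2[of "G x $ i" h] Finite_Cartesian_Product.norm_nth_le[of "G x" i]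
    by (metis (no_types, lifting) mult.commute mult_right_mono norm_ge_zero order_trans)
  \<comment> \<open>Absolute convergence for any bounded g of bounded support: on the segment G is
    evaluated only in the ball enlarged by |h|, whatever s is. The two facts that follow are used
    with indicators, to see that S is locally integrable, and with the test function itself.\<close>
  have dom: "(NNINT s. NNINT y. ennreal (indicator {0..1::real} s * \<bar>g y\<bar> * \<bar>G (y + s *\<^sub>R h) $ i \<bullet> h\<bar>)) < \<infinity>"
    if [measurable]: "g \<in> borel_measurable borel" and C: "\<And>x. \<bar>g x\<bar> \<le> C" and r: "\<And>x. r < norm x \<Longrightarrow> g x = 0" for g :: "real^'n \<Rightarrow> real" and C r
  proof -
    have C0: "0 \<le> C" using C[of 0] by linarith
    let ?I = "(NNINT x. indicator (cball 0 (r + norm h)) x * ennreal (norm (G x)))"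
    have "(NNINT s. NNINT y. ennreal (indicator {0..1::real} s * \<bar>g y\<bar> * \<bar>G (y + s *\<^sub>R h) $ i \<bullet> h\<bar>))
      \<le> (NNINT s. indicator {0..1::real} s * (ennreal (C * norm h) * ?I))"
    proof (rule nn_integral_mono)
      fix s :: real
      show "(NNINT y. ennreal (indicator {0..1::real} s * \<bar>g y\<bar> * \<bar>G (y + s *\<^sub>R h) $ i \<bullet> h\<bar>))
        \<le> indicator {0..1::real} s * (ennreal (C * norm h) * ?I)"
      proof (cases "s \<in> {0..1}")
        case True
        have "ennreal (indicator {0..1::real} s * \<bar>g y\<bar> * \<bar>G (y + s *\<^sub>R h) $ i \<bullet> h\<bar>)
          \<le> ennreal (C * norm h) * (indicator (cball 0 (r + norm h)) (y + s *\<^sub>R h) * ennreal (norm (G (y + s *\<^sub>R h))))" for y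
        proof (cases "r < norm y")
          case False
          have "norm (s *\<^sub>R h) \<le> norm h" using True by (simp add: mult_left_le_one_le)
          then have "norm (y + s *\<^sub>R h) \<le> r + norm h" using False norm_triangle_ineq[of y "s *\<^sub>R h"] by linarith
          moreover have "\<bar>g y\<bar> * \<bar>G (y + s *\<^sub>R h) $ i \<bullet> h\<bar> \<le> C * (norm h * norm (G (y + s *\<^sub>R h)))"
            by (intro mult_mono C Gh) (auto simp: C0)
          ultimately show ?thesis using True C0 by (simp add: mult.assoc ennreal_leI flip: ennreal_mult)
        qed (simp add: r)
        then have "(NNINT y. ennreal (indicator {0..1::real} s * \<bar>g y\<bar> * \<bar>G (y + s *\<^sub>R h) $ i \<bullet> h\<bar>))
          \<le> (NNINT y. ennreal (C * norm h) * (indicator (cball 0 (r + norm h)) (y + s *\<^sub>R h) * ennreal (norm (G (y + s *\<^sub>R h)))))"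
          by (rule nn_integral_mono)
        also have "\<dots> = (NNINT y. ennreal (C * norm h) * (indicator (cball 0 (r + norm h)) y * ennreal (norm (G y))))"
          by (rule nn_integral_lborel_shift) measurable
        also have "\<dots> = ennreal (C * norm h) * ?I" by (rule nn_integral_cmult) measurable
        finally show ?thesis using True by simp
      qed simp
    qed
    also have "\<dots> = ennreal (C * norm h) * ?I" by (subst nn_integral_multc) auto
    also have "\<dots> < \<infinity>" using locint_nn[OF lG] by (simp add: ennreal_mult_less_top)
    finally show ?thesis .
  qed
  have int2: "integrable lborel (\<lambda>y. g y * S y)"
    and fub: "(LINT y|lborel. g y * S y) = (LINT s|lborel. indicator {0..1::real} s * (LINT y|lborel. g y * (G (y + s *\<^sub>R h) $ i \<bullet> h)))"
    if [measurable]: "g \<in> borel_measurable borel" and C: "\<And>x. \<bar>g x\<bar> \<le> C" and r: "\<And>x. r < norm x \<Longrightarrow> g x = 0" for g :: "real^'n \<Rightarrow> real" and C r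
  proof -
    let ?F = "\<lambda>s y. g y * (indicator {0..1::real} s * (G (y + s *\<^sub>R h) $ i \<bullet> h))"
    have fin: "(NNINT s. NNINT y. ennreal \<bar>?F s y\<bar>) < \<infinity>"
      using dom[OF that] by (simp add: abs_mult mult_ac)
    have m: "(\<lambda>(s, y). ?F s y) \<in> borel_measurable (borel \<Otimes>\<^sub>M borel)" by measurable
    show "integrable lborel (\<lambda>y. g y * S y)" using pair_Fubini(5)[OF m fin] by (simp add: S_def)
    have "(LINT y|lborel. g y * S y) = (LINT y|lborel. LINT s|lborel. ?F s y)" by (simp add: S_def)
    also have "\<dots> = (LINT s|lborel. LINT y|lborel. ?F s y)" by (rule pair_Fubini(1)[OF m fin, symmetric])
    also have "\<dots> = (LINT s|lborel. indicator {0..1::real} s * (LINT y|lborel. g y * (G (y + s *\<^sub>R h) $ i \<bullet> h)))"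
      by (intro LINT_cong refl) (subst integral_mult_right_zero[symmetric], simp add: mult_ac)
    finally show "(LINT y|lborel. g y * S y) = \<dots>" .
  qed
  have lS: "locint S"
  proof -
    have "integrable lborel (\<lambda>x. indicator (cball 0 r) x *\<^sub>R S x)" for r
      using int2[of "indicator (cball 0 r)" 1 r] by (auto simp: indicator_def)
    then show ?thesis by (simp add: locint_def)
  qed
  have lbi: "locint (\<lambda>y. b y $ i)"
    by (rule locint_bound[OF lb, where C = 1]) (auto simp: component_le_norm_cart)
  have lbs: "locint (\<lambda>y. b (y + h) $ i)"
  proof (rule locintI_nn)
    fix r
    have "(NNINT x. indicator (cball 0 r) x * ennreal (norm (b (x + h) $ i)))
      \<le> (NNINT x. indicator (cball 0 (r + norm h)) (x + h) * ennreal (norm (b (x + h))))"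
    proof (intro nn_integral_mono mult_mono)
      fix x :: "real^'n"
      show "indicator (cball 0 r) x \<le> (indicator (cball 0 (r + norm h)) (x + h) :: ennreal)"
        using norm_triangle_ineq[of x h] by (auto simp: indicator_def)
    qed (auto simp: component_le_norm_cart ennreal_leI)
    also have "\<dots> = (NNINT x. indicator (cball 0 (r + norm h)) x * ennreal (norm (b x)))"
      by (rule nn_integral_lborel_shift) measurable
    also have "\<dots> < \<infinity>" by (rule locint_nn[OF lb])
    finally show "(NNINT x. indicator (cball 0 r) x * ennreal (norm (b (x + h) $ i))) < \<infinity>" .
  qed measurable
  have "AE y in lborel. b (y + h) $ i - b y $ i - S y = 0"
  proof (rule fundamental_lemma)
    show "locint (\<lambda>y. b (y + h) $ i - b y $ i - S y)"
      using lS lbi lbs unfolding locint_def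
      by (auto simp: scaleR_diff_right simp del: real_scaleR_def intro!: L1_diff)
    fix \<phi> :: "real^'n \<Rightarrow> real" assume \<phi>: "csmooth \<phi>"
    note [measurable] = csmooth_borel[OF \<phi>]
    obtain C where C: "\<And>x. \<bar>\<phi> x\<bar> \<le> C" using csmooth_bounded[OF \<phi>] by metis
    obtain r where r: "0 < r" "\<And>x. r \<le> norm x \<Longrightarrow> \<phi> x = 0" using csmooth_support[OF \<phi>] by metis
    have \<phi>s: "csmooth (\<lambda>x. \<phi> (- (s *\<^sub>R h) + x))" for s using csmooth_affine[OF \<phi>, of 1 "- (s *\<^sub>R h)"] by simp
    have fds: "fd (\<lambda>x. \<phi> (- (s *\<^sub>R h) + x)) x k = fd \<phi> (- (s *\<^sub>R h) + x) k" for s x k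
      using fd_affine[OF csmooth_smooth[OF \<phi>], of "- (s *\<^sub>R h)" 1] by simp
    have i1: "integrable lborel (\<lambda>y. b (y + h) $ i * \<phi> y)" "integrable lborel (\<lambda>y. b y $ i * \<phi> y)"
      using csmooth_locint[OF \<phi> lbs] csmooth_locint[OF \<phi> lbi] by (simp_all add: mult.commute)
    have i3: "integrable lborel (\<lambda>y. S y * \<phi> y)" using csmooth_locint[OF \<phi> lS] by (simp add: mult.commute)
    have i4: "integrable lborel (\<lambda>y. b y $ i * \<phi> (y - h))"
      using csmooth_locint[OF \<phi>s[of 1] lbi] by (simp add: mult.commute)
    have "(LINT y|lborel. b (y + h) $ i * \<phi> y) = (LINT y|lborel. b y $ i * \<phi> (y - h))"
      using integral_lborel_shift[of "\<lambda>y. b y $ i * \<phi> (y - h)" h] by simp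
    then have "(LINT y|lborel. b (y + h) $ i * \<phi> y) - (LINT y|lborel. b y $ i * \<phi> y)
      = (LINT y|lborel. b y $ i * (\<phi> (y - h) - \<phi> y))"
      using LINT_diff[OF i4 i1(2)] by (simp add: right_diff_distrib)
    \<comment> \<open>After the shift has been moved to \<phi>, its increment along -h is an
      integral of derivatives of translates of \<phi>. Each translate is a test function, to which
      the definition of \<open>jac\<close> applies.\<close>
    also have "\<dots> = (LINT y|lborel. LINT s|lborel. indicator {0..1::real} s * (b y $ i * fd \<phi> (- (s *\<^sub>R h) + y) (- h)))"
    proof (rule LINT_cong[OF refl])
      fix y
      show "b y $ i * (\<phi> (y - h) - \<phi> y) = (LINT s|lborel. indicator {0..1::real} s * (b y $ i * fd \<phi> (- (s *\<^sub>R h) + y) (- h)))"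
        using csmooth_FTC[OF \<phi>, of y "- h"]
        by (subst mult.left_commute, subst integral_mult_right_zero) (simp add: add.commute)
    qed
    also have "\<dots> = (LINT s|lborel. LINT y|lborel. indicator {0..1::real} s * (b y $ i * fd \<phi> (- (s *\<^sub>R h) + y) (- h)))"
    proof (rule pair_Fubini(1)[symmetric])
      note [measurable] = borel_fd[OF \<phi>]
      show "(\<lambda>(s, y). indicator {0..1::real} s * (b y $ i * fd \<phi> (- (s *\<^sub>R h) + y) (- h))) \<in> borel_measurable (borel \<Otimes>\<^sub>M borel)"
        by measurable
      obtain C' where C': "0 < C'" "\<And>x v. \<bar>fd \<phi> x v\<bar> \<le> C' * norm v" using csmooth_deriv_bounded[OF \<phi>] by metis
      have fd0: "fd \<phi> x k = 0" if "r < norm x" for x k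
      proof -
        have "(\<phi> has_derivative (\<lambda>_. 0)) (at x)"
          by (rule has_derivative_transform_within_open[of "\<lambda>_. 0" _ _ _ "- cball 0 r"])
            (use that r in \<open>auto simp: open_Compl\<close>)
        then show ?thesis using frechet_derivative_at by metis
      qed
      have "(NNINT s. NNINT y. ennreal \<bar>indicator {0..1::real} s * (b y $ i * fd \<phi> (- (s *\<^sub>R h) + y) (- h))\<bar>)
        \<le> (NNINT s. NNINT y. indicator {0..1::real} s * (ennreal (C' * norm h) * (indicator (cball 0 (r + norm h)) y * ennreal (norm (b y)))))"
      proof (intro nn_integral_mono)
        fix s :: real and y :: "real^'n"
        show "ennreal \<bar>indicator {0..1::real} s * (b y $ i * fd \<phi> (- (s *\<^sub>R h) + y) (- h))\<bar>
          \<le> indicator {0..1::real} s * (ennreal (C' * norm h) * (indicator (cball 0 (r + norm h)) y * ennreal (norm (b y))))"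
        proof (cases "s \<in> {0..1} \<and> norm y \<le> r + norm h")
          case True
          have "\<bar>b y $ i\<bar> * \<bar>fd \<phi> (- (s *\<^sub>R h) + y) (- h)\<bar> \<le> norm (b y) * (C' * norm h)"
            using C'(2)[of _ "- h"] by (intro mult_mono) (auto simp: component_le_norm_cart)
          then show ?thesis using True C' by (simp add: abs_mult mult_ac ennreal_leI flip: ennreal_mult)
        next
          case False
          have "fd \<phi> (- (s *\<^sub>R h) + y) (- h) = 0" if "s \<in> {0..1}"
          proof (rule fd0)
            have "norm (s *\<^sub>R h) \<le> norm h" using that by (simp add: mult_left_le_one_le)
            moreover have "norm y > r + norm h" using False that by simp
            ultimately show "r < norm (- (s *\<^sub>R h) + y)"
              using norm_triangle_ineq2[of y "s *\<^sub>R h"] by simp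
          qed
          then show ?thesis by (auto simp: indicator_def)
        qed
      qed
      also have "\<dots> = (NNINT s. indicator {0..1::real} s * (ennreal (C' * norm h) * (NNINT y. indicator (cball 0 (r + norm h)) y * ennreal (norm (b y)))))"
        by (intro nn_integral_cong) (simp add: nn_integral_cmult)
      also have "\<dots> = ennreal (C' * norm h) * (NNINT y. indicator (cball 0 (r + norm h)) y * ennreal (norm (b y)))"
        by (subst nn_integral_multc) auto
      also have "\<dots> < \<infinity>" using locint_nn[OF lb] by (simp add: ennreal_mult_less_top)
      finally show "(NNINT s. NNINT y. ennreal \<bar>indicator {0..1::real} s * (b y $ i * fd \<phi> (- (s *\<^sub>R h) + y) (- h))\<bar>) < \<infinity>" .
    qed
    also have "\<dots> = (LINT s|lborel. indicator {0..1::real} s * (LINT y|lborel. \<phi> y * (G (y + s *\<^sub>R h) $ i \<bullet> h)))"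
    proof (rule LINT_cong[OF refl])
      fix s :: real
      let ?\<psi> = "\<lambda>x. \<phi> (- (s *\<^sub>R h) + x)"
      have iA: "integrable lborel (\<lambda>y. b y $ i * fd ?\<psi> y (axis j 1))" for j
        using csmooth_locint[OF csmooth_deriv[OF \<phi>s] lbi] by (simp add: mult.commute)
      have iB: "integrable lborel (\<lambda>y. G y $ i $ j * ?\<psi> y)" for j
      proof -
        have "locint (\<lambda>y. G y $ i $ j)"
          by (rule locint_bound[OF lG, where C = 1])
            (auto intro: order_trans[OF component_le_norm_cart Finite_Cartesian_Product.norm_nth_le])
        from csmooth_locint[OF \<phi>s[of s] this] show ?thesis by (simp add: mult.commute)
      qed
      have fdb: "fd ?\<psi> y (- h) = - (\<Sum>j\<in>UNIV. h $ j * fd ?\<psi> y (axis j 1))" for y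
      proof -
        have lin: "linear (fd ?\<psi> y)" using csmooth_has_derivative[OF \<phi>s] has_derivative_linear by blast
        have "fd ?\<psi> y h = fd ?\<psi> y (\<Sum>j\<in>UNIV. h $ j *\<^sub>R axis j 1)"
          using basis_expansion[of h] by (simp add: scalar_mult_eq_scaleR)
        then show ?thesis by (simp only: linear_neg[OF lin] linear_sum[OF lin] linear_scale[OF lin] real_scaleR_def)
      qed
      have "(LINT y|lborel. b y $ i * fd \<phi> (- (s *\<^sub>R h) + y) (- h)) = (LINT y|lborel. - (\<Sum>j\<in>UNIV. h $ j * (b y $ i * fd ?\<psi> y (axis j 1))))"
        unfolding fds[symmetric] fdb by (simp add: sum_distrib_left mult.left_commute)
      also have "\<dots> = - (\<Sum>j\<in>UNIV. h $ j * (LINT y|lborel. b y $ i * fd ?\<psi> y (axis j 1)))"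
        using iA by (simp add: LINT_sum)
      also have "\<dots> = (\<Sum>j\<in>UNIV. h $ j * (LINT y|lborel. G y $ i $ j * ?\<psi> y))"
        using J \<phi>s unfolding jac_def by (simp add: sum_negf)
      also have "\<dots> = (LINT y|lborel. (\<Sum>j\<in>UNIV. h $ j * (G y $ i $ j * ?\<psi> y)))"
        using iB by (simp add: LINT_sum)
      also have "\<dots> = (LINT y|lborel. ?\<psi> y * (G y $ i \<bullet> h))"
        by (simp add: inner_vec_def sum_distrib_left mult_ac)
      also have "\<dots> = (LINT y|lborel. \<phi> y * (G (y + s *\<^sub>R h) $ i \<bullet> h))"
        using integral_lborel_shift[of "\<lambda>y. ?\<psi> y * (G y $ i \<bullet> h)" "s *\<^sub>R h"] by simp
      finally show "(LINT y|lborel. indicator {0..1::real} s * (b y $ i * fd \<phi> (- (s *\<^sub>R h) + y) (- h)))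
        = indicator {0..1::real} s * (LINT y|lborel. \<phi> y * (G (y + s *\<^sub>R h) $ i \<bullet> h))"
        by simp
    qed
    also have "\<dots> = (LINT y|lborel. \<phi> y * S y)"
      by (rule fub[symmetric, of \<phi> C r]) (use C r in auto)
    finally have eq: "(LINT y|lborel. b (y + h) $ i * \<phi> y) - (LINT y|lborel. b y $ i * \<phi> y) = (LINT y|lborel. \<phi> y * S y)" .
    have "(LINT y|lborel. (b (y + h) $ i - b y $ i - S y) * \<phi> y)
      = (LINT y|lborel. b (y + h) $ i * \<phi> y) - (LINT y|lborel. b y $ i * \<phi> y) - (LINT y|lborel. S y * \<phi> y)"
      using i1 i3 by (simp add: left_diff_distrib)
    then show "(LINT y|lborel. (b (y + h) $ i - b y $ i - S y) * \<phi> y) = 0"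
      using eq by (simp add: mult.commute)
  qed
  then show ?thesis by eventually_elim (simp add: S_def)
qed

subsection \<open>The commutator of mollification and transport\<close>

text \<open>The weak form of -(b . grad v) tested with \<phi>; \<open>trace G\<close> stands for div
  b.\<close>

definition flux :: "(real^'n \<Rightarrow> real^'n) \<Rightarrow> (real^'n \<Rightarrow> real^'n^'n) \<Rightarrow> (real^'n \<Rightarrow> real) \<Rightarrow> (real^'n \<Rightarrow> real) \<Rightarrow> real" where
  "flux b G \<phi> v = (LINT x|lborel. (fd \<phi> x (b x) + trace (G x) * \<phi> x) * v x)"

text \<open>The first term is the mollification of -(b . grad v), evaluated at y, and the second is
  b . grad of the mollified v. Their sum is therefore the error in the transport equation of the
  mollified function.\<close>

definition commutator :: "real \<Rightarrow> (real^'n \<Rightarrow> real^'n) \<Rightarrow> (real^'n \<Rightarrow> real^'n^'n) \<Rightarrow> (real^'n \<Rightarrow> real) \<Rightarrow> real^'n \<Rightarrow> real" where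
  "commutator e b G v y = flux b G (\<lambda>x. molr e (y - x)) v + fd (conv v (molr e)) y (b y)"

lemma borel_trace[measurable (raw)]:
  fixes f :: "'a \<Rightarrow> real^'n^'n"
  shows "f \<in> borel_measurable M \<Longrightarrow> (\<lambda>x. trace (f x)) \<in> borel_measurable M"
  unfolding trace_def by measurable

lemma abs_component2_le: "\<bar>A $ i $ j\<bar> \<le> norm (A::real^'n^'m)"
  using component_le_norm_cart[of "A $ i" j] Finite_Cartesian_Product.norm_nth_le[of A i] by linarith

lemma trace_le: "\<bar>trace A\<bar> \<le> real CARD('n) * norm (A::real^'n^'n)"
proof -
  have "\<bar>trace A\<bar> \<le> (\<Sum>i\<in>UNIV. \<bar>A $ i $ i\<bar>)" unfolding trace_def by (rule sum_abs)
  also have "\<dots> \<le> (\<Sum>i\<in>(UNIV::'n set). norm A)" by (intro sum_mono abs_component2_le)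
  finally show ?thesis by simp
qed

lemma fd_sum_axis:
  fixes \<phi> :: "real^'n \<Rightarrow> real"
  assumes "csmooth \<phi>"
  shows "fd \<phi> x h = (\<Sum>i\<in>UNIV. h $ i * fd \<phi> x (axis i 1))"
proof -
  have lin: "linear (fd \<phi> x)" using csmooth_has_derivative[OF assms] has_derivative_linear by blast
  have "fd \<phi> x h = fd \<phi> x (\<Sum>i\<in>UNIV. h $ i *\<^sub>R axis i 1)"
    using basis_expansion[of h] by (simp add: scalar_mult_eq_scaleR)
  then show ?thesis by (simp add: linear_sum[OF lin] linear_scale[OF lin])
qed

lemma csmooth_fd_zero:
  assumes "\<And>x. r \<le> norm x \<Longrightarrow> f x = (0::real)" "r < norm x"
  shows "fd f x h = 0"
proof -
  have "(f has_derivative (\<lambda>_. 0)) (at x)"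
    by (rule has_derivative_transform_within_open[of "\<lambda>_. 0" _ _ _ "- cball 0 r"])
      (use assms in \<open>auto simp: open_Compl\<close>)
  then show ?thesis using frechet_derivative_at by metis
qed

text \<open>The integrand is the divergence of the compactly supported field \<open>mol\<close> z
  times A z. It is the limit profile of the commutator, and this cancellation is why the commutator
  vanishes.\<close>

lemma integral_fd_mol:
  fixes A :: "real^'n^'n"
  shows "integrable lborel (\<lambda>z. fd mol z (A *v z) + trace A * mol z)" (is ?int)
    and "(LINT z|lborel. fd mol z (A *v z) + trace A * mol z) = 0" (is ?eq)
proof -
  have lin: "smooth_on UNIV (\<lambda>z::real^'n. z $ j)" for j
    unfolding smooth_on_def by (intro allI Ck_on_bounded_linear bounded_linear_vec_nth)
  let ?f = "\<lambda>j z. z $ j * mol (z::real^'n)"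
  have cs: "csmooth (?f j)" for j by (rule smooth_mult_csmooth[OF csmooth_mol lin])
  have fdn: "fd (\<lambda>z::real^'n. z $ j) z h = h $ j" for j z h
    using frechet_derivative_at[OF bounded_linear_imp_has_derivative[OF bounded_linear_vec_nth]] by metis
  have fdf: "fd (?f j) z (axis i 1) = z $ j * fd mol z (axis i 1) + (if i = j then 1 else 0) * mol z" for i j z
    by (subst fd_mult[OF lin csmooth_smooth[OF csmooth_mol]]) (simp add: fdn axis_def)
  have eq: "fd mol z (A *v z) + trace A * mol z = (\<Sum>i\<in>UNIV. \<Sum>j\<in>UNIV. A $ i $ j * fd (?f j) z (axis i 1))" for z
  proof -
    have "fd mol z (A *v z) = (\<Sum>i\<in>UNIV. \<Sum>j\<in>UNIV. A $ i $ j * (z $ j * fd mol z (axis i 1)))"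
      by (subst fd_sum_axis[OF csmooth_mol]) (simp add: matrix_vector_mult_def sum_distrib_right mult.assoc)
    moreover have "trace A * mol z = (\<Sum>i\<in>UNIV. \<Sum>j\<in>UNIV. A $ i $ j * ((if i = j then 1 else 0) * mol z))"
      by (simp add: trace_def sum_distrib_right if_distrib[of "\<lambda>x. x * _"] if_distrib[of "\<lambda>x. _ * x"] cong: if_cong)
    ultimately show ?thesis unfolding fdf by (simp add: distrib_left sum.distrib)
  qed
  have i: "integrable lborel (\<lambda>z. A $ i $ j * fd (?f j) z (axis i 1))" for i j
    by (intro integrable_mult_right csmooth_integrable csmooth_deriv cs)
  show ?int unfolding eq by (intro L1_sum i)
  show ?eq unfolding eq using i by (simp add: LINT_sum integral_fd_eq_0[OF cs])
qed

text \<open>Since [0,1] has length 1, the constant can be moved under the integral. When f is not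
  integrable there, the right side is \<infinity>.\<close>

lemma abs_integral_minus_const_le:
  assumes [measurable]: "f \<in> borel_measurable borel"
  shows "ennreal \<bar>(LINT s|lborel. indicator {0..1::real} s * f s) - c\<bar> \<le> (NNINT s. indicator {0..1::real} s * ennreal \<bar>f s - c\<bar>)"
proof (cases "(NNINT s. indicator {0..1::real} s * ennreal \<bar>f s - c\<bar>) = \<infinity>")
  case False
  have eq: "(NNINT s. ennreal (norm (indicator {0..1::real} s * (f s - c)))) = (NNINT s. indicator {0..1::real} s * ennreal \<bar>f s - c\<bar>)"
    by (intro nn_integral_cong) (auto simp: indicator_def)
  have i: "integrable lborel (\<lambda>s. indicator {0..1::real} s * (f s - c))"
    unfolding integrable_iff_bounded using False eq by (simp add: less_top)
  have ic: "integrable lborel (\<lambda>s. indicator {0..1::real} s * c)" by simp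
  have "(LINT s|lborel. indicator {0..1::real} s * f s) = (LINT s|lborel. indicator {0..1::real} s * (f s - c) + indicator {0..1::real} s * c)"
    by (simp add: algebra_simps)
  also have "\<dots> = (LINT s|lborel. indicator {0..1::real} s * (f s - c)) + c"
    by (subst LINT_add[OF i ic]) simp
  finally show ?thesis using integral_norm_bound_ennreal[OF i] unfolding eq by simp
qed simp

text \<open>Under x = y - e z the gradient of the kernel produces a factor 1/e, which joins the
  increment of b to form a difference quotient that stays bounded in L1.\<close>

lemma commutator_eq:
  fixes b :: "real^'n \<Rightarrow> real^'n"
  assumes J: "jac b G" and v[measurable]: "v \<in> borel_measurable borel" and M: "\<And>x. \<bar>v x\<bar> \<le> M" and e: "0 < e"
  shows "commutator e b G v y = (LINT z|lborel. (fd mol z ((1/e) *\<^sub>R (b y - b (y - e *\<^sub>R z))) + trace (G (y - e *\<^sub>R z)) * mol z) * v (y - e *\<^sub>R z))"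
proof -
  have lb: "locint b" and lG: "locint G" using J by (auto simp: jac_def)
  note [measurable] = locint_borel[OF lb] locint_borel[OF lG]
  let ?K = "molr e :: real^'n \<Rightarrow> real"
  let ?N = "CARD('n)"
  have K: "csmooth ?K" by (rule csmooth_molr[OF e])
  note [measurable] = csmooth_borel[OF K] borel_fd[OF K] borel_fd[OF csmooth_mol]
  have M0: "0 \<le> M" using M[of 0] by linarith
  have Ky: "csmooth (\<lambda>x. ?K (y - x))" by (rule csmooth_reflect[OF K])
  have linK: "linear (fd ?K x)" and linm: "linear (fd mol (x::real^'n))" for x
    using csmooth_has_derivative[OF K] csmooth_has_derivative[OF csmooth_mol] has_derivative_linear by blast+
  have fdK: "fd (\<lambda>x. ?K (y - x)) x h = - fd ?K (y - x) h" for x h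
    using fd_affine[OF csmooth_smooth[OF K], of y "-1"] by simp
  have fdm: "fd ?K u h = fd mol ((1/e) *\<^sub>R u) h / e ^ (?N + 1)" for u h
  proof -
    have "fd ?K u h = fd (\<lambda>x. (1 / e ^ ?N) * mol (0 + (1/e) *\<^sub>R x)) u h"
      by (simp add: molr_def[abs_def])
    also have "\<dots> = (1 / e ^ ?N) * ((1/e) * fd mol (0 + (1/e) *\<^sub>R u) h)"
      using csmooth_affine[OF csmooth_mol, of "1/e" 0] e
      by (subst fd_const_mult) (simp_all only: csmooth_smooth fd_affine[OF csmooth_smooth[OF csmooth_mol]], auto simp: csmooth_def)
    finally show ?thesis by simp
  qed
  have bd: "integrable lborel (\<lambda>x. g x * v x)" if g: "integrable lborel g" for g :: "real^'n \<Rightarrow> real"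
    by (rule L1_bound[OF integrable_mult_left[OF g, of M]])
      (use borel_measurable_integrable[OF g] in \<open>auto simp: abs_mult intro!: mult_left_mono order_trans[OF M]\<close>)
  have locb: "locint (\<lambda>x. b x $ i)" for i
    by (rule locint_bound[OF lb, where C = 1]) (auto simp: component_le_norm_cart)
  have loct: "locint (\<lambda>x. trace (G x))"
    by (rule locint_bound[OF lG, where C = "real ?N"]) (auto simp: trace_le)
  have i1: "integrable lborel (\<lambda>x. fd ?K (y - x) (b x))"
  proof -
    have "integrable lborel (\<lambda>x. \<Sum>i\<in>UNIV. fd (\<lambda>x. ?K (y - x)) x (axis i 1) * b x $ i)"
      by (intro L1_sum csmooth_locint[OF csmooth_deriv[OF Ky] locb, simplified])
    then have "integrable lborel (\<lambda>x. - fd (\<lambda>x. ?K (y - x)) x (b x))"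
      by (subst fd_sum_axis[OF Ky]) (simp add: mult.commute)
    then show ?thesis by (simp add: fdK)
  qed
  have i2: "integrable lborel (\<lambda>x. trace (G x) * ?K (y - x))"
    using csmooth_locint[OF Ky loct] by (simp add: mult.commute)
  have i3: "integrable lborel (\<lambda>x. fd ?K (y - x) (b y))"
    by (rule csmooth_integrable[OF csmooth_reflect[OF csmooth_deriv[OF K]]])
  have "commutator e b G v y = (LINT x|lborel. (- fd ?K (y - x) (b x) + trace (G x) * ?K (y - x)) * v x)
      + (LINT x|lborel. fd ?K (y - x) (b y) * v x)"
    using frechet_derivative_at[OF conv_has_derivative[OF K v M, of y]]
    by (simp add: commutator_def flux_def fdK conv_def mult.commute fun_eq_iff)
  also have "\<dots> = (LINT x|lborel. (- fd ?K (y - x) (b x) + trace (G x) * ?K (y - x)) * v x + fd ?K (y - x) (b y) * v x)"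
    by (rule LINT_add[symmetric])
      (intro bd L1_add Bochner_Integration.integrable_minus i1 i2 i3)+
  also have "\<dots> = (LINT x|lborel. (fd ?K (y - x) (b y - b x) + trace (G x) * ?K (y - x)) * v x)"
    by (simp add: linear_diff[OF linK] algebra_simps)
  also have "\<dots> = \<bar>- e\<bar> ^ DIM(real^'n) * (LINT z|lborel. (fd ?K (y - (y + (- e) *\<^sub>R z)) (b y - b (y + (- e) *\<^sub>R z)) + trace (G (y + (- e) *\<^sub>R z)) * ?K (y - (y + (- e) *\<^sub>R z))) * v (y + (- e) *\<^sub>R z))"
    by (rule integral_lborel_affine) (use e in auto)
  also have "\<dots> = (LINT z|lborel. e ^ ?N * ((fd ?K (e *\<^sub>R z) (b y - b (y - e *\<^sub>R z)) + trace (G (y - e *\<^sub>R z)) * ?K (e *\<^sub>R z)) * v (y - e *\<^sub>R z)))"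
    using e by simp
  also have "\<dots> = (LINT z|lborel. (fd mol z ((1/e) *\<^sub>R (b y - b (y - e *\<^sub>R z))) + trace (G (y - e *\<^sub>R z)) * mol z) * v (y - e *\<^sub>R z))"
  proof (intro LINT_cong refl)
    fix z :: "real^'n"
    have sc: "fd mol z ((1/e) *\<^sub>R h) = (1/e) * fd mol z h" for h
      using linear_scale[OF linm] by simp
    show "e ^ ?N * ((fd ?K (e *\<^sub>R z) (b y - b (y - e *\<^sub>R z)) + trace (G (y - e *\<^sub>R z)) * ?K (e *\<^sub>R z)) * v (y - e *\<^sub>R z))
      = (fd mol z ((1/e) *\<^sub>R (b y - b (y - e *\<^sub>R z))) + trace (G (y - e *\<^sub>R z)) * mol z) * v (y - e *\<^sub>R z)"
      unfolding sc using e by (simp add: fdm molr_def field_simps)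
  qed
  finally show ?thesis .
qed

definition comm_maj :: "real \<Rightarrow> real \<Rightarrow> (real^'n \<Rightarrow> real^'n^'n) \<Rightarrow> (real^'n \<Rightarrow> real) \<Rightarrow> real^'n \<Rightarrow> real^'n \<Rightarrow> real \<Rightarrow> ennreal" where
  "comm_maj M e G v y z s = ennreal M * ennreal (norm (G (y - (s * e) *\<^sub>R z) - G y))
     + ennreal M * ennreal (norm (G (y - e *\<^sub>R z) - G y)) + ennreal (norm (G y) * \<bar>v (y - e *\<^sub>R z) - v y\<bar>)"

text \<open>The difference quotient of b is an average of G over the segment. Comparing the
  integrand of \<open>commutator_eq\<close> with its version frozen at y, whose integral is 0,
  leaves only differences. K depends on the mollifier and the dimension alone.\<close>

lemma commutator_bound:
  "\<exists>K>0. \<forall>b G v M e. jac b G \<longrightarrow> v \<in> borel_measurable borel \<longrightarrow> (\<forall>x::real^'n. \<bar>v x\<bar> \<le> M) \<longrightarrow> 0 < e \<longrightarrow>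
      (AE y in lborel. ennreal \<bar>commutator e b G v y\<bar>
        \<le> (NNINT z. NNINT s. indicator (cball 0 1) z * indicator {0..1} s * (ennreal K * comm_maj M e G v y z s)))"
proof -
  obtain C1 where C1: "0 < C1" "\<And>(z::real^'n) h. \<bar>fd mol z h\<bar> \<le> C1 * norm h" using csmooth_deriv_bounded[OF csmooth_mol] by metis
  obtain C2 where C2: "0 < C2" "\<And>z::real^'n. \<bar>mol z\<bar> \<le> C2" using csmooth_bounded[OF csmooth_mol] by metis
  let ?N = "real CARD('n)"
  define K where "K = ?N * (C1 + C2) + C1"
  have Npos: "0 < ?N" by simp
  have K: "0 < K" "?N * C1 \<le> K" "?N * C2 \<le> K" "C1 + ?N * C2 \<le> K"
    using C1 C2 Npos by (auto simp: K_def distrib_left add_nonneg_pos)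
  show ?thesis
  proof (intro exI[of _ K] conjI allI impI)
    show "0 < K" by (rule K(1))
    fix b :: "real^'n \<Rightarrow> real^'n" and G and v :: "real^'n \<Rightarrow> real" and M e :: real
    assume J: "jac b G" and v[measurable]: "v \<in> borel_measurable borel" and "\<forall>x. \<bar>v x\<bar> \<le> M" and e: "0 < e"
    then have M: "\<And>x. \<bar>v x\<bar> \<le> M" by blast
    have lb: "locint b" and lG: "locint G" using J by (auto simp: jac_def)
    note [measurable] = locint_borel[OF lb] locint_borel[OF lG] borel_fd[OF csmooth_mol]
    have M0: "0 \<le> M" using M[of 0] by linarith
    let ?I = "\<lambda>z y i. (LINT s|lborel. indicator {0..1::real} s * (G (y - (s * e) *\<^sub>R z) $ i \<bullet> z))"
    \<comment> \<open>The null set of \<open>jac_increment\<close> depends on the increment - e z.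
      The result is for every z and almost every y; measurability of the predicate then allows the
      quantifiers to be exchanged.\<close>
    have "AE z in lborel. AE y in lborel. \<forall>i. (1/e) * (b y $ i - b (y - e *\<^sub>R z) $ i) = ?I z y i"
    proof (rule AE_I2)
      fix z :: "real^'n"
      have "AE y in lborel. (1/e) * (b y $ i - b (y - e *\<^sub>R z) $ i) = ?I z y i" for i
        using jac_increment[OF J, of "- (e *\<^sub>R z)" i]
      proof eventually_elim
        case (elim y)
        have "(LINT s|lborel. indicator {0..1::real} s * (G (y + s *\<^sub>R (- (e *\<^sub>R z))) $ i \<bullet> (- (e *\<^sub>R z))))
          = (LINT s|lborel. - e * (indicator {0..1::real} s * (G (y - (s * e) *\<^sub>R z) $ i \<bullet> z)))"
          by (intro LINT_cong refl) simp
        also have "\<dots> = - e * ?I z y i" by (rule integral_mult_right_zero)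
        finally have "b (y - e *\<^sub>R z) $ i - b y $ i = - e * ?I z y i" using elim by simp
        then have "b y $ i - b (y - e *\<^sub>R z) $ i = e * ?I z y i" by linarith
        then show ?case using e by simp
      qed
      then show "AE y in lborel. \<forall>i. (1/e) * (b y $ i - b (y - e *\<^sub>R z) $ i) = ?I z y i"
        by (subst AE_all_countable) auto
    qed
    moreover have "Measurable.pred (lborel \<Otimes>\<^sub>M lborel) (\<lambda>w. \<forall>i. (1/e) * (b (fst w) $ i - b (fst w - e *\<^sub>R snd w) $ i) = ?I (snd w) (fst w) i)"
      by measurable
    ultimately have "AE y in lborel. AE z in lborel. \<forall>i. (1/e) * (b y $ i - b (y - e *\<^sub>R z) $ i) = ?I z y i"
      by (subst lborel_pair.AE_commute) (simp_all only: pred_def)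
    then show "AE y in lborel. ennreal \<bar>commutator e b G v y\<bar>
        \<le> (NNINT z. NNINT s. indicator (cball 0 1) z * indicator {0..1} s * (ennreal K * comm_maj M e G v y z s))"
    proof eventually_elim
      case (elim y)
      define X where "X z = (fd mol z ((1/e) *\<^sub>R (b y - b (y - e *\<^sub>R z))) + trace (G (y - e *\<^sub>R z)) * mol z) * v (y - e *\<^sub>R z)" for z
      \<comment> \<open>G and v are frozen at y and the difference quotient is replaced by its
        limit. As Y has integral 0 it can be subtracted at no cost.\<close>
      define Y where "Y z = (fd mol z (G y *v z) + trace (G y) * mol z) * v y" for z
      have [measurable]: "X \<in> borel_measurable borel" unfolding X_def by measurable
      have Yi: "integrable lborel Y" and Y0: "(LINT z|lborel. Y z) = 0"
        unfolding Y_def using integral_fd_mol[of "G y"] by auto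
      have 1: "ennreal \<bar>commutator e b G v y\<bar> \<le> (NNINT z. ennreal \<bar>X z - Y z\<bar>)"
      proof (cases "integrable lborel X")
        case True
        then show ?thesis
          using integral_norm_bound_ennreal[OF L1_diff[OF True Yi]]
          by (simp add: Y0 Yi commutator_eq[OF J v M e] X_def[abs_def])
      next
        \<comment> \<open>A non-integrable X has Bochner integral 0, so the left side is 0.\<close>
        case False
        then show ?thesis
          using not_integrable_integral_eq[OF False] by (simp add: commutator_eq[OF J v M e] X_def[abs_def])
      qed
      also have "\<dots> \<le> (NNINT z. NNINT s. indicator (cball 0 1) z * indicator {0..1} s * (ennreal K * comm_maj M e G v y z s))"
      proof (rule nn_integral_mono_AE)
        show "AE z in lborel. ennreal \<bar>X z - Y z\<bar> \<le> (NNINT s. indicator (cball 0 1) z * indicator {0..1} s * (ennreal K * comm_maj M e G v y z s))"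
          using elim
        proof eventually_elim
          case (elim z)
          show ?case
          proof (cases "norm z \<le> 1")
            case False
            then have "X z = 0" "Y z = 0"
              unfolding X_def Y_def using csmooth_fd_zero[of 1 mol z] mol_zero[of z] mol_zero by auto
            then show ?thesis by simp
          next
            case True
            let ?A = "\<Sum>i\<in>UNIV. \<bar>?I z y i - G y $ i \<bullet> z\<bar>"
            let ?vz = "v (y - e *\<^sub>R z)" and ?Gz = "G (y - e *\<^sub>R z)"
            have lin: "linear (fd mol z)" using csmooth_has_derivative[OF csmooth_mol] has_derivative_linear by blast
            have "X z - Y z = (fd mol z ((1/e) *\<^sub>R (b y - b (y - e *\<^sub>R z))) - fd mol z (G y *v z)) * ?vz
               + trace (?Gz - G y) * mol z * ?vz + (fd mol z (G y *v z) + trace (G y) * mol z) * (?vz - v y)"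
              unfolding X_def Y_def trace_sub by (simp add: algebra_simps)
            also have "\<bar>\<dots>\<bar> \<le> (C1 * ?A) * M + ?N * norm (?Gz - G y) * C2 * M + (C1 * norm (G y) + ?N * norm (G y) * C2) * \<bar>?vz - v y\<bar>"
            proof (intro order_trans[OF abs_triangle_ineq] add_mono)
              have "norm ((1/e) *\<^sub>R (b y - b (y - e *\<^sub>R z)) - G y *v z) \<le> ?A"
              proof -
                have "((1/e) *\<^sub>R (b y - b (y - e *\<^sub>R z)) - G y *v z) $ i = ?I z y i - G y $ i \<bullet> z" for i
                  using elim[rule_format, of i] by (simp add: matrix_vector_mul_component)
                then show ?thesis using norm_le_l1_cart[of "(1/e) *\<^sub>R (b y - b (y - e *\<^sub>R z)) - G y *v z"] by simp
              qed
              then have "\<bar>fd mol z ((1/e) *\<^sub>R (b y - b (y - e *\<^sub>R z)) - G y *v z)\<bar> \<le> C1 * ?A"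
                using C1 by (meson less_imp_le mult_left_mono order_trans)
              then show "\<bar>(fd mol z ((1/e) *\<^sub>R (b y - b (y - e *\<^sub>R z))) - fd mol z (G y *v z)) * ?vz\<bar> \<le> (C1 * ?A) * M"
                unfolding abs_mult linear_diff[OF lin, symmetric] using C1
                by (intro mult_mono M) (auto intro!: mult_nonneg_nonneg sum_nonneg)
              show "\<bar>trace (?Gz - G y) * mol z * ?vz\<bar> \<le> ?N * norm (?Gz - G y) * C2 * M"
                unfolding abs_mult using C2 by (intro mult_mono M trace_le) auto
              have "norm (G y *v z) \<le> norm (G y)"
                using norm_matrix_vector_mult_le[of "G y" z] True by (meson mult_left_le norm_ge_zero order_trans)
              then have "\<bar>fd mol z (G y *v z)\<bar> \<le> C1 * norm (G y)"
                using C1 by (meson less_imp_le mult_left_mono order_trans)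
              moreover have "\<bar>trace (G y) * mol z\<bar> \<le> ?N * norm (G y) * C2"
                unfolding abs_mult using C2 by (intro mult_mono trace_le) auto
              ultimately show "\<bar>(fd mol z (G y *v z) + trace (G y) * mol z) * (?vz - v y)\<bar> \<le> (C1 * norm (G y) + ?N * norm (G y) * C2) * \<bar>?vz - v y\<bar>"
                unfolding abs_mult[of _ "?vz - v y"]
                by (intro mult_right_mono order_trans[OF abs_triangle_ineq] add_mono) auto
            qed
            also have "\<dots> = (C1 * M) * ?A + (?N * C2) * (M * norm (?Gz - G y)) + (C1 + ?N * C2) * (norm (G y) * \<bar>?vz - v y\<bar>)"
              by (simp add: algebra_simps)
            also have "\<dots> \<le> (C1 * M) * ?A + K * (M * norm (?Gz - G y)) + K * (norm (G y) * \<bar>?vz - v y\<bar>)"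
              using K M0 by (intro add_mono mult_right_mono order_refl) auto
            finally have "ennreal \<bar>X z - Y z\<bar> \<le> ennreal (C1 * M) * ennreal ?A + ennreal K * (ennreal M * ennreal (norm (?Gz - G y))) + ennreal K * ennreal (norm (G y) * \<bar>?vz - v y\<bar>)"
              using C1 M0 K by (simp add: ennreal_leI sum_nonneg flip: ennreal_mult ennreal_plus)
            also have "ennreal (C1 * M) * ennreal ?A \<le> ennreal K * (ennreal M * (NNINT s. indicator {0..1::real} s * ennreal (norm (G (y - (s * e) *\<^sub>R z) - G y))))"
            proof -
              have "ennreal ?A = (\<Sum>i\<in>UNIV. ennreal \<bar>?I z y i - G y $ i \<bullet> z\<bar>)" by (simp add: sum_ennreal)
              also have "\<dots> \<le> (\<Sum>i\<in>(UNIV::'n set). (NNINT s. indicator {0..1::real} s * ennreal (norm (G (y - (s * e) *\<^sub>R z) - G y))))"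
              proof (rule sum_mono)
                fix i
                have "ennreal \<bar>?I z y i - G y $ i \<bullet> z\<bar> \<le> (NNINT s. indicator {0..1::real} s * ennreal \<bar>G (y - (s * e) *\<^sub>R z) $ i \<bullet> z - G y $ i \<bullet> z\<bar>)"
                  by (rule abs_integral_minus_const_le) measurable
                also have "\<dots> \<le> (NNINT s. indicator {0..1::real} s * ennreal (norm (G (y - (s * e) *\<^sub>R z) - G y)))"
                proof (intro nn_integral_mono mult_left_mono ennreal_leI)
                  fix s
                  have "\<bar>G (y - (s * e) *\<^sub>R z) $ i \<bullet> z - G y $ i \<bullet> z\<bar> = \<bar>(G (y - (s * e) *\<^sub>R z) - G y) $ i \<bullet> z\<bar>"
                    by (simp add: inner_diff_left)
                  also have "\<dots> \<le> norm ((G (y - (s * e) *\<^sub>R z) - G y) $ i) * norm z" by (rule Cauchy_Schwarz_ineq2)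
                  also have "\<dots> \<le> norm (G (y - (s * e) *\<^sub>R z) - G y) * 1"
                    using True by (intro mult_mono Finite_Cartesian_Product.norm_nth_le) auto
                  finally show "\<bar>G (y - (s * e) *\<^sub>R z) $ i \<bullet> z - G y $ i \<bullet> z\<bar> \<le> norm (G (y - (s * e) *\<^sub>R z) - G y)" by simp
                qed simp
                finally show "ennreal \<bar>?I z y i - G y $ i \<bullet> z\<bar> \<le> \<dots>" .
              qed
              finally have "ennreal (C1 * M) * ennreal ?A \<le> ennreal (C1 * M) * (ennreal ?N * (NNINT s. indicator {0..1::real} s * ennreal (norm (G (y - (s * e) *\<^sub>R z) - G y))))"
                by (intro mult_left_mono) (simp_all add: ennreal_of_nat_eq_real_of_nat)
              also have "\<dots> = ennreal (?N * C1) * (ennreal M * (NNINT s. indicator {0..1::real} s * ennreal (norm (G (y - (s * e) *\<^sub>R z) - G y))))"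
                using C1 M0 by (simp add: ennreal_mult mult_ac)
              also have "\<dots> \<le> ennreal K * (ennreal M * (NNINT s. indicator {0..1::real} s * ennreal (norm (G (y - (s * e) *\<^sub>R z) - G y))))"
                using K by (intro mult_right_mono ennreal_leI) auto
              finally show ?thesis .
            qed
            also have "ennreal K * (ennreal M * (NNINT s. indicator {0..1::real} s * ennreal (norm (G (y - (s * e) *\<^sub>R z) - G y))))
                + ennreal K * (ennreal M * ennreal (norm (?Gz - G y))) + ennreal K * ennreal (norm (G y) * \<bar>?vz - v y\<bar>)
              = (NNINT s. indicator {0..1} s * (ennreal K * comm_maj M e G v y z s))"
            proof -
              have "(NNINT s. indicator {0..1::real} s * (ennreal K * comm_maj M e G v y z s))
                = (NNINT s. ennreal K * (ennreal M * (indicator {0..1::real} s * ennreal (norm (G (y - (s * e) *\<^sub>R z) - G y))))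
                   + indicator {0..1::real} s * (ennreal K * (ennreal M * ennreal (norm (?Gz - G y))) + ennreal K * ennreal (norm (G y) * \<bar>?vz - v y\<bar>)))"
                by (intro nn_integral_cong) (simp add: comm_maj_def distrib_left mult_ac add_ac)
              also have "\<dots> = ennreal K * (ennreal M * (NNINT s. indicator {0..1::real} s * ennreal (norm (G (y - (s * e) *\<^sub>R z) - G y))))
                + (NNINT s. indicator {0..1::real} s * (ennreal K * (ennreal M * ennreal (norm (?Gz - G y))) + ennreal K * ennreal (norm (G y) * \<bar>?vz - v y\<bar>)))"
                by (subst nn_integral_add, measurable, subst nn_integral_cmult, measurable, subst nn_integral_cmult, measurable)
              finally show ?thesis by (simp add: nn_integral_multc add.assoc)
            qed
            finally show ?thesis using True by simp
          qed
        qed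
      qed
      finally show ?case .
    qed
  qed
qed

lemma flux_molr:
  assumes e: "0 < e"
  shows "flux b G (\<lambda>x. molr e (y - x)) v = (LINT x|lborel. (- fd (molr e) (y - x) (b x) + trace (G x) * molr e (y - x)) * v x)"
proof -
  have "fd (\<lambda>x. molr e (y - x)) x h = - fd (molr e) (y - x) h" for x h
    using fd_affine[OF csmooth_smooth[OF csmooth_molr[OF e]], of y "-1"] by simp
  then show ?thesis by (simp add: flux_def)
qed

lemma borel_flux_molr:
  fixes b :: "real \<Rightarrow> real^'n \<Rightarrow> real^'n"
  assumes e: "0 < e" and [measurable]: "case_prod b \<in> borel_measurable (borel \<Otimes>\<^sub>M borel)"
    "case_prod G \<in> borel_measurable (borel \<Otimes>\<^sub>M borel)" "case_prod v \<in> borel_measurable (borel \<Otimes>\<^sub>M borel)"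
    and [measurable]: "f \<in> borel_measurable M" "g \<in> borel_measurable M"
  shows "(\<lambda>w. flux (b (f w)) (G (f w)) (\<lambda>x. molr e (g w - x)) (v (f w))) \<in> borel_measurable M"
proof -
  note [measurable] = csmooth_borel[OF csmooth_molr[OF e]] borel_fd[OF csmooth_molr[OF e]]
  show ?thesis unfolding flux_molr[OF e] by measurable
qed

lemma borel_commutator:
  fixes b :: "real^'n \<Rightarrow> real^'n"
  assumes e: "0 < e" and [measurable]: "b \<in> borel_measurable borel" "G \<in> borel_measurable borel" "v \<in> borel_measurable borel"
    and M: "\<And>x. \<bar>v x\<bar> \<le> M"
  shows "commutator e b G v \<in> borel_measurable borel"
proof -
  note [measurable] = csmooth_borel[OF csmooth_molr[OF e]] borel_fd[OF csmooth_molr[OF e]]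
  have "fd (conv v (molr e)) y = (\<lambda>h. conv v (\<lambda>x. fd (molr e) x h) y)" for y
    using frechet_derivative_at[OF conv_has_derivative[OF csmooth_molr[OF e] assms(4) M], of y] by simp
  then show ?thesis unfolding commutator_def[abs_def] flux_molr[OF e] conv_def by simp
qed

text \<open>Integrating \<open>comm_maj\<close> over y turns it into translation errors. They are
  bounded by the local L1 norm of G and tend to 0, the passage through z and s being dominated. The
  bound later serves as a majorant in time, the limit removes the commutators.\<close>

lemma commutator_L1_bound:
  "\<exists>K>0. \<forall>b G v M r. jac b G \<longrightarrow> v \<in> borel_measurable borel \<longrightarrow> (\<forall>x::real^'n. \<bar>v x\<bar> \<le> M) \<longrightarrow>
     (\<forall>e. 0 < e \<longrightarrow> e \<le> 1 \<longrightarrow> (NNINT y. indicator (cball 0 r) y * ennreal \<bar>commutator e b G v y\<bar>)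
        \<le> ennreal (K * M) * (NNINT y. indicator (cball 0 (r + 1)) y * ennreal (norm (G y)))) \<and>
     (\<forall>e. (\<forall>k. 0 < e k) \<longrightarrow> (\<forall>k. e k \<le> 1) \<longrightarrow> e \<longlonglongrightarrow> 0 \<longrightarrow>
      (\<lambda>k. NNINT y. indicator (cball 0 r) y * ennreal \<bar>commutator (e k) b G v y\<bar>) \<longlonglongrightarrow> 0)"
proof -
  obtain K :: real where K: "0 < K" and bnd:
    "\<And>b G v M e. jac b G \<Longrightarrow> v \<in> borel_measurable borel \<Longrightarrow> \<forall>x::real^'n. \<bar>v x\<bar> \<le> M \<Longrightarrow> 0 < e \<Longrightarrow>
      AE y in lborel. ennreal \<bar>commutator e b G v y\<bar>
        \<le> (NNINT z. NNINT s. indicator (cball 0 1) z * indicator {0..1} s * (ennreal K * comm_maj M e G v y z s))"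
    using commutator_bound[where 'n='n] by blast
  define c where "c = measure lborel (cball (0::real^'n) 1)"
  have c: "emeasure lborel (cball (0::real^'n) 1) = ennreal c"
    unfolding c_def using emeasure_lborel_cball_finite[of "0::real^'n" 1] by (intro emeasure_eq_ennreal_measure) auto
  have c0: "0 \<le> c" by (simp add: c_def)
  define J where "J M e H v z s = ennreal M * (NNINT y. ennreal (norm (H (y + (- ((s * e) *\<^sub>R z))) - H y)))
     + ennreal M * (NNINT y. ennreal (norm (H (y + (- (e *\<^sub>R z))) - H y)))
     + (NNINT y. ennreal (norm (H y) * \<bar>v (y + (- (e *\<^sub>R z))) - v y\<bar>))"
    for M e s :: real and H :: "real^'n \<Rightarrow> real^'n^'n" and v :: "real^'n \<Rightarrow> real" and z
  {
    fix b :: "real^'n \<Rightarrow> real^'n" and G and v :: "real^'n \<Rightarrow> real" and M r :: real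
    assume A: "jac b G" "v \<in> borel_measurable borel" "\<And>x. \<bar>v x\<bar> \<le> M"
    \<comment> \<open>Cutting off makes G globally integrable, as the translation lemmas ask. Radius
      r + 1 suffices because the shifts e z have length at most 1.\<close>
    define H where "H x = indicator (cball 0 (r + 1)) x *\<^sub>R G x" for x
    define I where "I = (NNINT y. ennreal (norm (H y)))"
    have lG: "locint G" and lb: "locint b" using A(1) by (auto simp: jac_def)
    note [measurable] = A(2) locint_borel[OF lG] locint_borel[OF lb]
    have M0: "0 \<le> M" using A(3)[of 0] by linarith
    have Hi: "integrable lborel H" unfolding H_def using lG by (simp add: locint_def)
    have [measurable]: "H \<in> borel_measurable borel" unfolding H_def by measurable
    have Ifin: "I < \<infinity>" using Hi unfolding I_def integrable_iff_bounded by blast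
    have Ieq: "I = (NNINT y. indicator (cball 0 (r + 1)) y * ennreal (norm (G y)))"
      unfolding I_def H_def by (intro nn_integral_cong) (auto simp: indicator_def)
    have Jm[measurable]: "(\<lambda>(z, s). J M e H v z s) \<in> borel_measurable (borel \<Otimes>\<^sub>M borel)" for e
      unfolding J_def by measurable
    have main: "(NNINT y. indicator (cball 0 r) y * ennreal \<bar>commutator e b G v y\<bar>)
        \<le> (NNINT z. NNINT s. indicator (cball 0 1) z * indicator {0..1} s * (ennreal K * J M e H v z s))"
      if e: "0 < e" "e \<le> 1" for e
    proof -
      let ?i = "\<lambda>z s. indicator (cball (0::real^'n) 1) z * indicator {0..1::real} s :: ennreal"
      have "(NNINT y. indicator (cball 0 r) y * ennreal \<bar>commutator e b G v y\<bar>)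
        \<le> (NNINT y. (NNINT z. NNINT s. ?i z s * (ennreal K * comm_maj M e H v y z s)))"
      proof (rule nn_integral_mono_AE)
        show "AE y in lborel. indicator (cball 0 r) y * ennreal \<bar>commutator e b G v y\<bar>
          \<le> (NNINT z. NNINT s. ?i z s * (ennreal K * comm_maj M e H v y z s))"
          using bnd[OF A(1,2) allI[OF A(3)] e(1)]
        proof eventually_elim
          case (elim y)
          show ?case
          proof (cases "norm y \<le> r")
            case True
            have "?i z s * (ennreal K * comm_maj M e G v y z s) = ?i z s * (ennreal K * comm_maj M e H v y z s)" for z s
            proof (cases "norm z \<le> 1 \<and> s \<in> {0..1}")
              case zs: True
              have n: "norm (y - t *\<^sub>R z) \<le> r + 1" if "0 \<le> t" "t \<le> 1" for t
              proof -
                have "norm (t *\<^sub>R z) \<le> 1" using that zs by (simp add: mult_le_one)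
                then show ?thesis using True norm_triangle_ineq4[of y "t *\<^sub>R z"] by linarith
              qed
              have "s * e \<le> 1" "0 \<le> s * e" using zs e by (auto intro: mult_le_one)
              then have "H y = G y" "H (y - (s * e) *\<^sub>R z) = G (y - (s * e) *\<^sub>R z)" "H (y - e *\<^sub>R z) = G (y - e *\<^sub>R z)"
                using n[of 0] n[of e] n[of "s * e"] e by (auto simp: H_def)
              then show ?thesis by (simp add: comm_maj_def)
            qed (auto simp: indicator_def)
            then show ?thesis using elim True by simp
          qed simp
        qed
      qed
      also have "\<dots> = (NNINT z. NNINT y. NNINT s. ?i z s * (ennreal K * comm_maj M e H v y z s))"
        unfolding comm_maj_def by (rule lborel_pair.Fubini') measurable
      also have "\<dots> = (NNINT z. NNINT s. NNINT y. ?i z s * (ennreal K * comm_maj M e H v y z s))"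
        unfolding comm_maj_def by (intro nn_integral_cong lborel_pair.Fubini') measurable
      also have "\<dots> = (NNINT z. NNINT s. ?i z s * (ennreal K * J M e H v z s))"
      proof (intro nn_integral_cong)
        fix z s
        have "(NNINT y. ?i z s * (ennreal K * comm_maj M e H v y z s)) = ?i z s * (ennreal K * (NNINT y. comm_maj M e H v y z s))"
          unfolding comm_maj_def by (subst nn_integral_cmult, measurable, subst nn_integral_cmult, measurable)
        also have "(NNINT y. comm_maj M e H v y z s) = J M e H v z s"
          unfolding comm_maj_def J_def by (simp add: nn_integral_add nn_integral_cmult)
        finally show "(NNINT y. ?i z s * (ennreal K * comm_maj M e H v y z s)) = ?i z s * (ennreal K * J M e H v z s)" .
      qed
      finally show ?thesis .
    qed
    have T: "(NNINT y. ennreal (norm (H (y + h) - H y))) \<le> 2 * I" for h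
    proof -
      have "(NNINT y. ennreal (norm (H (y + h) - H y))) \<le> (NNINT y. ennreal (norm (H (y + h))) + ennreal (norm (H y)))"
        by (intro nn_integral_mono) (auto simp: norm_triangle_ineq4 simp flip: ennreal_plus intro!: ennreal_leI)
      also have "\<dots> = (NNINT y. ennreal (norm (H (y + h)))) + I"
        unfolding I_def by (rule nn_integral_add) measurable
      also have "(NNINT y. ennreal (norm (H (y + h)))) = I"
        unfolding I_def by (rule nn_integral_lborel_shift) measurable
      finally show ?thesis by (simp add: mult_2)
    qed
    have W: "(NNINT y. ennreal (norm (H y) * \<bar>v (y + h) - v y\<bar>)) \<le> 2 * ennreal M * I" for h
    proof -
      have "(NNINT y. ennreal (norm (H y) * \<bar>v (y + h) - v y\<bar>)) \<le> (NNINT y. ennreal (2 * M) * ennreal (norm (H y)))"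
      proof (intro nn_integral_mono)
        fix y
        have "\<bar>v (y + h) - v y\<bar> \<le> 2 * M" using A(3)[of "y + h"] A(3)[of y] by linarith
        then have "norm (H y) * \<bar>v (y + h) - v y\<bar> \<le> 2 * M * norm (H y)"
          by (subst mult.commute) (rule mult_right_mono, auto)
        then show "ennreal (norm (H y) * \<bar>v (y + h) - v y\<bar>) \<le> ennreal (2 * M) * ennreal (norm (H y))"
          using M0 by (simp add: ennreal_leI flip: ennreal_mult)
      qed
      also have "\<dots> = ennreal (2 * M) * I" unfolding I_def by (rule nn_integral_cmult) measurable
      finally show ?thesis using M0 by (simp add: ennreal_mult)
    qed
    have JB: "J M e H v z s \<le> 6 * (ennreal M * I)" for e z s
    proof -
      have "J M e H v z s \<le> ennreal M * (2 * I) + ennreal M * (2 * I) + 2 * ennreal M * I"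
        unfolding J_def by (intro add_mono mult_left_mono T W) auto
      also have "\<dots> = (2 + 2 + 2) * (ennreal M * I)" by (simp only: distrib_right) (simp only: mult_ac)
      also have "(2 + 2 + 2 :: ennreal) = 6" by simp
      finally show ?thesis .
    qed
    have tot: "(NNINT z. NNINT s. indicator (cball (0::real^'n) 1) z * indicator {0..1::real} s * q) = ennreal c * q" for q
    proof -
      have "(NNINT s. indicator (cball (0::real^'n) 1) z * indicator {0..1::real} s * q) = indicator (cball (0::real^'n) 1) z * q" for z
        by (subst nn_integral_multc, measurable, subst nn_integral_cmult) (auto simp: mult.assoc)
      then show ?thesis by (simp add: nn_integral_multc c)
    qed
    \<comment> \<open>The 6 counts the three summands of J, each at most 2 M I; c is the measure of
      the unit ball of z. The extra 1 keeps the constant positive.\<close>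
    have b1: "(NNINT y. indicator (cball 0 r) y * ennreal \<bar>commutator e b G v y\<bar>) \<le> ennreal ((K * 6 * c + 1) * M) * I"
      if e: "0 < e" "e \<le> 1" for e
    proof -
      have "(NNINT y. indicator (cball 0 r) y * ennreal \<bar>commutator e b G v y\<bar>)
        \<le> (NNINT z. NNINT s. indicator (cball (0::real^'n) 1) z * indicator {0..1::real} s * (ennreal K * (6 * (ennreal M * I))))"
        by (rule order_trans[OF main[OF e]]) (intro nn_integral_mono mult_left_mono JB, auto)
      also have "\<dots> = ennreal (K * 6 * c * M) * I"
        unfolding tot using K c0 M0 by (simp add: ennreal_mult mult_ac)
      also have "\<dots> \<le> ennreal ((K * 6 * c + 1) * M) * I"
        using M0 by (intro mult_right_mono ennreal_leI) (auto simp: distrib_right)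
      finally show ?thesis .
    qed
    have b2: "(\<lambda>k. NNINT y. indicator (cball 0 r) y * ennreal \<bar>commutator (e k) b G v y\<bar>) \<longlonglongrightarrow> 0"
      if e: "\<And>k. 0 < e k" "\<And>k. e k \<le> 1" "e \<longlonglongrightarrow> 0" for e :: "nat \<Rightarrow> real"
    proof (rule tendsto_ennreal_0_le)
      let ?i = "\<lambda>z s. indicator (cball (0::real^'n) 1) z * indicator {0..1::real} s :: ennreal"
      let ?w = "ennreal K * (6 * (ennreal M * I))"
      have wf: "?w < \<infinity>" using Ifin by (auto simp: ennreal_mult_less_top)
      have Jl: "(\<lambda>k. ennreal K * J M (e k) H v z s) \<longlonglongrightarrow> 0" for z s
      proof -
        have h1: "(\<lambda>k. - ((s * e k) *\<^sub>R z)) \<longlonglongrightarrow> 0"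
        proof -
          have "(\<lambda>k. - ((s * e k) *\<^sub>R z)) \<longlonglongrightarrow> - ((s * 0) *\<^sub>R z)" by (intro tendsto_intros e)
          then show ?thesis by simp
        qed
        have h2: "(\<lambda>k. - (e k *\<^sub>R z)) \<longlonglongrightarrow> 0"
        proof -
          have "(\<lambda>k. - (e k *\<^sub>R z)) \<longlonglongrightarrow> - (0 *\<^sub>R z)" by (intro tendsto_intros e)
          then show ?thesis by simp
        qed
        have "(\<lambda>k. J M (e k) H v z s) \<longlonglongrightarrow> ennreal M * 0 + ennreal M * 0 + 0"
          unfolding J_def
          by (intro tendsto_add ennreal_tendsto_cmult nn_L1_translation[OF Hi h1] nn_L1_translation[OF Hi h2]
              weighted_translation[OF Hi A(2,3) h2]) auto
        then have "(\<lambda>k. ennreal K * J M (e k) H v z s) \<longlonglongrightarrow> ennreal K * 0"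
          by (intro ennreal_tendsto_cmult) auto
        then show ?thesis by simp
      qed
      have inner: "(\<lambda>k. NNINT s. ?i z s * (ennreal K * J M (e k) H v z s)) \<longlonglongrightarrow> (\<integral>\<^sup>+s. 0 \<partial>(lborel::real measure))" for z
      proof (rule nn_integral_dominated_convergence[where w = "\<lambda>s. ?i z s * ?w"])
        show "AE s in lborel. ?i z s * (ennreal K * J M (e k) H v z s) \<le> ?i z s * ?w" for k
          by (intro AE_I2 mult_left_mono JB) auto
        have "(NNINT s. ?i z s * ?w) = indicator (cball (0::real^'n) 1) z * ?w"
          by (subst nn_integral_multc, measurable, subst nn_integral_cmult) (auto simp: mult.assoc)
        also have "\<dots> < \<infinity>" using wf by (auto simp: indicator_def)
        finally show "(NNINT s. ?i z s * ?w) < \<infinity>" .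
        show "AE s in lborel. (\<lambda>k. ?i z s * (ennreal K * J M (e k) H v z s)) \<longlonglongrightarrow> 0"
        proof (rule AE_I2)
          fix s show "(\<lambda>k. ?i z s * (ennreal K * J M (e k) H v z s)) \<longlonglongrightarrow> 0"
            using Jl[of z s] by (auto simp: indicator_def)
        qed
      show "(\<lambda>s. ?i z s * (ennreal K * J M (e k) H v z s)) \<in> borel_measurable lborel" for k by measurable
        show "(\<lambda>s. ?i z s * ?w) \<in> borel_measurable lborel" by measurable
      qed simp
      have "(\<lambda>k. NNINT z. NNINT s. ?i z s * (ennreal K * J M (e k) H v z s)) \<longlonglongrightarrow> (\<integral>\<^sup>+z. 0 \<partial>(lborel::(real^'n) measure))"
      proof (rule nn_integral_dominated_convergence[where w = "\<lambda>z. NNINT s. ?i z s * ?w"])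
        show "AE z in lborel. (NNINT s. ?i z s * (ennreal K * J M (e k) H v z s)) \<le> (NNINT s. ?i z s * ?w)" for k
          by (intro AE_I2 nn_integral_mono mult_left_mono JB) auto
        show "(NNINT z. NNINT s. ?i z s * ?w) < \<infinity>"
          unfolding tot using wf by (auto simp: ennreal_mult_less_top)
        show "AE z in lborel. (\<lambda>k. NNINT s. ?i z s * (ennreal K * J M (e k) H v z s)) \<longlonglongrightarrow> 0"
          using inner by simp
        show "(\<lambda>z. NNINT s. ?i z s * (ennreal K * J M (e k) H v z s)) \<in> borel_measurable lborel" for k by measurable
        show "(\<lambda>z. NNINT s. ?i z s * ?w) \<in> borel_measurable lborel" by measurable
      qed simp
      then show "(\<lambda>k. NNINT z. NNINT s. ?i z s * (ennreal K * J M (e k) H v z s)) \<longlonglongrightarrow> 0" by simp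
      show "(NNINT y. indicator (cball 0 r) y * ennreal \<bar>commutator (e k) b G v y\<bar>)
         \<le> (NNINT z. NNINT s. ?i z s * (ennreal K * J M (e k) H v z s))" for k
        by (rule main[OF e(1,2)])
    qed
    from b1[unfolded Ieq] b2
    have "(\<forall>e. 0 < e \<longrightarrow> e \<le> 1 \<longrightarrow> (NNINT y. indicator (cball 0 r) y * ennreal \<bar>commutator e b G v y\<bar>)
        \<le> ennreal ((K * 6 * c + 1) * M) * (NNINT y. indicator (cball 0 (r + 1)) y * ennreal (norm (G y)))) \<and>
     (\<forall>e. (\<forall>k. 0 < e k) \<longrightarrow> (\<forall>k. e k \<le> 1) \<longrightarrow> e \<longlonglongrightarrow> 0 \<longrightarrow>
      (\<lambda>k. NNINT y. indicator (cball 0 r) y * ennreal \<bar>commutator (e k) b G v y\<bar>) \<longlonglongrightarrow> 0)"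
      by simp
  } note main = this
  have pos: "0 < K * 6 * c + 1" using K c0 by (intro add_nonneg_pos) auto
  show ?thesis
    by (rule exI[of _ "K * 6 * c + 1"], rule conjI[OF pos], intro allI impI) (rule main, simp_all)
qed

lemma jac_divergence:
  fixes b :: "real^'n \<Rightarrow> real^'n"
  assumes J: "jac b G" and \<psi>: "csmooth \<psi>"
  shows "integrable lborel (\<lambda>x. fd \<psi> x (b x))" and "integrable lborel (\<lambda>x. trace (G x) * \<psi> x)"
    and "(LINT x|lborel. fd \<psi> x (b x) + trace (G x) * \<psi> x) = 0"
proof -
  have lb: "locint b" and lG: "locint G" using J by (auto simp: jac_def)
  note [measurable] = locint_borel[OF lb] locint_borel[OF lG]
  have locb: "locint (\<lambda>x. b x $ i)" for i
    by (rule locint_bound[OF lb, where C = 1]) (auto simp: component_le_norm_cart)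
  have locG: "locint (\<lambda>x. G x $ i $ j)" for i j
    by (rule locint_bound[OF lG, where C = 1]) (auto simp: abs_component2_le)
  have i1: "integrable lborel (\<lambda>x. b x $ i * fd \<psi> x (axis i 1))" for i
    using csmooth_locint[OF csmooth_deriv[OF \<psi>, of "axis i 1"] locb[of i]] by (simp add: mult.commute)
  have i2: "integrable lborel (\<lambda>x. G x $ i $ i * \<psi> x)" for i
    using csmooth_locint[OF \<psi> locG[of i i]] by (simp add: mult.commute)
  show "integrable lborel (\<lambda>x. fd \<psi> x (b x))"
    by (subst fd_sum_axis[OF \<psi>]) (intro L1_sum i1)
  show "integrable lborel (\<lambda>x. trace (G x) * \<psi> x)"
    unfolding trace_def sum_distrib_right by (intro L1_sum i2)
  have "(LINT x|lborel. fd \<psi> x (b x) + trace (G x) * \<psi> x)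
    = (LINT x|lborel. (\<Sum>i\<in>UNIV. b x $ i * fd \<psi> x (axis i 1)) + (\<Sum>i\<in>UNIV. G x $ i $ i * \<psi> x))"
    by (subst fd_sum_axis[OF \<psi>]) (simp add: trace_def sum_distrib_right)
  also have "\<dots> = (\<Sum>i\<in>UNIV. (LINT x|lborel. b x $ i * fd \<psi> x (axis i 1))) + (\<Sum>i\<in>UNIV. (LINT x|lborel. G x $ i $ i * \<psi> x))"
    using i1 i2 by (simp add: LINT_add LINT_sum)
  also have "\<dots> = 0" using J \<psi> by (simp add: jac_def sum_negf)
  finally show "(LINT x|lborel. fd \<psi> x (b x) + trace (G x) * \<psi> x) = 0" .
qed

section \<open>Products of two mollified functions\<close>

lemma integrable_mult_bounded:
  fixes f :: "'a::euclidean_space \<Rightarrow> real"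
  assumes f: "integrable lborel f" and [measurable]: "g \<in> borel_measurable borel" and C: "\<And>x. \<bar>g x\<bar> \<le> C"
  shows "integrable lborel (\<lambda>x. f x * g x)"
  by (rule L1_bound[OF integrable_mult_left[OF f, of C]])
    (use borel_measurable_integrable[OF f] in \<open>auto simp: abs_mult intro!: mult_left_mono order_trans[OF C]\<close>)

text \<open>By the product rule this is the time derivative, at a fixed y, of the product of two
  mollified solutions.\<close>

definition flux_prod :: "real \<Rightarrow> (real^'n \<Rightarrow> real^'n) \<Rightarrow> (real^'n \<Rightarrow> real^'n^'n) \<Rightarrow> (real^'n \<Rightarrow> real) \<Rightarrow> (real^'n \<Rightarrow> real) \<Rightarrow> real^'n \<Rightarrow> real" where
  "flux_prod e b G v1 v2 y = flux b G (\<lambda>x. molr e (y - x)) v1 * conv v2 (molr e) y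
     + conv v1 (molr e) y * flux b G (\<lambda>x. molr e (y - x)) v2"

text \<open>Each flux is a commutator minus b . grad of a mollification. The gradients combine to b
  . grad (w1 w2), and since w1 w2 \<phi> is itself a test function, \<open>jac_divergence\<close>
  turns its integral against \<phi> into the flux of the product.\<close>

lemma flux_prod_eq:
  fixes b :: "real^'n \<Rightarrow> real^'n"
  assumes J: "jac b G" and v: "v1 \<in> borel_measurable borel" "\<And>x. \<bar>v1 x\<bar> \<le> M" "v2 \<in> borel_measurable borel" "\<And>x. \<bar>v2 x\<bar> \<le> M"
    and \<phi>: "csmooth \<phi>" and e: "0 < e" "e \<le> 1"
  shows "(LINT y|lborel. \<phi> y * flux_prod e b G v1 v2 y)
    = (LINT y|lborel. \<phi> y * (commutator e b G v1 y * conv v2 (molr e) y + conv v1 (molr e) y * commutator e b G v2 y))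
      + flux b G \<phi> (\<lambda>y. conv v1 (molr e) y * conv v2 (molr e) y)" (is ?eq)
    and "integrable lborel (\<lambda>y. \<phi> y * flux_prod e b G v1 v2 y)" (is ?i1)
    and "integrable lborel (\<lambda>y. \<phi> y * (commutator e b G v1 y * conv v2 (molr e) y + conv v1 (molr e) y * commutator e b G v2 y))" (is ?i2)
proof -
  have lb: "locint b" and lG: "locint G" using J by (auto simp: jac_def)
  note [measurable] = locint_borel[OF lb] locint_borel[OF lG]
  let ?K = "molr e :: real^'n \<Rightarrow> real"
  have K: "csmooth ?K" by (rule csmooth_molr[OF e(1)])
  note [measurable] = v(1,3) csmooth_borel[OF K] csmooth_borel[OF \<phi>]
    borel_commutator[OF e(1) locint_borel[OF lb] locint_borel[OF lG] v(1,2)]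
    borel_commutator[OF e(1) locint_borel[OF lb] locint_borel[OF lG] v(3,4)]
  define w1 where "w1 = conv v1 ?K"
  define w2 where "w2 = conv v2 ?K"
  have s: "smooth_on UNIV w1" "smooth_on UNIV w2" unfolding w1_def w2_def by (rule conv_smooth[OF K v(1,2)] conv_smooth[OF K v(3,4)])+
  have wb: "\<bar>w1 y\<bar> \<le> M" "\<bar>w2 y\<bar> \<le> M" for y unfolding w1_def w2_def by (rule conv_molr_bound[OF e(1) v(1,2)] conv_molr_bound[OF e(1) v(3,4)])+
  have [measurable]: "w1 \<in> borel_measurable borel" "w2 \<in> borel_measurable borel" unfolding w1_def w2_def by measurable
  obtain KK :: real where KK: "\<And>b G v M e r. jac b G \<Longrightarrow> v \<in> borel_measurable borel \<Longrightarrow> \<forall>x::real^'n. \<bar>v x\<bar> \<le> M \<Longrightarrow> 0 < e \<Longrightarrow> e \<le> 1 \<Longrightarrow>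
      (NNINT y. indicator (cball 0 r) y * ennreal \<bar>commutator e b G v y\<bar>)
        \<le> ennreal (KK * M) * (NNINT y. indicator (cball 0 (r + 1)) y * ennreal (norm (G y)))"
    using commutator_L1_bound[where 'n='n] by blast
  have lc: "locint (commutator e b G v)" if "v \<in> borel_measurable borel" "\<And>x. \<bar>v x\<bar> \<le> M" for v
  proof (rule locintI_nn)
    show "commutator e b G v \<in> borel_measurable borel"
      by (rule borel_commutator[OF e(1) locint_borel[OF lb] locint_borel[OF lG] that])
    fix r
    show "(NNINT y. indicator (cball 0 r) y * ennreal (norm (commutator e b G v y))) < \<infinity>"
      unfolding real_norm_def
      by (rule order.strict_trans1[OF KK[OF J that(1) allI[OF that(2)] e]]) (use locint_nn[OF lG] in \<open>auto simp: ennreal_mult_less_top\<close>)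
  qed
  define c1 where "c1 = commutator e b G v1"
  define c2 where "c2 = commutator e b G v2"
  have ic: "integrable lborel (\<lambda>y. \<phi> y * (c1 y * w2 y + w1 y * c2 y))"
    using L1_add[OF
        integrable_mult_bounded[OF csmooth_locint[OF \<phi> lc[OF v(1,2)], simplified] _ wb(2)]
        integrable_mult_bounded[OF csmooth_locint[OF \<phi> lc[OF v(3,4)], simplified] _ wb(1)]]
    by (simp add: c1_def c2_def algebra_simps)
  have cs: "csmooth (\<lambda>y. w1 y * (w2 y * \<phi> y))" by (intro smooth_mult_csmooth \<phi> s)
  have cs2: "csmooth (\<lambda>y. w2 y * \<phi> y)" by (intro smooth_mult_csmooth \<phi> s)
  have D: "fd (\<lambda>y. w1 y * (w2 y * \<phi> y)) y h = w1 y * (w2 y * fd \<phi> y h) + (w1 y * fd w2 y h + fd w1 y h * w2 y) * \<phi> y" for y h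
    by (subst fd_mult[OF s(1) csmooth_smooth[OF cs2]], subst fd_mult[OF s(2) csmooth_smooth[OF \<phi>]]) (simp add: algebra_simps)
  define F where "F y = fd \<phi> y (b y) + trace (G y) * \<phi> y" for y
  have F: "integrable lborel F" unfolding F_def by (intro L1_add jac_divergence[OF J \<phi>])
  have Fw: "integrable lborel (\<lambda>y. F y * (w1 y * w2 y))"
    by (rule integrable_mult_bounded[OF F, where C = "M * M"])
      (auto simp: abs_mult intro!: mult_mono wb order_trans[OF abs_ge_zero wb(1)])
  have wk: "(LINT y|lborel. fd (\<lambda>y. w1 y * (w2 y * \<phi> y)) y (b y) + trace (G y) * (w1 y * (w2 y * \<phi> y))) = 0"
    by (rule jac_divergence(3)[OF J cs])
  have iD: "integrable lborel (\<lambda>y. fd (\<lambda>y. w1 y * (w2 y * \<phi> y)) y (b y) + trace (G y) * (w1 y * (w2 y * \<phi> y)))"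
    by (intro L1_add jac_divergence[OF J cs])
  have De: "fd (\<lambda>y. w1 y * (w2 y * \<phi> y)) y (b y) + trace (G y) * (w1 y * (w2 y * \<phi> y))
     = F y * (w1 y * w2 y) + (w1 y * fd w2 y (b y) + fd w1 y (b y) * w2 y) * \<phi> y" for y
    unfolding D F_def by (simp add: algebra_simps)
  have iE: "integrable lborel (\<lambda>y. (w1 y * fd w2 y (b y) + fd w1 y (b y) * w2 y) * \<phi> y)"
    using L1_diff[OF iD Fw] unfolding De by simp
  have E: "(LINT y|lborel. (w1 y * fd w2 y (b y) + fd w1 y (b y) * w2 y) * \<phi> y) = - (LINT y|lborel. F y * (w1 y * w2 y))"
    using wk unfolding De LINT_add[OF Fw iE] by linarith
  have fp: "\<phi> y * flux_prod e b G v1 v2 y = \<phi> y * (c1 y * w2 y + w1 y * c2 y) - (w1 y * fd w2 y (b y) + fd w1 y (b y) * w2 y) * \<phi> y" for y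
    unfolding flux_prod_def c1_def c2_def commutator_def w1_def w2_def by (simp add: algebra_simps)
  show ?i1 unfolding fp by (rule L1_diff[OF ic iE])
  show ?i2 using ic unfolding c1_def c2_def w1_def w2_def .
  have "(LINT y|lborel. \<phi> y * flux_prod e b G v1 v2 y) = (LINT y|lborel. \<phi> y * (c1 y * w2 y + w1 y * c2 y)) + (LINT y|lborel. F y * (w1 y * w2 y))"
    unfolding fp LINT_diff[OF ic iE] E by simp
  then show ?eq unfolding c1_def c2_def w1_def w2_def flux_def F_def by simp
qed

text \<open>One factor is changed at a time: replacing w1 by v1 costs at most M times a weighted
  error, and then only w2 remains to be replaced.\<close>

lemma weighted_conv_prod:
  fixes F :: "'a::euclidean_space \<Rightarrow> real"
  assumes F: "integrable lborel F" and v: "v1 \<in> borel_measurable borel" "\<And>x. \<bar>v1 x\<bar> \<le> M" "v2 \<in> borel_measurable borel" "\<And>x. \<bar>v2 x\<bar> \<le> M"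
    and e: "\<And>k. 0 < e k" "e \<longlonglongrightarrow> 0"
  shows "(\<lambda>k. LINT y|lborel. F y * (conv v1 (molr (e k)) y * conv v2 (molr (e k)) y)) \<longlonglongrightarrow> (LINT y|lborel. F y * (v1 y * v2 y))"
proof -
  note [measurable] = v(1,3) borel_measurable_integrable[OF F, simplified] csmooth_borel[OF csmooth_molr[OF e(1)]]
  have M0: "0 \<le> M" using v(2)[of 0] by linarith
  let ?w1 = "\<lambda>k. conv v1 (molr (e k))" and ?w2 = "\<lambda>k. conv v2 (molr (e k))"
  have b: "\<bar>?w1 k y\<bar> \<le> M" "\<bar>?w2 k y\<bar> \<le> M" for k y
    by (rule conv_molr_bound[OF e(1) v(1,2)] conv_molr_bound[OF e(1) v(3,4)])+
  have F1: "integrable lborel (\<lambda>y. F y * v1 y)" by (rule integrable_mult_bounded[OF F v(1,2)])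
  have l1: "(\<lambda>k. LINT y|lborel. (F y * v1 y) * ?w2 k y) \<longlonglongrightarrow> (LINT y|lborel. (F y * v1 y) * v2 y)"
    by (rule weighted_integral_conv_molr[OF F1 v(3,4) e])
  have i1: "integrable lborel (\<lambda>y. F y * (?w1 k y * ?w2 k y))" for k
    by (rule integrable_mult_bounded[OF F, where C = "M * M"])
      (auto simp: abs_mult intro!: mult_mono b M0)
  have i2: "integrable lborel (\<lambda>y. (F y * v1 y) * ?w2 k y)" for k
    by (rule integrable_mult_bounded[OF F1 _ b(2)]) measurable
  have "(\<lambda>k. ennreal M * (NNINT y. ennreal (norm (F y) * \<bar>?w1 k y - v1 y\<bar>))) \<longlonglongrightarrow> ennreal M * 0"
    by (intro ennreal_tendsto_cmult weighted_conv_molr[OF F v(1,2) e]) auto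
  then have "(\<lambda>k. ennreal M * (NNINT y. ennreal (norm (F y) * \<bar>?w1 k y - v1 y\<bar>))) \<longlonglongrightarrow> 0" by simp
  then have "(\<lambda>k. ennreal (norm ((LINT y|lborel. F y * (?w1 k y * ?w2 k y)) - (LINT y|lborel. (F y * v1 y) * ?w2 k y)))) \<longlonglongrightarrow> 0"
  proof (rule tendsto_ennreal_0_le)
    fix k
    have "ennreal (norm ((LINT y|lborel. F y * (?w1 k y * ?w2 k y)) - (LINT y|lborel. (F y * v1 y) * ?w2 k y)))
      \<le> (NNINT y. ennreal (norm (F y * (?w1 k y * ?w2 k y) - (F y * v1 y) * ?w2 k y)))"
      unfolding LINT_diff[OF i1 i2, symmetric]
      by (rule integral_norm_bound_ennreal[OF L1_diff[OF i1 i2]])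
    also have "\<dots> \<le> (NNINT y. ennreal M * ennreal (norm (F y) * \<bar>?w1 k y - v1 y\<bar>))"
    proof (intro nn_integral_mono)
      fix y
      have "norm (F y * (?w1 k y * ?w2 k y) - (F y * v1 y) * ?w2 k y) = \<bar>?w2 k y\<bar> * (norm (F y) * \<bar>?w1 k y - v1 y\<bar>)"
        by (simp add: abs_mult[symmetric] algebra_simps)
      also have "\<dots> \<le> M * (norm (F y) * \<bar>?w1 k y - v1 y\<bar>)" by (intro mult_right_mono b) auto
      finally show "ennreal (norm (F y * (?w1 k y * ?w2 k y) - (F y * v1 y) * ?w2 k y)) \<le> ennreal M * ennreal (norm (F y) * \<bar>?w1 k y - v1 y\<bar>)"
        using M0 by (simp add: ennreal_leI flip: ennreal_mult)
    qed
    also have "\<dots> = ennreal M * (NNINT y. ennreal (norm (F y) * \<bar>?w1 k y - v1 y\<bar>))"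
      by (rule nn_integral_cmult) measurable
    finally show "ennreal (norm ((LINT y|lborel. F y * (?w1 k y * ?w2 k y)) - (LINT y|lborel. (F y * v1 y) * ?w2 k y))) \<le> \<dots>" .
  qed
  then have "(\<lambda>k. norm ((LINT y|lborel. F y * (?w1 k y * ?w2 k y)) - (LINT y|lborel. (F y * v1 y) * ?w2 k y))) \<longlonglongrightarrow> 0"
    by (simp add: tendsto_ennreal_iff[of _ _ 0, simplified] flip: ennreal_0)
  then have "(\<lambda>k. (LINT y|lborel. F y * (?w1 k y * ?w2 k y)) - (LINT y|lborel. (F y * v1 y) * ?w2 k y)) \<longlonglongrightarrow> 0"
    by (rule tendsto_norm_zero_cancel)
  from tendsto_add[OF this l1] show ?thesis by (simp add: mult.assoc)
qed

text \<open>The constants are explicit so that one estimate serves a fixed test function and all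
  translates of a mollifier kernel, whose bounds do not depend on the centre.\<close>

lemma flux_bound_aux:
  fixes \<phi> :: "real^'n \<Rightarrow> real"
  assumes C1: "\<And>x. \<bar>\<phi> x\<bar> \<le> C1" and C2: "\<And>x v. \<bar>fd \<phi> x v\<bar> \<le> C2 * norm v"
    and r: "\<And>x. r < norm x \<Longrightarrow> \<phi> x = 0" "\<And>x v. r < norm x \<Longrightarrow> fd \<phi> x v = 0"
    and C: "real CARD('n) * C1 \<le> C" "C2 \<le> C" "0 \<le> C"
    and J: "jac b G" and M: "\<And>x. \<bar>v x\<bar> \<le> M"
  shows "ennreal \<bar>flux b G \<phi> v\<bar> \<le> ennreal (C * M) * (NNINT y. indicator (cball 0 r) y * ennreal (norm (b y) + norm (G y)))"
proof (cases "integrable lborel (\<lambda>x. (fd \<phi> x (b x) + trace (G x) * \<phi> x) * v x)")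
  case True
  have [measurable]: "b \<in> borel_measurable borel" "G \<in> borel_measurable borel"
    using J by (auto simp: jac_def locint_def)
  have M0: "0 \<le> M" using M[of 0] by linarith
  have "ennreal \<bar>flux b G \<phi> v\<bar> \<le> (NNINT x. ennreal (norm ((fd \<phi> x (b x) + trace (G x) * \<phi> x) * v x)))"
    unfolding flux_def using integral_norm_bound_ennreal[OF True] by simp
  also have "\<dots> \<le> (NNINT x. ennreal (C * M) * (indicator (cball 0 r) x * ennreal (norm (b x) + norm (G x))))"
  proof (rule nn_integral_mono)
    fix x
    show "ennreal (norm ((fd \<phi> x (b x) + trace (G x) * \<phi> x) * v x)) \<le> ennreal (C * M) * (indicator (cball 0 r) x * ennreal (norm (b x) + norm (G x)))"
    proof (cases "norm x \<le> r")
      case True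
      have "\<bar>trace (G x)\<bar> * \<bar>\<phi> x\<bar> \<le> real CARD('n) * norm (G x) * C1"
        by (intro mult_mono trace_le C1) auto
      also have "\<dots> = real CARD('n) * C1 * norm (G x)" by simp
      also have "\<dots> \<le> C * norm (G x)" by (intro mult_right_mono C) auto
      finally have "\<bar>trace (G x) * \<phi> x\<bar> \<le> C * norm (G x)" by (simp add: abs_mult)
      moreover have "\<bar>fd \<phi> x (b x)\<bar> \<le> C * norm (b x)" by (rule order_trans[OF C2]) (intro mult_right_mono C, auto)
      ultimately have "\<bar>fd \<phi> x (b x) + trace (G x) * \<phi> x\<bar> \<le> C * (norm (b x) + norm (G x))"
        unfolding distrib_left by linarith
      then have "\<bar>fd \<phi> x (b x) + trace (G x) * \<phi> x\<bar> * \<bar>v x\<bar> \<le> C * (norm (b x) + norm (G x)) * M"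
        by (intro mult_mono M) (use C in auto)
      then have "norm ((fd \<phi> x (b x) + trace (G x) * \<phi> x) * v x) \<le> (C * M) * (norm (b x) + norm (G x))"
        by (simp add: abs_mult mult_ac)
      then have "ennreal (norm ((fd \<phi> x (b x) + trace (G x) * \<phi> x) * v x)) \<le> ennreal (C * M) * ennreal (norm (b x) + norm (G x))"
        using C M0 by (subst ennreal_mult[symmetric]) (auto intro: ennreal_leI)
      then show ?thesis using True by simp
    qed (simp add: r)
  qed
  also have "\<dots> = ennreal (C * M) * (NNINT x. indicator (cball 0 r) x * ennreal (norm (b x) + norm (G x)))"
    by (rule nn_integral_cmult) measurable
  finally show ?thesis .
qed (simp add: flux_def not_integrable_integral_eq)

lemma flux_bound:
  fixes \<phi> :: "real^'n \<Rightarrow> real"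
  assumes \<phi>: "csmooth \<phi>"
  shows "\<exists>C>0. \<exists>r>0. \<forall>b G v M. jac b G \<longrightarrow> (\<forall>x. \<bar>v x\<bar> \<le> M) \<longrightarrow> ennreal \<bar>flux b G \<phi> v\<bar>
        \<le> ennreal (C * M) * (NNINT y. indicator (cball 0 r) y * ennreal (norm (b y) + norm (G y)))"
proof -
  obtain C1 where C1: "0 < C1" "\<And>x. \<bar>\<phi> x\<bar> \<le> C1" using csmooth_bounded[OF \<phi>] by metis
  obtain C2 where C2: "0 < C2" "\<And>x v. \<bar>fd \<phi> x v\<bar> \<le> C2 * norm v" using csmooth_deriv_bounded[OF \<phi>] by metis
  obtain r where r: "0 < r" "\<And>x. r \<le> norm x \<Longrightarrow> \<phi> x = 0" using csmooth_support[OF \<phi>] by metis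
  define C where "C = C2 + real CARD('n) * C1"
  have C: "0 < C" "C2 \<le> C" "real CARD('n) * C1 \<le> C" using C1 C2 by (auto simp: C_def add_pos_nonneg)
  have "ennreal \<bar>flux b G \<phi> v\<bar> \<le> ennreal (C * M) * (NNINT y. indicator (cball 0 r) y * ennreal (norm (b y) + norm (G y)))"
    if "jac b G" "\<forall>x. \<bar>v x\<bar> \<le> M" for b G v and M :: real
    by (rule flux_bound_aux[OF C1(2) C2(2) _ _ C(3,2) _ that(1)])
      (use r C that csmooth_fd_zero[of r \<phi>] in auto)
  then show ?thesis using C(1) r(1) by blast
qed

text \<open>C may grow as e shrinks; the bound justifies Fubini at a fixed scale. The radius r + 1
  contains every kernel centred in the ball of radius r.\<close>

lemma flux_molr_bound:
  assumes e: "0 < e" "e \<le> 1"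
  shows "\<exists>C>0. \<forall>(b :: real^'n \<Rightarrow> real^'n) G v M r y. jac b G \<longrightarrow> (\<forall>x. \<bar>v x\<bar> \<le> M) \<longrightarrow> norm y \<le> r \<longrightarrow>
     ennreal \<bar>flux b G (\<lambda>x. molr e (y - x)) v\<bar>
        \<le> ennreal (C * M) * (NNINT y. indicator (cball 0 (r + 1)) y * ennreal (norm (b y) + norm (G y)))"
proof -
  let ?K = "molr e :: real^'n \<Rightarrow> real"
  have K: "csmooth ?K" by (rule csmooth_molr[OF e(1)])
  obtain C1 where C1: "0 < C1" "\<And>x. \<bar>?K x\<bar> \<le> C1" using csmooth_bounded[OF K] by metis
  obtain C2 where C2: "0 < C2" "\<And>x v. \<bar>fd ?K x v\<bar> \<le> C2 * norm v" using csmooth_deriv_bounded[OF K] by metis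
  define C where "C = C2 + real CARD('n) * C1"
  have C: "0 < C" "C2 \<le> C" "real CARD('n) * C1 \<le> C" using C1 C2 by (auto simp: C_def add_pos_nonneg)
  have fdK: "fd (\<lambda>x. ?K (y - x)) x h = - fd ?K (y - x) h" for y x h
    using fd_affine[OF csmooth_smooth[OF K], of y "-1"] by simp
  have far: "e < norm (y - x)" if "norm y \<le> r" "r + 1 < norm x" for x y :: "real^'n" and r
    using that e norm_triangle_ineq3[of x y] by (simp add: norm_minus_commute)
  have "ennreal \<bar>flux b G (\<lambda>x. molr e (y - x)) v\<bar> \<le> ennreal (C * M) * (NNINT y. indicator (cball 0 (r + 1)) y * ennreal (norm (b y) + norm (G y)))"
    if "jac b G" "\<forall>x. \<bar>v x\<bar> \<le> M" "norm y \<le> r" for b :: "real^'n \<Rightarrow> real^'n" and G v and M :: real and y r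
  proof (rule flux_bound_aux[OF _ _ _ _ C(3,2) _ that(1)])
    show "fd (\<lambda>x. ?K (y - x)) x h = 0" if "r + 1 < norm x" for x h
      using csmooth_fd_zero[of e ?K "y - x" h, OF molr_zero[OF e(1)] far[OF \<open>norm y \<le> r\<close> that]] by (simp add: fdK)
    show "?K (y - x) = 0" if "r + 1 < norm x" for x
      using molr_zero[OF e(1) less_imp_le[OF far[OF \<open>norm y \<le> r\<close> that]]] .
  qed (use C C1 C2 that in \<open>auto simp: fdK\<close>)
  then show ?thesis using C(1) by blast
qed

lemma commutator_term_bound:
  fixes b :: "real^'n \<Rightarrow> real^'n"
  assumes J: "jac b G" and v: "v1 \<in> borel_measurable borel" "\<And>x. \<bar>v1 x\<bar> \<le> M" "v2 \<in> borel_measurable borel" "\<And>x. \<bar>v2 x\<bar> \<le> M"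
    and \<phi>: "csmooth \<phi>" and e: "0 < e" "e \<le> 1" and C: "\<And>x. \<bar>\<phi> x\<bar> \<le> C" and r: "\<And>x. r \<le> norm x \<Longrightarrow> \<phi> x = 0"
  shows "ennreal \<bar>\<integral>y. \<phi> y * (commutator e b G v1 y * conv v2 (molr e) y + conv v1 (molr e) y * commutator e b G v2 y) \<partial>lborel\<bar>
    \<le> ennreal (C * M) * ((NNINT y. indicator (cball 0 r) y * ennreal \<bar>commutator e b G v1 y\<bar>)
        + (NNINT y. indicator (cball 0 r) y * ennreal \<bar>commutator e b G v2 y\<bar>))"
proof -
  have lb: "locint b" and lG: "locint G" using J by (auto simp: jac_def)
  have M0: "0 \<le> M" using v(2)[of 0] by linarith
  have C0: "0 \<le> C" using C[of 0] by linarith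
  define c1 where "c1 = commutator e b G v1"
  define c2 where "c2 = commutator e b G v2"
  have [measurable]: "c1 \<in> borel_measurable borel" "c2 \<in> borel_measurable borel" unfolding c1_def c2_def
    by (rule borel_commutator[OF e(1) locint_borel[OF lb] locint_borel[OF lG] v(1,2)]
      borel_commutator[OF e(1) locint_borel[OF lb] locint_borel[OF lG] v(3,4)])+
  let ?w1 = "conv v1 (molr e)" and ?w2 = "conv v2 (molr e)"
  have "ennreal \<bar>\<integral>y. \<phi> y * (c1 y * ?w2 y + ?w1 y * c2 y) \<partial>lborel\<bar> \<le> (NNINT y. ennreal (norm (\<phi> y * (c1 y * ?w2 y + ?w1 y * c2 y))))"
    using integral_norm_bound_ennreal[OF flux_prod_eq(3)[OF J v \<phi> e]] by (simp add: c1_def c2_def)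
  also have "\<dots> \<le> (NNINT y. ennreal (C * M) * (indicator (cball 0 r) y * ennreal \<bar>c1 y\<bar> + indicator (cball 0 r) y * ennreal \<bar>c2 y\<bar>))"
  proof (rule nn_integral_mono)
    fix y
    show "ennreal (norm (\<phi> y * (c1 y * ?w2 y + ?w1 y * c2 y))) \<le> ennreal (C * M) * (indicator (cball 0 r) y * ennreal \<bar>c1 y\<bar> + indicator (cball 0 r) y * ennreal \<bar>c2 y\<bar>)"
    proof (cases "norm y \<le> r")
      case True
      have "\<bar>c1 y * ?w2 y + ?w1 y * c2 y\<bar> \<le> \<bar>c1 y\<bar> * M + M * \<bar>c2 y\<bar>"
        by (intro order_trans[OF abs_triangle_ineq] add_mono)
          (auto simp: abs_mult intro!: mult_mono conv_molr_bound[OF e(1) v(1,2)] conv_molr_bound[OF e(1) v(3,4)] M0)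
      then have "norm (\<phi> y * (c1 y * ?w2 y + ?w1 y * c2 y)) \<le> C * (\<bar>c1 y\<bar> * M + M * \<bar>c2 y\<bar>)"
        unfolding real_norm_def abs_mult[of "\<phi> y"] by (intro mult_mono C) (auto simp: C0)
      also have "\<dots> = (C * M) * (\<bar>c1 y\<bar> + \<bar>c2 y\<bar>)" by (simp add: algebra_simps)
      finally have "ennreal (norm (\<phi> y * (c1 y * ?w2 y + ?w1 y * c2 y))) \<le> ennreal (C * M) * (ennreal \<bar>c1 y\<bar> + ennreal \<bar>c2 y\<bar>)"
        using C0 M0 by (subst ennreal_plus[symmetric], simp, simp, subst ennreal_mult[symmetric]) (auto intro: ennreal_leI)
      then show ?thesis using True by simp
    qed (simp add: r)
  qed
  also have "\<dots> = ennreal (C * M) * ((NNINT y. indicator (cball 0 r) y * ennreal \<bar>c1 y\<bar>) + (NNINT y. indicator (cball 0 r) y * ennreal \<bar>c2 y\<bar>))"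
    by (subst nn_integral_cmult, measurable, subst nn_integral_add, measurable)
  finally show ?thesis unfolding c1_def c2_def .
qed

text \<open>In \<open>flux_prod_eq\<close> the commutator part vanishes and the flux of the
  mollified product converges by \<open>weighted_conv_prod\<close>.\<close>

lemma flux_prod_limit:
  fixes b :: "real^'n \<Rightarrow> real^'n"
  assumes J: "jac b G" and v: "v1 \<in> borel_measurable borel" "\<And>x. \<bar>v1 x\<bar> \<le> M" "v2 \<in> borel_measurable borel" "\<And>x. \<bar>v2 x\<bar> \<le> M"
    and \<phi>: "csmooth \<phi>" and e: "\<And>k. 0 < e k" "\<And>k. e k \<le> 1" "e \<longlonglongrightarrow> 0"
  shows "(\<lambda>k. LINT y|lborel. \<phi> y * flux_prod (e k) b G v1 v2 y) \<longlonglongrightarrow> flux b G \<phi> (\<lambda>y. v1 y * v2 y)"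
proof -
  obtain C where C: "\<And>x. \<bar>\<phi> x\<bar> \<le> C" using csmooth_bounded[OF \<phi>] by metis
  obtain r where r: "\<And>x. r \<le> norm x \<Longrightarrow> \<phi> x = 0" using csmooth_support[OF \<phi>] by metis
  let ?t = "\<lambda>k. LINT y|lborel. \<phi> y * (commutator (e k) b G v1 y * conv v2 (molr (e k)) y + conv v1 (molr (e k)) y * commutator (e k) b G v2 y)"
  have lim: "\<And>(b::real^'n\<Rightarrow>real^'n) G v M r e. jac b G \<Longrightarrow> v \<in> borel_measurable borel \<Longrightarrow> \<forall>x. \<bar>v x\<bar> \<le> M \<Longrightarrow>
     \<forall>k. 0 < e k \<Longrightarrow> \<forall>k. e k \<le> 1 \<Longrightarrow> e \<longlonglongrightarrow> 0 \<Longrightarrow>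
      (\<lambda>k. NNINT y. indicator (cball 0 r) y * ennreal \<bar>commutator (e k) b G v y\<bar>) \<longlonglongrightarrow> 0"
    using commutator_L1_bound[where 'n='n] by blast
  have cl: "(\<lambda>k. NNINT y. indicator (cball 0 r) y * ennreal \<bar>commutator (e k) b G v y\<bar>) \<longlonglongrightarrow> 0"
    if "v \<in> borel_measurable borel" "\<And>x. \<bar>v x\<bar> \<le> M" for v
    by (rule lim[OF J that(1)]) (use that e in auto)
  have "(\<lambda>k. ennreal (C * M) * ((NNINT y. indicator (cball 0 r) y * ennreal \<bar>commutator (e k) b G v1 y\<bar>)
        + (NNINT y. indicator (cball 0 r) y * ennreal \<bar>commutator (e k) b G v2 y\<bar>))) \<longlonglongrightarrow> ennreal (C * M) * (0 + 0)"
    by (intro ennreal_tendsto_cmult tendsto_add cl v) auto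
  then have "(\<lambda>k. ennreal (C * M) * ((NNINT y. indicator (cball 0 r) y * ennreal \<bar>commutator (e k) b G v1 y\<bar>)
        + (NNINT y. indicator (cball 0 r) y * ennreal \<bar>commutator (e k) b G v2 y\<bar>))) \<longlonglongrightarrow> 0" by simp
  then have "(\<lambda>k. ennreal \<bar>?t k\<bar>) \<longlonglongrightarrow> 0"
    by (rule tendsto_ennreal_0_le) (rule commutator_term_bound[OF J v \<phi> e(1,2) C r])
  then have "(\<lambda>k. \<bar>?t k\<bar>) \<longlonglongrightarrow> 0" by (simp add: tendsto_ennreal_iff[of _ _ 0, simplified] flip: ennreal_0)
  then have t: "?t \<longlonglongrightarrow> 0" by (simp only: tendsto_rabs_zero_iff)
  have "integrable lborel (\<lambda>x. fd \<phi> x (b x) + trace (G x) * \<phi> x)"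
    by (intro L1_add jac_divergence[OF J \<phi>])
  from tendsto_add[OF t weighted_conv_prod[OF this v e(1,3)]]
  show ?thesis unfolding flux_prod_eq(1)[OF J v \<phi> e(1,2)] flux_def by simp
qed

text \<open>Here the constants are uniform in e, in contrast to a direct estimate of
  \<open>flux_prod\<close>, which would carry a factor 1/e. This is the majorant in time needed for
  the limit of vanishing scale.\<close>

lemma flux_prod_bound:
  fixes \<phi> :: "real^'n \<Rightarrow> real"
  assumes \<phi>: "csmooth \<phi>"
  shows "\<exists>C>0. \<exists>r>0. \<forall>b G v1 v2 M e. jac b G \<longrightarrow> v1 \<in> borel_measurable borel \<longrightarrow> (\<forall>x. \<bar>v1 x\<bar> \<le> M) \<longrightarrow>
     v2 \<in> borel_measurable borel \<longrightarrow> (\<forall>x. \<bar>v2 x\<bar> \<le> M) \<longrightarrow> 0 < e \<longrightarrow> e \<le> 1 \<longrightarrow>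
     ennreal \<bar>\<integral>y. \<phi> y * flux_prod e b G v1 v2 y \<partial>lborel\<bar>
        \<le> ennreal (C * (M * M)) * (NNINT y. indicator (cball 0 r) y * ennreal (norm (b y) + norm (G y)))"
proof -
  obtain C1 where C1: "0 < C1" "\<And>x. \<bar>\<phi> x\<bar> \<le> C1" using csmooth_bounded[OF \<phi>] by metis
  obtain r1 where r1: "0 < r1" "\<And>x. r1 \<le> norm x \<Longrightarrow> \<phi> x = 0" using csmooth_support[OF \<phi>] by metis
  obtain C2 r2 where C2: "0 < C2" "0 < r2" and fb: "\<And>b G v M. jac b G \<Longrightarrow> \<forall>x. \<bar>v x\<bar> \<le> M \<Longrightarrow> ennreal \<bar>flux b G \<phi> v\<bar>
        \<le> ennreal (C2 * M) * (NNINT y. indicator (cball 0 r2) y * ennreal (norm (b y) + norm (G y)))"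
    using flux_bound[OF \<phi>] by blast
  obtain K where K: "0 < K" and kb: "\<And>(b::real^'n\<Rightarrow>real^'n) G v M r e. jac b G \<Longrightarrow> v \<in> borel_measurable borel \<Longrightarrow> \<forall>x. \<bar>v x\<bar> \<le> M \<Longrightarrow>
     0 < e \<Longrightarrow> e \<le> 1 \<Longrightarrow> (NNINT y. indicator (cball 0 r) y * ennreal \<bar>commutator e b G v y\<bar>)
        \<le> ennreal (K * M) * (NNINT y. indicator (cball 0 (r + 1)) y * ennreal (norm (G y)))"
    using commutator_L1_bound[where 'n='n] by blast
  define r where "r = max (r1 + 1) r2"
  define C where "C = 2 * C1 * K + C2"
  show ?thesis
  proof (rule exI[of _ C], intro conjI exI[of _ r] allI impI)
    show "0 < C" using C1 K C2 by (simp add: C_def add_pos_pos)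
    show "0 < r" using C2 by (simp add: r_def)
    fix b :: "real^'n \<Rightarrow> real^'n" and G :: "real^'n \<Rightarrow> real^'n^'n" and v1 v2 :: "real^'n \<Rightarrow> real" and M e :: real
    assume J: "jac b G" and v1: "v1 \<in> borel_measurable borel" and v1M: "\<forall>x. \<bar>v1 x\<bar> \<le> M"
      and v2: "v2 \<in> borel_measurable borel" and v2M: "\<forall>x. \<bar>v2 x\<bar> \<le> M" and e: "0 < e" "e \<le> 1"
    note v = v1 v1M[rule_format] v2 v2M[rule_format]
    have M0: "0 \<le> M" using v(2)[of 0] by linarith
    let ?I = "NNINT y. indicator (cball 0 r) y * ennreal (norm (b y) + norm (G y))"
    let ?w1 = "conv v1 (molr e)" and ?w2 = "conv v2 (molr e)"
    let ?t = "LINT y|lborel. \<phi> y * (commutator e b G v1 y * ?w2 y + ?w1 y * commutator e b G v2 y)"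
    have I1: "(NNINT y. indicator (cball 0 (r1 + 1)) y * ennreal (norm (G y))) \<le> ?I"
      by (intro nn_integral_mono mult_mono ennreal_leI) (auto simp: indicator_def r_def)
    have I2: "(NNINT y. indicator (cball 0 r2) y * ennreal (norm (b y) + norm (G y))) \<le> ?I"
      by (intro nn_integral_mono mult_mono ennreal_leI) (auto simp: indicator_def r_def)
    have cI: "(NNINT y. indicator (cball 0 r1) y * ennreal \<bar>commutator e b G v y\<bar>) \<le> ennreal (K * M) * ?I"
      if "v \<in> borel_measurable borel" "\<forall>x. \<bar>v x\<bar> \<le> M" for v
      by (rule order_trans[OF kb[OF J that e] mult_left_mono[OF I1]]) simp
    have "ennreal \<bar>?t\<bar> \<le> ennreal (C1 * M) * (ennreal (K * M) * ?I + ennreal (K * M) * ?I)"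
      by (rule order_trans[OF commutator_term_bound[where r = r1, OF J v \<phi> e C1(2) r1(2)]])
        (assumption, rule mult_left_mono[OF add_mono[OF cI[OF v1 v1M] cI[OF v2 v2M]]], simp)
    also have "\<dots> = ennreal (2 * C1 * K * (M * M)) * ?I"
      using C1 K M0 by (simp add: ennreal_mult mult_ac flip: mult_2)
    finally have 1: "ennreal \<bar>?t\<bar> \<le> ennreal (2 * C1 * K * (M * M)) * ?I" .
    have "\<forall>y. \<bar>?w1 y * ?w2 y\<bar> \<le> M * M"
      by (auto simp: abs_mult intro!: mult_mono conv_molr_bound[OF e(1) v(1,2)] conv_molr_bound[OF e(1) v(3,4)] M0)
    from fb[OF J this] have 2: "ennreal \<bar>flux b G \<phi> (\<lambda>y. ?w1 y * ?w2 y)\<bar> \<le> ennreal (C2 * (M * M)) * ?I"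
      by (rule order_trans) (intro mult_left_mono I2, simp)
    have "ennreal \<bar>?t + flux b G \<phi> (\<lambda>y. ?w1 y * ?w2 y)\<bar> \<le> ennreal \<bar>?t\<bar> + ennreal \<bar>flux b G \<phi> (\<lambda>y. ?w1 y * ?w2 y)\<bar>"
      by (simp add: ennreal_leI flip: ennreal_plus)
    also have "\<dots> \<le> ennreal (2 * C1 * K * (M * M)) * ?I + ennreal (C2 * (M * M)) * ?I" by (rule add_mono[OF 1 2])
    also have "\<dots> = ennreal (C * (M * M)) * ?I"
      using C1 C2 K M0 by (simp add: C_def distrib_right flip: distrib_right ennreal_plus)
    finally show "ennreal \<bar>\<integral>y. \<phi> y * flux_prod e b G v1 v2 y \<partial>lborel\<bar> \<le> ennreal (C * (M * M)) * ?I"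
      unfolding flux_prod_eq(1)[OF J v \<phi> e] .
  qed
qed

subsection \<open>Absolutely continuous functions of time\<close>

text \<open>Primitives stand in for absolutely continuous functions: product rule, powers and
  Gronwall become statements about integrable densities, proved by Fubini instead of
  differentiation.\<close>

definition prim :: "(real \<Rightarrow> real) \<Rightarrow> real \<Rightarrow> real" where
  "prim g t = (LINT s|lborel. (if 0 \<le> s \<and> s \<le> t then g s else 0))"

lemma borel_prim[measurable]:
  assumes [measurable]: "case_prod g \<in> borel_measurable (M \<Otimes>\<^sub>M borel)" "f \<in> borel_measurable M"
  shows "(\<lambda>w. prim (g w) (f w)) \<in> borel_measurable M"
  unfolding prim_def by measurable

lemma prim_integrable:
  fixes g :: "real \<Rightarrow> real"
  assumes g: "integrable lborel g"
  shows "integrable lborel (\<lambda>s. if 0 \<le> s \<and> s \<le> t then g s else 0)"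
  by (rule L1_bound[OF g])
    (use borel_measurable_integrable[OF g] in auto)

lemma prim_cong_AE:
  assumes "f \<in> borel_measurable borel" "g \<in> borel_measurable borel" "AE s in lborel. f s = g s"
  shows "prim f t = prim g t"
  unfolding prim_def by (rule integral_cong_AE) (use assms in auto)

lemma prim_add: "integrable lborel f \<Longrightarrow> integrable lborel g \<Longrightarrow> prim (\<lambda>s. f s + g s) t = prim f t + prim g t"
  unfolding prim_def
  by (subst LINT_add[symmetric])
    (auto intro!: prim_integrable LINT_cong)

lemma prim_cmult: "prim (\<lambda>s. c * f s) t = c * prim f t"
  unfolding prim_def by (subst integral_mult_right_zero[symmetric], rule LINT_cong) auto

lemma prim_abs_le:
  assumes g: "integrable lborel g"
  shows "\<bar>prim g t\<bar> \<le> (LINT s|lborel. \<bar>g s\<bar>)"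
proof -
  have "\<bar>prim g t\<bar> \<le> (LINT s|lborel. \<bar>if 0 \<le> s \<and> s \<le> t then g s else 0\<bar>)"
    unfolding prim_def using integral_norm_bound[of lborel "\<lambda>s. if 0 \<le> s \<and> s \<le> t then g s else 0"] by simp
  also have "\<dots> \<le> (LINT s|lborel. \<bar>g s\<bar>)"
    by (rule integral_mono[OF integrable_abs[OF prim_integrable[OF g]] integrable_abs[OF g]]) auto
  finally show ?thesis .
qed

lemma prim_mono:
  assumes f: "integrable lborel f" and g: "integrable lborel g" and le: "\<And>s. 0 \<le> s \<Longrightarrow> s \<le> t \<Longrightarrow> f s \<le> g s"
  shows "prim f t \<le> prim g t"
  unfolding prim_def by (rule integral_mono[OF prim_integrable[OF f] prim_integrable[OF g]]) (use le in auto)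

lemma prim_dominated_convergence:
  assumes "\<And>k. f k \<in> borel_measurable borel" "g \<in> borel_measurable borel" and w: "integrable lborel w"
    and "AE s in lborel. (\<lambda>k. f k s) \<longlonglongrightarrow> g s" "\<And>k. AE s in lborel. \<bar>f k s\<bar> \<le> w s"
  shows "(\<lambda>k. prim (f k) t) \<longlonglongrightarrow> prim g t"
  unfolding prim_def
proof (rule integral_dominated_convergence[OF _ _ w])
  show "(\<lambda>s. if 0 \<le> s \<and> s \<le> t then g s else 0) \<in> borel_measurable lborel"
    and "\<And>k. (\<lambda>s. if 0 \<le> s \<and> s \<le> t then f k s else 0) \<in> borel_measurable lborel"
    using assms(1,2) by measurable
  show "AE s in lborel. (\<lambda>k. if 0 \<le> s \<and> s \<le> t then f k s else 0) \<longlonglongrightarrow> (if 0 \<le> s \<and> s \<le> t then g s else 0)"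
    using assms(4) by eventually_elim auto
  show "AE s in lborel. norm (if 0 \<le> s \<and> s \<le> t then f k s else 0) \<le> w s" for k
    using assms(5)[of k] by eventually_elim auto
qed

lemma prim_continuous:
  assumes g: "integrable lborel g" and lim: "t \<longlonglongrightarrow> t0"
  shows "(\<lambda>k. prim g (t k)) \<longlonglongrightarrow> prim g t0"
  unfolding prim_def
proof (rule integral_dominated_convergence[where w = "\<lambda>s. \<bar>g s\<bar>"])
  note [measurable] = borel_measurable_integrable[OF g, simplified]
  show "(\<lambda>s. if 0 \<le> s \<and> s \<le> t0 then g s else 0) \<in> borel_measurable lborel"
    and "\<And>k. (\<lambda>s. if 0 \<le> s \<and> s \<le> t k then g s else 0) \<in> borel_measurable lborel" by measurable
  have "AE s in lborel. s \<noteq> t0" by (rule AE_lborel_singleton)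
  then show "AE s in lborel. (\<lambda>k. if 0 \<le> s \<and> s \<le> t k then g s else 0) \<longlonglongrightarrow> (if 0 \<le> s \<and> s \<le> t0 then g s else 0)"
  proof eventually_elim
    case (elim s)
    then consider "s < t0" | "t0 < s" by linarith
    then show ?case
    proof cases
      case 1
      then have "\<forall>\<^sub>F k in sequentially. s < t k" using lim order_tendstoD(1) by blast
      then show ?thesis by (intro tendsto_eventually, elim eventually_mono) (use 1 in auto)
    next
      case 2
      then have "\<forall>\<^sub>F k in sequentially. t k < s" using lim order_tendstoD(2) by blast
      then show ?thesis by (intro tendsto_eventually, elim eventually_mono) (use 2 in auto)
    qed
  qed
qed (use g in auto)

lemma prim_mult_integrable:
  assumes f: "integrable lborel f" and g: "integrable lborel g"
  shows "integrable lborel (\<lambda>s. f s * (c + prim g s))"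
proof (rule integrable_mult_bounded[OF f])
  note [measurable] = borel_measurable_integrable[OF g, simplified]
  show "(\<lambda>s. c + prim g s) \<in> borel_measurable borel" by measurable
  show "\<bar>c + prim g s\<bar> \<le> \<bar>c\<bar> + (LINT s|lborel. \<bar>g s\<bar>)" for s using prim_abs_le[OF g, of s] by linarith
qed

text \<open>Integration by parts for absolutely continuous functions: split the square
  \<open>[0, t] \<times> [0, t]\<close> along its diagonal.\<close>

lemma prim_product:
  assumes f: "integrable lborel f" and g: "integrable lborel g"
  shows "(c + prim f t) * (d + prim g t) = c * d + prim (\<lambda>s. f s * (d + prim g s) + (c + prim f s) * g s) t"
proof -
  note [measurable] = borel_measurable_integrable[OF g, simplified] borel_measurable_integrable[OF f, simplified]
  let ?f = "\<lambda>s. if 0 \<le> s \<and> s \<le> t then f s else 0" and ?g = "\<lambda>s. if 0 \<le> s \<and> s \<le> t then g s else 0"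
  have fin: "(NNINT s. ennreal \<bar>h s\<bar>) < \<infinity>" if "integrable lborel h" for h :: "real \<Rightarrow> real"
    using that unfolding integrable_iff_bounded by simp
  define A where "A s r = (if r \<le> s then ?f s * ?g r else 0)" for s r
  define B where "B s r = (if s < r then ?f s * ?g r else 0)" for s r
  have fA: "(NNINT s. NNINT r. ennreal \<bar>H s r\<bar>) < \<infinity>" if H: "\<And>s r. \<bar>H s r\<bar> \<le> \<bar>f s\<bar> * \<bar>g r\<bar>" for H
  proof -
    have "(NNINT s. NNINT r. ennreal \<bar>H s r\<bar>) \<le> (NNINT s. NNINT r. ennreal \<bar>f s\<bar> * ennreal \<bar>g r\<bar>)"
      using H by (intro nn_integral_mono) (simp add: ennreal_leI flip: ennreal_mult)
    also have "\<dots> = (NNINT s. ennreal \<bar>f s\<bar>) * (NNINT r. ennreal \<bar>g r\<bar>)"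
      by (simp add: nn_integral_cmult nn_integral_multc)
    also have "\<dots> < \<infinity>" using fin[OF f] fin[OF g] by (simp add: ennreal_mult_less_top)
    finally show ?thesis .
  qed
  have mA: "(\<lambda>(s, r). A s r) \<in> borel_measurable (borel \<Otimes>\<^sub>M borel)" unfolding A_def by measurable
  have mB: "(\<lambda>(s, r). B s r) \<in> borel_measurable (borel \<Otimes>\<^sub>M borel)" unfolding B_def by measurable
  have FA: "(NNINT s. NNINT r. ennreal \<bar>A s r\<bar>) < \<infinity>" by (rule fA) (auto simp: A_def abs_mult)
  have FB: "(NNINT s. NNINT r. ennreal \<bar>B s r\<bar>) < \<infinity>" by (rule fA) (auto simp: B_def abs_mult)
  have intA: "(LINT r|lborel. A s r) = (if 0 \<le> s \<and> s \<le> t then f s * prim g s else 0)" for s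
  proof (cases "0 \<le> s \<and> s \<le> t")
    case True
    have "(LINT r|lborel. A s r) = (LINT r|lborel. f s * (if 0 \<le> r \<and> r \<le> s then g r else 0))"
      by (rule LINT_cong) (use True in \<open>auto simp: A_def\<close>)
    then show ?thesis using True by (simp add: prim_def)
  next
    case False
    then have "A s r = 0" for r unfolding A_def by auto
    then show ?thesis using False by (simp only: if_False) simp
  qed
  have intB: "(LINT s|lborel. B s r) = (if 0 \<le> r \<and> r \<le> t then prim f r * g r else 0)" for r
  proof (cases "0 \<le> r \<and> r \<le> t")
    case True
    have "(LINT s|lborel. B s r) = (LINT s|lborel. (if 0 \<le> s \<and> s \<le> r then f s else 0) * g r)"
    proof (rule integral_cong_AE)
      \<comment> \<open>B excludes the diagonal while \<open>prim\<close> includes the end point;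
        the difference is a single point.\<close>
      have "AE s in lborel. s \<noteq> r" by (rule AE_lborel_singleton)
      then show "AE s in lborel. B s r = (if 0 \<le> s \<and> s \<le> r then f s else 0) * g r"
        by eventually_elim (use True in \<open>auto simp: B_def\<close>)
    qed (unfold B_def, measurable)
    then show ?thesis using True by (simp add: prim_def)
  next
    case False
    then have "B s r = 0" for s unfolding B_def by auto
    then show ?thesis using False by (simp only: if_False) simp
  qed
  have "prim f t * prim g t = (LINT s|lborel. LINT r|lborel. ?f s * ?g r)"
    unfolding prim_def by simp
  also have "\<dots> = (LINT s|lborel. (LINT r|lborel. A s r) + (LINT r|lborel. B s r))"
  proof (rule integral_cong_AE)
    show "(\<lambda>s. LINT r|lborel. ?f s * ?g r) \<in> borel_measurable lborel" by measurable
    show "(\<lambda>s. (LINT r|lborel. A s r) + (LINT r|lborel. B s r)) \<in> borel_measurable lborel" using mA mB by measurable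
    show "AE s in lborel. (LINT r|lborel. ?f s * ?g r) = (LINT r|lborel. A s r) + (LINT r|lborel. B s r)"
      using pair_Fubini(2)[OF mA FA] pair_Fubini(2)[OF mB FB]
    proof eventually_elim
      case (elim s)
      have "(LINT r|lborel. ?f s * ?g r) = (LINT r|lborel. A s r + B s r)"
        by (rule LINT_cong) (auto simp: A_def B_def)
      then show ?case using elim by simp
    qed
  qed
  also have "\<dots> = (LINT s|lborel. LINT r|lborel. A s r) + (LINT s|lborel. LINT r|lborel. B s r)"
    by (rule LINT_add[OF pair_Fubini(4)[OF mA FA] pair_Fubini(4)[OF mB FB]])
  also have "(LINT s|lborel. LINT r|lborel. B s r) = (LINT r|lborel. LINT s|lborel. B s r)"
    by (rule pair_Fubini(1)[OF mB FB])
  finally have P: "prim f t * prim g t = prim (\<lambda>s. f s * prim g s) t + prim (\<lambda>s. prim f s * g s) t"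
    unfolding intA intB by (simp only: prim_def[of "\<lambda>s. f s * prim g s"] prim_def[of "\<lambda>s. prim f s * g s"])
  have i: "integrable lborel (\<lambda>s. f s * prim g s)" "integrable lborel (\<lambda>s. prim f s * g s)"
    using prim_mult_integrable[OF f g, of 0] prim_mult_integrable[OF g f, of 0] by (simp_all add: mult.commute)
  have "prim (\<lambda>s. f s * (d + prim g s) + (c + prim f s) * g s) t
    = prim (\<lambda>s. d * f s + (c * g s + (f s * prim g s + prim f s * g s))) t"
    by (simp add: algebra_simps)
  also have "\<dots> = d * prim f t + (c * prim g t + (prim (\<lambda>s. f s * prim g s) t + prim (\<lambda>s. prim f s * g s) t))"
    using f g i by (simp add: prim_add prim_cmult)
  finally show ?thesis using P by (simp add: algebra_simps)
qed

text \<open>Induction with the product rule: the previous case says that F^(k+1) is itself a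
  primitive, so F times it can be integrated by parts.\<close>

lemma prim_power:
  assumes f: "integrable lborel f"
  shows "integrable lborel (\<lambda>s. f s * prim f s ^ k)" and "prim (\<lambda>s. f s * prim f s ^ k) t = prim f t ^ Suc k / real (Suc k)"
proof -
  have "integrable lborel (\<lambda>s. f s * prim f s ^ k) \<and> (\<forall>t. prim (\<lambda>s. f s * prim f s ^ k) t = prim f t ^ Suc k / real (Suc k))"
  proof (induction k)
    case (Suc k)
    let ?h = "\<lambda>s. real (Suc k) * (f s * prim f s ^ k)"
    have h: "integrable lborel ?h" using Suc by (intro integrable_mult_right) auto
    have ph: "prim ?h s = prim f s ^ Suc k" for s using Suc by (simp add: prim_cmult)
    have i: "integrable lborel (\<lambda>s. f s * prim f s ^ Suc k)"
      using prim_mult_integrable[OF f h, of 0] by (simp only: ph add_0)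
    have e: "prim (\<lambda>s. f s * prim f s ^ Suc k) t = prim f t ^ Suc (Suc k) / real (Suc (Suc k))" for t
    proof -
      have "prim f t ^ Suc (Suc k) = (0 + prim f t) * (0 + prim ?h t)" by (simp only: ph add_0 power_Suc)
      also have "\<dots> = prim (\<lambda>s. real (Suc (Suc k)) * (f s * prim f s ^ Suc k)) t"
      proof -
        have "f s * (0 + prim ?h s) + (0 + prim f s) * ?h s = real (Suc (Suc k)) * (f s * prim f s ^ Suc k)" for s
          unfolding ph by (simp add: algebra_simps)
        then show ?thesis unfolding prim_product[OF f h] by simp
      qed
      finally show ?thesis unfolding prim_cmult by simp
    qed
    show ?case using i e by blast
  qed (use f in simp)
  then show "integrable lborel (\<lambda>s. f s * prim f s ^ k)" and "prim (\<lambda>s. f s * prim f s ^ k) t = prim f t ^ Suc k / real (Suc k)"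
    by blast+
qed

text \<open>X is merely measurable and bounded, so the inequality is iterated rather than
  differentiated. Starting from X \<le> S, each pass adds one term of the exponential series and
  divides the remainder by the next factorial; the remainder tends to 0.\<close>

lemma Gronwall_prim:
  assumes N: "integrable lborel N" "\<And>s. 0 \<le> N s" and X: "X \<in> borel_measurable borel" "\<And>s. \<bar>X s\<bar> \<le> S"
    and le: "\<And>t. 0 \<le> t \<Longrightarrow> t \<le> \<tau> \<Longrightarrow> X t \<le> K + a * prim (\<lambda>s. N s * X s) t" and a: "0 \<le> a" and K: "0 \<le> K"
    and t: "0 \<le> t" "t \<le> \<tau>"
  shows "X t \<le> K * exp (a * prim N t)"
proof -
  have S0: "0 \<le> S" using X(2)[of 0] by linarith
  have pN: "0 \<le> prim N s" for s unfolding prim_def by (rule LINT_nonneg) (simp add: N)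
  let ?e = "\<lambda>n s. K * (\<Sum>j<n. (a * prim N s) ^ j / fact j) + S * ((a * prim N s) ^ n / fact n)"
  have "X t \<le> ?e n t" if "0 \<le> t" "t \<le> \<tau>" for n t
    using that
  proof (induction n arbitrary: t)
    case 0
    then show ?case using X(2)[of t] by simp
  next
    case (Suc n)
    have i0: "integrable lborel (\<lambda>s. N s * X s)" by (rule integrable_mult_bounded[OF N(1) X])
    have i1: "integrable lborel (\<lambda>s. N s * prim N s ^ j)" for j by (rule prim_power(1)[OF N(1)])
    have eq: "N s * ?e n s = (\<Sum>j<n. (K * a ^ j / fact j) * (N s * prim N s ^ j)) + (S * a ^ n / fact n) * (N s * prim N s ^ n)" for s
      by (simp add: distrib_left sum_distrib_left power_mult_distrib mult_ac)
    have isum: "integrable lborel (\<lambda>s. (\<Sum>j<n. (K * a ^ j / fact j) * (N s * prim N s ^ j)))"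
      by (intro L1_sum integrable_mult_right i1)
    have i2: "integrable lborel (\<lambda>s. N s * ?e n s)"
      unfolding eq by (intro L1_add isum integrable_mult_right i1)
    have "prim (\<lambda>s. N s * X s) t \<le> prim (\<lambda>s. N s * ?e n s) t"
      by (rule prim_mono[OF i0 i2]) (use Suc N in \<open>auto intro!: mult_left_mono\<close>)
    also have "\<dots> = prim (\<lambda>s. (\<Sum>j<n. (K * a ^ j / fact j) * (N s * prim N s ^ j))) t + prim (\<lambda>s. (S * a ^ n / fact n) * (N s * prim N s ^ n)) t"
      unfolding eq by (rule prim_add[OF isum]) (intro integrable_mult_right i1)
    also have "prim (\<lambda>s. (\<Sum>j<n. (K * a ^ j / fact j) * (N s * prim N s ^ j))) t = (\<Sum>j<n. (K * a ^ j / fact j) * (prim N t ^ Suc j / real (Suc j)))"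
    proof -
      have "prim (\<lambda>s. (\<Sum>j<m. (K * a ^ j / fact j) * (N s * prim N s ^ j))) t = (\<Sum>j<m. (K * a ^ j / fact j) * (prim N t ^ Suc j / real (Suc j)))" for m
      proof (induction m)
        case 0
        then show ?case by (simp add: prim_def)
      next
        case (Suc m)
        show ?case unfolding sum.lessThan_Suc
          by (subst prim_add, intro L1_sum integrable_mult_right i1, intro integrable_mult_right i1,
              simp only: Suc prim_cmult prim_power(2)[OF N(1)])
      qed
      then show ?thesis .
    qed
    also have "prim (\<lambda>s. (S * a ^ n / fact n) * (N s * prim N s ^ n)) t = (S * a ^ n / fact n) * (prim N t ^ Suc n / real (Suc n))"
      unfolding prim_cmult prim_power(2)[OF N(1)] ..
    finally have "X t \<le> K + a * ((\<Sum>j<n. (K * a ^ j / fact j) * (prim N t ^ Suc j / real (Suc j))) + (S * a ^ n / fact n) * (prim N t ^ Suc n / real (Suc n)))"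
      using le[OF Suc.prems] a by (meson add_left_mono mult_left_mono order_trans)
    also have "\<dots> = K * (1 + (\<Sum>j<n. (a * prim N t) ^ Suc j / fact (Suc j))) + S * ((a * prim N t) ^ Suc n / fact (Suc n))"
      by (simp add: distrib_left sum_distrib_left power_mult_distrib fact_Suc mult_ac)
    also have "1 + (\<Sum>j<n. (a * prim N t) ^ Suc j / fact (Suc j)) = (\<Sum>j<Suc n. (a * prim N t) ^ j / fact j)"
      by (subst sum.lessThan_Suc_shift) simp
    finally show ?case .
  qed
  then have le': "X t \<le> ?e n t" for n using t by blast
  have s: "summable (\<lambda>j. (a * prim N t) ^ j / fact j)" using summable_exp[of "a * prim N t"] by (simp add: divide_inverse mult.commute)
  have "(\<lambda>n. \<Sum>j<n. (a * prim N t) ^ j / fact j) \<longlonglongrightarrow> exp (a * prim N t)"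
    using summable_LIMSEQ[OF s] by (simp add: exp_def scaleR_conv_of_real divide_inverse mult.commute)
  then have "(\<lambda>n. ?e n t) \<longlonglongrightarrow> K * exp (a * prim N t) + S * 0"
    by (intro tendsto_intros summable_LIMSEQ_zero[OF s])
  then show ?thesis using le' by (intro LIMSEQ_le_const[of "\<lambda>n. ?e n t"]) auto
qed

subsection \<open>Renormalization\<close>

text \<open>Every property holds for all t, not almost all: bad times are removed beforehand by
  setting b and G to 0 there, and likewise outside (0,T). This keeps null sets of times out of the
  spatial arguments.\<close>

locale transport =
  fixes T :: real and b :: "real \<Rightarrow> real^'n \<Rightarrow> real^'n" and G :: "real \<Rightarrow> real^'n \<Rightarrow> real^'n^'n"
  assumes T_pos: "0 < T"
    and borel_b[measurable]: "case_prod b \<in> borel_measurable (borel \<Otimes>\<^sub>M borel)"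
    and borel_G[measurable]: "case_prod G \<in> borel_measurable (borel \<Otimes>\<^sub>M borel)"
    and jac: "\<And>t. jac (b t) (G t)"
    and zero: "\<And>t. t \<notin> {0<..<T} \<Longrightarrow> b t = (\<lambda>_. 0)" "\<And>t. t \<notin> {0<..<T} \<Longrightarrow> G t = (\<lambda>_. 0)"
    and fin: "\<And>r. (NNINT t. NNINT y. indicator (cball 0 r) y * ennreal (norm (b t y) + norm (G t y))) < \<infinity>"
begin

definition mass :: "real \<Rightarrow> real \<Rightarrow> ennreal" where
  "mass r t = (NNINT y. indicator (cball 0 r) y * ennreal (norm (b t y) + norm (G t y)))"

lemma borel_mass[measurable]: "mass r \<in> borel_measurable borel"
  unfolding mass_def[abs_def] by measurable

lemma time_integrableI:
  assumes [measurable]: "f \<in> borel_measurable borel" and le: "\<And>s. ennreal \<bar>f s\<bar> \<le> ennreal C * mass r s"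
  shows "integrable lborel (f :: real \<Rightarrow> real)"
  unfolding integrable_iff_bounded
proof
  have "(NNINT s. ennreal (norm (f s))) \<le> (NNINT s. ennreal C * mass r s)"
    using le by (intro nn_integral_mono) simp
  also have "\<dots> = ennreal C * (NNINT s. mass r s)" by (rule nn_integral_cmult) measurable
  also have "\<dots> < \<infinity>" using fin[of r] by (simp add: mass_def ennreal_mult_less_top)
  finally show "(NNINT s. ennreal (norm (f s))) < \<infinity>" .
qed simp

definition bounded_fun :: "(real \<Rightarrow> real^'n \<Rightarrow> real) \<Rightarrow> real \<Rightarrow> bool" where
  "bounded_fun v M \<longleftrightarrow> case_prod v \<in> borel_measurable (borel \<Otimes>\<^sub>M borel) \<and> (\<forall>t x. \<bar>v t x\<bar> \<le> M)"

lemma bounded_funD: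
  assumes "bounded_fun v M"
  shows "case_prod v \<in> borel_measurable (borel \<Otimes>\<^sub>M borel)" "v t \<in> borel_measurable borel" "\<bar>v t x\<bar> \<le> M"
proof -
  show m[measurable]: "case_prod v \<in> borel_measurable (borel \<Otimes>\<^sub>M borel)" using assms by (simp add: bounded_fun_def)
  show "v t \<in> borel_measurable borel" by measurable
  show "\<bar>v t x\<bar> \<le> M" using assms by (simp add: bounded_fun_def)
qed

lemma flux_time_integrable:
  assumes \<phi>: "csmooth \<phi>" and v: "bounded_fun v M"
  shows "integrable lborel (\<lambda>s. flux (b s) (G s) \<phi> (v s))"
proof -
  note [measurable] = bounded_funD(1)[OF v] borel_fd[OF \<phi>] csmooth_borel[OF \<phi>]
  obtain C r where C: "\<And>b G v M. jac b G \<Longrightarrow> \<forall>x. \<bar>v x\<bar> \<le> M \<Longrightarrow> ennreal \<bar>flux b G \<phi> v\<bar>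
        \<le> ennreal (C * M) * (NNINT y. indicator (cball 0 r) y * ennreal (norm (b y) + norm (G y)))"
    using flux_bound[OF \<phi>] by blast
  show ?thesis
  proof (rule time_integrableI)
    show "(\<lambda>s. flux (b s) (G s) \<phi> (v s)) \<in> borel_measurable borel"
      unfolding flux_def by measurable
    show "ennreal \<bar>flux (b s) (G s) \<phi> (v s)\<bar> \<le> ennreal (C * M) * mass r s" for s
      unfolding mass_def by (rule C[OF jac]) (use bounded_funD(3)[OF v] in blast)
  qed
qed

lemma flux_zero:
  assumes "csmooth \<phi>" "t \<notin> {0<..<T}" shows "flux (b t) (G t) \<phi> v = 0"
proof -
  have "fd \<phi> x 0 = 0" for x using csmooth_has_derivative[OF assms(1)] has_derivative_linear linear_0 by blast
  then show ?thesis by (simp add: flux_def zero[OF assms(2)] trace_def)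
qed

text \<open>The weak formulation integrated in time.\<close>

definition sol :: "(real^'n \<Rightarrow> real) \<Rightarrow> (real \<Rightarrow> real^'n \<Rightarrow> real) \<Rightarrow> real \<Rightarrow> bool" where
  "sol v0 v M \<longleftrightarrow> v0 \<in> borel_measurable borel \<and> (\<forall>x. \<bar>v0 x\<bar> \<le> M) \<and> bounded_fun v M \<and>
    (\<forall>\<phi>. csmooth \<phi> \<longrightarrow> (AE t in lborel. 0 < t \<longrightarrow> t < T \<longrightarrow>
       (LINT x|lborel. v t x * \<phi> x) = (LINT x|lborel. v0 x * \<phi> x) + prim (\<lambda>s. flux (b s) (G s) \<phi> (v s)) t))"

lemma solD:
  assumes "sol v0 v M"
  shows "v0 \<in> borel_measurable borel" "\<bar>v0 x\<bar> \<le> M" "bounded_fun v M"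
    "csmooth \<phi> \<Longrightarrow> AE t in lborel. 0 < t \<longrightarrow> t < T \<longrightarrow>
       (LINT x|lborel. v t x * \<phi> x) = (LINT x|lborel. v0 x * \<phi> x) + prim (\<lambda>s. flux (b s) (G s) \<phi> (v s)) t"
  using assms by (auto simp: sol_def)

lemma sol_mono: "sol v0 v M \<Longrightarrow> M \<le> M' \<Longrightarrow> sol v0 v M'"
  by (auto simp: sol_def bounded_fun_def intro: order_trans)

text \<open>Testing with the kernel centred at y makes the mollified solution absolutely continuous
  in time for that fixed y. The product rule then applies pointwise in y, and integrating against
  \<phi> gives the identity by Fubini.\<close>

lemma sol_mult_mollified:
  assumes v: "sol v0 v M" and w: "sol w0 w M" and \<phi>: "csmooth \<phi>" and e: "0 < e" "e \<le> 1"
  shows "AE t in lborel. 0 < t \<longrightarrow> t < T \<longrightarrow>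
    (LINT y|lborel. \<phi> y * (conv (v t) (molr e) y * conv (w t) (molr e) y))
     = (LINT y|lborel. \<phi> y * (conv v0 (molr e) y * conv w0 (molr e) y))
       + prim (\<lambda>s. LINT y|lborel. \<phi> y * flux_prod e (b s) (G s) (v s) (w s) y) t"
proof -
  let ?K = "molr e :: real^'n \<Rightarrow> real"
  note bv = solD(3)[OF v] and bw = solD(3)[OF w]
  have K: "csmooth ?K" by (rule csmooth_molr[OF e(1)])
  have Ky: "csmooth (\<lambda>x. ?K (y - x))" for y by (rule csmooth_reflect[OF K])
  note [measurable] = solD(1)[OF v] solD(1)[OF w] bounded_funD(1)[OF bv] bounded_funD(1)[OF bw]
    csmooth_borel[OF K] csmooth_borel[OF \<phi>] borel_fd[OF K]
    borel_flux_molr[OF e(1) borel_b borel_G bounded_funD(1)[OF bv]]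
    borel_flux_molr[OF e(1) borel_b borel_G bounded_funD(1)[OF bw]]
  have M0: "0 \<le> M" using solD(2)[OF v, of 0] by linarith
  define A where "A y s = flux (b s) (G s) (\<lambda>x. ?K (y - x)) (v s)" for y s
  define B where "B y s = flux (b s) (G s) (\<lambda>x. ?K (y - x)) (w s)" for y s
  define Z where "Z y s = A y s * conv (w s) ?K y + conv (v s) ?K y * B y s" for y s
  have Zfp: "flux_prod e (b s) (G s) (v s) (w s) y = Z y s" for s y
    by (simp add: flux_prod_def Z_def A_def B_def)
  have Ai: "integrable lborel (A y)" and Bi: "integrable lborel (B y)" for y
    unfolding A_def B_def by (rule flux_time_integrable[OF Ky bv] flux_time_integrable[OF Ky bw])+
  have mA[measurable]: "(\<lambda>(y, s). A y s) \<in> borel_measurable (borel \<Otimes>\<^sub>M borel)"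
    and mB[measurable]: "(\<lambda>(y, s). B y s) \<in> borel_measurable (borel \<Otimes>\<^sub>M borel)"
    unfolding A_def B_def by measurable
  have mc[measurable]: "(\<lambda>(y, s). conv (v s) ?K y) \<in> borel_measurable (borel \<Otimes>\<^sub>M borel)"
    "(\<lambda>(y, s). conv (w s) ?K y) \<in> borel_measurable (borel \<Otimes>\<^sub>M borel)"
    "conv v0 ?K \<in> borel_measurable borel" "conv w0 ?K \<in> borel_measurable borel"
    unfolding conv_def by measurable
  have mZ[measurable]: "(\<lambda>(y, s). Z y s) \<in> borel_measurable (borel \<Otimes>\<^sub>M borel)" unfolding Z_def by measurable
  have pt: "AE t in lborel. 0 < t \<longrightarrow> t < T \<longrightarrow>
      conv (v t) ?K y * conv (w t) ?K y = conv v0 ?K y * conv w0 ?K y + prim (Z y) t" for y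
  proof -
    have ev: "AE t in lborel. 0 < t \<longrightarrow> t < T \<longrightarrow> conv (v t) ?K y = conv v0 ?K y + prim (A y) t"
      using solD(4)[OF v Ky[of y]] by (simp add: conv_def A_def[abs_def])
    have ew: "AE t in lborel. 0 < t \<longrightarrow> t < T \<longrightarrow> conv (w t) ?K y = conv w0 ?K y + prim (B y) t"
      using solD(4)[OF w Ky[of y]] by (simp add: conv_def B_def[abs_def])
    \<comment> \<open>The primitives agree with the mollifications only for almost every s in (0,T);
      outside this interval A and B vanish. This is enough under \<open>prim\<close>.\<close>
    have "AE s in lborel. A y s * (conv w0 ?K y + prim (B y) s) + (conv v0 ?K y + prim (A y) s) * B y s = Z y s"
      using ev ew
    proof eventually_elim
      case (elim s)
      show ?case
      proof (cases "s \<in> {0<..<T}")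
        case False
        then have "A y s = 0" "B y s = 0" unfolding A_def B_def by (auto intro: flux_zero[OF Ky])
        then show ?thesis by (simp add: Z_def)
      qed (use elim in \<open>simp add: Z_def\<close>)
    qed
    then have p: "prim (\<lambda>s. A y s * (conv w0 ?K y + prim (B y) s) + (conv v0 ?K y + prim (A y) s) * B y s) t = prim (Z y) t" for t
      by (rule prim_cong_AE[rotated 2]) measurable
    show ?thesis using ev ew
      by eventually_elim (auto simp: prim_product[OF Ai Bi] p)
  qed
  \<comment> \<open>The exceptional times depend on y. To integrate over y at a fixed t the
    quantifiers are exchanged, by measurability of the identity in (t, y).\<close>
  have "AE y in lborel. AE t in lborel. 0 < t \<longrightarrow> t < T \<longrightarrow>
      conv (v t) ?K y * conv (w t) ?K y = conv v0 ?K y * conv w0 ?K y + prim (Z y) t"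
    using pt by simp
  moreover have "Measurable.pred (lborel \<Otimes>\<^sub>M lborel) (\<lambda>p. 0 < fst p \<longrightarrow> fst p < T \<longrightarrow>
      conv (v (fst p)) ?K (snd p) * conv (w (fst p)) ?K (snd p) = conv v0 ?K (snd p) * conv w0 ?K (snd p) + prim (Z (snd p)) (fst p))"
    by measurable
  ultimately have sw: "AE t in lborel. AE y in lborel. 0 < t \<longrightarrow> t < T \<longrightarrow>
      conv (v t) ?K y * conv (w t) ?K y = conv v0 ?K y * conv w0 ?K y + prim (Z y) t"
    by (subst lborel_pair.AE_commute) (simp_all only: pred_def)
  obtain C1 where C1: "0 < C1" "\<And>x. \<bar>\<phi> x\<bar> \<le> C1" using csmooth_bounded[OF \<phi>] by metis
  obtain r where r: "0 < r" "\<And>x. r \<le> norm x \<Longrightarrow> \<phi> x = 0" using csmooth_support[OF \<phi>] by metis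
  obtain C where C: "0 < C" "\<And>(b :: real^'n \<Rightarrow> real^'n) G v M r y. jac b G \<Longrightarrow> \<forall>x. \<bar>v x\<bar> \<le> M \<Longrightarrow> norm y \<le> r \<Longrightarrow>
     ennreal \<bar>flux b G (\<lambda>x. ?K (y - x)) v\<bar>
        \<le> ennreal (C * M) * (NNINT y. indicator (cball 0 (r + 1)) y * ennreal (norm (b y) + norm (G y)))"
    using flux_molr_bound[OF e, where 'n='n] by blast
  \<comment> \<open>A majorant that factors into a ball indicator in y and \<open>mass\<close> in
    time, as Fubini requires.\<close>
  have Zb: "ennreal \<bar>\<phi> y * Z y s\<bar> \<le> indicator (cball 0 r) y * (ennreal (C1 * M) * (2 * (ennreal (C * M) * mass (r + 1) s)))" for y s
  proof (cases "norm y \<le> r")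
    case True
    have "\<bar>A y s * conv (w s) ?K y + conv (v s) ?K y * B y s\<bar> \<le> \<bar>A y s\<bar> * M + M * \<bar>B y s\<bar>"
      by (intro order_trans[OF abs_triangle_ineq] add_mono)
        (auto simp: abs_mult M0 intro!: mult_mono conv_molr_bound[OF e(1) bounded_funD(2)[OF bv] bounded_funD(3)[OF bv]]
          conv_molr_bound[OF e(1) bounded_funD(2)[OF bw] bounded_funD(3)[OF bw]])
    then have "\<bar>\<phi> y * Z y s\<bar> \<le> C1 * (\<bar>A y s\<bar> * M + M * \<bar>B y s\<bar>)"
      unfolding abs_mult Z_def using C1 by (intro mult_mono) auto
    also have "\<dots> = (C1 * M) * (\<bar>A y s\<bar> + \<bar>B y s\<bar>)" by (simp add: algebra_simps)
    finally have "ennreal \<bar>\<phi> y * Z y s\<bar> \<le> ennreal (C1 * M) * (ennreal \<bar>A y s\<bar> + ennreal \<bar>B y s\<bar>)"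
      using C1 M0 by (subst ennreal_plus[symmetric], simp, simp, subst ennreal_mult[symmetric]) (auto intro: ennreal_leI)
    also have "\<dots> \<le> ennreal (C1 * M) * (ennreal (C * M) * mass (r + 1) s + ennreal (C * M) * mass (r + 1) s)"
      unfolding A_def B_def mass_def using bounded_funD(3)[OF bv] bounded_funD(3)[OF bw]
      by (intro mult_left_mono add_mono C(2)[OF jac _ True]) auto
    finally show ?thesis using True by (simp add: mult_2)
  qed (simp add: r)
  have fub_fin: "(NNINT s. NNINT y. ennreal \<bar>if 0 \<le> s \<and> s \<le> t then \<phi> y * Z y s else 0\<bar>) < \<infinity>" for t
  proof -
    have "(NNINT s. NNINT y. ennreal \<bar>if 0 \<le> s \<and> s \<le> t then \<phi> y * Z y s else 0\<bar>)
      \<le> (NNINT s. NNINT y. indicator (cball (0::real^'n) r) y * (ennreal (C1 * M) * (2 * (ennreal (C * M) * mass (r + 1) s))))"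
      by (intro nn_integral_mono) (use Zb in auto)
    also have "\<dots> = (NNINT s. emeasure lborel (cball (0::real^'n) r) * (ennreal (C1 * M) * (2 * (ennreal (C * M) * mass (r + 1) s))))"
      by (intro nn_integral_cong) (simp add: nn_integral_multc)
    also have "\<dots> = emeasure lborel (cball (0::real^'n) r) * (ennreal (C1 * M) * (2 * (ennreal (C * M) * (NNINT s. mass (r + 1) s))))"
      by (simp add: nn_integral_cmult)
    also have "\<dots> < \<infinity>"
      using fin[of "r + 1"] emeasure_lborel_cball_finite[of "0::real^'n" r] by (simp add: mass_def ennreal_mult_less_top)
    finally show ?thesis .
  qed
  show ?thesis using sw
  proof eventually_elim
    case (elim t)
    show ?case
    proof (intro impI)
      assume t: "0 < t" "t < T"
      have m: "(\<lambda>(s, y). if 0 \<le> s \<and> s \<le> t then \<phi> y * Z y s else 0) \<in> borel_measurable (borel \<Otimes>\<^sub>M borel)" by measurable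
      have ip: "(LINT s|lborel. (if 0 \<le> s \<and> s \<le> t then \<phi> y * Z y s else 0)) = \<phi> y * prim (Z y) t" for y
        using prim_cmult[of "\<phi> y" "Z y" t] by (simp only: prim_def)
      have i0: "integrable lborel (\<lambda>y. \<phi> y * (conv v0 ?K y * conv w0 ?K y))"
        by (rule integrable_mult_bounded[OF csmooth_integrable[OF \<phi>], where C = "M * M"], measurable)
          (auto simp: abs_mult M0 intro!: mult_mono conv_molr_bound[OF e(1) solD(1,2)[OF v]] conv_molr_bound[OF e(1) solD(1,2)[OF w]])
      have i1: "integrable lborel (\<lambda>y. \<phi> y * prim (Z y) t)"
        using pair_Fubini(5)[OF m fub_fin] by (simp add: ip)
      have "(LINT y|lborel. \<phi> y * (conv (v t) ?K y * conv (w t) ?K y))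
          = (LINT y|lborel. \<phi> y * (conv v0 ?K y * conv w0 ?K y) + \<phi> y * prim (Z y) t)"
        by (rule integral_cong_AE, measurable) (use elim t in \<open>auto simp: distrib_left\<close>)
      also have "\<dots> = (LINT y|lborel. \<phi> y * (conv v0 ?K y * conv w0 ?K y)) + (LINT y|lborel. \<phi> y * prim (Z y) t)"
        by (rule LINT_add[OF i0 i1])
      also have "(LINT y|lborel. \<phi> y * prim (Z y) t) = (LINT s|lborel. LINT y|lborel. (if 0 \<le> s \<and> s \<le> t then \<phi> y * Z y s else 0))"
        unfolding ip[symmetric] by (rule pair_Fubini(1)[OF m fub_fin, symmetric])
      also have "\<dots> = prim (\<lambda>s. LINT y|lborel. \<phi> y * Z y s) t"
        unfolding prim_def by (intro LINT_cong) auto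
      finally show "(LINT y|lborel. \<phi> y * (conv (v t) ?K y * conv (w t) ?K y))
        = (LINT y|lborel. \<phi> y * (conv v0 ?K y * conv w0 ?K y)) + prim (\<lambda>s. LINT y|lborel. \<phi> y * flux_prod e (b s) (G s) (v s) (w s) y) t"
        unfolding Zfp .
    qed
  qed
qed

text \<open>The scale tends to 0 in \<open>sol_mult_mollified\<close>: the spatial terms converge as
  mollified products, the time integral by \<open>flux_prod_limit\<close> and domination.\<close>

lemma sol_mult:
  assumes v: "sol v0 v M" and w: "sol w0 w M"
  shows "sol (\<lambda>x. v0 x * w0 x) (\<lambda>t x. v t x * w t x) (M * M)"
  unfolding sol_def
proof (intro conjI allI impI)
  note bv = solD(3)[OF v] and bw = solD(3)[OF w]
  note [measurable] = solD(1)[OF v] solD(1)[OF w] bounded_funD(1)[OF bv] bounded_funD(1)[OF bw]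
  have M0: "0 \<le> M" using solD(2)[OF v, of 0] by linarith
  show "(\<lambda>x. v0 x * w0 x) \<in> borel_measurable borel" by measurable
  show "\<bar>v0 x * w0 x\<bar> \<le> M * M" for x
    unfolding abs_mult by (intro mult_mono solD(2)[OF v] solD(2)[OF w]) (auto simp: M0)
  show "bounded_fun (\<lambda>t x. v t x * w t x) (M * M)"
    unfolding bounded_fun_def
  proof (intro conjI allI)
    show "(\<lambda>(t, x). v t x * w t x) \<in> borel_measurable (borel \<Otimes>\<^sub>M borel)" by measurable
    show "\<bar>v t x * w t x\<bar> \<le> M * M" for t x
      unfolding abs_mult by (intro mult_mono bounded_funD(3)[OF bv] bounded_funD(3)[OF bw]) (auto simp: M0)
  qed
  fix \<phi> :: "real^'n \<Rightarrow> real" assume \<phi>: "csmooth \<phi>"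
  define e where "e k = 1 / real (Suc k)" for k
  have e: "0 < e k" "e k \<le> 1" "e \<longlonglongrightarrow> 0" for k unfolding e_def using LIMSEQ_Suc[OF lim_inverse_n'] by auto
  note \<phi>i = csmooth_integrable[OF \<phi>]
  have lim0: "(\<lambda>k. LINT y|lborel. \<phi> y * (conv v0 (molr (e k)) y * conv w0 (molr (e k)) y)) \<longlonglongrightarrow> (LINT y|lborel. \<phi> y * (v0 y * w0 y))"
    by (rule weighted_conv_prod[OF \<phi>i solD(1,2)[OF v] solD(1,2)[OF w] e(1,3)])
  have limt: "(\<lambda>k. LINT y|lborel. \<phi> y * (conv (v t) (molr (e k)) y * conv (w t) (molr (e k)) y)) \<longlonglongrightarrow> (LINT y|lborel. \<phi> y * (v t y * w t y))" for t
    by (rule weighted_conv_prod[OF \<phi>i bounded_funD(2,3)[OF bv] bounded_funD(2,3)[OF bw] e(1,3)])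
  obtain C r where C0: "0 < C" and C: "\<And>b G v1 v2 M e. jac b G \<Longrightarrow> v1 \<in> borel_measurable borel \<Longrightarrow> \<forall>x. \<bar>v1 x\<bar> \<le> M \<Longrightarrow>
     v2 \<in> borel_measurable borel \<Longrightarrow> \<forall>x. \<bar>v2 x\<bar> \<le> M \<Longrightarrow> 0 < e \<Longrightarrow> e \<le> 1 \<Longrightarrow>
     ennreal \<bar>\<integral>y. \<phi> y * flux_prod e b G v1 v2 y \<partial>lborel\<bar>
        \<le> ennreal (C * (M * M)) * (NNINT y. indicator (cball 0 r) y * ennreal (norm (b y) + norm (G y)))"
    using flux_prod_bound[OF \<phi>] by blast
  \<comment> \<open>\<open>enn2real\<close> sends \<infinity> to 0; this concerns only the null set
    of times where \<open>mass\<close> is infinite.\<close>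
  let ?W = "\<lambda>s. C * (M * M) * enn2real (mass r s)"
  have massfin: "AE s in lborel. mass r s \<noteq> \<infinity>"
  proof (rule nn_integral_PInf_AE)
    show "(NNINT s. mass r s) \<noteq> \<infinity>" using fin[of r] by (simp only: mass_def)
  qed measurable
  have Wi: "integrable lborel ?W"
  proof (intro integrable_mult_right)
    show "integrable lborel (\<lambda>s. enn2real (mass r s))"
    proof (rule time_integrableI)
      show "ennreal \<bar>enn2real (mass r s)\<bar> \<le> ennreal 1 * mass r s" for s
        by (cases "mass r s") auto
    qed measurable
  qed
  have limp: "(\<lambda>k. prim (\<lambda>s. LINT y|lborel. \<phi> y * flux_prod (e k) (b s) (G s) (v s) (w s) y) t)
     \<longlonglongrightarrow> prim (\<lambda>s. flux (b s) (G s) \<phi> (\<lambda>x. v s x * w s x)) t" for t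
  proof (rule prim_dominated_convergence[OF _ _ Wi])
    note [measurable] = csmooth_borel[OF \<phi>] borel_fd[OF \<phi>]
    show "(\<lambda>s. LINT y|lborel. \<phi> y * flux_prod (e k) (b s) (G s) (v s) (w s) y) \<in> borel_measurable borel" for k
    proof -
      note [measurable] = csmooth_borel[OF csmooth_molr[OF e(1)]]
        borel_flux_molr[OF e(1) borel_b borel_G bounded_funD(1)[OF bv]]
        borel_flux_molr[OF e(1) borel_b borel_G bounded_funD(1)[OF bw]]
      show ?thesis unfolding flux_prod_def conv_def by measurable
    qed
    show "(\<lambda>s. flux (b s) (G s) \<phi> (\<lambda>x. v s x * w s x)) \<in> borel_measurable borel"
      unfolding flux_def by measurable
    show "AE s in lborel. (\<lambda>k. LINT y|lborel. \<phi> y * flux_prod (e k) (b s) (G s) (v s) (w s) y) \<longlonglongrightarrow> flux (b s) (G s) \<phi> (\<lambda>x. v s x * w s x)"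
      by (intro AE_I2 flux_prod_limit[OF jac bounded_funD(2,3)[OF bv] bounded_funD(2,3)[OF bw] \<phi> e])
    show "AE s in lborel. \<bar>\<integral>y. \<phi> y * flux_prod (e k) (b s) (G s) (v s) (w s) y \<partial>lborel\<bar> \<le> ?W s" for k
      using massfin
    proof eventually_elim
      case (elim s)
      have "ennreal \<bar>\<integral>y. \<phi> y * flux_prod (e k) (b s) (G s) (v s) (w s) y \<partial>lborel\<bar> \<le> ennreal (C * (M * M)) * mass r s"
        unfolding mass_def
        by (rule C[OF jac bounded_funD(2)[OF bv] _ bounded_funD(2)[OF bw] _ e(1,2)])
          (use bounded_funD(3)[OF bv] bounded_funD(3)[OF bw] in blast)+
      also have "mass r s = ennreal (enn2real (mass r s))" using elim by (simp add: less_top)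
      also have "ennreal (C * (M * M)) * \<dots> = ennreal (C * (M * M) * enn2real (mass r s))"
        by (rule ennreal_mult''[symmetric]) simp
      finally show ?case
        using C0 M0 by simp
    qed
  qed
  \<comment> \<open>The scale runs through a sequence, so that the exceptional times form a
    countable union of null sets.\<close>
  have "AE t in lborel. \<forall>k. 0 < t \<longrightarrow> t < T \<longrightarrow>
    (LINT y|lborel. \<phi> y * (conv (v t) (molr (e k)) y * conv (w t) (molr (e k)) y))
     = (LINT y|lborel. \<phi> y * (conv v0 (molr (e k)) y * conv w0 (molr (e k)) y))
       + prim (\<lambda>s. LINT y|lborel. \<phi> y * flux_prod (e k) (b s) (G s) (v s) (w s) y) t"
    unfolding AE_all_countable using sol_mult_mollified[OF v w \<phi> e(1,2)] by blast
  then show "AE t in lborel. 0 < t \<longrightarrow> t < T \<longrightarrow>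
    (LINT x|lborel. v t x * w t x * \<phi> x) = (LINT x|lborel. v0 x * w0 x * \<phi> x) + prim (\<lambda>s. flux (b s) (G s) \<phi> (\<lambda>x. v s x * w s x)) t"
  proof eventually_elim
    case (elim t)
    show ?case
    proof (intro impI)
      assume t: "0 < t" "t < T"
      have "(\<lambda>k. LINT y|lborel. \<phi> y * (conv (v t) (molr (e k)) y * conv (w t) (molr (e k)) y))
        \<longlonglongrightarrow> (LINT y|lborel. \<phi> y * (v0 y * w0 y)) + prim (\<lambda>s. flux (b s) (G s) \<phi> (\<lambda>x. v s x * w s x)) t"
        using tendsto_add[OF lim0 limp[of t]] elim t by simp
      from LIMSEQ_unique[OF this limt]
      show "(LINT x|lborel. v t x * w t x * \<phi> x) = (LINT x|lborel. v0 x * w0 x * \<phi> x) + prim (\<lambda>s. flux (b s) (G s) \<phi> (\<lambda>x. v s x * w s x)) t"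
        by (simp add: mult_ac)
    qed
  qed
qed

end

section \<open>From the weak formulation to an integral equation in time\<close>

lemma smooth_antiderivative:
  fixes \<theta> :: "real \<Rightarrow> real"
  assumes \<theta>: "csmooth \<theta>"
  obtains \<psi> where "smooth_on UNIV \<psi>" "\<And>t. (\<psi> has_real_derivative \<theta> t) (at t)" "\<psi> T = 0"
proof -
  have "\<exists>F. \<forall>x::real. (-\<infinity>::ereal) < x \<longrightarrow> x < (\<infinity>::ereal) \<longrightarrow> (F has_vector_derivative \<theta> x) (at x)"
    by (rule einterval_antiderivative)
      (use csmooth_continuous[OF \<theta>] in \<open>auto simp: continuous_on_eq_continuous_at\<close>)
  then obtain F where F: "\<And>x. (F has_real_derivative \<theta> x) (at x)"
    by (auto simp: has_real_derivative_iff_has_vector_derivative)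
  define \<psi> where "\<psi> t = F t - F T" for t
  have d: "(\<psi> has_real_derivative \<theta> t) (at t)" for t
    unfolding \<psi>_def using DERIV_diff[OF F DERIV_const] by simp
  have "Ck_on k UNIV \<psi>" for k
  proof (cases k)
    case 0
    then show ?thesis using d by (auto intro!: continuous_at_imp_continuous_on DERIV_isCont)
  next
    case (Suc n)
    have "Ck_on n UNIV (\<lambda>t. \<theta> t * v)" for v
      using csmooth_smooth[OF \<theta>] by (intro Ck_on_mult accum_dirs_UNIV Ck_on_const) (auto simp: smooth_on_def)
    then show ?thesis unfolding Suc
      by (intro Ck_on_SucI[OF accum_dirs_UNIV d[unfolded has_field_derivative_def]])
  qed
  then show ?thesis using that[of \<psi>] d by (auto simp: smooth_on_def \<psi>_def)
qed

context transport
begin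

text \<open>A du Bois-Reymond argument. For fixed \<phi> let h be the defect of the integral
  equation. Every \<theta> is the derivative of some \<psi> with \<psi> T = 0, and testing with
  \<psi> \<phi> and integrating by parts gives \<integral> h \<theta> = 0, so h = 0 by
  \<open>fundamental_lemma\<close> in dimension one.\<close>

lemma sol_of_weak:
  assumes v0[measurable]: "v0 \<in> borel_measurable borel" and v0M: "\<And>x. \<bar>v0 x\<bar> \<le> M" and v: "bounded_fun v M"
    and weak: "\<And>\<psi> \<phi>. smooth_on UNIV \<psi> \<Longrightarrow> \<psi> T = 0 \<Longrightarrow> csmooth \<phi> \<Longrightarrow>
      (LINT t|lborel. indicator {0<..<T} t * (deriv \<psi> t * (LINT x|lborel. v t x * \<phi> x)))
      + (LINT t|lborel. indicator {0<..<T} t * (\<psi> t * flux (b t) (G t) \<phi> (v t))) = - (\<psi> 0 * (LINT x|lborel. v0 x * \<phi> x))"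
  shows "sol v0 v M"
  unfolding sol_def
proof (intro conjI allI impI v0 v0M v)
  fix \<phi> :: "real^'n \<Rightarrow> real" assume \<phi>: "csmooth \<phi>"
  note [measurable] = bounded_funD(1)[OF v] csmooth_borel[OF \<phi>]
  define a where "a t = (LINT x|lborel. v t x * \<phi> x)" for t
  define a0 where "a0 = (LINT x|lborel. v0 x * \<phi> x)"
  define c where "c t = flux (b t) (G t) \<phi> (v t)" for t
  have ci: "integrable lborel c" unfolding c_def by (rule flux_time_integrable[OF \<phi> v])
  note [measurable] = borel_measurable_integrable[OF ci, simplified]
  have am[measurable]: "a \<in> borel_measurable borel" unfolding a_def by measurable
  have c0: "c t = 0" if "t \<notin> {0<..<T}" for t unfolding c_def by (rule flux_zero[OF \<phi> that])
  have ab: "\<bar>a t\<bar> \<le> M * (LINT x|lborel. \<bar>\<phi> x\<bar>)" for t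
  proof -
    have i: "integrable lborel (\<lambda>x. \<phi> x * v t x)"
      by (rule integrable_mult_bounded[OF csmooth_integrable[OF \<phi>] bounded_funD(2,3)[OF v]])
    have "\<bar>a t\<bar> \<le> (LINT x|lborel. \<bar>\<phi> x * v t x\<bar>)"
      unfolding a_def using integral_norm_bound[of lborel "\<lambda>x. \<phi> x * v t x"] by (simp add: mult.commute)
    also have "\<dots> \<le> (LINT x|lborel. M * \<bar>\<phi> x\<bar>)"
      by (rule integral_mono[OF integrable_abs[OF i] integrable_mult_right[OF integrable_abs[OF csmooth_integrable[OF \<phi>]]]])
        (auto simp: abs_mult mult.commute[of M] intro!: mult_left_mono bounded_funD(3)[OF v])
    finally show ?thesis by simp
  qed
  define h where "h t = (if 0 < t \<and> t < T then a t - (a0 + prim c t) else 0)" for t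
  have [measurable]: "h \<in> borel_measurable borel" unfolding h_def by measurable
  define H where "H = M * (LINT x|lborel. \<bar>\<phi> x\<bar>) + \<bar>a0\<bar> + (LINT s|lborel. \<bar>c s\<bar>)"
  have hb: "\<bar>h t\<bar> \<le> H" for t
    using ab[of t] prim_abs_le[OF ci, of t] LINT_nonneg[of lborel "\<lambda>s. \<bar>c s\<bar>"]
      order_trans[OF abs_ge_zero ab[of t]] unfolding h_def H_def by (auto split: if_splits)
  have hi: "integrable lborel h"
    by (rule integrable_bounded_support[of h H T]) (use hb T_pos in \<open>auto simp: h_def\<close>)
  have "AE t in lborel. h t = 0"
  proof (rule fundamental_lemma)
    show "locint h" unfolding locint_def
      by (auto intro!: integrable_real_mult_indicator hi simp: mult.commute[of "indicator _ _"])
    fix \<theta> :: "real \<Rightarrow> real" assume \<theta>: "csmooth \<theta>"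
    note [measurable] = csmooth_borel[OF \<theta>]
    obtain \<psi> where \<psi>: "smooth_on UNIV \<psi>" "\<And>t. (\<psi> has_real_derivative \<theta> t) (at t)" "\<psi> T = 0"
      using smooth_antiderivative[OF \<theta>] by metis
    have \<psi>c: "continuous_on UNIV \<psi>" using \<psi>(2) by (auto intro!: continuous_at_imp_continuous_on DERIV_isCont)
    then have [measurable]: "\<psi> \<in> borel_measurable borel" by (rule borel_measurable_continuous_onI)
    define \<theta>' where "\<theta>' t = (if 0 < t \<and> t < T then \<theta> t else 0)" for t
    have [measurable]: "\<theta>' \<in> borel_measurable borel" unfolding \<theta>'_def by measurable
    have \<theta>i: "integrable lborel \<theta>'"
      by (rule L1_bound[OF csmooth_integrable[OF \<theta>]]) (auto simp: \<theta>'_def)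
    have FTC: "\<psi> 0 + prim \<theta>' t = \<psi> t" if t: "0 \<le> t" "t \<le> T" for t
    proof -
      have "(LINT s|lborel. indicator {0..t} s *\<^sub>R \<theta> s) = \<psi> t - \<psi> 0"
        by (rule integral_FTC_Icc[OF t(1)])
          (use \<psi>(2) csmooth_continuous[OF \<theta>] in \<open>auto intro: continuous_on_subset has_vector_derivative_at_within
             simp: has_real_derivative_iff_has_vector_derivative\<close>)
      moreover have "prim \<theta>' t = (LINT s|lborel. indicator {0..t} s *\<^sub>R \<theta> s)"
        unfolding prim_def
      proof (rule integral_cong_AE)
        have "AE s in lborel. s \<noteq> (0::real)" "AE s in lborel. s \<noteq> T" by (rule AE_lborel_singleton)+
        then show "AE s in lborel. (if 0 \<le> s \<and> s \<le> t then \<theta>' s else 0) = indicator {0..t} s *\<^sub>R \<theta> s"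
          by eventually_elim (use t in \<open>auto simp: \<theta>'_def indicator_def\<close>)
      qed measurable
      ultimately show ?thesis by simp
    qed
    have \<psi>b: "integrable lborel (\<lambda>s. c s * \<psi> s)"
    proof -
      have "bounded (\<psi> ` {0..T})"
        by (intro compact_imp_bounded compact_continuous_image continuous_on_subset[OF \<psi>c]) auto
      then obtain B where B: "0 < B" "\<And>s. s \<in> {0..T} \<Longrightarrow> \<bar>\<psi> s\<bar> \<le> B" unfolding bounded_pos by auto
      have "integrable lborel (\<lambda>s. c s * (if 0 \<le> s \<and> s \<le> T then \<psi> s else 0))"
        by (rule integrable_mult_bounded[OF ci, where C = B]) (use B in auto)
      moreover have "c s * (if 0 \<le> s \<and> s \<le> T then \<psi> s else 0) = c s * \<psi> s" for s using c0[of s] by auto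
      ultimately show ?thesis by simp
    qed
    have i1: "integrable lborel (\<lambda>s. \<theta>' s * (a0 + prim c s))" by (rule prim_mult_integrable[OF \<theta>i ci])
    have i3: "integrable lborel (\<lambda>s. \<theta>' s * a s)" by (rule integrable_mult_bounded[OF \<theta>i am ab])
    \<comment> \<open>Integration by parts in disguise: the product of the two primitives is
      evaluated at T, where the first factor is \<psi> T = 0.\<close>
    have "0 = (\<psi> 0 + prim \<theta>' T) * (a0 + prim c T)" using FTC[of T] T_pos \<psi>(3) by simp
    also have "\<dots> = \<psi> 0 * a0 + prim (\<lambda>s. \<theta>' s * (a0 + prim c s) + (\<psi> 0 + prim \<theta>' s) * c s) T"
      by (rule prim_product[OF \<theta>i ci])
    also have "prim (\<lambda>s. \<theta>' s * (a0 + prim c s) + (\<psi> 0 + prim \<theta>' s) * c s) T = (LINT s|lborel. \<theta>' s * (a0 + prim c s) + c s * \<psi> s)"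
      unfolding prim_def[of _ T]
      by (intro LINT_cong refl) (auto simp: FTC \<theta>'_def c0)
    also have "\<dots> = (LINT s|lborel. \<theta>' s * (a0 + prim c s)) + (LINT s|lborel. c s * \<psi> s)"
      by (rule LINT_add[OF i1 \<psi>b])
    finally have e1: "(LINT s|lborel. \<theta>' s * (a0 + prim c s)) + (LINT s|lborel. c s * \<psi> s) = - (\<psi> 0 * a0)" by linarith
    have "(LINT t|lborel. indicator {0<..<T} t * (deriv \<psi> t * a t)) = (LINT s|lborel. \<theta>' s * a s)"
      by (intro LINT_cong refl) (auto simp: \<theta>'_def DERIV_imp_deriv[OF \<psi>(2)])
    moreover have "(LINT t|lborel. indicator {0<..<T} t * (\<psi> t * c t)) = (LINT s|lborel. c s * \<psi> s)"
    proof (rule LINT_cong[OF refl])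
      fix t show "indicator {0<..<T} t * (\<psi> t * c t) = c t * \<psi> t"
        by (cases "t \<in> {0<..<T}") (simp_all add: c0)
    qed
    ultimately have "(LINT s|lborel. \<theta>' s * a s) + (LINT s|lborel. c s * \<psi> s) = - (\<psi> 0 * a0)"
      using weak[OF \<psi>(1,3) \<phi>] unfolding a_def a0_def c_def by simp
    then have "(LINT s|lborel. \<theta>' s * a s) - (LINT s|lborel. \<theta>' s * (a0 + prim c s)) = 0" using e1 by linarith
    then have "(LINT s|lborel. \<theta>' s * a s - \<theta>' s * (a0 + prim c s)) = 0" using i1 i3 by simp
    moreover have "\<theta>' s * a s - \<theta>' s * (a0 + prim c s) = h s * \<theta> s" for s by (simp add: \<theta>'_def h_def algebra_simps)
    ultimately show "(LINT s|lborel. h s * \<theta> s) = 0" by simp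
  qed
  then show "AE t in lborel. 0 < t \<longrightarrow> t < T \<longrightarrow>
       (LINT x|lborel. v t x * \<phi> x) = (LINT x|lborel. v0 x * \<phi> x) + prim (\<lambda>s. flux (b s) (G s) \<phi> (v s)) t"
    by eventually_elim (auto simp: h_def a_def a0_def c_def[abs_def])
qed

section \<open>Closure of solutions under sums, products and limits\<close>

lemma flux_integrand:
  assumes \<phi>: "csmooth \<phi>" and v: "v \<in> borel_measurable borel" "\<And>x. \<bar>v x\<bar> \<le> M"
  shows "integrable lborel (\<lambda>x. (fd \<phi> x (b s x) + trace (G s x) * \<phi> x) * v x)"
  by (intro integrable_mult_bounded[OF _ v] L1_add jac_divergence[OF jac \<phi>])

lemma sol_add:
  assumes v: "sol v0 v M" and w: "sol w0 w M'"
  shows "sol (\<lambda>x. v0 x + w0 x) (\<lambda>t x. v t x + w t x) (M + M')"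
proof -
  note bv = solD(3)[OF v] and bw = solD(3)[OF w]
  note [measurable] = solD(1)[OF v] solD(1)[OF w] bounded_funD(1)[OF bv] bounded_funD(1)[OF bw]
  show ?thesis unfolding sol_def
  proof (intro conjI allI impI)
    show "(\<lambda>x. v0 x + w0 x) \<in> borel_measurable borel" by measurable
    show "\<bar>v0 x + w0 x\<bar> \<le> M + M'" for x using solD(2)[OF v, of x] solD(2)[OF w, of x] by linarith
    show "bounded_fun (\<lambda>t x. v t x + w t x) (M + M')" unfolding bounded_fun_def
    proof (intro conjI allI)
      show "(\<lambda>(t, x). v t x + w t x) \<in> borel_measurable (borel \<Otimes>\<^sub>M borel)" by measurable
      show "\<bar>v t x + w t x\<bar> \<le> M + M'" for t x using bounded_funD(3)[OF bv, of t x] bounded_funD(3)[OF bw, of t x] by linarith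
    qed
    fix \<phi> :: "real^'n \<Rightarrow> real" assume \<phi>: "csmooth \<phi>"
    note i = integrable_mult_bounded[OF csmooth_integrable[OF \<phi>]]
    have f: "flux (b s) (G s) \<phi> (\<lambda>x. v s x + w s x) = flux (b s) (G s) \<phi> (v s) + flux (b s) (G s) \<phi> (w s)" for s
      unfolding flux_def distrib_left
      by (rule LINT_add[OF flux_integrand[OF \<phi> bounded_funD(2,3)[OF bv]] flux_integrand[OF \<phi> bounded_funD(2,3)[OF bw]]])
    have p: "prim (\<lambda>s. flux (b s) (G s) \<phi> (\<lambda>x. v s x + w s x)) t = prim (\<lambda>s. flux (b s) (G s) \<phi> (v s)) t + prim (\<lambda>s. flux (b s) (G s) \<phi> (w s)) t" for t
      unfolding f by (rule prim_add[OF flux_time_integrable[OF \<phi> bv] flux_time_integrable[OF \<phi> bw]])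
    have e: "(LINT x|lborel. (v t x + w t x) * \<phi> x) = (LINT x|lborel. v t x * \<phi> x) + (LINT x|lborel. w t x * \<phi> x)" for t
      unfolding distrib_right using i[OF bounded_funD(2,3)[OF bv], of t] i[OF bounded_funD(2,3)[OF bw], of t]
      by (intro LINT_add) (simp_all add: mult.commute)
    have e0: "(LINT x|lborel. (v0 x + w0 x) * \<phi> x) = (LINT x|lborel. v0 x * \<phi> x) + (LINT x|lborel. w0 x * \<phi> x)"
      unfolding distrib_right using i[OF solD(1,2)[OF v]] i[OF solD(1,2)[OF w]]
      by (intro LINT_add) (simp_all add: mult.commute)
    show "AE t in lborel. 0 < t \<longrightarrow> t < T \<longrightarrow> (LINT x|lborel. (v t x + w t x) * \<phi> x)
      = (LINT x|lborel. (v0 x + w0 x) * \<phi> x) + prim (\<lambda>s. flux (b s) (G s) \<phi> (\<lambda>x. v s x + w s x)) t"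
      using solD(4)[OF v \<phi>] solD(4)[OF w \<phi>] by eventually_elim (simp add: p e e0)
  qed
qed

text \<open>For constants the flux is the divergence identity \<open>jac_divergence\<close>: the
  equation is in transport form, with the term in div b compensating the divergence form.\<close>

lemma sol_const: "sol (\<lambda>x. c) (\<lambda>t x. c) \<bar>c\<bar>"
  unfolding sol_def
proof (intro conjI allI impI)
  show "bounded_fun (\<lambda>t x. c) \<bar>c\<bar>" unfolding bounded_fun_def by auto
  fix \<phi> :: "real^'n \<Rightarrow> real" assume \<phi>: "csmooth \<phi>"
  have "flux (b s) (G s) \<phi> (\<lambda>x. c) = 0" for s
    using jac_divergence(3)[OF jac \<phi>, of s] by (simp add: flux_def)
  then show "AE t in lborel. 0 < t \<longrightarrow> t < T \<longrightarrow> (LINT x|lborel. c * \<phi> x) = (LINT x|lborel. c * \<phi> x) + prim (\<lambda>s. flux (b s) (G s) \<phi> (\<lambda>x. c)) t"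
    by (simp add: prim_def)
qed auto

lemma sol_mult':
  assumes v: "sol v0 v M" and w: "sol w0 w M'"
  shows "\<exists>K. sol (\<lambda>x. v0 x * w0 x) (\<lambda>t x. v t x * w t x) K"
  using sol_mult[OF sol_mono[OF v, of "max M M'"] sol_mono[OF w, of "max M M'"]] by auto

lemma sol_polynomial:
  assumes "real_polynomial_function q" and v: "sol v0 v M"
  shows "\<exists>K. sol (\<lambda>x. q (v0 x)) (\<lambda>t x. q (v t x)) K"
  using assms(1)
proof (induction q)
  case (linear f)
  have f: "f y = f 1 * y" for y :: real
    using linear_scale[OF bounded_linear.linear[OF linear], of y 1] by (simp add: mult.commute)
  show ?case using sol_mult'[OF sol_const[of "f 1"] v] by (subst (1 2) f)
next
  case (const c)
  then show ?case using sol_const by blast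
next
  case (add f g)
  then show ?case using sol_add by blast
next
  case (mult f g)
  then show ?case using sol_mult' by blast
qed

text \<open>Pointwise limits under one bound M pass through the spatial integrals by dominated
  convergence, and through the time integral with majorant C M \<open>mass\<close>.\<close>

lemma sol_limit:
  assumes s: "\<And>k. sol (v0k k) (vk k) M"
    and l0: "\<And>x. (\<lambda>k. v0k k x) \<longlonglongrightarrow> v0 x" and l: "\<And>t x. (\<lambda>k. vk k t x) \<longlonglongrightarrow> v t x"
  shows "sol v0 v M"
proof -
  note b = solD(3)[OF s]
  have bl: "\<bar>z\<bar> \<le> M" if "\<And>k. \<bar>Z k\<bar> \<le> M" "Z \<longlonglongrightarrow> z" for Z :: "nat \<Rightarrow> real" and z
    using LIMSEQ_le_const2[OF tendsto_rabs[OF that(2)]] that(1) by blast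
  have v0m[measurable]: "v0 \<in> borel_measurable borel"
    by (rule borel_measurable_LIMSEQ_real[OF l0 solD(1)[OF s]])
  have vm: "case_prod v \<in> borel_measurable (borel \<Otimes>\<^sub>M borel)"
    by (rule borel_measurable_LIMSEQ_real[OF _ bounded_funD(1)[OF b]]) (use l in auto)
  have bv: "bounded_fun v M" unfolding bounded_fun_def
    using vm bl[OF bounded_funD(3)[OF b] l] by blast
  show ?thesis unfolding sol_def
  proof (intro conjI allI impI v0m bv)
    show "\<bar>v0 x\<bar> \<le> M" for x by (rule bl[OF solD(2)[OF s] l0])
    fix \<phi> :: "real^'n \<Rightarrow> real" assume \<phi>: "csmooth \<phi>"
    note [measurable] = csmooth_borel[OF \<phi>] borel_fd[OF \<phi>] bounded_funD(1)[OF b] bounded_funD(1)[OF bv]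
    have dc: "(\<lambda>k. LINT x|lborel. F x * z k x) \<longlonglongrightarrow> (LINT x|lborel. F x * y x)"
      if F: "integrable lborel F" and z: "\<And>k. z k \<in> borel_measurable borel" "\<And>k x. \<bar>z k x\<bar> \<le> M" "\<And>x. (\<lambda>k. z k x) \<longlonglongrightarrow> y x"
        and y: "y \<in> borel_measurable borel" for F y :: "real^'n \<Rightarrow> real" and z
    proof (rule integral_dominated_convergence[where w = "\<lambda>x. \<bar>F x\<bar> * M"])
      note [measurable] = borel_measurable_integrable[OF F, simplified] z(1) y
      show "(\<lambda>x. F x * y x) \<in> borel_measurable lborel" "\<And>k. (\<lambda>x. F x * z k x) \<in> borel_measurable lborel" by measurable
      show "integrable lborel (\<lambda>x. \<bar>F x\<bar> * M)" by (intro integrable_mult_left integrable_abs F)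
      show "AE x in lborel. (\<lambda>k. F x * z k x) \<longlonglongrightarrow> F x * y x" by (intro AE_I2 tendsto_intros z)
      show "AE x in lborel. norm (F x * z k x) \<le> \<bar>F x\<bar> * M" for k by (intro AE_I2) (auto simp: abs_mult intro!: mult_left_mono z)
    qed
    have F: "integrable lborel (\<lambda>x. fd \<phi> x (b s x) + trace (G s x) * \<phi> x)" for s
      by (intro L1_add jac_divergence[OF jac \<phi>])
    have fl: "(\<lambda>k. flux (b s) (G s) \<phi> (vk k s)) \<longlonglongrightarrow> flux (b s) (G s) \<phi> (v s)" for s
      unfolding flux_def by (rule dc[OF F bounded_funD(2,3)[OF b] l bounded_funD(2)[OF bv]])
    obtain C r where C0: "0 < C" and C: "\<And>b G v M. jac b G \<Longrightarrow> \<forall>x. \<bar>v x\<bar> \<le> M \<Longrightarrow> ennreal \<bar>flux b G \<phi> v\<bar>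
        \<le> ennreal (C * M) * (NNINT y. indicator (cball 0 r) y * ennreal (norm (b y) + norm (G y)))"
      using flux_bound[OF \<phi>] by blast
    have M0: "0 \<le> M" using solD(2)[OF s[of 0], of 0] by linarith
    have massfin: "AE s in lborel. mass r s \<noteq> \<infinity>"
    proof (rule nn_integral_PInf_AE)
      show "(NNINT s. mass r s) \<noteq> \<infinity>" using fin[of r] by (simp only: mass_def)
    qed measurable
    let ?W = "\<lambda>s. C * M * enn2real (mass r s)"
    have Wi: "integrable lborel ?W"
    proof (intro integrable_mult_right)
      show "integrable lborel (\<lambda>s. enn2real (mass r s))"
      proof (rule time_integrableI)
        show "ennreal \<bar>enn2real (mass r s)\<bar> \<le> ennreal 1 * mass r s" for s
          by (cases "mass r s") auto
      qed measurable
    qed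
    have pl: "(\<lambda>k. prim (\<lambda>s. flux (b s) (G s) \<phi> (vk k s)) t) \<longlonglongrightarrow> prim (\<lambda>s. flux (b s) (G s) \<phi> (v s)) t" for t
    proof (rule prim_dominated_convergence[OF _ _ Wi])
      show "(\<lambda>s. flux (b s) (G s) \<phi> (v s)) \<in> borel_measurable borel" "\<And>k. (\<lambda>s. flux (b s) (G s) \<phi> (vk k s)) \<in> borel_measurable borel"
        using borel_measurable_integrable[OF flux_time_integrable[OF \<phi> bv]] borel_measurable_integrable[OF flux_time_integrable[OF \<phi> b]] by auto
      show "AE s in lborel. (\<lambda>k. flux (b s) (G s) \<phi> (vk k s)) \<longlonglongrightarrow> flux (b s) (G s) \<phi> (v s)" using fl by simp
      show "AE s in lborel. \<bar>flux (b s) (G s) \<phi> (vk k s)\<bar> \<le> ?W s" for k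
        using massfin
      proof eventually_elim
        case (elim s)
        have "ennreal \<bar>flux (b s) (G s) \<phi> (vk k s)\<bar> \<le> ennreal (C * M) * mass r s"
          unfolding mass_def by (rule C[OF jac]) (use bounded_funD(3)[OF b] in blast)
        also have "mass r s = ennreal (enn2real (mass r s))" using elim by (simp add: less_top)
        also have "ennreal (C * M) * \<dots> = ennreal (C * M * enn2real (mass r s))"
          by (rule ennreal_mult''[symmetric]) simp
        finally show ?case using C0 M0 by simp
      qed
    qed
    have "AE t in lborel. \<forall>k. 0 < t \<longrightarrow> t < T \<longrightarrow>
       (LINT x|lborel. vk k t x * \<phi> x) = (LINT x|lborel. v0k k x * \<phi> x) + prim (\<lambda>s. flux (b s) (G s) \<phi> (vk k s)) t"
      unfolding AE_all_countable using solD(4)[OF s \<phi>] by blast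
    then show "AE t in lborel. 0 < t \<longrightarrow> t < T \<longrightarrow>
       (LINT x|lborel. v t x * \<phi> x) = (LINT x|lborel. v0 x * \<phi> x) + prim (\<lambda>s. flux (b s) (G s) \<phi> (v s)) t"
    proof eventually_elim
      case (elim t)
      show ?case
      proof (intro impI)
        assume t: "0 < t" "t < T"
        have 1: "(\<lambda>k. LINT x|lborel. \<phi> x * vk k t x) \<longlonglongrightarrow> (LINT x|lborel. \<phi> x * v t x)"
          by (rule dc[OF csmooth_integrable[OF \<phi>] bounded_funD(2,3)[OF b] l bounded_funD(2)[OF bv]])
        have 2: "(\<lambda>k. LINT x|lborel. \<phi> x * v0k k x) \<longlonglongrightarrow> (LINT x|lborel. \<phi> x * v0 x)"
          by (rule dc[OF csmooth_integrable[OF \<phi>] solD(1,2)[OF s] l0 v0m])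
        have "(\<lambda>k. LINT x|lborel. \<phi> x * vk k t x) \<longlonglongrightarrow> (LINT x|lborel. \<phi> x * v0 x) + prim (\<lambda>s. flux (b s) (G s) \<phi> (v s)) t"
          using tendsto_add[OF 2 pl[of t]] elim t by (simp add: mult.commute)
        from LIMSEQ_unique[OF this 1]
        show "(LINT x|lborel. v t x * \<phi> x) = (LINT x|lborel. v0 x * \<phi> x) + prim (\<lambda>s. flux (b s) (G s) \<phi> (v s)) t"
          by (simp add: mult.commute)
      qed
    qed
  qed
qed

text \<open>Renormalization: products of solutions are solutions, hence so are polynomials and, by
  the Weierstrass theorem, continuous functions of a solution.\<close>

lemma sol_continuous:
  assumes v: "sol v0 v M" and \<beta>: "continuous_on UNIV \<beta>" and B: "\<And>y. \<bar>y\<bar> \<le> M \<Longrightarrow> \<bar>\<beta> y\<bar> \<le> B"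
  shows "sol (\<lambda>x. \<beta> (v0 x)) (\<lambda>t x. \<beta> (v t x)) (B + 1)"
proof -
  have "\<exists>q. real_polynomial_function q \<and> (\<forall>y\<in>{-M..M}. \<bar>\<beta> y - q y\<bar> < 1 / real (Suc k))" for k
    by (rule Stone_Weierstrass_real_polynomial_function[of "{-M..M}" \<beta> "1 / real (Suc k)"])
      (auto intro: continuous_on_subset[OF \<beta>])
  then obtain q where q: "\<And>k. real_polynomial_function (q k)" "\<And>k y. \<bar>y\<bar> \<le> M \<Longrightarrow> \<bar>\<beta> y - q k y\<bar> < 1 / real (Suc k)"
    by (metis abs_le_iff atLeastAtMost_iff minus_le_iff)
  have ql: "(\<lambda>k. q k y) \<longlonglongrightarrow> \<beta> y" if "\<bar>y\<bar> \<le> M" for y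
  proof (rule LIM_zero_cancel, rule Lim_null_comparison[OF _ LIMSEQ_Suc[OF lim_inverse_n']])
    show "\<forall>\<^sub>F k in sequentially. norm (q k y - \<beta> y) \<le> 1 / real (Suc k)"
      using q(2)[OF that] by (intro always_eventually allI) (simp add: abs_minus_commute less_imp_le)
  qed
  have qb: "\<bar>q k y\<bar> \<le> B + 1" if "\<bar>y\<bar> \<le> M" for k y
  proof -
    have "1 / real (Suc k) \<le> 1" by simp
    then show ?thesis using q(2)[OF that, of k] B[OF that] by linarith
  qed
  show ?thesis
  proof (rule sol_limit[where vk = "\<lambda>k t x. q k (v t x)" and v0k = "\<lambda>k x. q k (v0 x)"])
    fix k
    \<comment> \<open>Only the integral identity is taken from K. The bound B + 1, common to all k,
      comes from the closeness of q k to \<beta> on [-M, M].\<close>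
    obtain K where K: "sol (\<lambda>x. q k (v0 x)) (\<lambda>t x. q k (v t x)) K" using sol_polynomial[OF q(1) v] by blast
    show "sol (\<lambda>x. q k (v0 x)) (\<lambda>t x. q k (v t x)) (B + 1)"
      using K qb solD(2)[OF v] bounded_funD(3)[OF solD(3)[OF v]] by (auto simp: sol_def bounded_fun_def)
  qed (use ql solD(2)[OF v] bounded_funD(3)[OF solD(3)[OF v]] in auto)
qed

end

section \<open>Cut-offs and the global balance\<close>

definition cutoff :: "nat \<Rightarrow> 'a::euclidean_space \<Rightarrow> real" where
  "cutoff j x = ball_bump ((1 / real (Suc j)) *\<^sub>R x) / ball_bump (0::'a)"

lemma csmooth_cutoff: "csmooth (cutoff j :: 'a::euclidean_space \<Rightarrow> real)"
  using csmooth_const_mult[OF csmooth_affine[OF csmooth_ball_bump, of "1 / real (Suc j)" "0::'a"], of "1 / ball_bump (0::'a)"]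
  by (simp add: cutoff_def[abs_def])

lemma cutoff_nonneg: "0 \<le> cutoff j x" and cutoff_le_1: "cutoff j (x::'a::euclidean_space) \<le> 1"
  using ball_bump_pos[of "0::'a"] ball_bump_nonneg[of "(1 / real (Suc j)) *\<^sub>R x"] ball_bump_le[of "(1 / real (Suc j)) *\<^sub>R x"]
  by (auto simp: cutoff_def divide_le_eq intro!: divide_nonneg_nonneg)

lemma cutoff_tendsto: "(\<lambda>j. cutoff j (x::'a::euclidean_space)) \<longlonglongrightarrow> 1"
proof -
  have l: "(\<lambda>j. (1 / real (Suc j)) *\<^sub>R x) \<longlonglongrightarrow> 0 *\<^sub>R x"
    by (intro tendsto_intros LIMSEQ_Suc[OF lim_inverse_n'])
  have "isCont (ball_bump :: 'a \<Rightarrow> real) 0"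
    using csmooth_continuous[OF csmooth_ball_bump[where 'a='a]] by (simp add: continuous_on_eq_continuous_at)
  then have "(\<lambda>j. ball_bump ((1 / real (Suc j)) *\<^sub>R x)) \<longlonglongrightarrow> ball_bump (0::'a)"
    using isCont_tendsto_compose[OF _ l] by simp
  then have "(\<lambda>j. ball_bump ((1 / real (Suc j)) *\<^sub>R x) / ball_bump (0::'a)) \<longlonglongrightarrow> ball_bump (0::'a) / ball_bump (0::'a)"
    by (intro tendsto_intros) (use ball_bump_pos[of "0::'a"] in auto)
  then show ?thesis using ball_bump_pos[of "0::'a"] by (simp add: cutoff_def)
qed

text \<open>The first bound makes the gradient term vanish pointwise as j grows. The second is
  independent of j and matches the growth hypothesis on b: the derivative lives where |x| \<le> j +
  1, and there 1/(j+1) \<le> 2/(1 + |x|).\<close>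

lemma fd_cutoff_bound:
  "\<exists>C>0. \<forall>j x h. \<bar>fd (cutoff j) (x::'a::euclidean_space) h\<bar> \<le> C * norm h / real (Suc j)
     \<and> \<bar>fd (cutoff j) x h\<bar> \<le> C * (norm h / (1 + norm x))"
proof -
  obtain C where C: "0 < C" "\<And>(x::'a) h. \<bar>fd (cutoff 0) x h\<bar> \<le> C * norm h"
    using csmooth_deriv_bounded[OF csmooth_cutoff] by metis
  have D: "fd (cutoff j) (x::'a) h = fd (cutoff 0) ((1 / real (Suc j)) *\<^sub>R x) h / real (Suc j)" for j x h
  proof -
    have "cutoff j = (\<lambda>x::'a. cutoff 0 (0 + (1 / real (Suc j)) *\<^sub>R x))" by (simp add: cutoff_def fun_eq_iff)
    then have "fd (cutoff j) x h = fd (\<lambda>x::'a. cutoff 0 (0 + (1 / real (Suc j)) *\<^sub>R x)) x h" by simp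
    also have "\<dots> = (1 / real (Suc j)) * fd (cutoff 0) (0 + (1 / real (Suc j)) *\<^sub>R x) h"
      by (rule fd_affine[OF csmooth_smooth[OF csmooth_cutoff]])
    finally show ?thesis by simp
  qed
  have 1: "\<bar>fd (cutoff j) (x::'a) h\<bar> \<le> C * norm h / real (Suc j)" for j x h
    using C(2)[of "(1 / real (Suc j)) *\<^sub>R x" h] by (subst D) (simp add: abs_divide divide_right_mono)
  have 2: "\<bar>fd (cutoff j) (x::'a) h\<bar> \<le> 2 * C * (norm h / (1 + norm x))" for j x h
  proof (cases "norm x \<le> real (Suc j)")
    case True
    have n: "0 < 1 + norm x" by (simp add: add_pos_nonneg)
    have "1 + norm x \<le> 2 * real (Suc j)" using True by simp
    then have "2 / (2 * real (Suc j)) \<le> 2 / (1 + norm x)"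
      by (rule divide_left_mono) (use n in \<open>auto intro!: mult_pos_pos\<close>)
    moreover have "2 / (2 * real (Suc j)) = 1 / real (Suc j)" by (simp del: of_nat_Suc)
    ultimately have "1 / real (Suc j) \<le> 2 / (1 + norm x)" by (simp only:)
    then have "C * norm h * (1 / real (Suc j)) \<le> C * norm h * (2 / (1 + norm x))"
      using C by (intro mult_left_mono) auto
    then show ?thesis using 1[of j x h] by (simp add: mult_ac)
  next
    case False
    have "cutoff j z = 0" if "real (Suc j) \<le> norm z" for z :: 'a
      using that by (simp add: cutoff_def ball_bump_zero del: of_nat_Suc)
    then have "fd (cutoff j) x h = 0" using False by (intro csmooth_fd_zero[of "real (Suc j)"]) auto
    moreover have "0 \<le> 2 * C * (norm h / (1 + norm x))"
      using C by (intro mult_nonneg_nonneg divide_nonneg_nonneg) (auto simp: add_nonneg_nonneg)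
    ultimately show ?thesis by simp
  qed
  have 3: "C * norm h / real (Suc j) \<le> 2 * C * norm h / real (Suc j)" for j and h :: 'a
    using C by (intro divide_right_mono mult_right_mono) auto
  show ?thesis
  proof (rule exI[of _ "2 * C"], intro conjI allI)
    show "0 < 2 * C" using C by simp
    show "\<bar>fd (cutoff j) x h\<bar> \<le> 2 * C * norm h / real (Suc j)" for j and x h :: 'a
      by (rule order_trans[OF 1 3])
    show "\<bar>fd (cutoff j) x h\<bar> \<le> 2 * C * (norm h / (1 + norm x))" for j and x h :: 'a by (rule 2)
  qed
qed

context transport
begin

text \<open>The equation is tested with cut-offs tending to 1. The gradient term is dominated by
  |b|/(1 + |x|), the divergence term by |G| on the ball of radius R, which carries it. Nonnegativity
  of w yields integrability of w t.\<close>

lemma energy: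
  assumes w: "sol w0 w M" and nn: "\<And>t x. 0 \<le> w t x" and w0i: "integrable lborel w0"
    and growth: "(NNINT t. NNINT x. ennreal (norm (b t x) / (1 + norm x))) < \<infinity>"
    and supp: "\<And>t. AE x in lborel. R < norm x \<longrightarrow> trace (G t x) = 0"
  shows "integrable lborel (\<lambda>s. LINT x|lborel. trace (G s x) * w s x)"
    and "AE t in lborel. 0 < t \<longrightarrow> t < T \<longrightarrow> integrable lborel (w t) \<and>
      (LINT x|lborel. w t x) = (LINT x|lborel. w0 x) + prim (\<lambda>s. LINT x|lborel. trace (G s x) * w s x) t"
proof -
  note bw = solD(3)[OF w]
  note [measurable] = solD(1)[OF w] bounded_funD(1)[OF bw] borel_fd[OF csmooth_cutoff] csmooth_borel[OF csmooth_cutoff]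
  have M0: "0 \<le> M" using solD(2)[OF w, of 0] by linarith
  let ?N = "real CARD('n)"
  obtain C where C0: "0 < C" and C: "\<And>j (x::real^'n) h. \<bar>fd (cutoff j) x h\<bar> \<le> C * norm h / real (Suc j)"
     "\<And>j (x::real^'n) h. \<bar>fd (cutoff j) x h\<bar> \<le> C * (norm h / (1 + norm x))"
    using fd_cutoff_bound[where 'a="real^'n"] by blast
  define gr where "gr s = (NNINT x. ennreal (norm (b s x) / (1 + norm x)))" for s
  have grm[measurable]: "gr \<in> borel_measurable borel" unfolding gr_def[abs_def] by measurable
  have "AE s in lborel. gr s \<noteq> \<infinity>"
  proof (rule nn_integral_PInf_AE)
    show "(NNINT s. gr s) \<noteq> \<infinity>" using growth by (simp only: gr_def)
  qed measurable
  moreover have "AE s in lborel. mass R s \<noteq> \<infinity>"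
  proof (rule nn_integral_PInf_AE)
    show "(NNINT s. mass R s) \<noteq> \<infinity>" using fin[of R] by (simp only: mass_def)
  qed measurable
  ultimately have finAE: "AE s in lborel. gr s < \<infinity> \<and> mass R s < \<infinity>"
    by eventually_elim (simp add: less_top)
  \<comment> \<open>A majorant in x common to all j, for the gradient part and for the divergence
    part; W below is the corresponding majorant in time.\<close>
  define D where "D s x = C * (norm (b s x) / (1 + norm x)) + ?N * (indicator (cball 0 R) x * norm (G s x))" for s x
  have Dm[measurable]: "case_prod D \<in> borel_measurable (borel \<Otimes>\<^sub>M borel)" unfolding D_def by measurable
  have D0: "0 \<le> D s x" for s x using C0 by (simp add: D_def add_nonneg_nonneg)
  have Dint: "(NNINT x. ennreal (D s x)) \<le> ennreal C * gr s + ennreal ?N * mass R s" for s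
  proof -
    have "(NNINT x. ennreal (D s x)) = (NNINT x. ennreal C * ennreal (norm (b s x) / (1 + norm x)) + ennreal ?N * (indicator (cball 0 R) x * ennreal (norm (G s x))))"
    proof (intro nn_integral_cong)
      fix x :: "real^'n"
      have a: "0 \<le> norm (b s x) / (1 + norm x)" by (intro divide_nonneg_nonneg add_nonneg_nonneg) auto
      have p: "0 \<le> C * (norm (b s x) / (1 + norm x))" using C0 a by (intro mult_nonneg_nonneg) auto
      have "ennreal (D s x) = ennreal (C * (norm (b s x) / (1 + norm x))) + ennreal (?N * (indicator (cball 0 R) x * norm (G s x)))"
        unfolding D_def by (rule ennreal_plus[OF p]) simp
      also have "ennreal (C * (norm (b s x) / (1 + norm x))) = ennreal C * ennreal (norm (b s x) / (1 + norm x))"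
        by (rule ennreal_mult[OF less_imp_le[OF C0] a])
      also have "ennreal (?N * (indicator (cball 0 R) x * norm (G s x))) = ennreal ?N * ennreal (indicator (cball 0 R) x * norm (G s x))"
        by (rule ennreal_mult) auto
      finally have "ennreal (D s x) = ennreal C * ennreal (norm (b s x) / (1 + norm x)) + ennreal ?N * ennreal (indicator (cball 0 R) x * norm (G s x))" .
      then show "ennreal (D s x) = ennreal C * ennreal (norm (b s x) / (1 + norm x)) + ennreal ?N * (indicator (cball 0 R) x * ennreal (norm (G s x)))"
        by (simp add: indicator_def)
    qed
    also have "\<dots> = ennreal C * gr s + ennreal ?N * (NNINT x. indicator (cball 0 R) x * ennreal (norm (G s x)))"
      unfolding gr_def by (subst nn_integral_add, measurable, subst nn_integral_cmult, measurable, subst nn_integral_cmult, measurable)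
    also have "(NNINT x. indicator (cball 0 R) x * ennreal (norm (G s x))) \<le> mass R s"
      unfolding mass_def by (intro nn_integral_mono mult_left_mono ennreal_leI) auto
    finally show ?thesis by (simp add: mult_left_mono)
  qed
  have Di: "integrable lborel (D s)" if "gr s < \<infinity> \<and> mass R s < \<infinity>" for s
    unfolding integrable_iff_bounded
  proof
    have "(NNINT x. ennreal (norm (D s x))) \<le> ennreal C * gr s + ennreal ?N * mass R s"
      using Dint[of s] D0 by simp
    also have "\<dots> < \<infinity>" using that by (simp add: ennreal_mult_less_top)
    finally show "(NNINT x. ennreal (norm (D s x))) < \<infinity>" .
  qed measurable
  define h where "h s = (LINT x|lborel. trace (G s x) * w s x)" for s
  have [measurable]: "h \<in> borel_measurable borel" unfolding h_def[abs_def] by measurable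
  have pw: "AE x in lborel. \<bar>trace (G s x)\<bar> \<le> D s x" for s
    using supp[of s]
  proof eventually_elim
    case (elim x)
    show ?case
    proof (cases "norm x \<le> R")
      case True
      then show ?thesis using trace_le[of "G s x"] C0 by (simp add: D_def add_nonneg_nonneg add_increasing)
    qed (use elim D0 in auto)
  qed
  have fluxD: "AE x in lborel. \<bar>(fd (cutoff j) x (b s x) + trace (G s x) * cutoff j x) * w s x\<bar> \<le> 2 * D s x * M" for j s
    using pw[of s]
  proof eventually_elim
    case (elim x)
    have "\<bar>fd (cutoff j) x (b s x)\<bar> \<le> D s x"
      using C(2)[of j x "b s x"] by (simp add: D_def add_increasing2)
    moreover have "\<bar>trace (G s x) * cutoff j x\<bar> \<le> D s x * 1"
      unfolding abs_mult using elim cutoff_nonneg[of j x] cutoff_le_1[of j x] D0 by (intro mult_mono) auto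
    ultimately have "\<bar>fd (cutoff j) x (b s x) + trace (G s x) * cutoff j x\<bar> \<le> 2 * D s x" by linarith
    then show ?case unfolding abs_mult using D0
      by (intro mult_mono bounded_funD(3)[OF bw]) auto
  qed
  have fluxlim: "(\<lambda>j. flux (b s) (G s) (cutoff j) (w s)) \<longlonglongrightarrow> h s" if "gr s < \<infinity> \<and> mass R s < \<infinity>" for s
    unfolding flux_def h_def
  proof (rule integral_dominated_convergence[where w = "\<lambda>x. 2 * D s x * M"])
    show "integrable lborel (\<lambda>x. 2 * D s x * M)" by (intro integrable_mult_left integrable_mult_right Di that)
    have "(\<lambda>j. (fd (cutoff j) x (b s x) + trace (G s x) * cutoff j x) * w s x) \<longlonglongrightarrow> (0 + trace (G s x) * 1) * w s x" for x
    proof (intro tendsto_intros cutoff_tendsto)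
      have "(\<lambda>j. C * norm (b s x) * (1 / real (Suc j))) \<longlonglongrightarrow> C * norm (b s x) * 0"
        by (intro tendsto_intros LIMSEQ_Suc[OF lim_inverse_n'])
      then have "(\<lambda>j. C * norm (b s x) / real (Suc j)) \<longlonglongrightarrow> 0" by simp
      then show "(\<lambda>j. fd (cutoff j) x (b s x)) \<longlonglongrightarrow> 0"
        by (rule Lim_null_comparison[rotated]) (use C(1) in auto)
    qed
    then show "AE x in lborel. (\<lambda>j. (fd (cutoff j) x (b s x) + trace (G s x) * cutoff j x) * w s x) \<longlonglongrightarrow> trace (G s x) * w s x"
      by simp
    show "AE x in lborel. norm ((fd (cutoff j) x (b s x) + trace (G s x) * cutoff j x) * w s x) \<le> 2 * D s x * M" for j
      using fluxD by simp
  qed measurable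
  define W where "W s = 2 * M * (C * enn2real (gr s) + ?N * enn2real (mass R s))" for s
  have Wi: "integrable lborel W"
  proof -
    have "integrable lborel (\<lambda>s. enn2real (gr s))" unfolding integrable_iff_bounded
    proof
      have "(NNINT s. ennreal (norm (enn2real (gr s)))) \<le> (NNINT s. gr s)"
      proof (rule nn_integral_mono)
        fix s show "ennreal (norm (enn2real (gr s))) \<le> gr s" by (cases "gr s") auto
      qed
      also have "\<dots> < \<infinity>" using growth by (simp only: gr_def)
      finally show "(NNINT s. ennreal (norm (enn2real (gr s)))) < \<infinity>" .
    qed measurable
    moreover have "integrable lborel (\<lambda>s. enn2real (mass R s))"
    proof (rule time_integrableI)
      show "ennreal \<bar>enn2real (mass R s)\<bar> \<le> ennreal 1 * mass R s" for s
        by (cases "mass R s") auto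
    qed measurable
    ultimately show ?thesis unfolding W_def[abs_def]
      by (intro integrable_mult_right L1_add)
  qed
  have DW: "(LINT x|lborel. 2 * D s x * M) \<le> W s" if "gr s < \<infinity> \<and> mass R s < \<infinity>" for s
  proof -
    have "ennreal (LINT x|lborel. D s x) = (NNINT x. ennreal (D s x))"
      by (rule nn_integral_eq_integral[OF Di[OF that], symmetric]) (simp add: D0)
    also have "\<dots> \<le> ennreal C * gr s + ennreal ?N * mass R s" by (rule Dint)
    also have "\<dots> = ennreal (C * enn2real (gr s) + ?N * enn2real (mass R s))"
      using that C0 by (cases "gr s"; cases "mass R s") (auto simp: ennreal_mult)
    finally have "(LINT x|lborel. D s x) \<le> C * enn2real (gr s) + ?N * enn2real (mass R s)"
      using C0 by (subst (asm) ennreal_le_iff) (auto simp: add_nonneg_nonneg)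
    then have "(2 * M) * (LINT x|lborel. D s x) \<le> W s" unfolding W_def using M0 by (intro mult_left_mono) auto
    then show ?thesis by (simp add: mult_ac)
  qed
  have bnd: "\<bar>\<integral>x. f x \<partial>lborel\<bar> \<le> W s"
    if s: "gr s < \<infinity> \<and> mass R s < \<infinity>" and le: "AE x in lborel. \<bar>f x\<bar> \<le> 2 * D s x * M" for f s
  proof (cases "integrable lborel f")
    case True
    have i: "integrable lborel (\<lambda>x. 2 * D s x * M)" by (intro integrable_mult_left integrable_mult_right Di s)
    have "\<bar>\<integral>x. f x \<partial>lborel\<bar> \<le> (LINT x|lborel. \<bar>f x\<bar>)" using integral_norm_bound[of lborel f] by simp
    also have "\<dots> \<le> (LINT x|lborel. 2 * D s x * M)" by (rule integral_mono_AE[OF integrable_abs[OF True] i le])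
    also have "\<dots> \<le> W s" by (rule DW[OF s])
    finally show ?thesis .
  next
    case False
    have "0 \<le> W s" using C0 M0 by (auto simp: W_def intro!: mult_nonneg_nonneg add_nonneg_nonneg)
    then show ?thesis by (simp add: not_integrable_integral_eq[OF False])
  qed
  have hW: "AE s in lborel. \<bar>h s\<bar> \<le> W s"
    using finAE
  proof eventually_elim
    case (elim s)
    show ?case unfolding h_def
    proof (rule bnd[OF elim])
      show "AE x in lborel. \<bar>trace (G s x) * w s x\<bar> \<le> 2 * D s x * M"
        using pw[of s]
      proof eventually_elim
        case (elim x)
        then have "\<bar>trace (G s x)\<bar> * \<bar>w s x\<bar> \<le> (2 * D s x) * M"
          using D0[of s x] by (intro mult_mono bounded_funD(3)[OF bw]) auto
        then show ?case by (simp add: abs_mult)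
      qed
    qed
  qed
  show hi: "integrable lborel (\<lambda>s. LINT x|lborel. trace (G s x) * w s x)"
    unfolding h_def[symmetric] by (rule L1_bound[OF Wi]) (measurable, use hW in \<open>eventually_elim, auto\<close>)
  have fluxW: "AE s in lborel. \<bar>flux (b s) (G s) (cutoff j) (w s)\<bar> \<le> W s" for j
    using finAE
  proof eventually_elim
    case (elim s)
    show ?case unfolding flux_def by (rule bnd[OF elim fluxD])
  qed
  have pl: "(\<lambda>j. prim (\<lambda>s. flux (b s) (G s) (cutoff j) (w s)) t) \<longlonglongrightarrow> prim h t" for t
  proof (rule prim_dominated_convergence[OF _ _ Wi])
    show "(\<lambda>s. flux (b s) (G s) (cutoff j) (w s)) \<in> borel_measurable borel" for j
      using borel_measurable_integrable[OF flux_time_integrable[OF csmooth_cutoff bw]] by simp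
    show "AE s in lborel. (\<lambda>j. flux (b s) (G s) (cutoff j) (w s)) \<longlonglongrightarrow> h s"
      using finAE by eventually_elim (rule fluxlim)
  qed (use fluxW in auto)
  have l0: "(\<lambda>j. LINT x|lborel. w0 x * cutoff j x) \<longlonglongrightarrow> (LINT x|lborel. w0 x)"
  proof (rule integral_dominated_convergence[where w = "\<lambda>x. \<bar>w0 x\<bar>"])
    show "AE x in lborel. (\<lambda>j. w0 x * cutoff j x) \<longlonglongrightarrow> w0 x"
      using tendsto_mult[OF tendsto_const cutoff_tendsto] by (intro AE_I2) fastforce
    show "AE x in lborel. norm (w0 x * cutoff j x) \<le> \<bar>w0 x\<bar>" for j
    proof (rule AE_I2)
      fix x :: "real^'n"
      have "\<bar>cutoff j x\<bar> \<le> 1" using cutoff_nonneg[of j x] cutoff_le_1[of j x] by simp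
      then show "norm (w0 x * cutoff j x) \<le> \<bar>w0 x\<bar>" by (simp add: abs_mult mult_left_le)
    qed
  qed (use w0i in \<open>auto intro: integrable_abs\<close>)
  have "AE t in lborel. \<forall>j. 0 < t \<longrightarrow> t < T \<longrightarrow>
      (LINT x|lborel. w t x * cutoff j x) = (LINT x|lborel. w0 x * cutoff j x) + prim (\<lambda>s. flux (b s) (G s) (cutoff j) (w s)) t"
    unfolding AE_all_countable using solD(4)[OF w csmooth_cutoff] by blast
  then show "AE t in lborel. 0 < t \<longrightarrow> t < T \<longrightarrow> integrable lborel (w t) \<and>
      (LINT x|lborel. w t x) = (LINT x|lborel. w0 x) + prim (\<lambda>s. LINT x|lborel. trace (G s x) * w s x) t"
  proof eventually_elim
    case (elim t)
    show ?case
    proof (intro impI)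
      assume t: "0 < t" "t < T"
      note [measurable] = bounded_funD(2)[OF bw, of t]
      let ?L = "(LINT x|lborel. w0 x) + prim h t"
      have lim: "(\<lambda>j. LINT x|lborel. w t x * cutoff j x) \<longlonglongrightarrow> ?L"
        using tendsto_add[OF l0 pl[of t]] elim t by simp
      have ij: "integrable lborel (\<lambda>x. w t x * cutoff j x)" for j
        using integrable_mult_bounded[OF csmooth_integrable[OF csmooth_cutoff] bounded_funD(2,3)[OF bw], of j t] by (simp add: mult.commute)
      have nnj: "(NNINT x. ennreal (w t x * cutoff j x)) = ennreal (LINT x|lborel. w t x * cutoff j x)" for j
        by (rule nn_integral_eq_integral[OF ij]) (simp add: nn cutoff_nonneg)
      have c1: "(\<lambda>j. w t x * cutoff j x) \<longlonglongrightarrow> w t x" for x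
        using tendsto_mult[OF tendsto_const cutoff_tendsto, of "w t x" x] by simp
      \<comment> \<open>Fatou: w t is not yet known to be integrable, so dominated convergence has
        to wait for this bound.\<close>
      have "(NNINT x. ennreal (w t x)) = (NNINT x. liminf (\<lambda>j. ennreal (w t x * cutoff j x)))"
        by (intro nn_integral_cong lim_imp_Liminf[symmetric] tendsto_ennrealI c1) simp
      also have "\<dots> \<le> liminf (\<lambda>j. NNINT x. ennreal (w t x * cutoff j x))"
        by (rule nn_integral_liminf) measurable
      also have "\<dots> = ennreal ?L"
        unfolding nnj by (intro lim_imp_Liminf tendsto_ennrealI lim) simp
      finally have "(NNINT x. ennreal (w t x)) < \<infinity>" by (rule le_less_trans) simp
      then have wi: "integrable lborel (w t)"
        unfolding integrable_iff_bounded using nn by simp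
      have "(\<lambda>j. LINT x|lborel. w t x * cutoff j x) \<longlonglongrightarrow> (LINT x|lborel. w t x)"
      proof (rule integral_dominated_convergence[where w = "w t"])
        show "AE x in lborel. norm (w t x * cutoff j x) \<le> w t x" for j
        proof (rule AE_I2)
          fix x :: "real^'n"
          have "\<bar>cutoff j x\<bar> \<le> 1" using cutoff_nonneg[of j x] cutoff_le_1[of j x] by simp
          then show "norm (w t x * cutoff j x) \<le> w t x" using nn[of t x] by (simp add: abs_mult mult_left_le)
        qed
      qed (use wi c1 in auto)
      from LIMSEQ_unique[OF this lim] wi
      show "integrable lborel (w t) \<and>
        (LINT x|lborel. w t x) = (LINT x|lborel. w0 x) + prim (\<lambda>s. LINT x|lborel. trace (G s x) * w s x) t"
        unfolding h_def[symmetric] by simp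
    qed
  qed
qed

end

subsection \<open>The John--Nirenberg inequality\<close>

definition avg :: "'a::euclidean_space \<Rightarrow> real \<Rightarrow> ('a \<Rightarrow> real) \<Rightarrow> real" where
  "avg x r f = (LINT y|lborel. indicator (ball x r) y * f y) / measure lborel (ball x r)"

text \<open>The Borel form of the statement that the BMO semi-norm is at most A.\<close>

definition osc_le :: "('a::euclidean_space \<Rightarrow> real) \<Rightarrow> real \<Rightarrow> bool" where
  "osc_le f A \<longleftrightarrow> locint f \<and> (\<forall>x r. 0 < r \<longrightarrow> avg x r (\<lambda>y. \<bar>f y - avg x r f\<bar>) \<le> A)"

lemma emeasure_ball_eq: "emeasure lborel (ball (x::'a::euclidean_space) r) = ennreal (measure lborel (ball x r))"
  using emeasure_lborel_ball_finite[of x r] by (intro emeasure_eq_ennreal_measure) auto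

lemma measure_ball_scale:
  "0 \<le> c \<Longrightarrow> 0 \<le> r \<Longrightarrow> measure lborel (ball (x::'a::euclidean_space) (c * r)) = c ^ DIM('a) * measure lborel (ball (y::'a) r)"
  by (simp add: content_ball power_mult_distrib)

lemma measure_ball_pos: "0 < r \<Longrightarrow> 0 < measure lborel (ball (x::'a::euclidean_space) r)"
  by (simp add: content_ball_pos)

lemma locint_ball_integrable:
  assumes f: "locint (f :: 'a::euclidean_space \<Rightarrow> real)"
  shows "integrable lborel (\<lambda>y. indicator (ball x r) y * f y)"
  using locint_integrable_mult[OF f, of "indicator (ball x r)" 1 "norm x + \<bar>r\<bar>"]
proof (simp, elim meta_mp)
  fix y :: 'a
  assume y: "norm x + \<bar>r\<bar> < norm y"
  have "norm y \<le> norm x + dist x y" using norm_triangle_ineq[of x "y - x"] by (simp add: dist_norm norm_minus_commute)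
  then show "indicator (ball x r) y = (0::real)" using y by (auto simp: indicator_def)
qed

lemma locint_abs_diff:
  assumes "locint (f :: 'a::euclidean_space \<Rightarrow> real)" shows "locint (\<lambda>y. \<bar>f y - c\<bar>)"
  unfolding locint_def
proof (intro conjI allI)
  note [measurable] = locint_borel[OF assms]
  show "(\<lambda>y. \<bar>f y - c\<bar>) \<in> borel_measurable borel" by measurable
  fix r
  have "integrable lborel (\<lambda>y. indicator (cball 0 r) y *\<^sub>R f y - indicator (cball 0 r) y *\<^sub>R c)"
    using assms unfolding locint_def
    by (intro L1_diff integrable_scaleR_left integrable_real_indicator)
      (use emeasure_lborel_cball_finite in auto)
  then have "integrable lborel (\<lambda>y. \<bar>indicator (cball 0 r) y *\<^sub>R f y - indicator (cball 0 r) y *\<^sub>R c\<bar>)"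
    by (rule integrable_abs)
  then show "integrable lborel (\<lambda>y. indicator (cball 0 r) y *\<^sub>R \<bar>f y - c\<bar>)"
    by (rule Bochner_Integration.integrable_cong[THEN iffD1, rotated 2]) (auto simp: indicator_def)
qed

lemma integrable_lborel_affine:
  fixes f :: "'a::euclidean_space \<Rightarrow> real"
  assumes c: "c \<noteq> 0" and f: "integrable lborel f"
  shows "integrable lborel (\<lambda>x. f (t + c *\<^sub>R x))"
proof -
  have "integrable (density (distr lborel borel (\<lambda>x. t + c *\<^sub>R x)) (\<lambda>_. ennreal (\<bar>c\<bar> ^ DIM('a)))) f"
    using f by (subst (asm) lborel_affine[OF c, of t])
  then have "integrable (distr lborel borel (\<lambda>x. t + c *\<^sub>R x)) (\<lambda>x. \<bar>c\<bar> ^ DIM('a) *\<^sub>R f x)"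
    using borel_measurable_integrable[OF f] by (subst (asm) integrable_density) auto
  then have "integrable lborel (\<lambda>x. \<bar>c\<bar> ^ DIM('a) * f (t + c *\<^sub>R x))"
    using borel_measurable_integrable[OF f] by (subst (asm) integrable_distr_eq) auto
  then show ?thesis using c by simp
qed

lemma avg_mono_ball:
  assumes f: "locint f" and nn: "\<And>y. 0 \<le> f y" and sub: "ball x r \<subseteq> ball (z::'a::euclidean_space) s" and r: "0 < r"
  shows "avg x r f \<le> measure lborel (ball z s) / measure lborel (ball x r) * avg z s f"
proof -
  have "0 < s" using sub r by (metis ball_eq_empty subset_empty linorder_not_le)
  have "(LINT y|lborel. indicator (ball x r) y * f y) \<le> (LINT y|lborel. indicator (ball z s) y * f y)"
    by (intro integral_mono locint_ball_integrable f mult_right_mono nn) (use sub in \<open>auto simp: indicator_def\<close>)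
  then show ?thesis
    using measure_ball_pos[OF r, of x] measure_ball_pos[OF \<open>0 < s\<close>, of z] by (simp add: avg_def divide_right_mono)
qed

lemma avg_diff_const:
  assumes f: "locint f" and r: "0 < r"
  shows "\<bar>avg x r f - c\<bar> \<le> avg (x::'a::euclidean_space) r (\<lambda>y. \<bar>f y - c\<bar>)"
proof -
  let ?m = "measure lborel (ball x r)"
  have m: "0 < ?m" by (rule measure_ball_pos[OF r])
  have ii: "integrable lborel (\<lambda>y. indicator (ball x r) y * c)"
    by (intro integrable_mult_left integrable_real_indicator) (use emeasure_lborel_ball_finite in auto)
  have "(LINT y|lborel. indicator (ball x r) y * (f y - c)) = (LINT y|lborel. indicator (ball x r) y * f y) - ?m * c"
    using LINT_diff[OF locint_ball_integrable[OF f, of x r] ii]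
    by (simp add: right_diff_distrib)
  then have "avg x r f - c = (LINT y|lborel. indicator (ball x r) y * (f y - c)) / ?m"
    using m by (simp add: avg_def diff_divide_distrib)
  also have "\<bar>\<dots>\<bar> \<le> (LINT y|lborel. indicator (ball x r) y * \<bar>f y - c\<bar>) / ?m"
    using integral_norm_bound[of lborel "\<lambda>y. indicator (ball x r) y * (f y - c)"] m
    by (simp add: abs_mult abs_divide divide_right_mono)
  finally show ?thesis by (simp add: avg_def)
qed

lemma avg_nn:
  assumes f: "locint f" and nn: "\<And>y. 0 \<le> f y"
  shows "(NNINT y. indicator (ball (x::'a::euclidean_space) r) y * ennreal (f y)) = ennreal (measure lborel (ball x r) * avg x r f)"
proof (cases "0 < r")
  case True
  have "(NNINT y. ennreal (indicator (ball x r) y * f y)) = ennreal (LINT y|lborel. indicator (ball x r) y * f y)"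
    by (rule nn_integral_eq_integral[OF locint_ball_integrable[OF f]]) (simp add: nn)
  moreover have "(NNINT y. ennreal (indicator (ball x r) y * f y)) = (NNINT y. indicator (ball x r) y * ennreal (f y))"
    by (intro nn_integral_cong) (auto simp: indicator_def)
  ultimately show ?thesis using measure_ball_pos[OF True, of x] by (simp add: avg_def)
qed (simp add: ball_empty)

text \<open>Averages over shrinking balls converge in \<open>L\<^sub>1\<close>, hence almost everywhere along a subsequence;
  this replaces the Lebesgue differentiation theorem.\<close>

lemma AE_avg_gt:
  fixes f :: "'a::euclidean_space \<Rightarrow> real"
  assumes f: "locint f" and \<rho>: "0 < \<rho>"
  shows "AE x in lborel. \<forall>c < f x. \<exists>r. 0 < r \<and> r \<le> \<rho> \<and> c < avg x r f"
proof -
  note [measurable] = locint_borel[OF f]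
  have "AE x in lborel. norm x < real n \<longrightarrow> (\<forall>c < f x. \<exists>r. 0 < r \<and> r \<le> \<rho> \<and> c < avg x r f)" for n
  proof -
    \<comment> \<open>For |x| < n all balls of radius at most \<rho> about x lie in the enlarged
      ball, so averages of f and of F agree there.\<close>
    define F where "F x = indicator (cball 0 (real n + \<rho>)) x *\<^sub>R f x" for x
    have F: "integrable lborel F" unfolding F_def using f by (simp add: locint_def)
    note [measurable] = borel_measurable_integrable[OF F, simplified]
    define e where "e k = \<rho> / real (Suc k)" for k
    have e: "0 < e k" "e k \<le> \<rho>" for k
    proof -
      show "0 < e k" using \<rho> by (simp add: e_def)
      have "\<rho> / real (Suc k) \<le> \<rho> / 1" by (rule divide_left_mono) (use \<rho> in auto)
      then show "e k \<le> \<rho>" by (simp add: e_def)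
    qed
    have el: "e \<longlonglongrightarrow> 0"
      unfolding e_def using tendsto_mult_right_zero[OF LIMSEQ_Suc[OF lim_inverse_n'], of \<rho>] by simp
    let ?m1 = "measure lborel (ball (0::'a) 1)"
    have m1: "0 < ?m1" by (rule measure_ball_pos) simp
    \<comment> \<open>Rescaling to the unit ball writes the average as a mean of translates, to
      which L1 continuity applies.\<close>
    have avgF: "avg x (e k) F = (LINT z|lborel. indicator (ball 0 1) z * F (x + e k *\<^sub>R z)) / ?m1" for x k
    proof -
      have [measurable]: "(\<lambda>y. indicator (ball x (e k)) y * F y) \<in> borel_measurable borel" by measurable
      have "(LINT y|lborel. indicator (ball x (e k)) y * F y) = e k ^ DIM('a) * (LINT z|lborel. indicator (ball x (e k)) (x + e k *\<^sub>R z) * F (x + e k *\<^sub>R z))"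
        using integral_lborel_affine[of "e k" "\<lambda>y. indicator (ball x (e k)) y * F y" x] e(1)[of k] by simp
      also have "(\<lambda>z. indicator (ball x (e k)) (x + e k *\<^sub>R z) :: real) = indicator (ball 0 1)"
        using e(1)[of k] by (auto simp: fun_eq_iff indicator_def dist_norm)
      finally show ?thesis
        using measure_ball_scale[of "e k" 1 x 0] e(1)[of k] by (simp add: avg_def fun_eq_iff)
    qed
    have [measurable]: "(\<lambda>x. avg x (e k) F) \<in> borel_measurable borel" for k unfolding avgF by measurable
    define J where "J k z = (NNINT x. ennreal (norm (F (x + e k *\<^sub>R z) - F x)))" for k and z :: 'a
    have Jm[measurable]: "J k \<in> borel_measurable borel" for k unfolding J_def[abs_def] by measurable
    define I where "I = (NNINT x. ennreal (norm (F x)))"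
    have Ifin: "I < \<infinity>" using F unfolding I_def integrable_iff_bounded by blast
    have JI: "J k z \<le> 2 * I" for k z
    proof -
      have "J k z \<le> (NNINT x. ennreal (norm (F (x + e k *\<^sub>R z))) + ennreal (norm (F x)))"
        unfolding J_def by (intro nn_integral_mono) (auto simp: norm_triangle_ineq4 simp flip: ennreal_plus intro!: ennreal_leI)
      also have "\<dots> = (NNINT x. ennreal (norm (F (x + e k *\<^sub>R z)))) + I"
        unfolding I_def by (rule nn_integral_add) measurable
      also have "(NNINT x. ennreal (norm (F (x + e k *\<^sub>R z)))) = I"
        unfolding I_def by (rule nn_integral_lborel_shift) measurable
      finally show ?thesis by (simp add: mult_2)
    qed
    have lim: "(\<lambda>k. NNINT z. indicator (ball 0 1) z * J k z) \<longlonglongrightarrow> (\<integral>\<^sup>+z. 0 \<partial>(lborel::'a measure))"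
    proof (rule nn_integral_dominated_convergence[where w = "\<lambda>z. indicator (ball 0 1) z * (2 * I)"])
      show "(NNINT z. indicator (ball (0::'a) 1) z * (2 * I)) < \<infinity>"
        using Ifin emeasure_lborel_ball_finite[of "0::'a" 1] by (simp add: nn_integral_multc ennreal_mult_less_top)
      show "AE z in lborel. (\<lambda>k. indicator (ball (0::'a) 1) z * J k z) \<longlonglongrightarrow> 0"
      proof (rule AE_I2)
        fix z :: 'a
        have "(\<lambda>k. e k *\<^sub>R z) \<longlonglongrightarrow> 0 *\<^sub>R z" by (intro tendsto_intros el)
        then have "(\<lambda>k. J k z) \<longlonglongrightarrow> 0" unfolding J_def by (intro nn_L1_translation[OF F]) simp
        then show "(\<lambda>k. indicator (ball (0::'a) 1) z * J k z) \<longlonglongrightarrow> 0" by (simp add: indicator_def)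
      qed
    qed (auto intro!: mult_left_mono JI)
    have L1: "(\<lambda>k. LINT x|lborel. norm (avg x (e k) F - F x)) \<longlonglongrightarrow> 0"
      and L1i: "\<And>k. integrable lborel (\<lambda>x. avg x (e k) F - F x)"
    proof -
      have bd: "(NNINT x. ennreal (norm (avg x (e k) F - F x))) \<le> ennreal (1 / ?m1) * (NNINT z. indicator (ball 0 1) z * J k z)" for k
      proof -
        have pt: "ennreal (norm (avg x (e k) F - F x)) \<le> ennreal (1 / ?m1) * (NNINT z. indicator (ball 0 1) z * ennreal (norm (F (x + e k *\<^sub>R z) - F x)))" for x
        proof -
          have iF: "integrable lborel (\<lambda>z. indicator (ball 0 1) z * F (x + e k *\<^sub>R z))"
            using integrable_mult_bounded[OF integrable_lborel_affine[OF _ F, of "e k" x], of "indicator (ball 0 1)" 1] e(1)[of k]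
            by (simp add: mult.commute indicator_def)
          have ic: "integrable lborel (\<lambda>z. indicator (ball (0::'a) 1) z * F x)"
            by (intro integrable_mult_left integrable_real_indicator) (use emeasure_lborel_ball_finite in auto)
          have "avg x (e k) F - F x = (1 / ?m1) * (LINT z|lborel. indicator (ball 0 1) z * (F (x + e k *\<^sub>R z) - F x))"
            unfolding avgF right_diff_distrib LINT_diff[OF iF ic] using m1 by (simp add: diff_divide_distrib)
          then have "norm (avg x (e k) F - F x) = (1 / ?m1) * norm (LINT z|lborel. indicator (ball 0 1) z * (F (x + e k *\<^sub>R z) - F x))"
            using m1 by (simp add: abs_mult)
          then have "ennreal (norm (avg x (e k) F - F x)) = ennreal (1 / ?m1) * ennreal (norm (LINT z|lborel. indicator (ball 0 1) z * (F (x + e k *\<^sub>R z) - F x)))"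
            using m1 by (simp only:) (rule ennreal_mult, auto)
          also have "ennreal (norm (LINT z|lborel. indicator (ball 0 1) z * (F (x + e k *\<^sub>R z) - F x)))
             \<le> (NNINT z. ennreal (norm (indicator (ball 0 1) z * (F (x + e k *\<^sub>R z) - F x))))"
            using integral_norm_bound_ennreal[OF L1_diff[OF iF ic]] by (simp add: right_diff_distrib)
          also have "\<dots> = (NNINT z. indicator (ball 0 1) z * ennreal (norm (F (x + e k *\<^sub>R z) - F x)))"
            by (intro nn_integral_cong) (auto simp: indicator_def)
          finally show ?thesis by (simp add: mult_left_mono)
        qed
        have "(NNINT x. ennreal (norm (avg x (e k) F - F x)))
          \<le> (NNINT x. ennreal (1 / ?m1) * (NNINT z. indicator (ball 0 1) z * ennreal (norm (F (x + e k *\<^sub>R z) - F x))))"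
          by (intro nn_integral_mono pt)
        also have "\<dots> = ennreal (1 / ?m1) * (NNINT x. NNINT z. indicator (ball 0 1) z * ennreal (norm (F (x + e k *\<^sub>R z) - F x)))"
          by (rule nn_integral_cmult) measurable
        also have "(NNINT x. NNINT z. indicator (ball 0 1) z * ennreal (norm (F (x + e k *\<^sub>R z) - F x)))
          = (NNINT z. NNINT x. indicator (ball 0 1) z * ennreal (norm (F (x + e k *\<^sub>R z) - F x)))"
          by (rule lborel_pair.Fubini') measurable
        also have "\<dots> = (NNINT z. indicator (ball 0 1) z * J k z)"
          unfolding J_def by (intro nn_integral_cong nn_integral_cmult) measurable
        finally show ?thesis .
      qed
      have fin: "(NNINT x. ennreal (norm (avg x (e k) F - F x))) < \<infinity>" for k
      proof -
        have "(NNINT z. indicator (ball 0 1) z * J k z) \<le> (NNINT z. indicator (ball (0::'a) 1) z * (2 * I))"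
          by (intro nn_integral_mono mult_left_mono JI) auto
        also have "\<dots> < \<infinity>"
          using Ifin emeasure_lborel_ball_finite[of "0::'a" 1] by (simp add: nn_integral_multc ennreal_mult_less_top)
        finally show ?thesis by (intro le_less_trans[OF bd]) (simp add: ennreal_mult_less_top)
      qed
      show i: "integrable lborel (\<lambda>x. avg x (e k) F - F x)" for k
        unfolding integrable_iff_bounded using fin by simp
      have "(\<lambda>k. ennreal (1 / ?m1) * (NNINT z. indicator (ball 0 1) z * J k z)) \<longlonglongrightarrow> ennreal (1 / ?m1) * 0"
        using lim by (intro ennreal_tendsto_cmult) auto
      then have "(\<lambda>k. NNINT x. ennreal (norm (avg x (e k) F - F x))) \<longlonglongrightarrow> 0"
        by (intro tendsto_ennreal_0_le[OF _ bd]) simp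
      moreover have "(NNINT x. ennreal (norm (avg x (e k) F - F x))) = ennreal (LINT x|lborel. norm (avg x (e k) F - F x))" for k
        by (rule nn_integral_eq_integral[OF integrable_norm[OF i]]) simp
      ultimately have "(\<lambda>k. ennreal (LINT x|lborel. norm (avg x (e k) F - F x))) \<longlonglongrightarrow> ennreal 0"
        by (simp only: ennreal_0)
      then show "(\<lambda>k. LINT x|lborel. norm (avg x (e k) F - F x)) \<longlonglongrightarrow> 0"
        by (subst (asm) tendsto_ennreal_iff) (auto intro!: always_eventually LINT_nonneg)
    qed
    \<comment> \<open>A subsequence is enough, because some radius below \<rho> is wanted, not all
      small radii.\<close>
    obtain s :: "nat \<Rightarrow> nat" where s: "strict_mono s" and ae: "AE x in lborel. (\<lambda>k. avg x (e (s k)) F - F x) \<longlonglongrightarrow> 0"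
      using tendsto_L1_AE_subseq[of lborel "\<lambda>k x. avg x (e k) F - F x", OF L1i L1] by blast
    show ?thesis using ae
    proof eventually_elim
      case (elim x)
      show ?case
      proof (intro impI allI)
        fix c assume x: "norm x < real n" and c: "c < f x"
        have Fx: "F x = f x" using x \<rho> by (simp add: F_def)
        have "(\<lambda>k. avg x (e (s k)) F) \<longlonglongrightarrow> f x" using LIM_zero_cancel[OF elim] Fx by simp
        then have "\<forall>\<^sub>F k in sequentially. c < avg x (e (s k)) F" using c order_tendstoD(1) by blast
        then obtain k where k: "c < avg x (e (s k)) F" using eventually_happens'[OF sequentially_bot] by blast
        have "indicator (ball x (e (s k))) y * F y = indicator (ball x (e (s k))) y * f y" for y
        proof (cases "y \<in> ball x (e (s k))")
          case True
          have "norm y \<le> norm x + dist x y" using norm_triangle_ineq[of x "y - x"] by (simp add: dist_norm norm_minus_commute)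
          then have "norm y \<le> real n + \<rho>" using True e(2)[of "s k"] x by simp
          then show ?thesis by (simp add: F_def)
        qed simp
        then have "avg x (e (s k)) F = avg x (e (s k)) f" by (simp only: avg_def)
        then show "\<exists>r. 0 < r \<and> r \<le> \<rho> \<and> c < avg x r f" using k e by metis
      qed
    qed
  qed
  then have "AE x in lborel. \<forall>n. norm x < real n \<longrightarrow> (\<forall>c < f x. \<exists>r. 0 < r \<and> r \<le> \<rho> \<and> c < avg x r f)"
    unfolding AE_all_countable by blast
  then show ?thesis
  proof eventually_elim
    case (elim x)
    obtain n where "norm x < real n" using reals_Archimedean2 by blast
    then show ?case using elim by blast
  qed
qed

section \<open>Stopping balls and the exponential decay of level sets\<close>

lemma emeasure_UN_le_countable:
  assumes I: "countable I" and X[measurable]: "\<And>i. i \<in> I \<Longrightarrow> X i \<in> sets M" and E[measurable]: "E \<in> sets M"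
    and sub: "E \<subseteq> (\<Union>i\<in>I. X i)"
  shows "emeasure M E \<le> (\<integral>\<^sup>+i. emeasure M (X i) \<partial>count_space I)"
proof -
  have "emeasure M E = (\<integral>\<^sup>+x. indicator E x \<partial>M)" by simp
  also have "\<dots> \<le> (\<integral>\<^sup>+x. \<integral>\<^sup>+i. indicator (X i) x \<partial>count_space I \<partial>M)"
  proof (rule nn_integral_mono)
    fix x
    show "indicator E x \<le> (\<integral>\<^sup>+i. indicator (X i) x \<partial>count_space I)"
    proof (cases "x \<in> E")
      case True
      then obtain i where i: "i \<in> I" "x \<in> X i" using sub by blast
      then show ?thesis using nn_integral_ge_point[OF i(1), of "\<lambda>i. indicator (X i) x"] True by simp
    qed simp
  qed
  also have "\<dots> = (\<integral>\<^sup>+i. \<integral>\<^sup>+x. indicator (X i) x \<partial>M \<partial>count_space I)"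
    by (rule nn_integral_count_space_nn_integral[OF I]) simp
  also have "\<dots> = (\<integral>\<^sup>+i. emeasure M (X i) \<partial>count_space I)"
    by (rule nn_integral_cong) simp
  finally show ?thesis .
qed

text \<open>Read as values of a measure with density f, the averages over disjoint balls can be
  summed by countable additivity.\<close>

lemma avg_density:
  fixes f :: "'a::euclidean_space \<Rightarrow> real"
  assumes f: "locint f" and nn: "\<And>y. 0 \<le> f y"
  shows "emeasure (density lborel (\<lambda>y. ennreal (f y))) (ball x r) = ennreal (measure lborel (ball x r) * avg x r f)"
proof -
  note [measurable] = locint_borel[OF f]
  have "emeasure (density lborel (\<lambda>y. ennreal (f y))) (ball x r) = (NNINT y. ennreal (f y) * indicator (ball x r) y)"
    by (rule emeasure_density) measurable
  also have "\<dots> = (NNINT y. indicator (ball x r) y * ennreal (f y))"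
    by (intro nn_integral_cong mult.commute)
  finally show ?thesis unfolding avg_nn[OF f nn] .
qed

lemma osc_leD:
  assumes "osc_le f A"
  shows "locint f" "0 < r \<Longrightarrow> avg x r (\<lambda>y. \<bar>f y - avg x r f\<bar>) \<le> A"
  using assms by (auto simp: osc_le_def)

lemma ball_scaled_subset: "dist x z + r \<le> s \<Longrightarrow> ball (x::'a::metric_space) r \<subseteq> ball z s"
proof
  fix y assume "dist x z + r \<le> s" "y \<in> ball x r"
  then show "y \<in> ball z s" using dist_triangle[of z y x] by (simp add: dist_commute)
qed

text \<open>The oscillation on the larger ball controls both means; passing to the smaller ball
  costs the ratio of measures, at most c to the power of the dimension.\<close>

lemma avg_diff_scaled:
  assumes f: "osc_le f A" and sub: "ball (x::'a::euclidean_space) r \<subseteq> ball z (c * r)" and r: "0 < r" and c: "0 < c"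
  shows "\<bar>avg x r f - avg z (c * r) f\<bar> \<le> c ^ DIM('a) * A"
proof -
  let ?a = "avg z (c * r) f"
  note lf = osc_leD(1)[OF f]
  have "\<bar>avg x r f - ?a\<bar> \<le> avg x r (\<lambda>y. \<bar>f y - ?a\<bar>)" by (rule avg_diff_const[OF lf r])
  also have "\<dots> \<le> measure lborel (ball z (c * r)) / measure lborel (ball x r) * avg z (c * r) (\<lambda>y. \<bar>f y - ?a\<bar>)"
    by (rule avg_mono_ball[OF locint_abs_diff[OF lf] _ sub r]) simp
  also have "measure lborel (ball z (c * r)) / measure lborel (ball x r) = c ^ DIM('a)"
    using measure_ball_scale[of c r z x] measure_ball_pos[OF r, of x] r c by simp
  also have "c ^ DIM('a) * avg z (c * r) (\<lambda>y. \<bar>f y - ?a\<bar>) \<le> c ^ DIM('a) * A"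
    using c r by (intro mult_left_mono osc_leD(2)[OF f]) auto
  finally show ?thesis .
qed

text \<open>The stopping radius: the largest dyadic multiple of \<open>r\<close>, not exceeding \<open>\<rho>\<close>, at which the average is
  still above the level \<open>\<kappa>\<close>.\<close>

lemma stopping_radius:
  fixes g :: "'a::euclidean_space \<Rightarrow> real"
  assumes g: "locint g" and nn: "\<And>y. 0 \<le> g y" and r: "0 < r" "r \<le> \<rho>" and gt: "\<kappa> < avg x r g" and \<kappa>: "0 \<le> \<kappa>"
    and top: "\<And>s. \<rho> / 2 < s \<Longrightarrow> s \<le> \<rho> \<Longrightarrow> avg x s g \<le> \<kappa>"
  shows "\<exists>s. 0 < s \<and> s \<le> \<rho> \<and> \<kappa> < avg x s g \<and> avg x s g \<le> 2 ^ DIM('a) * \<kappa>"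
proof -
  let ?P = "\<lambda>k. 2 ^ k * r \<le> \<rho> \<and> \<kappa> < avg x (2 ^ k * r) g"
  \<comment> \<open>The exponents k with 2^k r \<le> \<rho> are bounded, so a greatest admissible
    one exists.\<close>
  obtain B where B: "\<rho> / r < 2 ^ B" using real_arch_pow[of 2 "\<rho> / r"] by auto
  have bd: "k \<le> B" if "?P k" for k
  proof (rule ccontr)
    assume "\<not> k \<le> B"
    then have "(2::real) ^ B \<le> 2 ^ k" by (intro power_increasing) auto
    then have "\<rho> / r < 2 ^ k" using B by linarith
    then show False using that r by (simp add: divide_less_eq)
  qed
  have P0: "?P 0" using r gt by simp
  define k where "k = (GREATEST k. ?P k)"
  have k: "?P k" unfolding k_def by (rule GreatestI_nat[of ?P 0 B]) (use P0 bd in auto)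
  have "\<not> ?P (Suc k)" using Greatest_le_nat[of ?P "Suc k" B] bd unfolding k_def[symmetric] by auto
  \<comment> \<open>By \<open>top\<close> the stopping radius lies below \<rho>/2, so its double is
    still in the range and its average is at most \<kappa> by maximality.\<close>
  moreover have "2 * (2 ^ k * r) \<le> \<rho>" using top[of "2 ^ k * r"] k by (rule_tac ccontr) auto
  ultimately have le: "avg x (2 * (2 ^ k * r)) g \<le> \<kappa>" by (auto simp: mult.assoc)
  have s: "0 < 2 ^ k * r" using r by simp
  have "avg x (2 ^ k * r) g \<le> measure lborel (ball x (2 * (2 ^ k * r))) / measure lborel (ball x (2 ^ k * r)) * avg x (2 * (2 ^ k * r)) g"
    by (rule avg_mono_ball[OF g nn _ s]) (use s in \<open>auto intro: subset_ball\<close>)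
  also have "measure lborel (ball x (2 * (2 ^ k * r))) / measure lborel (ball x (2 ^ k * r)) = 2 ^ DIM('a)"
    using measure_ball_scale[of 2 "2 ^ k * r" x x] measure_ball_pos[OF s, of x] s by simp
  also have "2 ^ DIM('a) * avg x (2 * (2 ^ k * r)) g \<le> 2 ^ DIM('a) * \<kappa>" using le by simp
  finally show ?thesis using k s by blast
qed

text \<open>Raising the level by L A halves the fraction q of the exceptional set. Around almost
  every bad point sits a stopping ball where the mean of g = |f - c| exceeds K A. Vitali selects
  disjoint ones whose 5-fold dilates cover, and the assumption for level \<tau> is used on each
  dilate. Their total measure is at most \<integral> g over twice the ball, divided by K A; K is
  chosen so that the result is q/2. L A pays for moving the mean from a dilate to its stopping ball
  (5^n A) and from there to c (2^n K A).\<close>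

lemma John_Nirenberg_step:
  fixes f :: "'a::euclidean_space \<Rightarrow> real"
  defines "n \<equiv> DIM('a)" and "K \<equiv> 2 * 20 ^ DIM('a) * (1 + 2 ^ DIM('a)) :: real"
  defines "L \<equiv> 5 ^ n + 2 ^ n * K"
  assumes f: "osc_le f A" and A: "0 < A" and r0: "0 < r0"
    and q: "0 \<le> q" and IH: "\<And>x r. 0 < r \<Longrightarrow> emeasure lborel {y \<in> ball x r. \<tau> < \<bar>f y - avg x r f\<bar>} \<le> ennreal (q * measure lborel (ball x r))"
    and \<tau>: "0 \<le> \<tau>"
  shows "emeasure lborel {y \<in> ball x0 r0. \<tau> + L * A < \<bar>f y - avg x0 r0 f\<bar>} \<le> ennreal (q / 2 * measure lborel (ball x0 r0))"
proof -
  note lf = osc_leD(1)[OF f]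
  note [measurable] = locint_borel[OF lf]
  define c where "c = avg x0 r0 f"
  define g where "g y = \<bar>f y - c\<bar>" for y
  have lg: "locint g" unfolding g_def by (rule locint_abs_diff[OF lf])
  have g0: "0 \<le> g y" for y by (simp add: g_def)
  have [measurable]: "g \<in> borel_measurable borel" by (rule locint_borel[OF lg])
  have p1: "1 \<le> (2::real) ^ n" "1 \<le> (5::real) ^ n" "1 \<le> (20::real) ^ n" by simp_all
  have K0: "0 < K" unfolding K_def by (intro mult_pos_pos add_pos_pos) auto
  have KL: "K \<le> L" using mult_right_mono[OF p1(1), of K] K0 p1(2) unfolding L_def by linarith
  define B2 where "B2 = ball x0 (2 * r0)"
  let ?m = "measure lborel (ball x0 r0)"
  have m0: "0 < ?m" by (rule measure_ball_pos[OF r0])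
  have mB2: "measure lborel B2 = 2 ^ n * ?m" unfolding B2_def n_def using measure_ball_scale[of 2 r0 x0 x0] r0 by simp
  \<comment> \<open>One A is the oscillation on the doubled ball, 2^n A is the price for using the
    mean c of the original ball.\<close>
  have avg2: "avg x0 (2 * r0) g \<le> (1 + 2 ^ n) * A"
  proof -
    let ?a = "avg x0 (2 * r0) f"
    have d: "\<bar>c - ?a\<bar> \<le> 2 ^ n * A" unfolding c_def n_def
      by (rule avg_diff_scaled[OF f _ r0]) (use r0 in \<open>auto intro: subset_ball\<close>)
    have r2: "0 < 2 * r0" using r0 by simp
    have ii: "integrable lborel (\<lambda>y. indicator B2 y * (2 ^ n * A))"
      unfolding B2_def by (intro integrable_mult_left integrable_real_indicator) (use emeasure_lborel_ball_finite in auto)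
    have ia: "integrable lborel (\<lambda>y. indicator B2 y * \<bar>f y - ?a\<bar>)"
      unfolding B2_def by (rule locint_ball_integrable[OF locint_abs_diff[OF lf]])
    have "(LINT y|lborel. indicator B2 y * g y) \<le> (LINT y|lborel. indicator B2 y * \<bar>f y - ?a\<bar> + indicator B2 y * (2 ^ n * A))"
    proof (rule integral_mono)
      show "integrable lborel (\<lambda>y. indicator B2 y * g y)" unfolding B2_def by (rule locint_ball_integrable[OF lg])
      show "integrable lborel (\<lambda>y. indicator B2 y * \<bar>f y - ?a\<bar> + indicator B2 y * (2 ^ n * A))"
        by (rule L1_add[OF ia ii])
      show "indicator B2 y * g y \<le> indicator B2 y * \<bar>f y - ?a\<bar> + indicator B2 y * (2 ^ n * A)" for y
        using d by (auto simp: indicator_def g_def)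
    qed
    also have "\<dots> = (LINT y|lborel. indicator B2 y * \<bar>f y - ?a\<bar>) + measure lborel B2 * (2 ^ n * A)"
      unfolding LINT_add[OF ia ii] by (simp add: B2_def)
    finally have "avg x0 (2 * r0) g \<le> avg x0 (2 * r0) (\<lambda>y. \<bar>f y - ?a\<bar>) + 2 ^ n * A"
      using measure_ball_pos[OF r2, of x0] unfolding avg_def B2_def[symmetric]
      by (simp add: field_simps B2_def[symmetric])
    then show ?thesis using osc_leD(2)[OF f r2, of x0] by (simp add: algebra_simps)
  qed
  \<comment> \<open>Radii in (r0/10, r0/5] are too large to stop at. The 20 in K is the ratio of 2
    r0 to the smallest of them, r0/10.\<close>
  have top: "avg x s g \<le> K * A" if x: "x \<in> ball x0 r0" and s: "r0 / 5 / 2 < s" "s \<le> r0 / 5" for x s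
  proof -
    have s0: "0 < s" using s r0 by simp
    have sub: "ball x s \<subseteq> B2" unfolding B2_def
      by (rule ball_scaled_subset) (use x s r0 in \<open>auto simp: dist_commute\<close>)
    have "avg x s g \<le> measure lborel B2 / measure lborel (ball x s) * avg x0 (2 * r0) g"
      unfolding B2_def by (rule avg_mono_ball[OF lg g0 sub[unfolded B2_def] s0])
    also have "measure lborel B2 / measure lborel (ball x s) \<le> 20 ^ n"
    proof -
      have "measure lborel B2 \<le> measure lborel (ball x0 (20 * s))"
        unfolding B2_def by (rule measure_mono_fmeasurable) (use s in \<open>auto intro!: subset_ball simp: fmeasurable_def less_top[symmetric] emeasure_ball_eq\<close>)
      also have "\<dots> = 20 ^ n * measure lborel (ball x s)" unfolding n_def by (rule measure_ball_scale) (use s0 in auto)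
      finally show ?thesis using measure_ball_pos[OF s0, of x] by (simp add: divide_le_eq)
    qed
    then have "measure lborel B2 / measure lborel (ball x s) * avg x0 (2 * r0) g \<le> 20 ^ n * ((1 + 2 ^ n) * A)"
      by (intro mult_mono avg2) (auto simp: avg_def intro!: divide_nonneg_nonneg LINT_nonneg mult_nonneg_nonneg g0)
    also have "\<dots> \<le> K * A"
      using A mult_pos_pos[OF zero_less_power[of "20::real" n] add_pos_pos[OF zero_less_one zero_less_power[of "2::real" n]]]
      unfolding K_def n_def by (simp add: mult_ac)
    finally show ?thesis .
  qed
  \<comment> \<open>Bad points outside N have some small ball with mean above the level, from which
    the stopping radius is searched upwards.\<close>
  obtain N where N: "{x. \<not> (\<forall>t < g x. \<exists>r. 0 < r \<and> r \<le> r0 / 5 \<and> t < avg x r g)} \<subseteq> N" "emeasure lborel N = 0" "N \<in> sets lborel"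
    using AE_E[OF AE_avg_gt[OF lg, of "r0 / 5"]] r0 by auto
  define E where "E = {y \<in> ball x0 r0. \<tau> + L * A < g y}"
  have [measurable]: "E \<in> sets lborel" "N \<in> sets lborel" unfolding E_def using N(3) by measurable
  have "\<exists>s. 0 < s \<and> s \<le> r0 / 5 \<and> K * A < avg x s g \<and> avg x s g \<le> 2 ^ n * (K * A)" if x: "x \<in> E - N" for x
  proof -
    have "K * A \<le> L * A" using KL A by simp
    then have "K * A < g x" using x \<tau> by (simp add: E_def)
    moreover have "\<forall>t < g x. \<exists>r. 0 < r \<and> r \<le> r0 / 5 \<and> t < avg x r g" using x N(1) by blast
    ultimately obtain r where r: "0 < r" "r \<le> r0 / 5" "K * A < avg x r g" by blast
    show ?thesis unfolding n_def
      by (rule stopping_radius[OF lg g0 r]) (use K0 A top x in \<open>auto simp: E_def\<close>)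
  qed
  then obtain \<rho> where \<rho>: "\<And>x. x \<in> E - N \<Longrightarrow> 0 < \<rho> x \<and> \<rho> x \<le> r0 / 5 \<and> K * A < avg x (\<rho> x) g \<and> avg x (\<rho> x) g \<le> 2 ^ n * (K * A)"
    by metis
  obtain C where C: "countable C" "C \<subseteq> E - N" "pairwise (\<lambda>i j. disjnt (ball i (\<rho> i)) (ball j (\<rho> j))) C"
    "E - N \<subseteq> (\<Union>i\<in>C. ball i (5 * \<rho> i))"
  proof (rule Vitali_covering_lemma_balls[where S = "E - N" and K = "E - N" and a = "\<lambda>x. x" and r = \<rho> and B = "r0 / 5"])
    show "E - N \<subseteq> (\<Union>i\<in>E - N. ball i (\<rho> i))" using \<rho> by force
  qed (use \<rho> in auto)
  have \<rho>C: "0 < \<rho> i" "\<rho> i \<le> r0 / 5" "K * A < avg i (\<rho> i) g" "avg i (\<rho> i) g \<le> 2 ^ n * (K * A)" if "i \<in> C" for i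
    using \<rho> C(2) that by blast+
  have disj: "disjoint_family_on (\<lambda>i. ball i (\<rho> i)) C"
    using C(3) by (auto simp: disjoint_family_on_def pairwise_def disjnt_def)
  have subB2: "ball i (\<rho> i) \<subseteq> B2" if "i \<in> C" for i
    unfolding B2_def by (rule ball_scaled_subset) (use \<rho>C[OF that] that C(2) r0 in \<open>auto simp: dist_commute E_def\<close>)
  have sumB: "(\<integral>\<^sup>+i. ennreal (K * A) * emeasure lborel (ball i (\<rho> i)) \<partial>count_space C) \<le> ennreal (2 ^ n * ?m * ((1 + 2 ^ n) * A))"
  proof -
    have "(\<integral>\<^sup>+i. ennreal (K * A) * emeasure lborel (ball i (\<rho> i)) \<partial>count_space C)
       \<le> (\<integral>\<^sup>+i. emeasure (density lborel (\<lambda>y. ennreal (g y))) (ball i (\<rho> i)) \<partial>count_space C)"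
    proof (rule nn_integral_mono)
      fix i assume "i \<in> space (count_space C)"
      then have i: "i \<in> C" by simp
      have "ennreal (K * A) * emeasure lborel (ball i (\<rho> i)) = ennreal (measure lborel (ball i (\<rho> i)) * (K * A))"
        using K0 A by (simp add: emeasure_ball_eq ennreal_mult mult.commute)
      also have "\<dots> \<le> ennreal (measure lborel (ball i (\<rho> i)) * avg i (\<rho> i) g)"
        using \<rho>C(3)[OF i] by (intro ennreal_leI mult_left_mono) auto
      also have "\<dots> = emeasure (density lborel (\<lambda>y. ennreal (g y))) (ball i (\<rho> i))"
        by (rule avg_density[OF lg g0, symmetric])
      finally show "ennreal (K * A) * emeasure lborel (ball i (\<rho> i)) \<le> \<dots>" .
    qed
    also have "\<dots> = emeasure (density lborel (\<lambda>y. ennreal (g y))) (\<Union>i\<in>C. ball i (\<rho> i))"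
      by (rule emeasure_UN_countable[OF _ C(1) disj, symmetric]) simp
    also have "\<dots> \<le> emeasure (density lborel (\<lambda>y. ennreal (g y))) B2"
      by (rule emeasure_mono) (use subB2 in \<open>auto simp: B2_def\<close>)
    also have "\<dots> = ennreal (measure lborel B2 * avg x0 (2 * r0) g)"
      unfolding B2_def by (rule avg_density[OF lg g0])
    also have "\<dots> \<le> ennreal (2 ^ n * ?m * ((1 + 2 ^ n) * A))"
      unfolding mB2 using m0 by (intro ennreal_leI mult_left_mono avg2) auto
    finally show ?thesis .
  qed
  let ?X = "\<lambda>i. {y \<in> ball i (5 * \<rho> i). \<tau> < \<bar>f y - avg i (5 * \<rho> i) f\<bar>}"
  have "E - N \<subseteq> (\<Union>i\<in>C. ?X i)"
  proof
    fix y assume y: "y \<in> E - N"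
    then obtain i where i: "i \<in> C" "y \<in> ball i (5 * \<rho> i)" using C(4) by blast
    have "\<bar>avg i (\<rho> i) f - avg i (5 * \<rho> i) f\<bar> \<le> 5 ^ n * A" unfolding n_def
      by (rule avg_diff_scaled[OF f _ \<rho>C(1)[OF i(1)]]) (use \<rho>C(1)[OF i(1)] in \<open>auto intro: subset_ball\<close>)
    moreover have "\<bar>avg i (\<rho> i) f - c\<bar> \<le> 2 ^ n * (K * A)"
      using avg_diff_const[OF lf \<rho>C(1)[OF i(1)], of i c] \<rho>C(4)[OF i(1)] unfolding g_def by linarith
    moreover have "L * A = 5 ^ n * A + 2 ^ n * (K * A)" by (simp add: L_def algebra_simps)
    moreover have "\<tau> + L * A < \<bar>f y - c\<bar>" using y by (simp add: E_def g_def)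
    ultimately have "\<tau> < \<bar>f y - avg i (5 * \<rho> i) f\<bar>" by linarith
    then show "y \<in> (\<Union>i\<in>C. ?X i)" using i by blast
  qed
  then have "emeasure lborel (E - N) \<le> (\<integral>\<^sup>+i. emeasure lborel (?X i) \<partial>count_space C)"
    by (intro emeasure_UN_le_countable C(1)) measurable
  also have "\<dots> \<le> (\<integral>\<^sup>+i. ennreal (q * 5 ^ n) * emeasure lborel (ball i (\<rho> i)) \<partial>count_space C)"
  proof (rule nn_integral_mono)
    fix i assume "i \<in> space (count_space C)"
    then have i: "i \<in> C" by simp
    have "emeasure lborel (?X i) \<le> ennreal (q * measure lborel (ball i (5 * \<rho> i)))"
      by (rule IH) (use \<rho>C(1)[OF i] in simp)
    also have "measure lborel (ball i (5 * \<rho> i)) = 5 ^ n * measure lborel (ball i (\<rho> i))"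
      unfolding n_def by (rule measure_ball_scale) (use \<rho>C(1)[OF i] in auto)
    also have "ennreal (q * (5 ^ n * measure lborel (ball i (\<rho> i)))) = ennreal (q * 5 ^ n) * emeasure lborel (ball i (\<rho> i))"
      using q by (simp add: emeasure_ball_eq mult.assoc flip: ennreal_mult)
    finally show "emeasure lborel (?X i) \<le> \<dots>" .
  qed
  also have "\<dots> = ennreal (q * 5 ^ n / (K * A)) * (\<integral>\<^sup>+i. ennreal (K * A) * emeasure lborel (ball i (\<rho> i)) \<partial>count_space C)"
  proof -
    have "ennreal (q * 5 ^ n) = ennreal (q * 5 ^ n / (K * A)) * ennreal (K * A)"
      using K0 A q by (subst ennreal_mult[symmetric]) auto
    then show ?thesis by (simp add: nn_integral_cmult mult.assoc)
  qed
  also have "\<dots> \<le> ennreal (q * 5 ^ n / (K * A)) * ennreal (2 ^ n * ?m * ((1 + 2 ^ n) * A))"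
    by (intro mult_left_mono sumB) simp
  also have "\<dots> = ennreal (q * 5 ^ n / (K * A) * (2 ^ n * ?m * ((1 + 2 ^ n) * A)))"
    using K0 A q m0 by (intro ennreal_mult[symmetric]) auto
  also have "\<dots> \<le> ennreal (q / 2 * ?m)"
  proof (rule ennreal_leI)
    define \<alpha> where "\<alpha> = 1 + (2::real) ^ n"
    have \<alpha>: "0 < \<alpha>" by (simp add: \<alpha>_def add_pos_pos)
    \<comment> \<open>The accumulated factor is 5^n 2^n (1 + 2^n) / K; with the value of K it equals
      (10/20)^n / 2.\<close>
    have "(5::real) ^ n * 2 ^ n \<le> 20 ^ n" by (subst power_mult_distrib[symmetric]) (intro power_mono, auto)
    then have "5 ^ n * 2 ^ n / 20 ^ n \<le> (1::real)" by (simp add: divide_le_eq)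
    then have "q * ?m / 2 * (5 ^ n * 2 ^ n / 20 ^ n) \<le> q * ?m / 2 * 1"
      using q m0 by (intro mult_left_mono) auto
    moreover have "q * 5 ^ n / (K * A) * (2 ^ n * ?m * ((1 + 2 ^ n) * A)) = q * ?m / 2 * (5 ^ n * 2 ^ n / 20 ^ n)"
      using A \<alpha> unfolding K_def n_def[symmetric] \<alpha>_def[symmetric] by (simp add: field_simps)
    ultimately show "q * 5 ^ n / (K * A) * (2 ^ n * ?m * ((1 + 2 ^ n) * A)) \<le> q / 2 * ?m" by simp
  qed
  finally have "emeasure lborel (E - N) \<le> ennreal (q / 2 * ?m)" .
  moreover have "emeasure lborel (E - N) = emeasure lborel E"
    by (rule emeasure_Diff_null_set) (use N \<open>E \<in> sets lborel\<close> in \<open>auto simp: null_sets_def\<close>)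
  ultimately show ?thesis by (simp add: E_def g_def c_def)
qed

text \<open>Induction on m with fraction q = 2^-m. The bound L \<ge> 2 is recorded because the mean
  of a function supported in a ball will cost 2A.\<close>

lemma John_Nirenberg:
  "\<exists>L\<ge>2. \<forall>(f :: 'a::euclidean_space \<Rightarrow> real) A m x r. osc_le f A \<longrightarrow> 0 < A \<longrightarrow> 0 < r \<longrightarrow>
     emeasure lborel {y \<in> ball x r. real m * (L * A) < \<bar>f y - avg x r f\<bar>} \<le> ennreal ((1 / 2) ^ m * measure lborel (ball x r))"
proof -
  define K where "K = 2 * 20 ^ DIM('a) * (1 + 2 ^ DIM('a) :: real)"
  define L where "L = 5 ^ DIM('a) + 2 ^ DIM('a) * K"
  have "1 \<le> (20::real) ^ DIM('a)" "1 \<le> (2::real) ^ DIM('a)" "1 \<le> (5::real) ^ DIM('a)" by simp_all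
  moreover from this have "2 * 1 * (1 + 1) \<le> K" unfolding K_def by (intro mult_mono add_mono) auto
  moreover from this calculation have "1 * 4 \<le> 2 ^ DIM('a) * K" by (intro mult_mono) auto
  ultimately have L2: "2 \<le> L" unfolding L_def by linarith
  have "emeasure lborel {y \<in> ball x r. real m * (L * A) < \<bar>f y - avg x r f\<bar>} \<le> ennreal ((1 / 2) ^ m * measure lborel (ball x r))"
    if f: "osc_le f A" and A: "0 < A" and r: "0 < r" for f :: "'a \<Rightarrow> real" and A m x r
    using r
  proof (induction m arbitrary: x r)
    case 0
    have [measurable]: "f \<in> borel_measurable borel" using locint_borel[OF osc_leD(1)[OF f]] .
    have "emeasure lborel {y \<in> ball x r. 0 < \<bar>f y - avg x r f\<bar>} \<le> emeasure lborel (ball x r)"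
      by (rule emeasure_mono) auto
    then show ?case by (simp add: emeasure_ball_eq)
  next
    case (Suc m)
    have "emeasure lborel {y \<in> ball x r. real m * (L * A) + L * A < \<bar>f y - avg x r f\<bar>} \<le> ennreal ((1 / 2) ^ m / 2 * measure lborel (ball x r))"
      unfolding L_def K_def
      by (rule John_Nirenberg_step[OF f A Suc.prems]) (use Suc.IH A L2 in \<open>auto simp: L_def K_def\<close>)
    then show ?case by (simp add: algebra_simps)
  qed
  then show ?thesis using L2 by blast
qed

text \<open>On at least half of the doubled ball f vanishes, and there |f - c| = |c|. So the
  oscillation is at least |c|/2, which bounds the mean itself, not only oscillations about
  it.\<close>

lemma avg_tail_mean_le:
  fixes f :: "'a::euclidean_space \<Rightarrow> real"
  assumes f: "osc_le f A" and R: "0 < R" and supp: "AE x in lborel. R < norm x \<longrightarrow> f x = 0"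
  shows "\<bar>avg 0 (2 * R) f\<bar> \<le> 2 * A"
proof -
  let ?c = "avg 0 (2 * R) f" and ?B = "ball (0::'a) (2 * R)"
  note lf = osc_leD(1)[OF f]
  have R2: "0 < 2 * R" using R by simp
  have mB: "0 < measure lborel ?B" by (rule measure_ball_pos[OF R2])
  have "measure lborel (cball (0::'a) R) = measure lborel (ball (0::'a) R)" by (rule content_cball_conv_ball)
  moreover have "measure lborel ?B = 2 ^ DIM('a) * measure lborel (ball (0::'a) R)"
    by (rule measure_ball_scale) (use R in auto)
  moreover have "2 * measure lborel (ball (0::'a) R) \<le> 2 ^ DIM('a) * measure lborel (ball (0::'a) R)"
    using power_increasing[of 1 "DIM('a)" "2::real"] DIM_positive[where 'a='a] by (intro mult_right_mono) (auto simp: Suc_le_eq)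
  ultimately have half: "measure lborel (cball (0::'a) R) \<le> measure lborel ?B / 2" by simp
  have sub: "cball 0 R \<subseteq> ?B" using R by auto
  have fm: "?B \<in> fmeasurable lborel" "cball (0::'a) R \<in> fmeasurable lborel"
    using emeasure_lborel_ball_finite[of "0::'a" "2 * R"] emeasure_lborel_cball_finite[of "0::'a" R] by (auto simp: fmeasurable_def)
  have "measure lborel (?B - cball 0 R) = measure lborel ?B - measure lborel (cball (0::'a) R)"
    by (rule measurable_measure_Diff[OF fm(1) _ sub]) simp
  then have "measure lborel ?B / 2 \<le> measure lborel (?B - cball 0 R)" using half by linarith
  then have "measure lborel ?B / 2 * \<bar>?c\<bar> \<le> measure lborel (?B - cball 0 R) * \<bar>?c\<bar>" by (rule mult_right_mono) simp
  also have "\<dots> = (LINT y|lborel. indicator (?B - cball 0 R) y * \<bar>?c\<bar>)" by simp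
  also have "\<dots> \<le> (LINT y|lborel. indicator ?B y * \<bar>f y - ?c\<bar>)"
  proof (rule integral_mono_AE)
    show "integrable lborel (\<lambda>y. indicator (?B - cball 0 R) y * \<bar>?c\<bar>)"
      using fm by (intro integrable_mult_left integrable_real_indicator) (auto simp: fmeasurable_def intro: le_less_trans[OF emeasure_mono])
    show "integrable lborel (\<lambda>y. indicator ?B y * \<bar>f y - ?c\<bar>)" by (rule locint_ball_integrable[OF locint_abs_diff[OF lf]])
    show "AE y in lborel. indicator (?B - cball 0 R) y * \<bar>?c\<bar> \<le> indicator ?B y * \<bar>f y - ?c\<bar>"
      using supp by eventually_elim (auto simp: indicator_def)
  qed
  also have "\<dots> = measure lborel ?B * avg 0 (2 * R) (\<lambda>y. \<bar>f y - ?c\<bar>)"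
    using mB by (simp add: avg_def)
  also have "\<dots> \<le> measure lborel ?B * A" using mB by (intro mult_left_mono osc_leD(2)[OF f R2]) auto
  finally have "measure lborel ?B * (\<bar>?c\<bar> / 2) \<le> measure lborel ?B * A" by simp
  then show ?thesis using mB by simp
qed

text \<open>A discrete layer-cake formula in steps of size a, started at level m a: the series
  counts the levels above m a that lie strictly below s.\<close>

lemma ennreal_le_layers:
  assumes a: "0 < a" and s: "0 \<le> s"
  shows "ennreal s \<le> ennreal (real m * a) + (\<Sum>j. ennreal a * indicator {x. real (m + j) * a < x} s)"
proof -
  let ?g = "\<lambda>j. ennreal a * indicator {x. real (m + j) * a < x} s"
  define N where "N = nat \<lceil>s / a\<rceil>"
  have N: "s / a \<le> real N" "\<And>j. j < N \<Longrightarrow> real j < s / a"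
    unfolding N_def using s a by linarith+
  have le: "s \<le> real N * a" using N(1) a by (simp add: divide_le_eq)
  have "ennreal s \<le> ennreal (real m * a) + (\<Sum>j<N - m. ?g j)"
  proof -
    have "(\<Sum>j<N - m. ?g j) = (\<Sum>j<N - m. ennreal a)"
    proof (rule sum.cong[OF refl])
      fix j assume "j \<in> {..<N - m}"
      then have "real (m + j) < s / a" by (intro N(2)) auto
      then have "real (m + j) * a < s" using a by (simp add: less_divide_eq)
      then show "?g j = ennreal a" by simp
    qed
    also have "\<dots> = ennreal (real (N - m) * a)"
      using a by (simp add: ennreal_mult ennreal_of_nat_eq_real_of_nat)
    finally have "ennreal (real m * a) + (\<Sum>j<N - m. ?g j) = ennreal (real m * a + real (N - m) * a)"
      using a by (simp add: ennreal_plus)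
    moreover have "s \<le> real m * a + real (N - m) * a"
    proof -
      have "real N \<le> real m + real (N - m)" by linarith
      then have "real N * a \<le> (real m + real (N - m)) * a" using a by (intro mult_right_mono) auto
      then show ?thesis using le by (simp add: distrib_right)
    qed
    ultimately show ?thesis by (simp add: ennreal_leI)
  qed
  also have "\<dots> \<le> ennreal (real m * a) + (\<Sum>j. ?g j)"
    by (intro add_left_mono sum_le_suminf) auto
  finally show ?thesis .
qed

text \<open>Below the level m L A, |f| is bounded and the weight stays under the integral; above it
  the weight is replaced by M and the layers are summed. Passing from |f| to |f - mean| costs one
  level, hence the exponent m + j - 1 and the condition 1 \<le> m. The 4 is 2 for that level times 2
  for the geometric series.\<close>

lemma John_Nirenberg_weighted:
  "\<exists>L>0. \<forall>(f :: 'a::euclidean_space \<Rightarrow> real) A R M w m. osc_le f A \<longrightarrow> 0 < A \<longrightarrow> 0 < R \<longrightarrow>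
     (AE x in lborel. R < norm x \<longrightarrow> f x = 0) \<longrightarrow> w \<in> borel_measurable borel \<longrightarrow> (\<forall>x. 0 \<le> w x \<and> w x \<le> M) \<longrightarrow> 1 \<le> m \<longrightarrow>
     (NNINT x. ennreal (\<bar>f x\<bar> * w x)) \<le> ennreal (real m * (L * A)) * (NNINT x. ennreal (w x))
        + ennreal (4 * L * A * M * measure lborel (ball (0::'a) (2 * R)) * (1 / 2) ^ m)"
proof -
  obtain L where L: "2 \<le> L" and JN: "\<And>(f :: 'a \<Rightarrow> real) A m x r. osc_le f A \<Longrightarrow> 0 < A \<Longrightarrow> 0 < r \<Longrightarrow>
     emeasure lborel {y \<in> ball x r. real m * (L * A) < \<bar>f y - avg x r f\<bar>} \<le> ennreal ((1 / 2) ^ m * measure lborel (ball x r))"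
    using John_Nirenberg[where 'a='a] by blast
  have "(NNINT x. ennreal (\<bar>f x\<bar> * w x)) \<le> ennreal (real m * (L * A)) * (NNINT x. ennreal (w x))
        + ennreal (4 * L * A * M * measure lborel (ball (0::'a) (2 * R)) * (1 / 2) ^ m)"
    if f: "osc_le f A" and A: "0 < A" and R: "0 < R" and supp: "AE x in lborel. R < norm x \<longrightarrow> f x = 0"
      and w[measurable]: "w \<in> borel_measurable borel" and wM: "\<forall>x. 0 \<le> w x \<and> w x \<le> M" and m: "1 \<le> m"
    for f :: "'a \<Rightarrow> real" and A R M w m
  proof -
    note [measurable] = locint_borel[OF osc_leD(1)[OF f]]
    have M0: "0 \<le> M" using wM[rule_format, of 0] by linarith
    let ?c = "avg 0 (2 * R) f" and ?B = "ball (0::'a) (2 * R)"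
    let ?a = "L * A"
    have a0: "0 < ?a" using L A by simp
    have c: "\<bar>?c\<bar> \<le> ?a" using avg_tail_mean_le[OF f R supp] mult_right_mono[OF L, of A] A by linarith
    define E where "E j = {x. real (m + j) * ?a < \<bar>f x\<bar>}" for j
    have [measurable]: "E j \<in> sets borel" for j unfolding E_def by measurable
    \<comment> \<open>The layer lies in the ball of radius 2R up to a null set, since f vanishes
      outside R; so one application of \<open>John_Nirenberg\<close> to this ball suffices.\<close>
    have Ej: "emeasure lborel (E j) \<le> ennreal (2 * (1 / 2) ^ m * measure lborel ?B * (1 / 2) ^ j)" for j
    proof -
      have "emeasure lborel (E j) \<le> emeasure lborel {y \<in> ?B. real (m + j - 1) * ?a < \<bar>f y - ?c\<bar>}"
      proof (rule emeasure_mono_AE)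
        show "AE x in lborel. x \<in> E j \<longrightarrow> x \<in> {y \<in> ?B. real (m + j - 1) * ?a < \<bar>f y - ?c\<bar>}"
          using supp
        proof eventually_elim
          case (elim x)
          show ?case
          proof
            assume x: "x \<in> E j"
            have "0 \<le> real (m + j) * ?a" by (rule mult_nonneg_nonneg[OF of_nat_0_le_iff less_imp_le[OF a0]])
            then have "f x \<noteq> 0" using x by (auto simp: E_def)
            then have "norm x \<le> R" using elim by auto
            moreover have "real (m + j - 1) * ?a + ?a = real (m + j) * ?a"
              using m by (simp add: of_nat_diff algebra_simps)
            then have "real (m + j - 1) * ?a < \<bar>f x - ?c\<bar>" using x c by (simp add: E_def)
            ultimately show "x \<in> {y \<in> ?B. real (m + j - 1) * ?a < \<bar>f y - ?c\<bar>}" using R by simp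
          qed
        qed
      qed measurable
      also have "\<dots> \<le> ennreal ((1 / 2) ^ (m + j - 1) * measure lborel ?B)"
        using JN[OF f A, where r = "2 * R" and m = "m + j - 1" and x = 0] R by simp
      also have "(1 / 2 :: real) ^ (m + j - 1) = 2 * (1 / 2) ^ m * (1 / 2) ^ j"
        using m by (cases m) (auto simp: power_add)
      finally show ?thesis by (simp add: mult_ac)
    qed
    have "(NNINT x. ennreal (\<bar>f x\<bar> * w x))
      \<le> (NNINT x. ennreal (real m * ?a) * ennreal (w x) + (\<Sum>j. ennreal (?a * M) * indicator (E j) x))"
    proof (rule nn_integral_mono)
      fix x
      have "ennreal (\<bar>f x\<bar> * w x) = ennreal \<bar>f x\<bar> * ennreal (w x)" using wM by (simp add: ennreal_mult)
      also have "\<dots> \<le> (ennreal (real m * ?a) + (\<Sum>j. ennreal ?a * indicator {x. real (m + j) * ?a < x} \<bar>f x\<bar>)) * ennreal (w x)"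
        by (intro mult_right_mono ennreal_le_layers a0) auto
      also have "\<dots> = ennreal (real m * ?a) * ennreal (w x) + (\<Sum>j. ennreal ?a * indicator {x. real (m + j) * ?a < x} \<bar>f x\<bar>) * ennreal (w x)"
        by (rule distrib_right)
      also have "(\<Sum>j. ennreal ?a * indicator {x. real (m + j) * ?a < x} \<bar>f x\<bar>) * ennreal (w x)
        \<le> (\<Sum>j. ennreal ?a * indicator {x. real (m + j) * ?a < x} \<bar>f x\<bar>) * ennreal M"
        using wM by (intro mult_left_mono ennreal_leI) auto
      also have "\<dots> = (\<Sum>j. ennreal (?a * M) * indicator (E j) x)"
      proof -
        have "ennreal (?a * M) = ennreal ?a * ennreal M" by (rule ennreal_mult[OF less_imp_le[OF a0] M0])
        then have "ennreal ?a * indicator {x. real (m + j) * ?a < x} \<bar>f x\<bar> * ennreal M = ennreal (?a * M) * indicator (E j) x" for j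
          by (cases "x \<in> E j") (simp_all add: E_def)
        then show ?thesis unfolding ennreal_suminf_multc[symmetric] by (intro suminf_cong)
      qed
      finally show "ennreal (\<bar>f x\<bar> * w x) \<le> ennreal (real m * ?a) * ennreal (w x) + (\<Sum>j. ennreal (?a * M) * indicator (E j) x)"
        by (simp add: add_left_mono)
    qed
    also have "\<dots> = ennreal (real m * ?a) * (NNINT x. ennreal (w x)) + (NNINT x. (\<Sum>j. ennreal (?a * M) * indicator (E j) x))"
      by (subst nn_integral_add, measurable, subst nn_integral_cmult, measurable)
    also have "(NNINT x. (\<Sum>j. ennreal (?a * M) * indicator (E j) x)) = (\<Sum>j. ennreal (?a * M) * emeasure lborel (E j))"
      by (subst nn_integral_suminf, measurable) (simp add: nn_integral_cmult)
    also have "\<dots> \<le> (\<Sum>j. ennreal (?a * M * (2 * (1 / 2) ^ m * measure lborel ?B) * (1 / 2) ^ j))"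
    proof (rule suminf_le[OF _ summableI summableI])
      fix j
      have "ennreal (?a * M) * emeasure lborel (E j) \<le> ennreal (?a * M) * ennreal (2 * (1 / 2) ^ m * measure lborel ?B * (1 / 2) ^ j)"
        by (intro mult_left_mono Ej) simp
      also have "\<dots> = ennreal (?a * M * (2 * (1 / 2) ^ m * measure lborel ?B * (1 / 2) ^ j))"
        using L A M0 by (intro ennreal_mult[symmetric]) auto
      finally show "ennreal (?a * M) * emeasure lborel (E j) \<le> ennreal (?a * M * (2 * (1 / 2) ^ m * measure lborel ?B) * (1 / 2) ^ j)"
        by (simp add: mult_ac)
    qed
    also have "\<dots> = ennreal (?a * M * (2 * (1 / 2) ^ m * measure lborel ?B) * 2)"
    proof (rule suminf_ennreal_eq)
      show "0 \<le> ?a * M * (2 * (1 / 2) ^ m * measure lborel ?B) * (1 / 2) ^ j" for j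
        using L A M0 by (intro mult_nonneg_nonneg) auto
      show "(\<lambda>j. ?a * M * (2 * (1 / 2) ^ m * measure lborel ?B) * (1 / 2) ^ j) sums (?a * M * (2 * (1 / 2) ^ m * measure lborel ?B) * 2)"
        using geometric_sums[of "1/2::real"] by (intro sums_mult) simp
    qed
    also have "?a * M * (2 * (1 / 2) ^ m * measure lborel ?B) * 2 = 4 * L * A * M * measure lborel ?B * (1 / 2) ^ m" by simp
    finally show ?thesis by (simp add: add_left_mono)
  qed
  moreover have "0 < L" using L by simp
  ultimately show ?thesis by blast
qed

text \<open>Countably many balls decide the BMO bound up to a constant, which makes a majorant in
  time measurable. Enlarging to a nearby ball of the family costs 2^n, and changing the mean costs
  the same again.\<close>

lemma osc_le_from_dense:
  fixes f :: "'a::euclidean_space \<Rightarrow> real"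
  assumes f: "locint f" and D: "\<And>x e. 0 < e \<Longrightarrow> \<exists>y\<in>D. dist x y < e"
    and osc: "\<And>x r. x \<in> D \<Longrightarrow> r \<in> \<rat> \<Longrightarrow> 0 < r \<Longrightarrow> avg x r (\<lambda>y. \<bar>f y - avg x r f\<bar>) \<le> A"
  shows "osc_le f (2 * 2 ^ DIM('a) * A)"
  unfolding osc_le_def
proof (intro conjI allI impI f)
  fix x :: 'a and r :: real assume r: "0 < r"
  \<comment> \<open>With |x - z| < r/2 and s between 3r/2 and 2r the new ball contains the old one,
    and the ratio of measures is at most 2^n.\<close>
  obtain z where z: "z \<in> D" "dist x z < r / 2" using D[of "r / 2" x] r by auto
  obtain s where s: "s \<in> \<rat>" "3 / 2 * r < s" "s < 2 * r" using Rats_dense_in_real[of "3 / 2 * r" "2 * r"] r by auto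
  have s0: "0 < s" using s r by linarith
  have sub: "ball x r \<subseteq> ball z s" by (rule ball_scaled_subset) (use z s in linarith)
  let ?a = "avg z s f" and ?b = "avg x r f"
  have A0: "0 \<le> A" 
    by (rule order_trans[OF _ osc[OF z(1) s(1) s0]]) (auto simp: avg_def intro!: divide_nonneg_nonneg LINT_nonneg)
  have ratio: "measure lborel (ball z s) / measure lborel (ball x r) \<le> 2 ^ DIM('a)"
  proof -
    have "measure lborel (ball z s) \<le> measure lborel (ball z (2 * r))"
      by (rule measure_mono_fmeasurable) (use s in \<open>auto intro!: subset_ball simp: fmeasurable_def less_top[symmetric] emeasure_ball_eq\<close>)
    also have "\<dots> = 2 ^ DIM('a) * measure lborel (ball x r)" by (rule measure_ball_scale) (use r in auto)
    finally show ?thesis using measure_ball_pos[OF r, of x] by (simp add: divide_le_eq)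
  qed
  have 1: "avg x r (\<lambda>y. \<bar>f y - ?a\<bar>) \<le> 2 ^ DIM('a) * A"
  proof -
    have "avg x r (\<lambda>y. \<bar>f y - ?a\<bar>) \<le> measure lborel (ball z s) / measure lborel (ball x r) * avg z s (\<lambda>y. \<bar>f y - ?a\<bar>)"
      by (rule avg_mono_ball[OF locint_abs_diff[OF f] _ sub r]) simp
    also have "\<dots> \<le> measure lborel (ball z s) / measure lborel (ball x r) * A"
      by (intro mult_left_mono osc[OF z(1) s(1) s0]) (auto intro: divide_nonneg_nonneg)
    also have "\<dots> \<le> 2 ^ DIM('a) * A" by (intro mult_right_mono ratio A0)
    finally show ?thesis .
  qed
  have 2: "\<bar>?b - ?a\<bar> \<le> 2 ^ DIM('a) * A" using avg_diff_const[OF f r, of x ?a] 1 by linarith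
  have m: "0 < measure lborel (ball x r)" by (rule measure_ball_pos[OF r])
  have ia: "integrable lborel (\<lambda>y. indicator (ball x r) y * \<bar>f y - ?a\<bar>)" by (rule locint_ball_integrable[OF locint_abs_diff[OF f]])
  have ib: "integrable lborel (\<lambda>y. indicator (ball x r) y * \<bar>?b - ?a\<bar>)"
    by (intro integrable_mult_left integrable_real_indicator) (use emeasure_lborel_ball_finite in auto)
  have "(LINT y|lborel. indicator (ball x r) y * \<bar>f y - ?b\<bar>) \<le> (LINT y|lborel. indicator (ball x r) y * \<bar>f y - ?a\<bar> + indicator (ball x r) y * \<bar>?b - ?a\<bar>)"
    by (rule integral_mono[OF locint_ball_integrable[OF locint_abs_diff[OF f]] L1_add[OF ia ib]])
      (auto simp: indicator_def)
  also have "\<dots> = (LINT y|lborel. indicator (ball x r) y * \<bar>f y - ?a\<bar>) + measure lborel (ball x r) * \<bar>?b - ?a\<bar>"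
    unfolding LINT_add[OF ia ib] by simp
  finally have "avg x r (\<lambda>y. \<bar>f y - ?b\<bar>) \<le> avg x r (\<lambda>y. \<bar>f y - ?a\<bar>) + \<bar>?b - ?a\<bar>"
    using m unfolding avg_def by (simp add: field_simps)
  then show "avg x r (\<lambda>y. \<bar>f y - ?b\<bar>) \<le> 2 * 2 ^ DIM('a) * A" using 1 2 by linarith
qed

subsection \<open>Stability of the \<open>L\<^sub>p\<close> norm\<close>

text \<open>A is an integrable majorant in time of the BMO semi-norm of div b. It is strictly
  positive on (0,T), as the John--Nirenberg level L A has to be.\<close>

locale transport_BMO = transport T b G for T and b :: "real \<Rightarrow> real^'n \<Rightarrow> real^'n" and G +
  fixes A :: "real \<Rightarrow> real" and R :: real
  assumes R_pos: "0 < R" and A_integrable: "integrable lborel A" and A_nonneg: "\<And>s. 0 \<le> A s"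
    and osc: "AE s in lborel. 0 < s \<longrightarrow> s < T \<longrightarrow> 0 < A s \<and> osc_le (\<lambda>x. trace (G s x)) (A s)"
    and growth: "(NNINT t. NNINT x. ennreal (norm (b t x) / (1 + norm x))) < \<infinity>"
    and supp: "\<And>t. AE x in lborel. R < norm x \<longrightarrow> trace (G t x) = 0"
begin

definition div_term :: "real \<Rightarrow> (real \<Rightarrow> real^'n \<Rightarrow> real) \<Rightarrow> real \<Rightarrow> real" where
  "div_term p w s = (LINT x|lborel. trace (G s x) * \<bar>w s x\<bar> powr p)"

text \<open>The continuous version of the p-th power of the norm. It agrees with \<integral>
  |w(t)|^p only for almost every t, but as a primitive it has a value at each time, so intervals can
  be joined at end points.\<close>

definition Lp_power :: "real \<Rightarrow> (real^'n \<Rightarrow> real) \<Rightarrow> (real \<Rightarrow> real^'n \<Rightarrow> real) \<Rightarrow> real \<Rightarrow> real" where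
  "Lp_power p w0 w t = (LINT x|lborel. \<bar>w0 x\<bar> powr p) + prim (div_term p w) t"

lemma Lp_power:
  assumes w: "sol w0 w M" and p: "0 < p" and i0: "integrable lborel (\<lambda>x. \<bar>w0 x\<bar> powr p)"
  shows "integrable lborel (div_term p w)"
    and "AE t in lborel. 0 < t \<longrightarrow> t < T \<longrightarrow> integrable lborel (\<lambda>x. \<bar>w t x\<bar> powr p) \<and> (LINT x|lborel. \<bar>w t x\<bar> powr p) = Lp_power p w0 w t"
proof -
  have c: "continuous_on UNIV (\<lambda>y::real. \<bar>y\<bar> powr p)"
    by (rule continuous_on_powr') (use p in \<open>auto intro!: continuous_intros\<close>)
  have s: "sol (\<lambda>x. \<bar>w0 x\<bar> powr p) (\<lambda>t x. \<bar>w t x\<bar> powr p) (M powr p + 1)"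
    by (rule sol_continuous[OF w c]) (use p in \<open>auto intro!: powr_mono2\<close>)
  note e = energy[OF s _ i0 growth supp]
  show "integrable lborel (div_term p w)" using e(1) by (simp add: div_term_def[abs_def])
  show "AE t in lborel. 0 < t \<longrightarrow> t < T \<longrightarrow> integrable lborel (\<lambda>x. \<bar>w t x\<bar> powr p) \<and> (LINT x|lborel. \<bar>w t x\<bar> powr p) = Lp_power p w0 w t"
    using e(2) by (simp add: Lp_power_def div_term_def[abs_def])
qed

text \<open>L and C depend on M, p and the field but not on the solution or on m. This uniformity
  lets m be chosen late and \<delta> be the same for all solutions.\<close>

lemma div_term_bound:
  assumes p: "0 < p" and M: "0 \<le> M"
  shows "\<exists>L>0. \<exists>C>0. \<forall>w0 w m. sol w0 w M \<longrightarrow> integrable lborel (\<lambda>x. \<bar>w0 x\<bar> powr p) \<longrightarrow> 1 \<le> m \<longrightarrow>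
    (AE s in lborel. 0 < s \<longrightarrow> s < T \<longrightarrow>
      \<bar>div_term p w s\<bar> \<le> real m * (L * A s) * \<bar>Lp_power p w0 w s\<bar> + C * (1 / 2) ^ m * A s)"
proof -
  obtain L where L: "0 < L" and JN: "\<And>(f :: real^'n \<Rightarrow> real) A R M w m. osc_le f A \<Longrightarrow> 0 < A \<Longrightarrow> 0 < R \<Longrightarrow>
     (AE x in lborel. R < norm x \<longrightarrow> f x = 0) \<Longrightarrow> w \<in> borel_measurable borel \<Longrightarrow> (\<forall>x. 0 \<le> w x \<and> w x \<le> M) \<Longrightarrow> 1 \<le> m \<Longrightarrow>
     (NNINT x. ennreal (\<bar>f x\<bar> * w x)) \<le> ennreal (real m * (L * A)) * (NNINT x. ennreal (w x))
        + ennreal (4 * L * A * M * measure lborel (ball (0::real^'n) (2 * R)) * (1 / 2) ^ m)"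
    using John_Nirenberg_weighted[where 'a="real^'n"] by blast
  define C where "C = 4 * L * (M powr p) * measure lborel (ball (0::real^'n) (2 * R)) + 1"
  have C0: "0 < C" unfolding C_def using L by (intro add_nonneg_pos mult_nonneg_nonneg) auto
  have "AE s in lborel. 0 < s \<longrightarrow> s < T \<longrightarrow>
      \<bar>div_term p w s\<bar> \<le> real m * (L * A s) * \<bar>Lp_power p w0 w s\<bar> + C * (1 / 2) ^ m * A s"
    if w: "sol w0 w M" and i0: "integrable lborel (\<lambda>x. \<bar>w0 x\<bar> powr p)" and m: "1 \<le> m" for w0 w m
    using Lp_power(2)[OF w p i0] osc
  proof eventually_elim
    case (elim s)
    show ?case
    proof (intro impI)
      assume s: "0 < s" "s < T"
      note bw = solD(3)[OF w]
      have As: "0 < A s" "osc_le (\<lambda>x. trace (G s x)) (A s)" and iw: "integrable lborel (\<lambda>x. \<bar>w s x\<bar> powr p)"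
        and eq: "(LINT x|lborel. \<bar>w s x\<bar> powr p) = Lp_power p w0 w s"
        using elim s by auto
      have wm[measurable]: "(\<lambda>x. \<bar>w s x\<bar> powr p) \<in> borel_measurable borel"
        using bounded_funD(2)[OF bw, of s] by measurable
      have wb: "\<forall>x. 0 \<le> \<bar>w s x\<bar> powr p \<and> \<bar>w s x\<bar> powr p \<le> M powr p"
        using bounded_funD(3)[OF bw] p by (auto intro!: powr_mono2)
      have nn: "0 \<le> Lp_power p w0 w s" unfolding eq[symmetric] by (rule LINT_nonneg) simp
      have "(NNINT x. ennreal (\<bar>trace (G s x)\<bar> * \<bar>w s x\<bar> powr p))
        \<le> ennreal (real m * (L * A s)) * (NNINT x. ennreal (\<bar>w s x\<bar> powr p))
          + ennreal (4 * L * A s * (M powr p) * measure lborel (ball (0::real^'n) (2 * R)) * (1 / 2) ^ m)"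
        by (rule JN[OF As(2,1) R_pos supp wm wb m])
      also have "(NNINT x. ennreal (\<bar>w s x\<bar> powr p)) = ennreal (Lp_power p w0 w s)"
        unfolding eq[symmetric] by (rule nn_integral_eq_integral[OF iw]) simp
      also have "ennreal (real m * (L * A s)) * ennreal (Lp_power p w0 w s)
          + ennreal (4 * L * A s * (M powr p) * measure lborel (ball (0::real^'n) (2 * R)) * (1 / 2) ^ m)
        = ennreal (real m * (L * A s) * Lp_power p w0 w s + 4 * L * A s * (M powr p) * measure lborel (ball (0::real^'n) (2 * R)) * (1 / 2) ^ m)"
        using L As nn by (subst ennreal_mult[symmetric]) (auto intro!: ennreal_plus[symmetric] mult_nonneg_nonneg)
      also have "\<dots> \<le> ennreal (real m * (L * A s) * \<bar>Lp_power p w0 w s\<bar> + C * (1 / 2) ^ m * A s)"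
        using As nn by (intro ennreal_leI add_mono) (auto simp: C_def algebra_simps)
      finally have le: "(NNINT x. ennreal (\<bar>trace (G s x)\<bar> * \<bar>w s x\<bar> powr p)) \<le> ennreal (real m * (L * A s) * \<bar>Lp_power p w0 w s\<bar> + C * (1 / 2) ^ m * A s)" .
      have pos: "0 \<le> real m * (L * A s) * \<bar>Lp_power p w0 w s\<bar> + C * (1 / 2) ^ m * A s"
        using L As C0 by (intro add_nonneg_nonneg mult_nonneg_nonneg) auto
      show "\<bar>div_term p w s\<bar> \<le> real m * (L * A s) * \<bar>Lp_power p w0 w s\<bar> + C * (1 / 2) ^ m * A s"
      proof (cases "integrable lborel (\<lambda>x. trace (G s x) * \<bar>w s x\<bar> powr p)")
        case True
        have "ennreal \<bar>div_term p w s\<bar> \<le> (NNINT x. ennreal (\<bar>trace (G s x)\<bar> * \<bar>w s x\<bar> powr p))"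
          unfolding div_term_def using integral_norm_bound_ennreal[OF True] by (simp add: abs_mult)
        then have "ennreal \<bar>div_term p w s\<bar> \<le> ennreal (real m * (L * A s) * \<bar>Lp_power p w0 w s\<bar> + C * (1 / 2) ^ m * A s)"
          using le by (rule order_trans)
        then show ?thesis using pos by (subst (asm) ennreal_le_iff)
      qed (use pos in \<open>simp add: div_term_def not_integrable_integral_eq\<close>)
    qed
  qed
  then show ?thesis using L C0 by blast
qed

lemma prim_add_interval:
  assumes g: "integrable lborel g" and t: "0 \<le> t1" "t1 \<le> t"
  shows "prim (\<lambda>s. if t1 < s then g s else 0) t = prim g t - prim g t1"
proof -
  have i1: "integrable lborel (\<lambda>s. if t1 < s then g s else 0)"
    by (rule L1_bound[OF g]) (use borel_measurable_integrable[OF g] in auto)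
  have i2: "integrable lborel (\<lambda>s. if s \<le> t1 then g s else 0)"
    by (rule L1_bound[OF g]) (use borel_measurable_integrable[OF g] in auto)
  have "prim g t = prim (\<lambda>s. (if t1 < s then g s else 0) + (if s \<le> t1 then g s else 0)) t"
    unfolding prim_def by (intro LINT_cong) auto
  also have "\<dots> = prim (\<lambda>s. if t1 < s then g s else 0) t + prim (\<lambda>s. if s \<le> t1 then g s else 0) t"
    by (rule prim_add[OF i1 i2])
  also have "prim (\<lambda>s. if s \<le> t1 then g s else 0) t = prim g t1"
    unfolding prim_def by (intro LINT_cong) (use t in auto)
  finally show ?thesis by simp
qed

text \<open>On an interval where \<open>\<integral> L A \<le> ln 2 / 2\<close>, Gronwall's inequality loses a factor \<open>2\<^sup>m\<^sup>/\<^sup>2\<close> while the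
  error term gains \<open>2\<^sup>-\<^sup>m\<close>.\<close>

lemma Lp_power_step:
  assumes p: "0 < p" and M: "0 \<le> M"
  shows "\<exists>L>0. \<exists>C>0. \<forall>w0 w m t1 t2 t. sol w0 w M \<longrightarrow> integrable lborel (\<lambda>x. \<bar>w0 x\<bar> powr p) \<longrightarrow> 1 \<le> m \<longrightarrow>
     0 \<le> t1 \<longrightarrow> t2 \<le> T \<longrightarrow> prim A t2 - prim A t1 \<le> ln 2 / 2 / L \<longrightarrow>
     t1 \<le> t \<longrightarrow> t \<le> t2 \<longrightarrow> \<bar>Lp_power p w0 w t\<bar> \<le> (\<bar>Lp_power p w0 w t1\<bar> + C * (1 / 2) ^ m) * exp (ln 2 / 2) ^ m"
proof -
  obtain L C where L: "0 < L" and C: "0 < C" and bnd: "\<And>w0 w m. sol w0 w M \<Longrightarrow> integrable lborel (\<lambda>x. \<bar>w0 x\<bar> powr p) \<Longrightarrow> 1 \<le> m \<Longrightarrow>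
    (AE s in lborel. 0 < s \<longrightarrow> s < T \<longrightarrow>
      \<bar>div_term p w s\<bar> \<le> real m * (L * A s) * \<bar>Lp_power p w0 w s\<bar> + C * (1 / 2) ^ m * A s)"
    using div_term_bound[OF p M] by blast
  define I where "I = (LINT s|lborel. \<bar>A s\<bar>)"
  have I0: "0 \<le> I" unfolding I_def by (rule LINT_nonneg) simp
  note [measurable] = borel_measurable_integrable[OF A_integrable, simplified]
  \<comment> \<open>The error C 2^-m A is integrated in time, which gives C I 2^-m; the added 1
    keeps the new constant positive when I = 0.\<close>
  have "\<bar>Lp_power p w0 w t\<bar> \<le> (\<bar>Lp_power p w0 w t1\<bar> + C * (I + 1) * (1 / 2) ^ m) * exp (ln 2 / 2) ^ m"
    if w: "sol w0 w M" and i0: "integrable lborel (\<lambda>x. \<bar>w0 x\<bar> powr p)" and m: "1 \<le> m"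
      and t12: "0 \<le> t1" "t2 \<le> T" and small: "prim A t2 - prim A t1 \<le> ln 2 / 2 / L" and t: "t1 \<le> t" "t \<le> t2" for w0 w m t1 t2 t
  proof -
    have hi: "integrable lborel (div_term p w)" by (rule Lp_power(1)[OF w p i0])
    note [measurable] = borel_measurable_integrable[OF hi, simplified]
    let ?Y = "Lp_power p w0 w"
    define S where "S = (LINT x|lborel. \<bar>w0 x\<bar> powr p) + (LINT s|lborel. \<bar>div_term p w s\<bar>)"
    have I00: "0 \<le> (LINT x|lborel. \<bar>w0 x\<bar> powr p)" by (rule LINT_nonneg) simp
    have YS: "\<bar>?Y s\<bar> \<le> S" for s
      using prim_abs_le[OF hi, of s] I00 unfolding Lp_power_def S_def by linarith
    have [measurable]: "?Y \<in> borel_measurable borel" unfolding Lp_power_def by measurable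
    \<comment> \<open>\<open>Gronwall_prim\<close> starts at 0. Switching the density N on at t1 and
      setting X to 0 before t1 moves its starting point to t1.\<close>
    define N where "N s = (if t1 < s then L * A s else 0)" for s
    have Ni: "integrable lborel N" unfolding N_def
      by (rule L1_bound[OF integrable_mult_right[OF A_integrable, of L]]) auto
    note [measurable] = borel_measurable_integrable[OF Ni, simplified]
    have N0: "0 \<le> N s" for s using L A_nonneg by (simp add: N_def)
    define X where "X s = (if t1 \<le> s \<and> s \<le> T then \<bar>?Y s\<bar> else 0)" for s
    have [measurable]: "X \<in> borel_measurable borel" unfolding X_def by measurable
    have S0: "0 \<le> S" using YS[of 0] by linarith
    have XS: "\<bar>X s\<bar> \<le> S" for s using YS S0 by (simp add: X_def)
    let ?K = "\<bar>?Y t1\<bar> + C * (I + 1) * (1 / 2) ^ m"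
    have K0: "0 \<le> ?K" using C I0 by (intro add_nonneg_nonneg mult_nonneg_nonneg) auto
    have iA: "integrable lborel (\<lambda>s. if t1 < s then C * (1 / 2) ^ m * A s else 0)"
      by (rule L1_bound[OF integrable_mult_right[OF A_integrable, of "C * (1/2)^m"]]) auto
    have iNX: "integrable lborel (\<lambda>s. real m * (N s * X s))"
      by (rule integrable_mult_right[OF integrable_mult_bounded[OF Ni _ XS]]) measurable
    have ih: "integrable lborel (\<lambda>s. if t1 < s then div_term p w s else 0)"
      by (rule L1_bound[OF hi]) auto
    have main: "X s \<le> ?K + real m * prim (\<lambda>s. N s * X s) s" if s: "0 \<le> s" "s \<le> t2" for s
    proof (cases "t1 \<le> s")
      case True
      have "\<bar>?Y s - ?Y t1\<bar> = \<bar>prim (\<lambda>r. if t1 < r then div_term p w r else 0) s\<bar>"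
        unfolding prim_add_interval[OF hi t12(1) True] by (simp add: Lp_power_def)
      also have "\<dots> \<le> (LINT r|lborel. \<bar>if 0 \<le> r \<and> r \<le> s then (if t1 < r then div_term p w r else 0) else 0\<bar>)"
        unfolding prim_def using integral_norm_bound[of lborel "\<lambda>r. if 0 \<le> r \<and> r \<le> s then (if t1 < r then div_term p w r else 0) else 0"] by simp
      also have "\<dots> \<le> (LINT r|lborel. (if 0 \<le> r \<and> r \<le> s then real m * (N r * X r) + (if t1 < r then C * (1 / 2) ^ m * A r else 0) else 0))"
      proof (rule integral_mono_AE[OF integrable_abs[OF prim_integrable[OF ih]] prim_integrable[OF L1_add[OF iNX iA]]])
        \<comment> \<open>The bound on \<open>div_term\<close> is for times strictly below T, while
          t2 may equal T.\<close>
        have "AE r in lborel. r \<noteq> T" by (rule AE_lborel_singleton)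
        then show "AE r in lborel. \<bar>if 0 \<le> r \<and> r \<le> s then (if t1 < r then div_term p w r else 0) else 0\<bar>
          \<le> (if 0 \<le> r \<and> r \<le> s then real m * (N r * X r) + (if t1 < r then C * (1 / 2) ^ m * A r else 0) else 0)"
          using bnd[OF w i0 m]
        proof eventually_elim
          case (elim r)
          show ?case
          proof (cases "0 \<le> r \<and> r \<le> s \<and> t1 < r")
            case True
            then have "0 < r" "r < T" "t1 \<le> r" "r \<le> T" using elim s t12 by auto
            then show ?thesis using elim True by (simp add: N_def X_def mult_ac)
          qed (use L C A_nonneg in \<open>auto simp: N_def\<close>)
        qed
      qed
      also have "\<dots> = prim (\<lambda>r. real m * (N r * X r)) s + prim (\<lambda>r. if t1 < r then C * (1 / 2) ^ m * A r else 0) s"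
        using prim_add[OF iNX iA, of s] by (simp only: prim_def)
      also have "prim (\<lambda>r. real m * (N r * X r)) s = real m * prim (\<lambda>s. N s * X s) s" by (rule prim_cmult)
      also have "prim (\<lambda>r. if t1 < r then C * (1 / 2) ^ m * A r else 0) s \<le> C * (I + 1) * (1 / 2) ^ m"
      proof -
        have "prim (\<lambda>r. if t1 < r then C * (1 / 2) ^ m * A r else 0) s \<le> (LINT r|lborel. \<bar>if t1 < r then C * (1 / 2) ^ m * A r else 0\<bar>)"
          using prim_abs_le[OF iA, of s] by linarith
        also have "\<dots> \<le> (LINT r|lborel. C * (1 / 2) ^ m * \<bar>A r\<bar>)"
          by (rule integral_mono[OF integrable_abs[OF iA] integrable_mult_right[OF integrable_abs[OF A_integrable]]])
            (use C in \<open>auto simp: abs_mult\<close>)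
        also have "\<dots> = C * I * (1 / 2) ^ m" by (simp add: I_def)
        also have "\<dots> \<le> C * (I + 1) * (1 / 2) ^ m" using C by (intro mult_right_mono mult_left_mono) auto
        finally show ?thesis .
      qed
      finally have "\<bar>?Y s\<bar> \<le> ?K + real m * prim (\<lambda>s. N s * X s) s" by linarith
      then show ?thesis using True s t12 by (simp add: X_def)
    next
      case False
      have "0 \<le> prim (\<lambda>s. N s * X s) s" unfolding prim_def
        by (rule LINT_nonneg) (auto simp: X_def intro!: mult_nonneg_nonneg N0)
      then have "0 \<le> ?K + real m * prim (\<lambda>s. N s * X s) s" using K0 by (intro add_nonneg_nonneg[OF K0] mult_nonneg_nonneg) auto
      then show ?thesis using False by (simp add: X_def)
    qed
    have "X t \<le> ?K * exp (real m * prim N t)"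
      by (rule Gronwall_prim[OF Ni N0 _ XS main _ K0]) (use t t12 in auto)
    also have "prim N t = L * (prim A t - prim A t1)"
    proof -
      have "prim N t = prim (\<lambda>s. L * (if t1 < s then A s else 0)) t"
        unfolding N_def by (simp add: if_distrib[of "\<lambda>x. L * x"] cong: if_cong)
      then show ?thesis using prim_add_interval[OF A_integrable t12(1) t(1)] by (simp add: prim_cmult)
    qed
    also have "?K * exp (real m * (L * (prim A t - prim A t1))) \<le> ?K * exp (real m * (ln 2 / 2))"
    proof -
      have "prim A t \<le> prim A t2" unfolding prim_def
        by (rule integral_mono[OF prim_integrable[OF A_integrable] prim_integrable[OF A_integrable]]) (use t A_nonneg in auto)
      then have "L * (prim A t - prim A t1) \<le> L * (ln 2 / 2 / L)" using small L by (intro mult_left_mono) auto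
      also have "\<dots> = ln 2 / 2" using L by simp
      finally have "real m * (L * (prim A t - prim A t1)) \<le> real m * (ln 2 / 2)" by (rule mult_left_mono) simp
      then show ?thesis by (intro mult_left_mono K0) simp
    qed
    also have "exp (real m * (ln 2 / 2)) = exp (ln 2 / 2 :: real) ^ m" by (rule exp_of_nat_mult)
    finally show ?thesis using t t12 by (simp add: X_def)
  qed
  moreover have "0 < C * (I + 1)" using C I0 by simp
  ultimately show ?thesis using L by blast
qed

text \<open>Smallness is carried from one interval to the next, each short enough for
  \<open>Lp_power_step\<close>. The quantity \<delta> depends on M, p and the field only, which is
  what a sequence of solutions needs.\<close>

lemma Lp_power_stable:
  assumes p: "0 < p" and M: "0 \<le> M"
  shows "\<forall>\<epsilon>>0. \<exists>\<delta>>0. \<forall>w0 w. sol w0 w M \<longrightarrow> integrable lborel (\<lambda>x. \<bar>w0 x\<bar> powr p) \<longrightarrow> (LINT x|lborel. \<bar>w0 x\<bar> powr p) \<le> \<delta> \<longrightarrow>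
     (\<forall>t. 0 \<le> t \<longrightarrow> t \<le> T \<longrightarrow> \<bar>Lp_power p w0 w t\<bar> \<le> \<epsilon>)"
proof -
  obtain L C where L: "0 < L" and C: "0 < C" and step: "\<And>w0 w m t1 t2 t. sol w0 w M \<Longrightarrow> integrable lborel (\<lambda>x. \<bar>w0 x\<bar> powr p) \<Longrightarrow> 1 \<le> m \<Longrightarrow>
     0 \<le> t1 \<Longrightarrow> t2 \<le> T \<Longrightarrow> prim A t2 - prim A t1 \<le> ln 2 / 2 / L \<Longrightarrow> t1 \<le> t \<Longrightarrow> t \<le> t2 \<Longrightarrow>
     \<bar>Lp_power p w0 w t\<bar> \<le> (\<bar>Lp_power p w0 w t1\<bar> + C * (1 / 2) ^ m) * exp (ln 2 / 2) ^ m"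
    using Lp_power_step[OF p M] by blast
  define Q where "Q \<tau> \<longleftrightarrow> (\<forall>\<epsilon>>0. \<exists>\<delta>>0. \<forall>w0 w. sol w0 w M \<longrightarrow> integrable lborel (\<lambda>x. \<bar>w0 x\<bar> powr p) \<longrightarrow> (LINT x|lborel. \<bar>w0 x\<bar> powr p) \<le> \<delta> \<longrightarrow>
     (\<forall>t. 0 \<le> t \<longrightarrow> t \<le> \<tau> \<longrightarrow> \<bar>Lp_power p w0 w t\<bar> \<le> \<epsilon>))" for \<tau>
  define c where "c = ln 2 / 2 / L"
  have c0: "0 < c" using L by (simp add: c_def)
  \<comment> \<open>E is the square root of 2, so E/2 < 1: the error C (E/2)^m after Gronwall still
    tends to 0.\<close>
  define E where "E = exp (ln 2 / 2 :: real)"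
  have E0: "0 < E" by (simp add: E_def)
  have E2: "E < 2"
  proof -
    have "E < exp (ln 2)" unfolding E_def by (subst exp_less_cancel_iff) simp
    then show ?thesis by simp
  qed
  have A0: "prim A 0 = 0"
  proof -
    have "prim A 0 = (\<integral>s. 0 \<partial>(lborel::real measure))" unfolding prim_def
    proof (rule integral_cong_AE)
      have "AE s in lborel. s \<noteq> (0::real)" by (rule AE_lborel_singleton)
      then show "AE s in lborel. (if 0 \<le> s \<and> s \<le> 0 then A s else 0) = 0" by eventually_elim auto
    qed (use borel_measurable_integrable[OF A_integrable] in auto)
    then show ?thesis by simp
  qed
  have Q0: "Q 0"
  proof -
    have "prim (div_term p w) 0 = 0" if w: "sol w0 w M" and i0: "integrable lborel (\<lambda>x. \<bar>w0 x\<bar> powr p)" for w0 w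
    proof -
      note hi = Lp_power(1)[OF w p i0]
      have "prim (div_term p w) 0 = (\<integral>s. 0 \<partial>(lborel::real measure))" unfolding prim_def
      proof (rule integral_cong_AE)
        have "AE s in lborel. s \<noteq> (0::real)" by (rule AE_lborel_singleton)
        then show "AE s in lborel. (if 0 \<le> s \<and> s \<le> 0 then div_term p w s else 0) = 0" by eventually_elim auto
      qed (use borel_measurable_integrable[OF hi] in auto)
      then show ?thesis by simp
    qed
    then have start: "\<bar>Lp_power p w0 w 0\<bar> = (LINT x|lborel. \<bar>w0 x\<bar> powr p)" if "sol w0 w M" "integrable lborel (\<lambda>x. \<bar>w0 x\<bar> powr p)" for w0 w
      using that LINT_nonneg[of lborel "\<lambda>x. \<bar>w0 x\<bar> powr p"] by (simp add: Lp_power_def)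
    show ?thesis unfolding Q_def
    proof (intro allI impI)
      fix \<epsilon> :: real assume \<epsilon>: "0 < \<epsilon>"
      show "\<exists>\<delta>>0. \<forall>w0 w. sol w0 w M \<longrightarrow> integrable lborel (\<lambda>x. \<bar>w0 x\<bar> powr p) \<longrightarrow> (LINT x|lborel. \<bar>w0 x\<bar> powr p) \<le> \<delta> \<longrightarrow>
        (\<forall>t. 0 \<le> t \<longrightarrow> t \<le> 0 \<longrightarrow> \<bar>Lp_power p w0 w t\<bar> \<le> \<epsilon>)"
      proof (intro exI[of _ \<epsilon>] conjI allI impI \<epsilon>)
        fix w0 w and t :: real
        assume w: "sol w0 w M" "integrable lborel (\<lambda>x. \<bar>w0 x\<bar> powr p)" "(LINT x|lborel. \<bar>w0 x\<bar> powr p) \<le> \<epsilon>" and "0 \<le> t" "t \<le> 0"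
        then have "t = 0" by (intro antisym)
        show "\<bar>Lp_power p w0 w t\<bar> \<le> \<epsilon>" unfolding \<open>t = 0\<close> start[OF w(1,2)] by (rule w(3))
      qed
    qed
  qed
  have Qstep: "Q t2" if Q1: "Q t1" and t12: "0 \<le> t1" "t1 \<le> t2" "t2 \<le> T" and small: "prim A t2 - prim A t1 \<le> c" for t1 t2
    unfolding Q_def
  proof (intro allI impI)
    fix \<epsilon> :: real assume \<epsilon>: "0 < \<epsilon>"
    have "(\<lambda>m. C * (E / 2) ^ m) \<longlonglongrightarrow> C * 0"
      by (intro tendsto_intros LIMSEQ_realpow_zero) (use E0 E2 in auto)
    then have "\<forall>\<^sub>F m in sequentially. C * (E / 2) ^ m < \<epsilon> / 2" using \<epsilon> by (intro order_tendstoD(2)) auto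
    then have "\<forall>\<^sub>F m in sequentially. C * (E / 2) ^ m < \<epsilon> / 2 \<and> 1 \<le> m"
      using eventually_ge_at_top[of 1] by (rule eventually_conj)
    then obtain m where m: "C * (E / 2) ^ m < \<epsilon> / 2" "1 \<le> m" using eventually_happens'[OF sequentially_bot] by blast
    \<comment> \<open>The order matters: m is fixed by \<epsilon> alone, and only then is the value
      at t1 required to be so small that the loss E^m leaves it below \<epsilon>/2.\<close>
    define \<epsilon>1 where "\<epsilon>1 = min \<epsilon> (\<epsilon> / 2 / E ^ m)"
    have "0 < \<epsilon>1" using \<epsilon> E0 by (simp add: \<epsilon>1_def)
    then have "\<exists>\<delta>>0. \<forall>w0 w. sol w0 w M \<longrightarrow> integrable lborel (\<lambda>x. \<bar>w0 x\<bar> powr p) \<longrightarrow> (LINT x|lborel. \<bar>w0 x\<bar> powr p) \<le> \<delta> \<longrightarrow>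
       (\<forall>t. 0 \<le> t \<longrightarrow> t \<le> t1 \<longrightarrow> \<bar>Lp_power p w0 w t\<bar> \<le> \<epsilon>1)"
      using Q1 unfolding Q_def by (elim allE[of _ \<epsilon>1] impE)
    then obtain \<delta> where \<delta>: "0 < \<delta>" and "\<forall>w0 w. sol w0 w M \<longrightarrow> integrable lborel (\<lambda>x. \<bar>w0 x\<bar> powr p) \<longrightarrow> (LINT x|lborel. \<bar>w0 x\<bar> powr p) \<le> \<delta> \<longrightarrow>
       (\<forall>t. 0 \<le> t \<longrightarrow> t \<le> t1 \<longrightarrow> \<bar>Lp_power p w0 w t\<bar> \<le> \<epsilon>1)" by (elim exE conjE)
    note \<delta>1 = this(2)[rule_format]
    have "\<bar>Lp_power p w0 w t\<bar> \<le> \<epsilon>"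
      if w: "sol w0 w M" "integrable lborel (\<lambda>x. \<bar>w0 x\<bar> powr p)" "(LINT x|lborel. \<bar>w0 x\<bar> powr p) \<le> \<delta>" and t: "0 \<le> t" "t \<le> t2" for w0 w t
    proof (cases "t \<le> t1")
      case True
      then show ?thesis using \<delta>1[OF w t(1)] by (simp add: \<epsilon>1_def)
    next
      case False
      have "\<bar>Lp_power p w0 w t\<bar> \<le> (\<bar>Lp_power p w0 w t1\<bar> + C * (1 / 2) ^ m) * E ^ m"
        unfolding E_def by (rule step[OF w(1,2) m(2) t12(1,3)]) (use small t False in \<open>auto simp: c_def\<close>)
      also have "\<dots> = \<bar>Lp_power p w0 w t1\<bar> * E ^ m + C * (E / 2) ^ m"
        by (simp add: distrib_right power_divide)
      also have "\<bar>Lp_power p w0 w t1\<bar> * E ^ m \<le> (\<epsilon> / 2 / E ^ m) * E ^ m"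
        using \<delta>1[OF w t12(1) order_refl] E0 by (intro mult_right_mono) (auto simp: \<epsilon>1_def)
      also have "\<dots> = \<epsilon> / 2" using E0 by simp
      finally show ?thesis using m(1) by linarith
    qed
    then show "\<exists>\<delta>>0. \<forall>w0 w. sol w0 w M \<longrightarrow> integrable lborel (\<lambda>x. \<bar>w0 x\<bar> powr p) \<longrightarrow> (LINT x|lborel. \<bar>w0 x\<bar> powr p) \<le> \<delta> \<longrightarrow>
     (\<forall>t. 0 \<le> t \<longrightarrow> t \<le> t2 \<longrightarrow> \<bar>Lp_power p w0 w t\<bar> \<le> \<epsilon>)" by (intro exI[of _ \<delta>] conjI \<delta> allI impI) simp
  qed
  have cont: "continuous_on UNIV (prim A)"
    unfolding continuous_on_eq_continuous_at[OF open_UNIV] continuous_at_sequentially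
    using prim_continuous[OF A_integrable] by (auto simp: o_def)
  have "Q t" if "0 \<le> t" "t \<le> T" "prim A t \<le> real k * c" for k t
    using that
  proof (induction k arbitrary: t)
    case 0
    then show ?case using Qstep[OF Q0, of t] A0 c0 by simp
  next
    case (Suc k)
    show ?case
    proof (cases "prim A t \<le> real k * c")
      case True
      then show ?thesis using Suc by blast
    next
      case False
      obtain t1 where t1: "0 \<le> t1" "t1 \<le> t" "prim A t1 = real k * c"
        using IVT'[of "prim A" 0 "real k * c" t] False A0 c0 Suc.prems cont by (auto intro: continuous_on_subset)
      have "Q t1" using Suc.IH[of t1] t1 Suc.prems by simp
      then show ?thesis
        by (rule Qstep[OF _ t1(1,2)]) (use t1 Suc.prems in \<open>auto simp: algebra_simps\<close>)
    qed
  qed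
  moreover obtain k where "prim A T / c < real k" using reals_Archimedean2 by blast
  then have "prim A T \<le> real k * c" using c0 by (simp add: divide_less_eq)
  ultimately have "Q T" using T_pos by simp
  then show ?thesis unfolding Q_def .
qed

end

subsection \<open>Borel representatives\<close>

lemma ex_borel_version:
  fixes f :: "'a::euclidean_space \<Rightarrow> 'b::euclidean_space"
  assumes f: "f \<in> borel_measurable lebesgue"
  shows "\<exists>g\<in>borel_measurable borel. AE x in lborel. f x = g x"
proof -
  have "\<exists>h\<in>borel_measurable lborel. AE x in lborel. f x \<bullet> i = h x" for i
    by (rule completion_ex_borel_measurable_real) (use f in measurable)
  then obtain h where h: "\<And>i. h i \<in> borel_measurable lborel" "\<And>i. AE x in lborel. f x \<bullet> i = h i x" by metis
  have "AE x in lborel. \<forall>i\<in>Basis. f x \<bullet> i = h i x" by (rule AE_finite_allI) (use h in auto)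
  then have "AE x in lborel. f x = (\<Sum>i\<in>Basis. h i x *\<^sub>R i)"
  proof eventually_elim
    case (elim x)
    have "f x = (\<Sum>i\<in>Basis. (f x \<bullet> i) *\<^sub>R i)" by (simp add: euclidean_representation)
    then show ?case using elim by simp
  qed
  moreover have "(\<lambda>x. \<Sum>i\<in>Basis. h i x *\<^sub>R i) \<in> borel_measurable borel"
    by (intro borel_measurable_sum borel_measurable_scaleR borel_measurable_const) (use h(1) in simp)
  ultimately show ?thesis by (rule bexI)
qed

text \<open>Completeness of Lebesgue measure: any change on a null set is harmless.\<close>

lemma lebesgue_measurable_AE:
  assumes "g \<in> borel_measurable borel" "AE x in lborel. f x = g x"
  shows "f \<in> borel_measurable lebesgue"
proof -
  have g: "g \<in> borel_measurable lebesgue" by (rule measurable_completion) (use assms in simp)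
  have "AE x in lebesgue. g x = f x" using AE_completion[OF assms(2)] by eventually_elim simp
  then obtain N where N: "N \<in> null_sets lebesgue" "{x. g x \<noteq> f x} \<subseteq> N"
    unfolding eventually_ae_filter by auto
  show ?thesis
  proof (rule measurableI)
    fix A :: "'b set" assume A: "A \<in> sets borel"
    have eq: "f -` A = (g -` A - N) \<union> (f -` A \<inter> N)"
    proof -
      have "g x = f x" if "x \<notin> N" for x using N(2) that by blast
      then show ?thesis by auto
    qed
    have gA: "g -` A \<in> sets lebesgue" using measurable_sets[OF g A] by simp
    have fA: "f -` A \<inter> N \<in> sets lebesgue" using completion.complete2[of "f -` A \<inter> N" N] N by auto
    have "(g -` A - N) \<union> (f -` A \<inter> N) \<in> sets lebesgue" using gA fA null_setsD2[OF N(1)] by (intro sets.Un sets.Diff)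
    then have "f -` A \<in> sets lebesgue" by (subst eq)
    then show "f -` A \<inter> space lebesgue \<in> sets lebesgue" by simp
  qed auto
qed

lemma integral_lebesgue_AE:
  fixes f g :: "'a::euclidean_space \<Rightarrow> 'b::euclidean_space"
  assumes g: "g \<in> borel_measurable borel" and AE: "AE x in lborel. f x = g x"
  shows "(\<integral>x. f x \<partial>lebesgue) = (LINT x|lborel. g x)" and "integrable lebesgue f \<longleftrightarrow> integrable lborel g"
proof -
  have gl: "g \<in> borel_measurable lborel" using g by simp
  then have gc: "g \<in> borel_measurable lebesgue" by (rule measurable_completion)
  have f: "f \<in> borel_measurable lebesgue" by (rule lebesgue_measurable_AE[OF assms])
  have AE': "AE x in lebesgue. f x = g x" by (rule AE_completion[OF AE])
  show "(\<integral>x. f x \<partial>lebesgue) = (LINT x|lborel. g x)"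
    using integral_cong_AE[OF f gc AE'] integral_completion[OF gl] by simp
  show "integrable lebesgue f \<longleftrightarrow> integrable lborel g"
    using integrable_cong_AE[OF f gc AE'] integrable_completion[OF gl] by simp
qed

lemma AE_lebesgue_on_interval:
  "(AE t in lebesgue_on {0<..<T::real}. P t) \<longleftrightarrow> (AE t in lborel. 0 < t \<longrightarrow> t < T \<longrightarrow> P t)"
proof -
  have "(AE t in lebesgue_on {0<..<T}. P t) \<longleftrightarrow> (AE t in lebesgue. t \<in> {0<..<T} \<longrightarrow> P t)"
    by (rule AE_restrict_space_iff) auto
  then show ?thesis by (simp add: AE_completion_iff imp_conjL)
qed

text \<open>After extension by 0 a Borel version exists on the product space, and Fubini turns its
  null set into null sets of almost every time section.\<close>

lemma ex_spacetime_borel_version: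
  fixes u :: "real \<Rightarrow> 'a::euclidean_space \<Rightarrow> 'b::euclidean_space"
  assumes u: "spacetime_measurable T u"
  shows "\<exists>g. case_prod g \<in> borel_measurable (borel \<Otimes>\<^sub>M borel) \<and>
     (AE t in lborel. 0 < t \<longrightarrow> t < T \<longrightarrow> (AE x in lborel. u t x = g t x))"
proof -
  let ?S = "{0<..<T} \<times> (UNIV::'a set)"
  have "open ?S" by (intro open_Times) auto
  then have S: "?S \<in> sets lebesgue" using lborelD borel_open by blast
  have "(\<lambda>z. if z \<in> ?S then (\<lambda>(t, x). u t x) z else 0) \<in> borel_measurable lebesgue"
    by (rule borel_measurable_if_I) (use u S in \<open>auto simp: spacetime_measurable_def\<close>)
  from ex_borel_version[OF this] obtain h where h: "h \<in> borel_measurable borel"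
    "AE z in lborel. (if z \<in> ?S then (\<lambda>(t, x). u t x) z else 0) = h z" by blast
  have hm: "h \<in> borel_measurable (borel \<Otimes>\<^sub>M borel)" using h(1) by (simp add: borel_prod)
  have "AE z in lborel \<Otimes>\<^sub>M lborel. (if z \<in> ?S then (\<lambda>(t, x). u t x) z else 0) = h z" using h(2) by (simp only: lborel_prod)
  from lborel_pair.AE_pair[OF this] have "AE t in lborel. AE x in lborel. (if (t, x) \<in> ?S then u t x else 0) = h (t, x)" by (simp only: prod.case)
  then have AE: "AE t in lborel. 0 < t \<longrightarrow> t < T \<longrightarrow> (AE x in lborel. u t x = h (t, x))"
  proof eventually_elim
    case (elim t)
    show ?case
    proof (intro impI)
      assume t: "0 < t" "t < T"
      from elim show "AE x in lborel. u t x = h (t, x)" by eventually_elim (use t in simp)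
    qed
  qed
  have "case_prod (\<lambda>t x. h (t, x)) = h" by (simp add: fun_eq_iff)
  then have "case_prod (\<lambda>t x. h (t, x)) \<in> borel_measurable (borel \<Otimes>\<^sub>M borel)" using hm by simp
  with AE show ?thesis by (intro exI[of _ "\<lambda>t x. h (t, x)"] conjI)
qed

lemma double_integral_lebesgue_AE:
  fixes h :: "real \<Rightarrow> 'a::euclidean_space \<Rightarrow> real"
  assumes [measurable]: "case_prod h \<in> borel_measurable (borel \<Otimes>\<^sub>M borel)"
    and AE: "AE t in lborel. 0 < t \<longrightarrow> t < T \<longrightarrow> (AE x in lborel. F t x = h t x)"
  shows "(LINT t:{0<..<T}|lebesgue. LINT x|lebesgue. F t x) = (LINT t|lborel. indicator {0<..<T} t * (LINT x|lborel. h t x))"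
  unfolding set_lebesgue_integral_def
proof (rule integral_lebesgue_AE(1))
  show "(\<lambda>t. indicator {0<..<T} t * (LINT x|lborel. h t x)) \<in> borel_measurable borel" by measurable
  show "AE t in lborel. indicator {0<..<T} t *\<^sub>R (\<integral>x. F t x \<partial>lebesgue) = indicator {0<..<T} t * (LINT x|lborel. h t x)"
    using AE
  proof eventually_elim
    case (elim t)
    have ht: "h t \<in> borel_measurable borel"
      using measurable_compose[OF measurable_Pair1'[of t borel borel] assms(1)] by simp
    show ?case
    proof (cases "0 < t \<and> t < T")
      case True
      then have "AE x in lborel. F t x = h t x" using elim by blast
      from integral_lebesgue_AE(1)[OF ht this] have "(\<integral>x. F t x \<partial>lebesgue) = (LINT x|lborel. h t x)" .
      then show ?thesis by (simp only: real_scaleR_def)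
    next
      case False
      then have "indicator {0<..<T} t = (0::real)" by (simp add: indicator_def)
      then show ?thesis by (simp only: scale_zero_left mult_zero_left)
    qed
  qed
qed

subsection \<open>The hypotheses in terms of Borel representatives\<close>

lemma locally_integrable_locint:
  fixes f g :: "'a::euclidean_space \<Rightarrow> 'b::euclidean_space"
  assumes f: "locally_integrable f" and g[measurable]: "g \<in> borel_measurable borel" and AE: "AE x in lborel. f x = g x"
  shows "locint g"
  unfolding locint_def
proof (intro conjI allI g)
  fix r
  have "set_integrable lebesgue (cball 0 r) f" using f by (auto simp: locally_integrable_def)
  moreover have "integrable lebesgue (\<lambda>x. indicator (cball 0 r) x *\<^sub>R f x) \<longleftrightarrow> integrable lborel (\<lambda>x. indicator (cball 0 r) x *\<^sub>R g x)"
  proof (rule integral_lebesgue_AE(2))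
    show "(\<lambda>x. indicator (cball 0 r) x *\<^sub>R g x) \<in> borel_measurable borel" by measurable
    show "AE x in lborel. indicator (cball 0 r) x *\<^sub>R f x = indicator (cball 0 r) x *\<^sub>R g x"
      using AE by eventually_elim simp
  qed
  ultimately show "integrable lborel (\<lambda>x. indicator (cball 0 r) x *\<^sub>R g x)" by (simp add: set_integrable_def)
qed

lemma weak_jacobian_jac:
  fixes f :: "real^'n \<Rightarrow> real^'n"
  assumes J: "weak_jacobian f F" and [measurable]: "g \<in> borel_measurable borel" "G \<in> borel_measurable borel"
    and AE: "AE x in lborel. f x = g x" "AE x in lborel. F x = G x"
  shows "jac g G"
  unfolding jac_def
proof (intro conjI allI impI)
  show "locint g" "locint G"
    by (rule locally_integrable_locint[OF _ _ AE(1)] locally_integrable_locint[OF _ _ AE(2)]; use J in \<open>simp add: weak_jacobian_def\<close>)+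
  fix \<phi> :: "real^'n \<Rightarrow> real" and i j
  assume \<phi>: "csmooth \<phi>"
  note [measurable] = csmooth_borel[OF \<phi>] borel_fd[OF \<phi>]
  have "(\<integral>x. f x $ i * grad \<phi> x $ j \<partial>lebesgue) = (LINT x|lborel. g x $ i * fd \<phi> x (axis j 1))"
  proof (rule integral_lebesgue_AE(1))
    show "AE x in lborel. f x $ i * grad \<phi> x $ j = g x $ i * fd \<phi> x (axis j 1)"
      using AE(1) by eventually_elim (simp add: grad_def)
  qed measurable
  moreover have "(\<integral>x. F x $ i $ j * \<phi> x \<partial>lebesgue) = (LINT x|lborel. G x $ i $ j * \<phi> x)"
  proof (rule integral_lebesgue_AE(1))
    show "AE x in lborel. F x $ i $ j * \<phi> x = G x $ i $ j * \<phi> x"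
      using AE(2) by eventually_elim simp
  qed measurable
  ultimately show "(LINT x|lborel. g x $ i * fd \<phi> x (axis j 1)) = - (LINT x|lborel. G x $ i $ j * \<phi> x)"
    using J \<phi> by (auto simp: weak_jacobian_def csmooth_test_function)
qed

lemma inner_grad:
  fixes \<phi> :: "real^'n \<Rightarrow> real"
  assumes "csmooth \<phi>"
  shows "h \<bullet> grad \<phi> x = fd \<phi> x h"
  by (subst fd_sum_axis[OF assms]) (simp add: inner_vec_def grad_def)

text \<open>The divergence and the Jacobian are given by separate weak identities. Both represent
  the same distribution, so \<open>fundamental_lemma\<close> identifies d with the trace.\<close>

lemma weak_divergence_trace:
  fixes f :: "real^'n \<Rightarrow> real^'n"
  assumes W: "weak_divergence f d" and J: "jac g G" and [measurable]: "e \<in> borel_measurable borel"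
    and AE: "AE x in lborel. f x = g x" "AE x in lborel. d x = e x"
  shows "AE x in lborel. d x = trace (G x)"
proof -
  have lg: "locint g" and lG: "locint G" using J by (auto simp: jac_def)
  note [measurable] = locint_borel[OF lg] locint_borel[OF lG]
  have le: "locint e" by (rule locally_integrable_locint[OF _ _ AE(2)]) (use W in \<open>simp_all add: weak_divergence_def\<close>)
  have lt: "locint (\<lambda>x. trace (G x))"
    by (rule locint_bound[OF lG, where C = "real CARD('n)"]) (auto simp: trace_le)
  have "locint (\<lambda>x. e x - trace (G x))"
    using le lt unfolding locint_def
    by (intro conjI allI) (simp_all add: right_diff_distrib)
  moreover have "(LINT x|lborel. (e x - trace (G x)) * \<phi> x) = 0" if \<phi>: "csmooth \<phi>" for \<phi>
  proof -
    note [measurable] = csmooth_borel[OF \<phi>] borel_fd[OF \<phi>]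
    note D = jac_divergence[OF J \<phi>]
    have "(\<integral>x. f x \<bullet> grad \<phi> x \<partial>lebesgue) = (LINT x|lborel. fd \<phi> x (g x))"
    proof (rule integral_lebesgue_AE(1))
      show "AE x in lborel. f x \<bullet> grad \<phi> x = fd \<phi> x (g x)"
        using AE(1) by eventually_elim (simp add: inner_grad[OF \<phi>])
    qed measurable
    moreover have "(\<integral>x. d x * \<phi> x \<partial>lebesgue) = (LINT x|lborel. e x * \<phi> x)"
    proof (rule integral_lebesgue_AE(1))
      show "AE x in lborel. d x * \<phi> x = e x * \<phi> x" using AE(2) by eventually_elim simp
    qed measurable
    ultimately have "(LINT x|lborel. fd \<phi> x (g x)) = - (LINT x|lborel. e x * \<phi> x)"
      using W \<phi> by (auto simp: weak_divergence_def csmooth_test_function)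
    moreover have "(LINT x|lborel. fd \<phi> x (g x)) + (LINT x|lborel. trace (G x) * \<phi> x) = 0"
      using D(3) by (simp add: LINT_add[OF D(1,2)])
    moreover have "(LINT x|lborel. (e x - trace (G x)) * \<phi> x) = (LINT x|lborel. e x * \<phi> x) - (LINT x|lborel. trace (G x) * \<phi> x)"
      unfolding left_diff_distrib
      by (rule LINT_diff) (use csmooth_locint[OF \<phi> le] D(2) in \<open>auto simp: mult.commute\<close>)
    ultimately show ?thesis by linarith
  qed
  ultimately have "AE x in lborel. e x - trace (G x) = 0" by (rule fundamental_lemma)
  then show ?thesis using AE(2) by eventually_elim simp
qed

lemma avg_eq_mean_on:
  assumes [measurable]: "g \<in> borel_measurable borel" and AE: "AE x in lborel. f x = g x"
  shows "mean_on (ball x r) f = avg x r g"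
proof -
  have "(\<integral>y. indicator (ball x r) y *\<^sub>R f y \<partial>lebesgue) = (LINT y|lborel. indicator (ball x r) y * g y)"
  proof (rule integral_lebesgue_AE(1))
    show "(\<lambda>y. indicator (ball x r) y * g y) \<in> borel_measurable borel" by measurable
    show "AE y in lborel. indicator (ball x r) y *\<^sub>R f y = indicator (ball x r) y * g y"
      using AE by eventually_elim simp
  qed
  then show ?thesis by (simp add: mean_on_def avg_def set_lebesgue_integral_def)
qed

lemma avg_le_BMO_norm:
  fixes f g :: "'a::euclidean_space \<Rightarrow> real"
  assumes g[measurable]: "g \<in> borel_measurable borel" and AE: "AE x in lborel. f x = g x" and r: "0 < r"
  shows "ennreal (avg x r (\<lambda>y. \<bar>g y - avg x r g\<bar>)) \<le> BMO_norm f"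
proof (cases "locally_integrable f")
  case True
  have "mean_on (ball x r) (\<lambda>y. \<bar>f y - mean_on (ball x r) f\<bar>) = avg x r (\<lambda>y. \<bar>g y - avg x r g\<bar>)"
    unfolding avg_eq_mean_on[OF g AE]
  proof (rule avg_eq_mean_on)
    show "AE y in lborel. \<bar>f y - avg x r g\<bar> = \<bar>g y - avg x r g\<bar>" using AE by eventually_elim simp
  qed measurable
  then have "ennreal (avg x r (\<lambda>y. \<bar>g y - avg x r g\<bar>)) =
      (\<lambda>(x, r). ennreal (mean_on (ball x r) (\<lambda>y. \<bar>f y - mean_on (ball x r) f\<bar>))) (x, r)" by simp
  also have "\<dots> \<le> BMO_norm f" unfolding BMO_norm_def using True r by (simp only: if_True) (intro SUP_upper, simp)
  finally show ?thesis .
qed (simp add: BMO_norm_def)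

lemma nn_integral_le_Lp_norm_1: "(NNINT x. ennreal (norm (f x))) \<le> Lp_norm 1 f"
proof -
  have "(\<integral>\<^sup>+x. ennreal (norm (f x) powr 1) \<partial>lebesgue) = (NNINT x. ennreal (norm (f x)))"
    by (simp add: nn_integral_completion)
  then show ?thesis unfolding Lp_norm_def by (auto simp: Let_def)
qed

text \<open>The complement of the support is a union of open sets on each of which d vanishes almost
  everywhere. By Lindelof countably many of them suffice, so the null sets add up to a null
  set.\<close>

lemma ess_support_AE:
  fixes d :: "'a::euclidean_space \<Rightarrow> real"
  assumes "ess_support d \<subseteq> ball 0 R"
  shows "AE x in lborel. R < norm x \<longrightarrow> d x = 0"
proof -
  define F where "F = {U :: 'a set. open U \<and> (AE y in lebesgue. y \<in> U \<longrightarrow> d y = 0)}"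
  have "\<And>U. U \<in> F \<Longrightarrow> openin (top_of_set UNIV) U" by (simp add: F_def)
  then obtain F' where F': "F' \<subseteq> F" "countable F'" "\<Union>F' = \<Union>F" using Lindelof_openin[of F UNIV] by metis
  have "AE x in lborel. \<forall>U\<in>F'. x \<in> U \<longrightarrow> d x = 0"
    using F' by (subst AE_ball_countable) (auto simp: F_def AE_completion_iff)
  then show ?thesis
  proof eventually_elim
    case (elim x)
    show ?case
    proof
      assume "R < norm x"
      then have "x \<notin> ess_support d" using assms by auto
      then have "x \<in> \<Union>F" by (auto simp: ess_support_def F_def)
      then show "d x = 0" using elim F'(3) by blast
    qed
  qed
qed

lemma ex_bounded_borel_version:
  fixes u :: "real \<Rightarrow> 'a::euclidean_space \<Rightarrow> real"
  assumes u: "spacetime_measurable T u" and M: "Linf_time_norm T Linf_norm u \<le> ennreal M" "0 \<le> M"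
  shows "\<exists>v. case_prod v \<in> borel_measurable (borel \<Otimes>\<^sub>M borel) \<and> (\<forall>t x. \<bar>v t x\<bar> \<le> M) \<and>
     (AE t in lborel. 0 < t \<longrightarrow> t < T \<longrightarrow> (AE x in lborel. u t x = v t x))"
proof -
  obtain g where g[measurable]: "case_prod g \<in> borel_measurable (borel \<Otimes>\<^sub>M borel)"
    and eq: "AE t in lborel. 0 < t \<longrightarrow> t < T \<longrightarrow> (AE x in lborel. u t x = g t x)"
    using ex_spacetime_borel_version[OF u] by blast
  \<comment> \<open>Clamping makes the bound hold everywhere, as \<open>bounded_fun\<close> demands,
    and changes g only on null sets.\<close>
  define v where "v t x = max (- M) (min M (g t x))" for t x
  have "case_prod v \<in> borel_measurable (borel \<Otimes>\<^sub>M borel)" unfolding v_def by measurable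
  moreover have "\<bar>v t x\<bar> \<le> M" for t x using M(2) by (auto simp: v_def)
  moreover have "AE t in lebesgue_on {0<..<T}. Linf_norm (u t) \<le> Linf_time_norm T Linf_norm u"
    unfolding Linf_time_norm_def by (rule esssup_AE)
  then have "AE t in lborel. 0 < t \<longrightarrow> t < T \<longrightarrow> Linf_norm (u t) \<le> Linf_time_norm T Linf_norm u"
    unfolding AE_lebesgue_on_interval .
  then have "AE t in lborel. 0 < t \<longrightarrow> t < T \<longrightarrow> (AE x in lborel. u t x = v t x)" using eq
  proof eventually_elim
    case (elim t)
    show ?case
    proof (intro impI)
      assume t: "0 < t" "t < T"
      have nt: "Linf_norm (u t) \<le> Linf_time_norm T Linf_norm u" using elim t by blast
      have "AE x in lebesgue. ennreal \<bar>u t x\<bar> \<le> Linf_norm (u t)" unfolding Linf_norm_def by (rule esssup_AE)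
      then have "AE x in lborel. ennreal \<bar>u t x\<bar> \<le> Linf_norm (u t)" by (simp add: AE_completion_iff)
      moreover have "AE x in lborel. u t x = g t x" using elim t by blast
      ultimately show "AE x in lborel. u t x = v t x"
      proof eventually_elim
        case (elim x)
        have "ennreal \<bar>u t x\<bar> \<le> ennreal M" using elim(1) nt M(1) by (metis order_trans)
        then have "\<bar>u t x\<bar> \<le> M" using M(2) by simp
        then show ?case using elim by (auto simp: v_def)
      qed
    qed
  qed
  ultimately show ?thesis by blast
qed

lemma ex_bounded_borel_initial:
  fixes f :: "'a::euclidean_space \<Rightarrow> real"
  assumes f: "f \<in> borel_measurable lebesgue" and M: "Linf_norm f \<le> ennreal M" "0 \<le> M"
  shows "\<exists>g\<in>borel_measurable borel. (\<forall>x. \<bar>g x\<bar> \<le> M) \<and> (AE x in lborel. f x = g x)"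
proof -
  obtain g where g[measurable]: "g \<in> borel_measurable borel" and eq: "AE x in lborel. f x = g x"
    using ex_borel_version[OF f] by blast
  have "AE x in lebesgue. ennreal \<bar>f x\<bar> \<le> Linf_norm f" unfolding Linf_norm_def by (rule esssup_AE)
  then have "AE x in lborel. ennreal \<bar>f x\<bar> \<le> Linf_norm f" by (simp add: AE_completion_iff)
  then have "AE x in lborel. f x = max (- M) (min M (g x))" using eq
  proof eventually_elim
    case (elim x)
    have "ennreal \<bar>f x\<bar> \<le> ennreal M" using elim(1) M(1) by (rule order_trans)
    then have "\<bar>f x\<bar> \<le> M" using M(2) by simp
    then show ?case using elim(2) by auto
  qed
  moreover have "(\<lambda>x. max (- M) (min M (g x))) \<in> borel_measurable borel" by measurable
  moreover have "\<bar>max (- M) (min M (g x))\<bar> \<le> M" for x using M(2) by simp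
  ultimately show ?thesis by (intro bexI[of _ "\<lambda>x. max (- M) (min M (g x))"] conjI allI)
qed

subsection \<open>Weak solutions in terms of Borel representatives\<close>

text \<open>The weak formulation is tested only with products of a function of time and one of
  space, which is what \<open>sol_of_weak\<close> consumes.\<close>

lemma spacetime_test_function_product:
  fixes \<phi> :: "real^'n \<Rightarrow> real"
  assumes T: "0 < T" and \<psi>: "smooth_on UNIV \<psi>" and \<phi>: "csmooth \<phi>"
  shows "spacetime_test_function T (\<lambda>t x. \<psi> t * \<phi> x)"
  unfolding spacetime_test_function_def
proof (intro conjI)
  let ?S = "{0..T} \<times> (UNIV :: (real^'n) set)"
  note S = accum_dirs_strip[OF T, where 'a = "real^'n"]
  have "Ck_on k ?S (\<lambda>z. \<psi> (0 + fst z) * \<phi> (0 + snd z))" for k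
    by (rule Ck_on_mult[OF S Ck_on_affine[OF S bounded_linear_fst] Ck_on_affine[OF S bounded_linear_snd]])
      (use \<psi> csmooth_smooth[OF \<phi>] in \<open>simp_all add: smooth_on_def\<close>)
  moreover have "(\<lambda>z. \<psi> (0 + fst z) * \<phi> (0 + snd z)) = (\<lambda>(t, x). \<psi> t * \<phi> x)" by (simp add: fun_eq_iff)
  ultimately show "smooth_on ?S (\<lambda>(t, x). \<psi> t * \<phi> x)" by (simp only: smooth_on_def simp_thms)
  obtain r where "\<And>x. r \<le> norm x \<Longrightarrow> \<phi> x = 0" using csmooth_support[OF \<phi>] by metis
  then show "\<exists>K. compact K \<and> (\<forall>t\<in>{0..T}. \<forall>x. x \<notin> K \<longrightarrow> \<psi> t * \<phi> x = 0)"
    by (intro exI[of _ "cball 0 r"]) simp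
qed

lemma smooth_on_real_deriv:
  assumes "smooth_on UNIV (\<psi> :: real \<Rightarrow> real)"
  shows "(\<psi> has_real_derivative deriv \<psi> t) (at t)" and "deriv \<psi> \<in> borel_measurable borel"
proof -
  have C: "Ck_on (Suc 0) UNIV \<psi>" using assms by (simp only: smooth_on_def)
  have D: "(\<psi> has_real_derivative deriv \<psi> t) (at t)" for t
  proof -
    have "\<psi> differentiable (at t)" using C by simp
    then obtain D where "(\<psi> has_real_derivative D) (at t)" unfolding real_differentiable_def by blast
    then show ?thesis using DERIV_imp_deriv by blast
  qed
  then show "(\<psi> has_real_derivative deriv \<psi> t) (at t)" .
  have "fd \<psi> t 1 = deriv \<psi> t" for t
    using frechet_derivative_at[OF D[of t, unfolded has_field_derivative_def]] by (metis mult.right_neutral)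
  moreover have "continuous_on UNIV (\<lambda>t. fd \<psi> t 1)" using C by simp
  ultimately have "continuous_on UNIV (deriv \<psi>)" by simp
  then show "deriv \<psi> \<in> borel_measurable borel" by (rule borel_measurable_continuous_onI)
qed

lemma grad_cmult:
  fixes \<phi> :: "real^'n \<Rightarrow> real"
  assumes "csmooth \<phi>" shows "grad (\<lambda>x. c * \<phi> x) x = c *\<^sub>R grad \<phi> x"
  by (simp add: vec_eq_iff grad_def fd_const_mult[OF csmooth_smooth[OF assms]])

context transport
begin

lemma integrable_dominated:
  assumes h[measurable]: "case_prod h \<in> borel_measurable (borel \<Otimes>\<^sub>M borel)"
    and K: "0 \<le> K" and le: "\<And>t x. \<bar>h t x\<bar> \<le> K * (indicator (cball 0 r) x * (norm (b t x) + norm (G t x)))"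
  shows "AE t in lborel. integrable lborel (h t)" and "integrable lborel (\<lambda>t. LINT x|lborel. h t x)"
proof -
  note [measurable] = borel_b borel_G
  have "(NNINT t. NNINT x. ennreal \<bar>h t x\<bar>)
      \<le> (NNINT t. NNINT x. ennreal K * (indicator (cball 0 r) x * ennreal (norm (b t x) + norm (G t x))))"
  proof (intro nn_integral_mono)
    fix t x
    have "ennreal \<bar>h t x\<bar> \<le> ennreal (K * (indicator (cball 0 r) x * (norm (b t x) + norm (G t x))))"
      by (rule ennreal_leI[OF le])
    also have "\<dots> = ennreal K * (indicator (cball 0 r) x * ennreal (norm (b t x) + norm (G t x)))"
      using K by (cases "x \<in> cball 0 r") (simp_all add: ennreal_mult)
    finally show "ennreal \<bar>h t x\<bar> \<le> ennreal K * (indicator (cball 0 r) x * ennreal (norm (b t x) + norm (G t x)))" .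
  qed
  also have "\<dots> = ennreal K * (NNINT t. NNINT x. indicator (cball 0 r) x * ennreal (norm (b t x) + norm (G t x)))"
    by (simp add: nn_integral_cmult)
  also have "\<dots> < \<infinity>" using fin[of r] by (simp add: ennreal_mult_less_top)
  finally have f: "(NNINT t. NNINT x. ennreal \<bar>h t x\<bar>) < \<infinity>" .
  show "AE t in lborel. integrable lborel (h t)" by (rule pair_Fubini(2)[OF h f])
  show "integrable lborel (\<lambda>t. LINT x|lborel. h t x)" by (rule pair_Fubini(4)[OF h f])
qed

text \<open>The three integrals become iterated Borel integrals of h0, h1, h2. Merging the last two
  into \<open>flux\<close> needs their separate integrability, obtained from domination by the local
  norm of b and G.\<close>

lemma weak_solution_sol:
  assumes W: "weak_solution T \<beta> d u0 u"
    and ae\<beta>: "AE t in lborel. 0 < t \<longrightarrow> t < T \<longrightarrow> (AE x in lborel. \<beta> t x = b t x)"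
    and aed: "AE t in lborel. 0 < t \<longrightarrow> t < T \<longrightarrow> (AE x in lborel. d t x = trace (G t x))"
    and aeu: "AE t in lborel. 0 < t \<longrightarrow> t < T \<longrightarrow> (AE x in lborel. u t x = v t x)"
    and v: "bounded_fun v M" and v0: "v0 \<in> borel_measurable borel" and v0M: "\<And>x. \<bar>v0 x\<bar> \<le> M"
    and ae0: "AE x in lborel. u0 x = v0 x"
  shows "sol v0 v M"
proof (rule sol_of_weak[OF v0 v0M v])
  fix \<psi> :: "real \<Rightarrow> real" and \<phi> :: "real^'n \<Rightarrow> real"
  assume \<psi>: "smooth_on UNIV \<psi>" and \<psi>T: "\<psi> T = 0" and \<phi>: "csmooth \<phi>"
  have c\<psi>: "continuous_on UNIV \<psi>" using \<psi> Ck_on.simps(1) unfolding smooth_on_def by blast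
  have m\<psi>: "\<psi> \<in> borel_measurable borel" by (rule borel_measurable_continuous_onI[OF c\<psi>])
  note [measurable] = borel_b borel_G bounded_funD(1)[OF v] csmooth_borel[OF \<phi>] m\<psi> smooth_on_real_deriv(2)[OF \<psi>] v0
  define h0 where "h0 t x = deriv \<psi> t * (v t x * \<phi> x)" for t x
  \<comment> \<open>The indicator is part of the integrand because \<psi> is bounded on [0,T] only;
    it makes the majorant valid for all t.\<close>
  define h1 where "h1 t x = indicator {0<..<T} t * (trace (G t x) * v t x * (\<psi> t * \<phi> x))" for t x
  define h2 where "h2 t x = indicator {0<..<T} t * (\<psi> t * fd \<phi> x (b t x) * v t x)" for t x
  have m0[measurable]: "case_prod h0 \<in> borel_measurable (borel \<Otimes>\<^sub>M borel)" unfolding h0_def by measurable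
  have m1[measurable]: "case_prod h1 \<in> borel_measurable (borel \<Otimes>\<^sub>M borel)" unfolding h1_def by measurable
  have mf[measurable]: "(\<lambda>(t, x). fd \<phi> x (b t x)) \<in> borel_measurable (borel \<Otimes>\<^sub>M borel)"
    unfolding case_prod_beta by (rule borel_fd[OF \<phi>]) measurable
  have m2[measurable]: "case_prod h2 \<in> borel_measurable (borel \<Otimes>\<^sub>M borel)" unfolding h2_def by measurable
  have I: "(LINT t:{0<..<T}|lebesgue. LINT x|lebesgue. u t x * deriv (\<lambda>s. \<psi> s * \<phi> x) t)
      + (LINT t:{0<..<T}|lebesgue. LINT x|lebesgue. d t x * u t x * (\<psi> t * \<phi> x))
      + (LINT t:{0<..<T}|lebesgue. LINT x|lebesgue. (\<beta> t x \<bullet> grad (\<lambda>x. \<psi> t * \<phi> x) x) * u t x)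
      = - (LINT x|lebesgue. u0 x * (\<psi> 0 * \<phi> x))"
    using W spacetime_test_function_product[OF T_pos \<psi> \<phi>] \<psi>T unfolding weak_solution_def by simp
  have "(LINT t:{0<..<T}|lebesgue. LINT x|lebesgue. u t x * deriv (\<lambda>s. \<psi> s * \<phi> x) t)
      = (LINT t|lborel. indicator {0<..<T} t * (LINT x|lborel. h0 t x))"
  proof (rule double_integral_lebesgue_AE[OF m0])
    have "deriv (\<lambda>s. \<psi> s * \<phi> x) t = deriv \<psi> t * \<phi> x" for t x
      by (rule DERIV_imp_deriv[OF DERIV_cmult_right[OF smooth_on_real_deriv(1)[OF \<psi>]]])
    then have eq: "u t x * deriv (\<lambda>s. \<psi> s * \<phi> x) t = h0 t x" if "u t x = v t x" for t x
      using that by (simp add: h0_def)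
    from aeu show "AE t in lborel. 0 < t \<longrightarrow> t < T \<longrightarrow> (AE x in lborel. u t x * deriv (\<lambda>s. \<psi> s * \<phi> x) t = h0 t x)"
    proof eventually_elim
      case (elim t)
      show ?case
      proof (intro impI)
        assume "0 < t" "t < T"
        with elim have "AE x in lborel. u t x = v t x" by blast
        then show "AE x in lborel. u t x * deriv (\<lambda>s. \<psi> s * \<phi> x) t = h0 t x" by eventually_elim (rule eq)
      qed
    qed
  qed
  moreover have "(LINT t:{0<..<T}|lebesgue. LINT x|lebesgue. d t x * u t x * (\<psi> t * \<phi> x))
      = (LINT t|lborel. indicator {0<..<T} t * (LINT x|lborel. h1 t x))"
  proof (rule double_integral_lebesgue_AE[OF m1])
    from aed aeu show "AE t in lborel. 0 < t \<longrightarrow> t < T \<longrightarrow> (AE x in lborel. d t x * u t x * (\<psi> t * \<phi> x) = h1 t x)"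
    proof eventually_elim
      case (elim t)
      show ?case
      proof (intro impI)
        assume t: "0 < t" "t < T"
        with elim have "AE x in lborel. d t x = trace (G t x)" "AE x in lborel. u t x = v t x" by blast+
        then show "AE x in lborel. d t x * u t x * (\<psi> t * \<phi> x) = h1 t x" by eventually_elim (simp add: h1_def t)
      qed
    qed
  qed
  moreover have "(LINT t:{0<..<T}|lebesgue. LINT x|lebesgue. (\<beta> t x \<bullet> grad (\<lambda>x. \<psi> t * \<phi> x) x) * u t x)
      = (LINT t|lborel. indicator {0<..<T} t * (LINT x|lborel. h2 t x))"
  proof (rule double_integral_lebesgue_AE[OF m2])
    from ae\<beta> aeu show "AE t in lborel. 0 < t \<longrightarrow> t < T \<longrightarrow> (AE x in lborel. (\<beta> t x \<bullet> grad (\<lambda>x. \<psi> t * \<phi> x) x) * u t x = h2 t x)"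
    proof eventually_elim
      case (elim t)
      show ?case
      proof (intro impI)
        assume t: "0 < t" "t < T"
        with elim have "AE x in lborel. \<beta> t x = b t x" "AE x in lborel. u t x = v t x" by blast+
        then show "AE x in lborel. (\<beta> t x \<bullet> grad (\<lambda>x. \<psi> t * \<phi> x) x) * u t x = h2 t x"
          by eventually_elim (simp add: h2_def t grad_cmult[OF \<phi>] inner_grad[OF \<phi>])
      qed
    qed
  qed
  moreover have "(\<integral>x. u0 x * (\<psi> 0 * \<phi> x) \<partial>lebesgue) = \<psi> 0 * (LINT x|lborel. v0 x * \<phi> x)"
  proof -
    have "(\<integral>x. u0 x * (\<psi> 0 * \<phi> x) \<partial>lebesgue) = (LINT x|lborel. \<psi> 0 * (v0 x * \<phi> x))"
    proof (rule integral_lebesgue_AE(1))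
      show "(\<lambda>x. \<psi> 0 * (v0 x * \<phi> x)) \<in> borel_measurable borel" by measurable
      from ae0 show "AE x in lborel. u0 x * (\<psi> 0 * \<phi> x) = \<psi> 0 * (v0 x * \<phi> x)" by eventually_elim simp
    qed
    then show ?thesis by simp
  qed
  moreover have "(LINT x|lborel. h0 t x) = deriv \<psi> t * (LINT x|lborel. v t x * \<phi> x)" for t
    unfolding h0_def by (rule integral_mult_right_zero)
  moreover have "(LINT t|lborel. indicator {0<..<T} t * (LINT x|lborel. h1 t x)) + (LINT t|lborel. indicator {0<..<T} t * (LINT x|lborel. h2 t x))
      = (LINT t|lborel. indicator {0<..<T} t * (\<psi> t * flux (b t) (G t) \<phi> (v t)))"
  proof -
    obtain C1 where C1: "0 < C1" "\<And>x. \<bar>\<phi> x\<bar> \<le> C1" using csmooth_bounded[OF \<phi>] by metis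
    obtain C2 where C2: "0 < C2" "\<And>x h. \<bar>fd \<phi> x h\<bar> \<le> C2 * norm h" using csmooth_deriv_bounded[OF \<phi>] by metis
    obtain r where r: "0 < r" "\<And>x. r \<le> norm x \<Longrightarrow> \<phi> x = 0" using csmooth_support[OF \<phi>] by metis
    have rd: "fd \<phi> x h = 0" if "r < norm x" for x h
    proof -
      have "open {x :: real^'n. r < norm x}" by (intro open_Collect_less continuous_intros)
      then have "(\<phi> has_derivative (\<lambda>_. 0)) (at x)"
        by (rule has_derivative_transform_within_open[OF has_derivative_const[of 0]]) (use that r(2) in auto)
      then show ?thesis using frechet_derivative_at by metis
    qed
    have "compact (\<psi> ` {0..T})" by (intro compact_continuous_image continuous_on_subset[OF c\<psi>]) auto
    then obtain C3 where C3: "0 < C3" "\<And>t. 0 \<le> t \<Longrightarrow> t \<le> T \<Longrightarrow> \<bar>\<psi> t\<bar> \<le> C3"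
      using compact_imp_bounded[of "\<psi> ` {0..T}"] unfolding bounded_pos by fastforce
    have M0: "0 \<le> M" using v0M[of 0] by linarith
    have vM: "\<bar>v t x\<bar> \<le> M" for t x by (rule bounded_funD(3)[OF v])
    have le1: "\<bar>h1 t x\<bar> \<le> (real CARD('n) * M * (C3 * C1)) * (indicator (cball 0 r) x * (norm (b t x) + norm (G t x)))" for t x
    proof (cases "t \<in> {0<..<T} \<and> norm x \<le> r")
      case True
      have "\<bar>h1 t x\<bar> = \<bar>trace (G t x)\<bar> * \<bar>v t x\<bar> * (\<bar>\<psi> t\<bar> * \<bar>\<phi> x\<bar>)" using True by (simp add: h1_def abs_mult)
      also have "\<dots> \<le> (real CARD('n) * (norm (b t x) + norm (G t x))) * M * (C3 * C1)"
        using True C1 C3 M0 by (intro mult_mono vM order_trans[OF trace_le] mult_left_mono) auto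
      finally show ?thesis using True by (simp add: mult_ac)
    next
      case False
      then have "h1 t x = 0" using r(2)[of x] by (cases "t \<in> {0<..<T}") (simp_all add: h1_def)
      then show ?thesis using C1(1) C3(1) M0 by simp
    qed
    have le2: "\<bar>h2 t x\<bar> \<le> (C3 * C2 * M) * (indicator (cball 0 r) x * (norm (b t x) + norm (G t x)))" for t x
    proof (cases "t \<in> {0<..<T} \<and> norm x \<le> r")
      case True
      have "\<bar>h2 t x\<bar> = \<bar>\<psi> t\<bar> * \<bar>fd \<phi> x (b t x)\<bar> * \<bar>v t x\<bar>" using True by (simp add: h2_def abs_mult)
      also have "\<dots> \<le> C3 * (C2 * (norm (b t x) + norm (G t x))) * M"
        using True C2 C3 M0 by (intro mult_mono vM order_trans[OF C2(2)] mult_left_mono) auto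
      finally show ?thesis using True by (simp add: mult_ac)
    next
      case False
      then have "h2 t x = 0" using rd[of x] by (cases "t \<in> {0<..<T}") (simp_all add: h2_def)
      then show ?thesis using C2(1) C3(1) M0 by simp
    qed
    have K1: "0 \<le> real CARD('n) * M * (C3 * C1)" and K2: "0 \<le> C3 * C2 * M" using C1 C2 C3 M0 by simp_all
    note i1 = integrable_dominated[OF m1 K1 le1] and i2 = integrable_dominated[OF m2 K2 le2]
    have ind: "indicator {0<..<T} t * (LINT x|lborel. h1 t x) = (LINT x|lborel. h1 t x)"
      "indicator {0<..<T} t * (LINT x|lborel. h2 t x) = (LINT x|lborel. h2 t x)" for t
      by (cases "t \<in> {0<..<T}"; simp add: h1_def h2_def)+
    have "(LINT t|lborel. (LINT x|lborel. h1 t x) + (LINT x|lborel. h2 t x))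
      = (LINT t|lborel. indicator {0<..<T} t * (\<psi> t * flux (b t) (G t) \<phi> (v t)))"
    proof (rule integral_cong_AE)
      show "(\<lambda>t. (LINT x|lborel. h1 t x) + (LINT x|lborel. h2 t x)) \<in> borel_measurable lborel" by measurable
      have [measurable]: "(\<lambda>t. flux (b t) (G t) \<phi> (v t)) \<in> borel_measurable borel"
        using borel_measurable_integrable[OF flux_time_integrable[OF \<phi> v]] by simp
      show "(\<lambda>t. indicator {0<..<T} t * (\<psi> t * flux (b t) (G t) \<phi> (v t))) \<in> borel_measurable lborel" by measurable
      from i1(1) i2(1) show "AE t in lborel. (LINT x|lborel. h1 t x) + (LINT x|lborel. h2 t x)
          = indicator {0<..<T} t * (\<psi> t * flux (b t) (G t) \<phi> (v t))"
      proof eventually_elim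
        case (elim t)
        have "(LINT x|lborel. h1 t x) + (LINT x|lborel. h2 t x) = (LINT x|lborel. h1 t x + h2 t x)"
          by (rule LINT_add[OF elim, symmetric])
        also have "\<dots> = (LINT x|lborel. (indicator {0<..<T} t * \<psi> t) * ((fd \<phi> x (b t x) + trace (G t x) * \<phi> x) * v t x))"
          by (rule LINT_cong[OF refl]) (simp add: h1_def h2_def algebra_simps)
        also have "\<dots> = (indicator {0<..<T} t * \<psi> t) * flux (b t) (G t) \<phi> (v t)"
          unfolding flux_def by (rule integral_mult_right_zero)
        finally show ?case by (simp only: mult.assoc)
      qed
    qed
    then show ?thesis unfolding ind using LINT_add[OF i1(2) i2(2)] by simp
  qed
  ultimately show "(LINT t|lborel. indicator {0<..<T} t * (deriv \<psi> t * (LINT x|lborel. v t x * \<phi> x)))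
      + (LINT t|lborel. indicator {0<..<T} t * (\<psi> t * flux (b t) (G t) \<phi> (v t))) = - (\<psi> 0 * (LINT x|lborel. v0 x * \<phi> x))"
    using I by simp
qed

end

lemma jac_0: "jac (\<lambda>_. 0 :: real^'n) (\<lambda>_. 0)"
  by (simp add: jac_def locint_def)

text \<open>The weak Jacobian, the divergence and the support condition hold at almost every time.
  Redefining b and G to be 0 on a null set of times makes them hold at each time, since zero fields
  satisfy them trivially.\<close>

lemma ex_transport:
  fixes \<beta> :: "real \<Rightarrow> real^'n \<Rightarrow> real^'n"
  assumes T: "0 < T" and W: "in_L1_W11_loc T \<beta>" and d: "has_weak_divergence T \<beta> d"
    and S: "AE t in lebesgue_on {0<..<T}. ess_support (d t) \<subseteq> ball 0 R"
  shows "\<exists>b G. transport T b G \<and> (\<forall>t. AE x in lborel. R < norm x \<longrightarrow> trace (G t x) = 0) \<and> (AE t in lborel. 0 < t \<longrightarrow> t < T \<longrightarrow>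
     (AE x in lborel. \<beta> t x = b t x) \<and> (AE x in lborel. d t x = trace (G t x)))"
proof -
  obtain F where \<beta>m: "spacetime_measurable T \<beta>" and Fm: "spacetime_measurable T F"
    and aeJ: "AE t in lebesgue_on {0<..<T}. weak_jacobian (\<beta> t) (F t)"
    and finF: "\<And>r. 0 < r \<Longrightarrow> (\<integral>\<^sup>+t\<in>{0<..<T}. (\<integral>\<^sup>+x\<in>ball 0 r. ennreal (norm (\<beta> t x) + norm (F t x)) \<partial>lebesgue) \<partial>lebesgue) < \<infinity>"
    using W unfolding in_L1_W11_loc_def by blast
  obtain b0 where b0[measurable]: "case_prod b0 \<in> borel_measurable (borel \<Otimes>\<^sub>M borel)"
    and aeb: "AE t in lborel. 0 < t \<longrightarrow> t < T \<longrightarrow> (AE x in lborel. \<beta> t x = b0 t x)"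
    using ex_spacetime_borel_version[OF \<beta>m] by blast
  obtain G0 where G0[measurable]: "case_prod G0 \<in> borel_measurable (borel \<Otimes>\<^sub>M borel)"
    and aeG: "AE t in lborel. 0 < t \<longrightarrow> t < T \<longrightarrow> (AE x in lborel. F t x = G0 t x)"
    using ex_spacetime_borel_version[OF Fm] by blast
  have dm: "spacetime_measurable T d" and aeD: "AE t in lebesgue_on {0<..<T}. weak_divergence (\<beta> t) (d t)"
    using d by (simp_all add: has_weak_divergence_def)
  obtain e where e: "case_prod e \<in> borel_measurable (borel \<Otimes>\<^sub>M borel)"
    and aee: "AE t in lborel. 0 < t \<longrightarrow> t < T \<longrightarrow> (AE x in lborel. d t x = e t x)"
    using ex_spacetime_borel_version[OF dm] by blast
  have sec: "f t \<in> borel_measurable borel" if "case_prod f \<in> borel_measurable (borel \<Otimes>\<^sub>M borel)"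
    for f :: "real \<Rightarrow> real^'n \<Rightarrow> 'c::euclidean_space" and t
    using measurable_compose[OF measurable_Pair1'[of t borel borel] that] by simp
  define P where "P t \<longleftrightarrow> jac (b0 t) (G0 t) \<and> (AE x in lborel. \<beta> t x = b0 t x) \<and> (AE x in lborel. F t x = G0 t x) \<and>
      (AE x in lborel. d t x = trace (G0 t x)) \<and> (AE x in lborel. R < norm x \<longrightarrow> trace (G0 t x) = 0)" for t
  have "AE t in lborel. 0 < t \<longrightarrow> t < T \<longrightarrow> P t"
    using aeb aeG aee aeJ[unfolded AE_lebesgue_on_interval] aeD[unfolded AE_lebesgue_on_interval] S[unfolded AE_lebesgue_on_interval]
  proof eventually_elim
    case (elim t)
    show ?case
    proof (intro impI)
      assume t: "0 < t" "t < T"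
      have 1: "AE x in lborel. \<beta> t x = b0 t x" and 2: "AE x in lborel. F t x = G0 t x" and 3: "AE x in lborel. d t x = e t x"
        and J: "weak_jacobian (\<beta> t) (F t)" and D: "weak_divergence (\<beta> t) (d t)"
        and E: "ess_support (d t) \<subseteq> ball 0 R" using elim t by blast+
      have j: "jac (b0 t) (G0 t)" by (rule weak_jacobian_jac[OF J sec[OF b0] sec[OF G0] 1 2])
      have 4: "AE x in lborel. d t x = trace (G0 t x)" by (rule weak_divergence_trace[OF D j sec[OF e] 1 3])
      from ess_support_AE[OF E] 4 have "AE x in lborel. R < norm x \<longrightarrow> trace (G0 t x) = 0" by eventually_elim simp
      with 1 2 4 j show "P t" unfolding P_def by blast
    qed
  qed
  then obtain N where N: "N \<in> null_sets lborel" "{t. \<not> (0 < t \<longrightarrow> t < T \<longrightarrow> P t)} \<subseteq> N"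
    unfolding eventually_ae_filter by auto
  define S where "S = {0<..<T} - N"
  have Sm[measurable]: "S \<in> sets borel" using null_setsD2[OF N(1)] by (simp add: S_def)
  have SP: "P t" if "t \<in> S" for t using that N(2) by (auto simp: S_def)
  have aeS: "AE t in lborel. 0 < t \<longrightarrow> t < T \<longrightarrow> t \<in> S"
    using AE_not_in[OF N(1)] by eventually_elim (simp add: S_def)
  define b where "b t x = (if t \<in> S then b0 t x else 0)" for t x
  define G where "G t x = (if t \<in> S then G0 t x else 0)" for t x
  have bS: "b t = b0 t" "G t = G0 t" if "t \<in> S" for t using that by (simp_all add: b_def G_def fun_eq_iff)
  have bn: "b t = (\<lambda>_. 0)" "G t = (\<lambda>_. 0)" if "t \<notin> S" for t using that by (simp_all add: b_def G_def fun_eq_iff)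
  have "transport T b G"
  proof (unfold_locales, rule T)
    show "case_prod b \<in> borel_measurable (borel \<Otimes>\<^sub>M borel)" unfolding b_def by measurable
    show "case_prod G \<in> borel_measurable (borel \<Otimes>\<^sub>M borel)" unfolding G_def by measurable
    show "jac (b t) (G t)" for t
    proof (cases "t \<in> S")
      case True
      then show ?thesis using SP[OF True] by (simp add: bS P_def)
    next
      case False
      then show ?thesis by (simp add: bn jac_0)
    qed
    show "b t = (\<lambda>_. 0)" "G t = (\<lambda>_. 0)" if "t \<notin> {0<..<T}" for t
    proof -
      have "t \<notin> S" using that by (auto simp: S_def)
      then show "b t = (\<lambda>_. 0)" "G t = (\<lambda>_. 0)" by (rule bn)+
    qed
    fix r :: real
    have "(NNINT t. NNINT y. indicator (cball 0 r) y * ennreal (norm (b t y) + norm (G t y)))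
       \<le> (NNINT t. (NNINT x. ennreal (norm (\<beta> t x) + norm (F t x)) * indicator (ball 0 (\<bar>r\<bar> + 1)) x) * indicator {0<..<T} t)"
    proof (rule nn_integral_mono)
      fix t
      show "(NNINT y. indicator (cball 0 r) y * ennreal (norm (b t y) + norm (G t y)))
        \<le> (NNINT x. ennreal (norm (\<beta> t x) + norm (F t x)) * indicator (ball 0 (\<bar>r\<bar> + 1)) x) * indicator {0<..<T} t"
      proof (cases "t \<in> S")
        case True
        have "AE x in lborel. \<beta> t x = b0 t x" "AE x in lborel. F t x = G0 t x" using SP[OF True] by (simp_all add: P_def)
        then have "AE x in lborel. indicator (cball 0 r) x * ennreal (norm (b t x) + norm (G t x))
            \<le> ennreal (norm (\<beta> t x) + norm (F t x)) * indicator (ball 0 (\<bar>r\<bar> + 1)) x"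
        proof eventually_elim
          case (elim x)
          show ?case
          proof (cases "x \<in> cball 0 r")
            case c: True
            then have "x \<in> ball 0 (\<bar>r\<bar> + 1)" by simp
            then show ?thesis using elim c by (simp add: bS[OF True])
          qed simp
        qed
        then have "(NNINT y. indicator (cball 0 r) y * ennreal (norm (b t y) + norm (G t y)))
          \<le> (NNINT x. ennreal (norm (\<beta> t x) + norm (F t x)) * indicator (ball 0 (\<bar>r\<bar> + 1)) x)" by (rule nn_integral_mono_AE)
        moreover have "t \<in> {0<..<T}" using True by (simp add: S_def)
        ultimately show ?thesis by (simp only: indicator_simps mult_1_right)
      next
        case False
        then show ?thesis by (simp add: bn)
      qed
    qed
    also have "\<dots> < \<infinity>" using finF[of "\<bar>r\<bar> + 1"] by (simp add: nn_integral_completion)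
    finally show "(NNINT t. NNINT y. indicator (cball 0 r) y * ennreal (norm (b t y) + norm (G t y))) < \<infinity>" .
  qed
  moreover have "AE x in lborel. R < norm x \<longrightarrow> trace (G t x) = 0" for t
  proof (cases "t \<in> S")
    case True
    then show ?thesis using SP[OF True] by (simp add: bS P_def)
  next
    case False
    then show ?thesis by (simp add: bn trace_def)
  qed
  moreover have "AE t in lborel. 0 < t \<longrightarrow> t < T \<longrightarrow>
     (AE x in lborel. \<beta> t x = b t x) \<and> (AE x in lborel. d t x = trace (G t x))"
    using aeS
  proof eventually_elim
    case (elim t)
    show ?case
    proof (intro impI)
      assume "0 < t" "t < T"
      with elim have t: "t \<in> S" by blast
      show "(AE x in lborel. \<beta> t x = b t x) \<and> (AE x in lborel. d t x = trace (G t x))"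
        using SP[OF t] unfolding P_def bS[OF t] by blast
    qed
  qed
  ultimately show ?thesis by blast
qed

context transport
begin

text \<open>The supremum over balls with centres in a countable dense set and rational radii is
  measurable in time and below the BMO norm. The constant c is the loss of
  \<open>osc_le_from_dense\<close>, and the added 1 makes A strictly positive on (0,T).\<close>

lemma BMO_majorant:
  assumes B: "in_L1_time T BMO_norm d"
    and ae: "AE t in lborel. 0 < t \<longrightarrow> t < T \<longrightarrow> (AE x in lborel. d t x = trace (G t x))"
  shows "\<exists>A. integrable lborel A \<and> (\<forall>s. 0 \<le> A s) \<and>
     (AE s in lborel. 0 < s \<longrightarrow> s < T \<longrightarrow> 0 < A s \<and> osc_le (\<lambda>x. trace (G s x)) (A s))"
proof -
  note [measurable] = borel_G
  obtain D :: "(real^'n) set" where D: "countable D" "\<forall>X. open X \<longrightarrow> X \<noteq> {} \<longrightarrow> (\<exists>d\<in>D. d \<in> X)"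
    using countable_dense_exists by blast
  define I where "I = D \<times> (\<rat> \<inter> {0<..} :: real set)"
  have cI: "countable I" unfolding I_def using D(1) countable_rat by (intro countable_SIGMA countable_Int1)
  define osc where "osc i t = ennreal (avg (fst i) (snd i) (\<lambda>y. \<bar>trace (G t y) - avg (fst i) (snd i) (\<lambda>y. trace (G t y))\<bar>))" for i t
  define N where "N t = (SUP i\<in>I. osc i t)" for t
  have "osc i \<in> borel_measurable borel" for i unfolding osc_def avg_def by measurable
  then have Nm[measurable]: "N \<in> borel_measurable borel" unfolding N_def using cI by (intro borel_measurable_SUP)
  have tr: "(\<lambda>x. trace (G t x)) \<in> borel_measurable borel" for t
    using locint_borel[of "G t"] jac[of t] borel_trace[of "G t"] by (simp add: jac_def)
  have "(NNINT t. N t) \<le> (NNINT t. BMO_norm (d t) * indicator {0<..<T} t)"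
  proof (rule nn_integral_mono_AE)
    from ae show "AE t in lborel. N t \<le> BMO_norm (d t) * indicator {0<..<T} t"
    proof eventually_elim
      case (elim t)
      show ?case
      proof (cases "t \<in> {0<..<T}")
        case True
        then have a: "AE x in lborel. d t x = trace (G t x)" using elim by simp
        have "N t \<le> BMO_norm (d t)" unfolding N_def
        proof (rule SUP_least)
          fix i assume "i \<in> I"
          then have "0 < snd i" by (auto simp: I_def)
          from avg_le_BMO_norm[OF tr a this] show "osc i t \<le> BMO_norm (d t)" unfolding osc_def .
        qed
        then show ?thesis using True by simp
      next
        case False
        have "osc i t = 0" for i unfolding osc_def zero(2)[OF False] by (simp add: trace_def avg_def)
        then have "N t \<le> 0" unfolding N_def by (intro SUP_least) simp
        then show ?thesis by simp
      qed
    qed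
  qed
  also have "\<dots> < \<infinity>" using B by (simp add: in_L1_time_def nn_integral_completion)
  finally have Nfin: "(NNINT t. N t) < \<infinity>" .
  have aeN: "AE t in lborel. N t \<noteq> \<infinity>" by (rule nn_integral_noteq_infinite) (use Nfin in simp_all)
  have iN: "integrable lborel (\<lambda>t. enn2real (N t))"
  proof (rule integrableI_bounded)
    show "(\<lambda>t. enn2real (N t)) \<in> borel_measurable lborel" by measurable
    have "(NNINT t. ennreal (norm (enn2real (N t)))) \<le> (NNINT t. N t)"
      by (rule nn_integral_mono) (simp add: ennreal_enn2real_if)
    then show "(NNINT t. ennreal (norm (enn2real (N t)))) < \<infinity>" using Nfin by (rule le_less_trans)
  qed
  define c where "c = 2 * 2 ^ DIM(real^'n) * (1::real)"
  define A where "A t = c * (indicator {0<..<T} t * (enn2real (N t) + 1))" for t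
  have c: "0 < c" by (simp add: c_def)
  have "integrable lborel (\<lambda>t. indicator {0<..<T} t *\<^sub>R enn2real (N t))" using iN by (intro integrable_mult_indicator) simp
  moreover have "integrable lborel (indicator {0<..<T} :: real \<Rightarrow> real)" by (rule integrable_real_indicator) (use T_pos in simp_all)
  ultimately have iA: "integrable lborel (\<lambda>t. c * (indicator {0<..<T} t *\<^sub>R enn2real (N t) + indicator {0<..<T} t))"
    by (intro integrable_mult_right L1_add)
  have eqA: "(\<lambda>t. c * (indicator {0<..<T} t *\<^sub>R enn2real (N t) + indicator {0<..<T} t)) = A"
    by (simp add: A_def fun_eq_iff distrib_left)
  have "integrable lborel A" using iA unfolding eqA .
  moreover have "0 \<le> A s" for s using c by (simp add: A_def)
  moreover have "AE s in lborel. 0 < s \<longrightarrow> s < T \<longrightarrow> 0 < A s \<and> osc_le (\<lambda>x. trace (G s x)) (A s)"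
    using aeN
  proof eventually_elim
    case (elim s)
    show ?case
    proof (intro impI conjI)
      assume s: "0 < s" "s < T"
      have As: "A s = 2 * 2 ^ DIM(real^'n) * (enn2real (N s) + 1)" using s by (simp add: A_def c_def)
      show "0 < A s" unfolding As by (intro mult_pos_pos add_nonneg_pos) simp_all
      show "osc_le (\<lambda>x. trace (G s x)) (A s)" unfolding As
      proof (rule osc_le_from_dense[where D = D])
        have lG: "locint (G s)" using jac[of s] by (simp add: jac_def)
        show "locint (\<lambda>x. trace (G s x))"
          by (rule locint_bound[OF lG tr, where C = "real CARD('n)"]) (simp add: trace_le)
        show "\<exists>y\<in>D. dist x y < e" if "0 < e" for x :: "real^'n" and e
          using D(2)[rule_format, of "ball x e"] that by auto
        show "avg x r (\<lambda>y. \<bar>trace (G s y) - avg x r (\<lambda>x. trace (G s x))\<bar>) \<le> enn2real (N s) + 1"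
          if "x \<in> D" "r \<in> \<rat>" "0 < r" for x r
        proof -
          have "osc (x, r) s \<le> N s" unfolding N_def by (rule SUP_upper) (use that in \<open>simp add: I_def\<close>)
          also have "N s = ennreal (enn2real (N s))" using elim by (simp add: ennreal_enn2real_if)
          finally have "avg x r (\<lambda>y. \<bar>trace (G s y) - avg x r (\<lambda>x. trace (G s x))\<bar>) \<le> enn2real (N s)"
            unfolding osc_def by simp
          then show ?thesis by linarith
        qed
      qed
    qed
  qed
  ultimately show ?thesis by blast
qed

end

lemma ex_transport_BMO:
  fixes \<beta> :: "real \<Rightarrow> real^'n \<Rightarrow> real^'n"
  assumes T: "0 < T" and R: "0 < R" and W: "in_L1_W11_loc T \<beta>" and d: "has_weak_divergence T \<beta> d"
    and B: "in_L1_time T BMO_norm d" and gr: "in_L1_time T (Lp_norm 1) (\<lambda>t x. \<beta> t x /\<^sub>R (1 + norm x))"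
    and S: "AE t in lebesgue_on {0<..<T}. ess_support (d t) \<subseteq> ball 0 R"
  shows "\<exists>b G A. transport_BMO T b G A R \<and> (AE t in lborel. 0 < t \<longrightarrow> t < T \<longrightarrow>
     (AE x in lborel. \<beta> t x = b t x) \<and> (AE x in lborel. d t x = trace (G t x)))"
proof -
  obtain b G where tr: "transport T b G" and supp: "\<forall>t. AE x in lborel. R < norm x \<longrightarrow> trace (G t x) = 0"
    and ae: "AE t in lborel. 0 < t \<longrightarrow> t < T \<longrightarrow> (AE x in lborel. \<beta> t x = b t x) \<and> (AE x in lborel. d t x = trace (G t x))"
    using ex_transport[OF T W d S] by blast
  interpret tr: transport T b G by (rule tr)
  from ae have aed: "AE t in lborel. 0 < t \<longrightarrow> t < T \<longrightarrow> (AE x in lborel. d t x = trace (G t x))"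
    by eventually_elim blast
  obtain A where A: "integrable lborel A" "\<forall>s. 0 \<le> A s"
     "AE s in lborel. 0 < s \<longrightarrow> s < T \<longrightarrow> 0 < A s \<and> osc_le (\<lambda>x. trace (G s x)) (A s)"
    using tr.BMO_majorant[OF B aed] by blast
  have "transport_BMO T b G A R"
  proof (intro transport_BMO.intro tr transport_BMO_axioms.intro R A(1,3))
    show "0 \<le> A s" for s using A(2) by blast
    have "(NNINT t. NNINT x. ennreal (norm (b t x) / (1 + norm x)))
      \<le> (NNINT t. Lp_norm 1 (\<lambda>x. \<beta> t x /\<^sub>R (1 + norm x)) * indicator {0<..<T} t)"
    proof (rule nn_integral_mono_AE)
      from ae show "AE t in lborel. (NNINT x. ennreal (norm (b t x) / (1 + norm x)))
          \<le> Lp_norm 1 (\<lambda>x. \<beta> t x /\<^sub>R (1 + norm x)) * indicator {0<..<T} t"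
      proof eventually_elim
        case (elim t)
        show ?case
        proof (cases "t \<in> {0<..<T}")
          case True
          then have aet: "AE x in lborel. \<beta> t x = b t x" using elim by simp
          have "(NNINT x. ennreal (norm (b t x) / (1 + norm x))) \<le> (NNINT x. ennreal (norm (\<beta> t x /\<^sub>R (1 + norm x))))"
          proof (rule nn_integral_mono_AE)
            from aet show "AE x in lborel. ennreal (norm (b t x) / (1 + norm x)) \<le> ennreal (norm (\<beta> t x /\<^sub>R (1 + norm x)))"
              by eventually_elim (simp add: divide_inverse mult.commute)
          qed
          also have "\<dots> \<le> Lp_norm 1 (\<lambda>x. \<beta> t x /\<^sub>R (1 + norm x))" by (rule nn_integral_le_Lp_norm_1)
          finally show ?thesis using True by simp
        next
          case False
          then show ?thesis by (simp add: tr.zero)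
        qed
      qed
    qed
    also have "\<dots> < \<infinity>" using gr by (simp add: in_L1_time_def nn_integral_completion)
    finally show "(NNINT t. NNINT x. ennreal (norm (b t x) / (1 + norm x))) < \<infinity>" .
    show "AE x in lborel. R < norm x \<longrightarrow> trace (G t x) = 0" for t using supp by blast
  qed
  then show ?thesis using ae by blast
qed

subsection \<open>Convergence\<close>

lemma Lp_norm_AE:
  fixes f :: "'a::euclidean_space \<Rightarrow> real"
  assumes g: "g \<in> borel_measurable borel" and AE: "AE x in lborel. f x = g x"
    and i: "integrable lborel (\<lambda>x. \<bar>g x\<bar> powr p)"
  shows "Lp_norm p f = ennreal ((LINT x|lborel. \<bar>g x\<bar> powr p) powr (1 / p))"
proof -
  have "(\<integral>\<^sup>+x. ennreal (norm (f x) powr p) \<partial>lebesgue) = (NNINT x. ennreal (\<bar>g x\<bar> powr p))"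
    unfolding nn_integral_completion
    by (rule nn_integral_cong_AE) (use AE in \<open>eventually_elim, simp\<close>)
  also have "\<dots> = ennreal (LINT x|lborel. \<bar>g x\<bar> powr p)" by (rule nn_integral_eq_integral[OF i]) simp
  finally have I: "(\<integral>\<^sup>+x. ennreal (norm (f x) powr p) \<partial>lebesgue) = ennreal (LINT x|lborel. \<bar>g x\<bar> powr p)" .
  have "0 \<le> (LINT x|lborel. \<bar>g x\<bar> powr p)" by (rule LINT_nonneg) simp
  then show ?thesis unfolding Lp_norm_def I using lebesgue_measurable_AE[OF g AE] by (simp add: Let_def)
qed

lemma in_Lp_integrable:
  fixes f :: "'a::euclidean_space \<Rightarrow> real"
  assumes f: "in_Lp p f" and g[measurable]: "g \<in> borel_measurable borel" and AE: "AE x in lborel. f x = g x"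
  shows "integrable lborel (\<lambda>x. \<bar>g x\<bar> powr p)"
proof (rule integrableI_bounded)
  have "(NNINT x. ennreal (norm (\<bar>g x\<bar> powr p))) = (NNINT x. ennreal (norm (f x) powr p))"
    by (rule nn_integral_cong_AE) (use AE in \<open>eventually_elim, simp\<close>)
  also have "\<dots> = (\<integral>\<^sup>+x. ennreal (norm (f x) powr p) \<partial>lebesgue)" by (simp only: nn_integral_completion)
  also have "\<dots> < \<infinity>"
    using f by (simp add: in_Lp_def Lp_norm_def Let_def split: if_splits)
  finally show "(NNINT x. ennreal (norm (\<bar>g x\<bar> powr p))) < \<infinity>" .
qed measurable

lemma measurable_lebesgue_on_interval_AE:
  fixes f g :: "real \<Rightarrow> ennreal"
  assumes g: "g \<in> borel_measurable borel" and AE: "AE t in lborel. 0 < t \<longrightarrow> t < T \<longrightarrow> f t = g t"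
  shows "f \<in> borel_measurable (lebesgue_on {0<..<T})"
proof -
  have "(\<lambda>t. if t \<in> {0<..<T} then f t else g t) \<in> borel_measurable lebesgue"
    by (rule lebesgue_measurable_AE[OF g]) (use AE in \<open>eventually_elim, simp\<close>)
  then have "(\<lambda>t. if t \<in> {0<..<T} then f t else g t) \<in> borel_measurable (lebesgue_on {0<..<T})"
    by (rule measurable_restrict_space1)
  then show ?thesis by (rule measurable_cong[THEN iffD1, rotated]) (simp add: space_restrict_space)
qed

context transport_BMO
begin

text \<open>\<open>esssup_I\<close> asks for measurability in time of the norm; it comes from the
  almost everywhere equality with a function of \<open>Lp_power\<close>, which is continuous in
  t.\<close>

lemma Linf_time_norm_le:
  assumes w: "sol w0 w M" and p: "1 \<le> p" and i0: "integrable lborel (\<lambda>x. \<bar>w0 x\<bar> powr p)"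
    and ae: "AE t in lborel. 0 < t \<longrightarrow> t < T \<longrightarrow> (AE x in lborel. f t x = w t x)"
    and K: "\<And>t. 0 \<le> t \<Longrightarrow> t \<le> T \<Longrightarrow> \<bar>Lp_power p w0 w t\<bar> \<le> K"
  shows "Linf_time_norm T (Lp_norm p) f \<le> ennreal (K powr (1 / p))"
proof -
  have p0: "0 < p" using p by simp
  note L = Lp_power[OF w p0 i0]
  define g where "g t = ennreal (Lp_power p w0 w t powr (1 / p))" for t
  have cont: "continuous_on UNIV (prim (div_term p w))"
    unfolding continuous_on_eq_continuous_at[OF open_UNIV] continuous_at_sequentially
    using prim_continuous[OF L(1)] by (auto simp: o_def)
  note [measurable] = borel_measurable_continuous_onI[OF cont]
  have g: "g \<in> borel_measurable borel" unfolding g_def Lp_power_def by measurable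
  have eq: "AE t in lborel. 0 < t \<longrightarrow> t < T \<longrightarrow> Lp_norm p (f t) = g t"
    using L(2) ae
  proof eventually_elim
    case (elim t)
    show ?case
    proof (intro impI)
      assume t: "0 < t" "t < T"
      have i: "integrable lborel (\<lambda>x. \<bar>w t x\<bar> powr p)" and e: "(LINT x|lborel. \<bar>w t x\<bar> powr p) = Lp_power p w0 w t"
        and a: "AE x in lborel. f t x = w t x" using elim t by blast+
      show "Lp_norm p (f t) = g t"
        using Lp_norm_AE[OF bounded_funD(2)[OF solD(3)[OF w]] a i] by (simp only: e g_def)
    qed
  qed
  show ?thesis unfolding Linf_time_norm_def
  proof (rule esssup_I)
    show "(\<lambda>t. Lp_norm p (f t)) \<in> borel_measurable (lebesgue_on {0<..<T})"
      by (rule measurable_lebesgue_on_interval_AE[OF g eq])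
    show "AE t in lebesgue_on {0<..<T}. Lp_norm p (f t) \<le> ennreal (K powr (1 / p))"
      unfolding AE_lebesgue_on_interval using eq L(2)
    proof eventually_elim
      case (elim t)
      show ?case
      proof (intro impI)
        assume t: "0 < t" "t < T"
        have "0 \<le> (LINT x|lborel. \<bar>w t x\<bar> powr p)" by (rule LINT_nonneg) simp
        then have "0 \<le> Lp_power p w0 w t" "Lp_power p w0 w t \<le> K" using elim t K[of t] by simp_all
        then have "g t \<le> ennreal (K powr (1 / p))" unfolding g_def using p by (intro ennreal_leI powr_mono2) simp_all
        then show "Lp_norm p (f t) \<le> ennreal (K powr (1 / p))" using elim t by simp
      qed
    qed
  qed
qed

text \<open>A crude bound for each single solution, giving membership in the space; smallness is a
  matter of \<open>Lp_power_stable\<close>.\<close>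

lemma Lp_power_bounded:
  assumes w: "sol w0 w M" and p: "0 < p" and i0: "integrable lborel (\<lambda>x. \<bar>w0 x\<bar> powr p)"
  shows "\<exists>K. \<forall>t. \<bar>Lp_power p w0 w t\<bar> \<le> K"
proof (intro exI allI)
  fix t
  have "0 \<le> (LINT x|lborel. \<bar>w0 x\<bar> powr p)" by (rule LINT_nonneg) simp
  then show "\<bar>Lp_power p w0 w t\<bar> \<le> (LINT x|lborel. \<bar>w0 x\<bar> powr p) + (LINT s|lborel. \<bar>div_term p w s\<bar>)"
    unfolding Lp_power_def using prim_abs_le[OF Lp_power(1)[OF w p i0], of t] by linarith
qed

end

theorem theoremB:
  fixes p T R :: real and m :: ennreal
    and b :: "real \<Rightarrow> real^'n \<Rightarrow> real^'n"
    and divb :: "real \<Rightarrow> real^'n \<Rightarrow> real"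
    and u0 :: "real^'n \<Rightarrow> real"
    and u0k :: "nat \<Rightarrow> real^'n \<Rightarrow> real"
    and u :: "real \<Rightarrow> real^'n \<Rightarrow> real"
    and uk :: "nat \<Rightarrow> real \<Rightarrow> real^'n \<Rightarrow> real"
  assumes "1 \<le> p" and "0 < T" and "0 < R"
    and "in_L1_W11_loc T b"
    and "has_weak_divergence T b divb"
    and "in_L1_time T BMO_norm divb"
    and "in_L1_time T (Lp_norm 1) (\<lambda>t x. b t x /\<^sub>R (1 + norm x))"
    and "AE t in lebesgue_on {0<..<T}. ess_support (divb t) \<subseteq> ball 0 R"
    and "in_Linf u0"
    and "\<And>k. in_Linf (u0k k)"
    and "\<And>k. in_Lp p (\<lambda>x. u0k k x - u0 x)"
    and "(SUP k. Linf_norm (u0k k)) + Linf_norm u0 = m" and "m < \<infinity>"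
    and "(\<lambda>k. Lp_norm p (\<lambda>x. u0k k x - u0 x)) \<longlonglongrightarrow> 0"
    and "weak_solution T b divb u0 u"
    and "Linf_time_norm T Linf_norm u \<le> Linf_norm u0"
    and "\<And>k. weak_solution T b divb (u0k k) (uk k)"
    and "\<And>k. Linf_time_norm T Linf_norm (uk k) \<le> Linf_norm (u0k k)"
  shows "(\<forall>k. in_Linf_time T (Lp_norm p) (\<lambda>t x. uk k t x - u t x)) \<and>
         (\<lambda>k. Linf_time_norm T (Lp_norm p) (\<lambda>t x. uk k t x - u t x)) \<longlonglongrightarrow> 0"
proof -
  note p = assms(1) and in_Lp = assms(11) and conv0 = assms(14) and wu = assms(15) and wuk = assms(17)
  have p0: "0 < p" using p by simp
  define M where "M = enn2real m"
  have M: "0 \<le> M" "ennreal M = m" using assms(13) by (simp_all add: M_def)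
  have n0: "Linf_norm u0 \<le> ennreal M" unfolding M(2) assms(12)[symmetric] by simp
  have nk: "Linf_norm (u0k k) \<le> ennreal M" for k
  proof -
    have "Linf_norm (u0k k) \<le> (SUP k. Linf_norm (u0k k))" by (rule SUP_upper) simp
    also have "\<dots> \<le> m" unfolding assms(12)[symmetric] by simp
    finally show ?thesis by (simp only: M(2))
  qed
  obtain b' G A where "transport_BMO T b' G A R" and ae: "AE t in lborel. 0 < t \<longrightarrow> t < T \<longrightarrow>
     (AE x in lborel. b t x = b' t x) \<and> (AE x in lborel. divb t x = trace (G t x))"
    using ex_transport_BMO[OF assms(2-8)] by blast
  then interpret transport_BMO T b' G A R by blast
  from ae have aeb: "AE t in lborel. 0 < t \<longrightarrow> t < T \<longrightarrow> (AE x in lborel. b t x = b' t x)" by eventually_elim blast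
  from ae have aed: "AE t in lborel. 0 < t \<longrightarrow> t < T \<longrightarrow> (AE x in lborel. divb t x = trace (G t x))" by eventually_elim blast
  have rep: "\<exists>v0 v. sol v0 v M \<and> (AE x in lborel. f0 x = v0 x) \<and> (AE t in lborel. 0 < t \<longrightarrow> t < T \<longrightarrow> (AE x in lborel. f t x = v t x))"
    if W: "weak_solution T b divb f0 f" and f0: "in_Linf f0" and le0: "Linf_norm f0 \<le> ennreal M"
      and le: "Linf_time_norm T Linf_norm f \<le> Linf_norm f0" for f0 f
  proof -
    have mf: "spacetime_measurable T f" using W by (simp add: weak_solution_def in_Linf_time_def)
    obtain v where v: "case_prod v \<in> borel_measurable (borel \<Otimes>\<^sub>M borel)" "\<forall>t x. \<bar>v t x\<bar> \<le> M"
      and aev: "AE t in lborel. 0 < t \<longrightarrow> t < T \<longrightarrow> (AE x in lborel. f t x = v t x)"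
      using ex_bounded_borel_version[OF mf order_trans[OF le le0] M(1)] by blast
    have mf0: "f0 \<in> borel_measurable lebesgue" using f0 by (simp add: in_Linf_def)
    obtain v0 where v0: "v0 \<in> borel_measurable borel" "\<forall>x. \<bar>v0 x\<bar> \<le> M" and aev0: "AE x in lborel. f0 x = v0 x"
      using ex_bounded_borel_initial[OF mf0 le0 M(1)] by blast
    have "bounded_fun v M" using v by (simp add: bounded_fun_def)
    from weak_solution_sol[OF W aeb aed aev this v0(1) v0(2)[rule_format] aev0] show ?thesis using aev aev0 by blast
  qed
  obtain v0 v where v: "sol v0 v M" "AE x in lborel. u0 x = v0 x" "AE t in lborel. 0 < t \<longrightarrow> t < T \<longrightarrow> (AE x in lborel. u t x = v t x)"
    using rep[OF wu assms(9) n0 assms(16)] by blast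
  define S where "S k f0 f \<longleftrightarrow> sol f0 f M \<and> (AE x in lborel. u0k k x = f0 x) \<and>
    (AE t in lborel. 0 < t \<longrightarrow> t < T \<longrightarrow> (AE x in lborel. uk k t x = f t x))" for k f0 f
  have "\<exists>f0 f. S k f0 f" for k unfolding S_def by (rule rep[OF wuk assms(10) nk assms(18)])
  then obtain v0k vk where "\<And>k. S k (v0k k) (vk k)" by metis
  then have vk: "sol (v0k k) (vk k) M" "AE x in lborel. u0k k x = v0k k x"
    "AE t in lborel. 0 < t \<longrightarrow> t < T \<longrightarrow> (AE x in lborel. uk k t x = vk k t x)" for k
    unfolding S_def by blast+
  define w0 where "w0 k x = v0k k x - v0 x" for k x
  define w where "w k t x = vk k t x - v t x" for k t x
  \<comment> \<open>The bound 2M is the same for all k, so a single \<delta> of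
    \<open>Lp_power_stable\<close> serves the whole sequence.\<close>
  have sw: "sol (w0 k) (w k) (2 * M)" for k
  proof -
    obtain K where "sol (\<lambda>x. (-1) * v0 x) (\<lambda>t x. (-1) * v t x) K" using sol_mult'[OF sol_const[of "-1"] v(1)] by blast
    from sol_add[OF vk(1) this] have "sol (w0 k) (w k) (M + K)" by (simp add: w0_def[abs_def] w_def[abs_def])
    moreover have "\<bar>w0 k x\<bar> \<le> 2 * M" for x
      using solD(2)[OF v(1), of x] solD(2)[OF vk(1), of k x] unfolding w0_def by linarith
    moreover have "\<bar>w k t x\<bar> \<le> 2 * M" for t x
      using bounded_funD(3)[OF solD(3)[OF v(1)], of t x] bounded_funD(3)[OF solD(3)[OF vk(1)], of k t x] unfolding w_def by linarith
    ultimately show ?thesis by (simp add: sol_def bounded_fun_def)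
  qed
  have ae0: "AE x in lborel. u0k k x - u0 x = w0 k x" for k
    using v(2) vk(2)[of k] by eventually_elim (simp add: w0_def)
  have aew: "AE t in lborel. 0 < t \<longrightarrow> t < T \<longrightarrow> (AE x in lborel. uk k t x - u t x = w k t x)" for k
    using v(3) vk(3)[of k]
  proof eventually_elim
    case (elim t)
    show ?case
    proof (intro impI)
      assume "0 < t" "t < T"
      with elim have "AE x in lborel. u t x = v t x" "AE x in lborel. uk k t x = vk k t x" by blast+
      then show "AE x in lborel. uk k t x - u t x = w k t x" by eventually_elim (simp add: w_def)
    qed
  qed
  have i0: "integrable lborel (\<lambda>x. \<bar>w0 k x\<bar> powr p)" for k by (rule in_Lp_integrable[OF in_Lp solD(1)[OF sw] ae0])
  show ?thesis
  proof (intro conjI allI)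
    fix k
    have "spacetime_measurable T (\<lambda>t x. uk k t x - u t x)"
      using wu wuk[of k] unfolding weak_solution_def in_Linf_time_def spacetime_measurable_def case_prod_beta
      by (intro borel_measurable_diff) simp_all
    moreover obtain K where "\<forall>t. \<bar>Lp_power p (w0 k) (w k) t\<bar> \<le> K" using Lp_power_bounded[OF sw p0 i0] by blast
    then have "Linf_time_norm T (Lp_norm p) (\<lambda>t x. uk k t x - u t x) \<le> ennreal (K powr (1 / p))"
      by (intro Linf_time_norm_le[OF sw p i0 aew]) blast
    then have "Linf_time_norm T (Lp_norm p) (\<lambda>t x. uk k t x - u t x) < \<infinity>" by (rule le_less_trans) simp
    ultimately show "in_Linf_time T (Lp_norm p) (\<lambda>t x. uk k t x - u t x)" by (simp add: in_Linf_time_def)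
  next
    show "(\<lambda>k. Linf_time_norm T (Lp_norm p) (\<lambda>t x. uk k t x - u t x)) \<longlonglongrightarrow> 0"
    proof (rule order_tendstoI)
      fix a :: ennreal assume "0 < a"
      then obtain c where c: "0 < c" "c < a" using dense by blast
      have "c < top" using c(2) by (rule less_le_trans) simp
      define \<eta> where "\<eta> = enn2real c"
      have \<eta>: "0 < \<eta>" "ennreal \<eta> < a"
        using c \<open>c < top\<close> by (simp_all add: \<eta>_def enn2real_positive_iff)
      \<comment> \<open>\<open>Lp_power\<close> measures p-th powers of norms, so the threshold for
        the norm is raised to the power p; likewise \<delta> becomes
        \<open>\<delta> powr (1 / p)\<close> for the data.\<close>
      define \<epsilon> where "\<epsilon> = \<eta> powr p"
      have "0 < \<epsilon>" using \<eta> by (simp add: \<epsilon>_def)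
      have "0 \<le> 2 * M" using M(1) by simp
      from Lp_power_stable[OF p0 this, THEN spec, THEN mp, OF \<open>0 < \<epsilon>\<close>]
      obtain \<delta> where \<delta>: "0 < \<delta>" and st: "\<forall>w0 w. sol w0 w (2 * M) \<longrightarrow> integrable lborel (\<lambda>x. \<bar>w0 x\<bar> powr p) \<longrightarrow>
          (LINT x|lborel. \<bar>w0 x\<bar> powr p) \<le> \<delta> \<longrightarrow> (\<forall>t. 0 \<le> t \<longrightarrow> t \<le> T \<longrightarrow> \<bar>Lp_power p w0 w t\<bar> \<le> \<epsilon>)"
        by (elim exE conjE)
      have "0 < ennreal (\<delta> powr (1 / p))" using \<delta> by simp
      from order_tendstoD(2)[OF conv0 this]
      show "\<forall>\<^sub>F k in sequentially. Linf_time_norm T (Lp_norm p) (\<lambda>t x. uk k t x - u t x) < a"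
      proof eventually_elim
        case (elim k)
        let ?I = "LINT x|lborel. \<bar>w0 k x\<bar> powr p"
        have I0: "0 \<le> ?I" by (rule LINT_nonneg) simp
        have "ennreal (?I powr (1 / p)) < ennreal (\<delta> powr (1 / p))"
          using elim unfolding Lp_norm_AE[OF solD(1)[OF sw] ae0 i0] .
        then have lt: "?I powr (1 / p) < \<delta> powr (1 / p)" by (simp add: ennreal_less_iff)
        have le: "?I \<le> \<delta>"
        proof (rule ccontr)
          assume "\<not> ?I \<le> \<delta>"
          then have "\<delta> powr (1 / p) \<le> ?I powr (1 / p)" using p0 \<delta> by (intro powr_mono2) simp_all
          then show False using lt by linarith
        qed
        have "\<bar>Lp_power p (w0 k) (w k) t\<bar> \<le> \<epsilon>" if "0 \<le> t" "t \<le> T" for t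
          by (rule st[rule_format, OF sw i0 le that])
        then have "Linf_time_norm T (Lp_norm p) (\<lambda>t x. uk k t x - u t x) \<le> ennreal (\<epsilon> powr (1 / p))"
          by (rule Linf_time_norm_le[OF sw p i0 aew])
        also have "\<epsilon> powr (1 / p) = \<eta>" using p0 \<eta>(1) by (simp add: \<epsilon>_def powr_powr)
        finally show ?case using \<eta>(2) by (rule le_less_trans)
      qed
    qed simp
  qed
qed

end
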